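(* Let $k$ be an imaginary quadratic field in which the rational prime $p$ splits, and let $\mathrm{T}:=\ker\big(\mathrm{Res}^{\mathcal{O}_k}_{\mathbb{Z}}(\mathbb{G}_{m,\mathcal{O}_k})\xrightarrow{\mathrm{N}^k_{\mathbb{Q}}}\mathbb{G}_{m,\mathbb{Z}}\big)$. Then there exist infinitely many rational primes $l\neq p$ which split in $k/\mathbb{Q}$ and are such that $\mathrm{T}(\mathbb{Z}[1/l])\subseteq\mathrm{T}(\mathbb{Z}_p)$ is a dense subgroup.
   Context: Concretely, $\mathrm{T}(\mathbb{Z}[1/l])=\{\alpha\in\mathcal{O}_k[1/l]^*\mid\alpha\overline{\alpha}=1\}$ ($\overline{\phantom{x}}$ complex conjugation) and $\mathrm{T}(\mathbb{Z}_p)\simeq\mathbb{Z}_p^*$ carries the $p$-adic topology. *)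

theory Defs
  imports Complex_Main "HOL-Computational_Algebra.Computational_Algebra"
begin

definition qfield :: "nat \<Rightarrow> complex set" where
  "qfield d = {of_rat a + of_rat b * (\<i> * complex_of_real (sqrt (real d))) | a b. True}"

definition OK :: "nat \<Rightarrow> complex set" where
  "OK d = {x \<in> qfield d. algebraic_int x}"

definition is_ideal :: "nat \<Rightarrow> complex set \<Rightarrow> bool" where
  "is_ideal d I \<longleftrightarrow> I \<subseteq> OK d \<and> 0 \<in> I \<and> (\<forall>x\<in>I. \<forall>y\<in>I. x + y \<in> I) \<and>
     (\<forall>x\<in>I. - x \<in> I) \<and> (\<forall>r\<in>OK d. \<forall>x\<in>I. r * x \<in> I)"

definition ideal_mult :: "nat \<Rightarrow> complex set \<Rightarrow> complex set \<Rightarrow> complex set" where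
  "ideal_mult d I J = \<Inter>{K. is_ideal d K \<and> (\<forall>x\<in>I. \<forall>y\<in>J. x * y \<in> K)}"

definition ideal_pow :: "nat \<Rightarrow> complex set \<Rightarrow> nat \<Rightarrow> complex set" where
  "ideal_pow d P n = ((ideal_mult d P) ^^ n) (OK d)"

definition principal_ideal :: "nat \<Rightarrow> complex \<Rightarrow> complex set" where
  "principal_ideal d x = {r * x | r. r \<in> OK d}"

definition prime_ideal :: "nat \<Rightarrow> complex set \<Rightarrow> bool" where
  "prime_ideal d P \<longleftrightarrow> is_ideal d P \<and> P \<noteq> OK d \<and>
     (\<forall>x\<in>OK d. \<forall>y\<in>OK d. x * y \<in> P \<longrightarrow> x \<in> P \<or> y \<in> P)"

definition splits :: "nat \<Rightarrow> nat \<Rightarrow> bool" where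
  "splits d p \<longleftrightarrow> (\<exists>P Q. prime_ideal d P \<and> prime_ideal d Q \<and> P \<noteq> Q \<and>
      ideal_mult d P Q = principal_ideal d (of_nat p))"

definition OK_inv :: "nat \<Rightarrow> nat \<Rightarrow> complex set" where
  "OK_inv d l = {x \<in> qfield d. \<exists>m::nat. of_nat l ^ m * x \<in> OK d}"

definition T_points :: "nat \<Rightarrow> nat \<Rightarrow> complex set" where
  "T_points d l = {\<alpha> \<in> OK_inv d l. (\<exists>\<beta>\<in>OK_inv d l. \<alpha> * \<beta> = 1) \<and> \<alpha> * cnj \<alpha> = 1}"

text \<open>Density of T(Z[1/l]) in T(Z_p) = Z_p^*, where the identification
  T(Z_p) = Z_p^* is via the completion at a prime P above p.  Since Z has dense image
  in Z_p, density in Z_p^* means: every p-adic unit, i.e. every integer a prime to p,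
  is approximated modulo P^n for every n.  An element alpha = beta / l^m of O_k[1/l]
  (beta in O_k, l prime to p) satisfies alpha = a mod P^n in the completion iff
  beta - a l^m lies in P^n.\<close>
definition T_dense_at :: "nat \<Rightarrow> nat \<Rightarrow> nat \<Rightarrow> bool" where
  "T_dense_at d p l \<longleftrightarrow>
     (\<forall>P. prime_ideal d P \<and> of_nat p \<in> P \<longrightarrow>
        (\<forall>n::nat. \<forall>a::int. coprime a (int p) \<longrightarrow>
          (\<exists>\<alpha>\<in>T_points d l. \<exists>\<beta>\<in>OK d. \<exists>m::nat.
              \<alpha> = \<beta> / of_nat l ^ m \<and> \<beta> - of_int a * of_nat l ^ m \<in> ideal_pow d P n)))"

end

theory Submission
  imports "HOL-Number_Theory.Number_Theory" "HOL-Analysis.Analysis" "HOL-Real_Asymp.Real_Asymp" Defs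
begin

text \<open>If \<open>l = \<delta> \<cdot> cnj \<delta>\<close> is a rational prime with \<open>\<delta>\<close> in \<open>\<int>[\<surd>-d]\<close>, then \<open>l\<close> splits and the torus contains the
  elements \<open>\<plusminus>(\<delta> / cnj \<delta>)\<^sup>k\<close>. They are dense in the p-adic units as soon as the image of \<open>\<delta> / cnj \<delta>\<close>
  is a primitive root modulo \<open>p\<^sup>2\<close> (for \<open>p = 2\<close>: is 3 modulo 8), which is a congruence condition on \<open>\<delta>\<close>
  modulo some \<open>M\<close>. That infinitely many prime norms occur in a residue class of \<open>\<delta>\<close> is Dirichlet's theorem for
  the ray class group modulo \<open>M\<close>. The group is finite by Minkowski's argument; all its classes have the
  same Riesz means up to \<open>O(1)\<close>, by an oscillation estimate for the truncated paraboloid on lattice cosets that rests on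
  the parallelogram law. Dirichlet's theorem then follows as in Mertens' elementary proof, from Moebius
  inversion of character sums, with the nonvanishing at real characters by the hyperbola method.\<close>

section \<open>Characters of finite abelian groups\<close>

text \<open>Sharp ideal counts carry an error \<open>O(sqrt x)\<close>; with it the error of the
  hyperbola method at a real character competes with the lower bound that comes from squares.
  Damping by \<open>1 - N D / x\<close> brings the error down to \<open>O(1)\<close>. Sharp counts
  are recovered by differencing and serve only for partial summation. The arithmetic takes place in
  \<open>\<int>[\<surd>-d]\<close>, although the ring of integers may be larger: as
  \<open>2 * d\<close> divides \<open>M\<close>, the two agree at every prime that occurs, and
  valuations are built from divisibility by powers of \<open>l\<close> instead of an ideal theory.
  Since \<open>M \<ge> 3\<close>, an element congruent to 1 modulo \<open>M\<close> is determined by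
  its divisor, so the ideals of a class correspond to the points of one lattice coset. Inert primes
  drop out at the end because their norms are squares. At the two primes above \<open>p\<close> the
  quotients \<open>\<delta> / cnj \<delta>\<close> are inverse to each other, so one condition on
  \<open>\<delta>\<close> serves both. The sign is there for \<open>p = 2\<close>, where the units
  have no single topological generator.\<close>

definition characters :: "('a, 'b) monoid_scheme \<Rightarrow> ('a \<Rightarrow> complex) set" where
  "characters G = {\<psi>. (\<forall>x\<in>carrier G. \<forall>y\<in>carrier G. \<psi> (x \<otimes>\<^bsub>G\<^esub> y) = \<psi> x * \<psi> y) \<and>
     \<psi> \<one>\<^bsub>G\<^esub> = 1 \<and> (\<forall>x. x \<notin> carrier G \<longrightarrow> \<psi> x = 0)}"

definition principal_char :: "('a, 'b) monoid_scheme \<Rightarrow> 'a \<Rightarrow> complex" where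
  "principal_char G x = (if x \<in> carrier G then 1 else 0)"

text \<open>Characters of a subgroup \<open>H\<close>, with values off \<open>H\<close> left free;
  they are the stages of the extension argument.\<close>

definition char_on :: "('a, 'b) monoid_scheme \<Rightarrow> 'a set \<Rightarrow> ('a \<Rightarrow> complex) \<Rightarrow> bool" where
  "char_on G H \<phi> \<longleftrightarrow> (\<forall>x\<in>H. \<forall>y\<in>H. \<phi> (x \<otimes>\<^bsub>G\<^esub> y) = \<phi> x * \<phi> y) \<and> \<phi> \<one>\<^bsub>G\<^esub> = 1"

locale finite_comm_group = comm_group G for G (structure) +
  assumes fin: "finite (carrier G)"
begin

lemma nat_pow_mem_subgroup:
  assumes "subgroup H G" "x \<in> H" shows "x [^] (n::nat) \<in> H"
  by (induction n) (use assms in \<open>auto simp: subgroup.one_closed subgroup.m_closed\<close>)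

lemma char_on_nat_pow:
  assumes "char_on G H \<phi>" "subgroup H G" "x \<in> H"
  shows "\<phi> (x [^] (n::nat)) = \<phi> x ^ n"
proof (induction n)
  case (Suc n)
  have "x [^] n \<in> H" by (rule nat_pow_mem_subgroup[OF assms(2,3)])
  thus ?case using Suc assms by (simp add: char_on_def mult.commute)
qed (use assms in \<open>simp add: char_on_def\<close>)

lemma char_on_nonzero:
  assumes "char_on G H \<phi>" "subgroup H G" "x \<in> H"
  shows "\<phi> x \<noteq> 0"
proof -
  have "\<phi> (x \<otimes> inv x) = \<phi> x * \<phi> (inv x)"
    using assms by (simp add: char_on_def subgroup.m_inv_closed)
  moreover have "x \<in> carrier G" using assms by (meson subgroup.mem_carrier)
  ultimately show ?thesis using assms by (auto simp: char_on_def)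
qed

text \<open>The extension to the group generated by \<open>H\<close> and \<open>x\<close> may send
  \<open>x\<close> to any \<open>k\<close>-th root \<open>w\<close> of
  \<open>\<phi> (x [^] k)\<close>: two representations \<open>h \<otimes> x [^] i\<close> of one
  element differ by a power of \<open>x\<close> in \<open>H\<close>, and on such powers
  \<open>\<phi>\<close> already agrees with powers of \<open>w\<close>.\<close>

lemma char_extend:
  assumes H: "subgroup H G" and \<phi>: "char_on G H \<phi>" and x: "x \<in> carrier G"
    and k: "k > 0" "x [^] k \<in> H" and least: "\<And>j. 0 < j \<Longrightarrow> j < k \<Longrightarrow> x [^] j \<notin> H"
    and w: "w ^ k = \<phi> (x [^] k)"
  shows "\<exists>H' \<phi>'. subgroup H' G \<and> H \<subseteq> H' \<and> x \<in> H' \<and> char_on G H' \<phi>' \<and> \<phi>' x = w \<and>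
    (\<forall>h\<in>H. \<phi>' h = \<phi> h)"
proof -
  have Hc: "H \<subseteq> carrier G" using H by (rule subgroup.subset)
  have oneH: "\<one> \<in> H" using H by (rule subgroup.one_closed)
  define H' where "H' = {h \<otimes> x [^] (i::nat) | h i. h \<in> H}"
  have w0: "w \<noteq> 0"
  proof
    assume "w = 0"
    hence "\<phi> (x [^] k) = 0" using w k by (simp add: zero_power)
    thus False using char_on_nonzero[OF \<phi> H k(2)] by blast
  qed
  \<comment> \<open>Division with remainder: a remainder strictly between 0 and \<open>k\<close>
    would contradict minimality.\<close>
  have dvd: "k dvd j" if "x [^] j \<in> H" for j :: nat
  proof -
    have xk: "x [^] (k * (j div k)) \<in> H"
      using nat_pow_mem_subgroup[OF H k(2), of "j div k"] x by (simp add: nat_pow_pow)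
    have "x [^] j = x [^] (k * (j div k)) \<otimes> x [^] (j mod k)"
      using x by (simp add: nat_pow_mult)
    hence "x [^] (j mod k) = inv (x [^] (k * (j div k))) \<otimes> x [^] j"
      using x by (simp add: m_assoc[symmetric])
    also have "\<dots> \<in> H" using xk that H by (simp add: subgroup.m_closed subgroup.m_inv_closed)
    finally have "\<not> (0 < j mod k \<and> j mod k < k)" using least by blast
    thus ?thesis using k(1) by (simp add: mod_eq_0_iff_dvd)
  qed
  have powH: "\<phi> (x [^] j) = w ^ j" if "x [^] j \<in> H" for j :: nat
  proof -
    from dvd[OF that] obtain m where m: "j = k * m" by blast
    have "x [^] j = (x [^] k) [^] m" using x by (simp add: m nat_pow_pow)
    thus ?thesis using char_on_nat_pow[OF \<phi> H k(2)] by (simp add: w[symmetric] m power_mult)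
  qed
  have wd_le: "\<phi> h * w ^ i = \<phi> h' * w ^ j"
    if h: "h \<in> H" "h' \<in> H" and eq: "h \<otimes> x [^] i = h' \<otimes> x [^] j" and ij: "i \<le> j" for h h' and i j :: nat
  proof -
    have hc: "h \<in> carrier G" "h' \<in> carrier G" using h Hc by auto
    have "h' \<otimes> x [^] j = (h' \<otimes> x [^] (j - i)) \<otimes> x [^] i"
      using x hc ij by (simp add: m_assoc nat_pow_mult)
    hence e: "h = h' \<otimes> x [^] (j - i)" using eq x hc by (metis m_closed nat_pow_closed right_cancel)
    hence "x [^] (j - i) = inv h' \<otimes> h" using x hc by (simp add: m_assoc[symmetric])
    hence mem: "x [^] (j - i) \<in> H" using h H by (simp add: subgroup.m_closed subgroup.m_inv_closed)
    have "\<phi> h = \<phi> h' * \<phi> (x [^] (j - i))" using e mem h \<phi> by (simp add: char_on_def)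
    thus ?thesis using powH[OF mem] ij by (simp add: power_add[symmetric])
  qed
  have wd: "\<phi> h * w ^ i = \<phi> h' * w ^ j"
    if "h \<in> H" "h' \<in> H" "h \<otimes> x [^] i = h' \<otimes> x [^] j" for h h' and i j :: nat
    using wd_le[OF that] wd_le[OF that(2,1) that(3)[symmetric]] by (cases "i \<le> j") auto
  \<comment> \<open>The description has a definite value only on \<open>H'\<close>, where
    \<open>wd\<close> makes it unique.\<close>
  define \<phi>' where "\<phi>' y = (THE z. \<exists>h (i::nat). h \<in> H \<and> y = h \<otimes> x [^] i \<and> z = \<phi> h * w ^ i)" for y
  have \<phi>': "\<phi>' (h \<otimes> x [^] i) = \<phi> h * w ^ i" if "h \<in> H" for h and i :: nat
    unfolding \<phi>'_def
  proof (rule the_equality)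
    show "\<exists>h' j. h' \<in> H \<and> h \<otimes> x [^] i = h' \<otimes> x [^] j \<and> \<phi> h * w ^ i = \<phi> h' * w ^ (j::nat)"
      using that by blast
  next
    fix z assume "\<exists>h' j. h' \<in> H \<and> h \<otimes> x [^] i = h' \<otimes> x [^] j \<and> z = \<phi> h' * w ^ (j::nat)"
    thus "z = \<phi> h * w ^ i" using wd[OF that] by metis
  qed
  have prod: "(h \<otimes> x [^] i) \<otimes> (h' \<otimes> x [^] j) = (h \<otimes> h') \<otimes> x [^] (i + j)"
    if "h \<in> H" "h' \<in> H" for h h' and i j :: nat
    using that Hc x by (simp add: subset_iff m_ac nat_pow_mult[symmetric])
  have HH': "H \<subseteq> H'"
  proof
    fix h assume "h \<in> H"
    hence "h = h \<otimes> x [^] (0::nat)" "h \<in> H" using Hc by auto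
    thus "h \<in> H'" unfolding H'_def by blast
  qed
  have cl: "a \<otimes> b \<in> H'" if "a \<in> H'" "b \<in> H'" for a b
  proof -
    from that obtain h i h' j where *: "h \<in> H" "h' \<in> H" "a = h \<otimes> x [^] (i::nat)" "b = h' \<otimes> x [^] (j::nat)"
      unfolding H'_def by blast
    have "h \<otimes> h' \<in> H" using * H by (simp add: subgroup.m_closed)
    thus ?thesis using prod[OF *(1,2)] * unfolding H'_def by auto
  qed
  have H'c: "H' \<subseteq> carrier G" using Hc x unfolding H'_def by auto
  have powcl: "a [^] (n::nat) \<in> H'" if "a \<in> H'" for a n
    by (induction n) (use HH' oneH cl that in auto)
  have subH': "subgroup H' G"
  proof (rule subgroupI)
    show "H' \<subseteq> carrier G" by (rule H'c)
    show "H' \<noteq> {}" using HH' oneH by blast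
    fix a assume a: "a \<in> H'"
    have ac: "a \<in> carrier G" using a H'c by auto
    \<comment> \<open>In a finite group the inverse is the power with exponent order minus 1, so
      natural exponents already give a subgroup.\<close>
    have "Coset.order G > 0" using fin order_gt_0_iff_finite by blast
    hence "a [^] (Coset.order G - 1) \<otimes> a = a [^] Coset.order G"
      using ac by (metis Suc_diff_1 nat_pow_Suc)
    hence "a [^] (Coset.order G - 1) \<otimes> a = \<one>" using ac pow_order_eq_1 by simp
    hence "inv a = a [^] (Coset.order G - 1)" using ac by (metis inv_equality nat_pow_closed)
    thus "inv a \<in> H'" using powcl[OF a] by simp
  qed (use cl in auto)
  have xH': "x = \<one> \<otimes> x [^] (1::nat)" using x by simp
  have "x \<in> H'" unfolding H'_def using xH' oneH by blast
  moreover have "\<phi>' x = w" using \<phi>'[OF oneH, of 1] \<phi> x by (simp add: char_on_def)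
  moreover have "char_on G H' \<phi>'"
    unfolding char_on_def
  proof (intro conjI ballI)
    show "\<phi>' \<one> = 1" using \<phi>'[OF oneH, of 0] \<phi> by (simp add: char_on_def)
    fix a b assume "a \<in> H'" "b \<in> H'"
    then obtain h i h' j where *: "h \<in> H" "h' \<in> H" "a = h \<otimes> x [^] (i::nat)" "b = h' \<otimes> x [^] (j::nat)"
      unfolding H'_def by blast
    have "h \<otimes> h' \<in> H" using * H by (simp add: subgroup.m_closed)
    thus "\<phi>' (a \<otimes> b) = \<phi>' a * \<phi>' b"
      using * prod[OF *(1,2)] \<phi>' \<phi> by (simp add: char_on_def power_add)
  qed
  moreover have "\<phi>' h = \<phi> h" if "h \<in> H" for h
    using \<phi>'[OF that, of 0] that Hc by auto
  ultimately show ?thesis using subH' HH' by blast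
qed

lemma ex_least_pow:
  assumes "subgroup H G" "x \<in> carrier G"
  shows "\<exists>k::nat>0. x [^] k \<in> H \<and> (\<forall>j. 0 < j \<longrightarrow> j < k \<longrightarrow> x [^] j \<notin> H)"
proof -
  have "x [^] Coset.order G \<in> H" "Coset.order G > 0"
    using assms fin pow_order_eq_1 order_gt_0_iff_finite subgroup.one_closed by auto
  hence "\<exists>k::nat. k > 0 \<and> x [^] k \<in> H" by blast
  from LeastI_ex[OF this] show ?thesis by (metis (no_types, lifting) not_less_Least)
qed

lemma complex_nth_root: "k > 0 \<Longrightarrow> \<exists>w::complex. w ^ k = z"
proof -
  assume k: "k > 0"
  show ?thesis
  proof (cases "z = 0")
    case True thus ?thesis using k by (intro exI[of _ 0]) auto
  next
    case False
    have "exp (Ln z / of_nat k) ^ k = exp (of_nat k * (Ln z / of_nat k))"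
      by (simp add: exp_of_nat_mult[symmetric])
    thus ?thesis using False k by (intro exI[of _ "exp (Ln z / of_nat k)"]) simp
  qed
qed

text \<open>A nontrivial root of unity as value at \<open>a\<close> gives a character on some
  subgroup containing \<open>a\<close>. Among the subgroups carrying a character nontrivial at
  \<open>a\<close>, one of maximal cardinality must be the whole group, since
  \<open>char_extend\<close> would enlarge any other.\<close>

lemma char_separates:
  assumes a: "a \<in> carrier G" "a \<noteq> \<one>"
  shows "\<exists>\<psi>\<in>characters G. \<psi> a \<noteq> 1"
proof -
  define S where "S = {H. subgroup H G \<and> a \<in> H \<and> (\<exists>\<phi>. char_on G H \<phi> \<and> \<phi> a \<noteq> 1)}"
  have triv: "subgroup {\<one>} G" by (rule triv_subgroup)
  obtain k :: nat where k: "k > 0" "a [^] k \<in> {\<one>}" "\<And>j. 0 < j \<Longrightarrow> j < k \<Longrightarrow> a [^] j \<notin> {\<one>}"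
    using ex_least_pow[OF triv a(1)] by blast
  have k1: "k \<noteq> 1" using k(2) a by auto
  have "\<exists>w::complex. w ^ k = 1 \<and> w \<noteq> 1"
  proof -
    have "card {z::complex. z ^ k = 1} = k" using k by (intro card_roots_unity_eq) auto
    hence "{z::complex. z ^ k = 1} \<noteq> {1}" using k1 by auto
    moreover have "1 \<in> {z::complex. z ^ k = 1}" by simp
    ultimately show ?thesis by blast
  qed
  then obtain w :: complex where w: "w ^ k = 1" "w \<noteq> 1" by blast
  have "char_on G {\<one>} (\<lambda>_. 1)" by (simp add: char_on_def)
  from char_extend[OF triv this a(1) k(1,2) k(3), of w] w have "S \<noteq> {}"
    unfolding S_def by auto
  moreover have "finite S" using fin by (rule_tac finite_subset[of _ "Pow (carrier G)"]) (auto simp: S_def dest: subgroup.subset)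
  ultimately have "Max (card ` S) \<in> card ` S" by (intro Max_in) auto
  then obtain H where "H \<in> S" "card H = Max (card ` S)" by auto
  hence H: "H \<in> S" "\<And>K. K \<in> S \<Longrightarrow> card K \<le> card H" using \<open>finite S\<close> by auto
  from H(1) obtain \<phi> where \<phi>: "subgroup H G" "a \<in> H" "char_on G H \<phi>" "\<phi> a \<noteq> 1" unfolding S_def by blast
  have Hc: "H = carrier G"
  proof (rule ccontr)
    assume "H \<noteq> carrier G"
    then obtain x where x: "x \<in> carrier G" "x \<notin> H" using subgroup.subset[OF \<phi>(1)] by blast
    obtain k :: nat where k: "k > 0" "x [^] k \<in> H" "\<And>j. 0 < j \<Longrightarrow> j < k \<Longrightarrow> x [^] j \<notin> H"
      using ex_least_pow[OF \<phi>(1) x(1)] by blast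
    obtain w where w: "w ^ k = \<phi> (x [^] k)" using complex_nth_root[OF k(1)] by blast
    obtain H' \<phi>' where *: "subgroup H' G" "H \<subseteq> H'" "x \<in> H'" "char_on G H' \<phi>'" "\<forall>h\<in>H. \<phi>' h = \<phi> h"
      using char_extend[OF \<phi>(1,3) x(1) k w] by blast
    have "H' \<in> S" using * \<phi> unfolding S_def by auto
    moreover have "card H < card H'"
      using * x by (intro psubset_card_mono) (auto intro: finite_subset[OF _ fin] dest: subgroup.subset)
    ultimately show False using H(2) by fastforce
  qed
  define \<psi> where "\<psi> x = (if x \<in> carrier G then \<phi> x else 0)" for x
  have "\<psi> \<in> characters G" using \<phi> Hc by (auto simp: \<psi>_def characters_def char_on_def)
  moreover have "\<psi> a \<noteq> 1" using \<phi> a by (simp add: \<psi>_def)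
  ultimately show ?thesis by blast
qed

lemma principal_char_in: "principal_char G \<in> characters G"
  by (simp add: characters_def principal_char_def)

lemma char_mult: "\<psi> \<in> characters G \<Longrightarrow> x \<in> carrier G \<Longrightarrow> y \<in> carrier G \<Longrightarrow> \<psi> (x \<otimes> y) = \<psi> x * \<psi> y"
  by (simp add: characters_def)

lemma char_one: "\<psi> \<in> characters G \<Longrightarrow> \<psi> \<one> = 1"
  by (simp add: characters_def)

lemma char_pow_order:
  assumes "\<psi> \<in> characters G" "x \<in> carrier G"
  shows "\<psi> x ^ Coset.order G = 1"
proof -
  have "char_on G (carrier G) \<psi>" using assms by (simp add: characters_def char_on_def)
  from char_on_nat_pow[OF this subgroup_self assms(2), of "Coset.order G"]
  show ?thesis using assms pow_order_eq_1 by (simp add: char_one)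
qed

lemma order_pos: "Coset.order G > 0"
  using fin order_gt_0_iff_finite by blast

lemma char_norm:
  assumes "\<psi> \<in> characters G" "x \<in> carrier G"
  shows "norm (\<psi> x) = 1"
proof -
  have "norm (\<psi> x) ^ Coset.order G = 1" by (metis assms char_pow_order norm_one norm_power)
  thus ?thesis using order_pos by (metis power_eq_1_iff not_gr_zero abs_norm_cancel real_norm_def)
qed

text \<open>Being 0 off the carrier, a character is determined by its values on the group, which are
  roots of unity of exponent the group order.\<close>

lemma finite_characters: "finite (characters G)"
proof (rule finite_subset)
  show "characters G \<subseteq> {f. \<forall>x. (x \<in> carrier G \<longrightarrow> f x \<in> {z. z ^ Coset.order G = 1}) \<and> (x \<notin> carrier G \<longrightarrow> f x = 0)}"
    using char_pow_order by (auto simp: characters_def)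
  show "finite \<dots>"
    using order_pos by (intro finite_set_of_finite_funs fin finite_roots_unity) auto
qed

lemma char_cnj:
  assumes "\<psi> \<in> characters G" shows "(\<lambda>x. cnj (\<psi> x)) \<in> characters G"
  using assms by (auto simp: characters_def)

lemma sum_over_group:
  assumes \<psi>: "\<psi> \<in> characters G" "\<psi> \<noteq> principal_char G"
  shows "(\<Sum>x\<in>carrier G. \<psi> x) = 0"
proof -
  obtain a where a: "a \<in> carrier G" "\<psi> a \<noteq> 1"
  proof (rule ccontr)
    assume "\<not> thesis"
    hence "\<psi> = principal_char G" using \<psi>(1) that by (auto simp: characters_def principal_char_def fun_eq_iff)
    thus False using \<psi>(2) by simp
  qed
  have "(\<Sum>x\<in>carrier G. \<psi> x) = (\<Sum>x\<in>carrier G. \<psi> (a \<otimes> x))"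
    using a by (intro sum.reindex_bij_witness[of _ "\<lambda>x. a \<otimes> x" "\<lambda>x. inv a \<otimes> x"]) (auto simp: m_assoc[symmetric])
  also have "\<dots> = \<psi> a * (\<Sum>x\<in>carrier G. \<psi> x)"
    using a \<psi>(1) by (simp add: sum_distrib_left char_mult)
  finally show ?thesis using a by (simp add: algebra_simps)
qed

text \<open>Multiplication by a character \<open>\<phi>\<close> with
  \<open>\<phi> a \<noteq> 1\<close> permutes the characters and scales the sum by
  \<open>\<phi> a\<close>.\<close>

lemma sum_over_characters:
  assumes a: "a \<in> carrier G" "a \<noteq> \<one>"
  shows "(\<Sum>\<psi>\<in>characters G. \<psi> a) = 0"
proof -
  obtain \<phi> where \<phi>: "\<phi> \<in> characters G" "\<phi> a \<noteq> 1" using char_separates[OF a] by blast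
  have nz: "x \<in> carrier G \<Longrightarrow> \<phi> x \<noteq> 0" for x using char_norm[OF \<phi>(1)] by fastforce
  have "(\<Sum>\<psi>\<in>characters G. \<psi> a) = (\<Sum>\<psi>\<in>characters G. \<phi> a * \<psi> a)"
    by (rule sum.reindex_bij_witness[of _ "\<lambda>\<psi> x. \<phi> x * \<psi> x" "\<lambda>\<psi> x. if x \<in> carrier G then \<psi> x / \<phi> x else 0"])
      (use \<phi> nz a in \<open>auto simp: characters_def fun_eq_iff\<close>)
  also have "\<dots> = \<phi> a * (\<Sum>\<psi>\<in>characters G. \<psi> a)" by (simp add: sum_distrib_left)
  finally show ?thesis using \<phi> by (simp add: algebra_simps)
qed

lemma sum_over_characters_quotient:
  assumes a: "a \<in> carrier G" and b: "b \<in> carrier G"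
  shows "(\<Sum>\<psi>\<in>characters G. cnj (\<psi> a) * \<psi> b) = (if a = b then of_nat (card (characters G)) else 0)"
proof -
  have inv: "\<psi> (inv a) = cnj (\<psi> a)" if "\<psi> \<in> characters G" for \<psi>
  proof -
    have "\<psi> a * \<psi> (inv a) = 1" using that a char_mult[OF that a, of "inv a"] by (simp add: char_one)
    moreover have "\<psi> a * cnj (\<psi> a) = 1" using char_norm[OF that a] by (simp add: complex_norm_square[symmetric])
    ultimately show ?thesis by (metis mult_cancel_left mult_zero_left zero_neq_one)
  qed
  have "(\<Sum>\<psi>\<in>characters G. cnj (\<psi> a) * \<psi> b) = (\<Sum>\<psi>\<in>characters G. \<psi> (inv a \<otimes> b))"
    using a b by (intro sum.cong) (auto simp: char_mult inv)
  also have "\<dots> = (if a = b then of_nat (card (characters G)) else 0)"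
  proof (cases "a = b")
    case False
    have "inv a \<otimes> b \<noteq> \<one>" using False a b by (metis inv_closed inv_equality inv_inv)
    thus ?thesis using a b False by (simp add: sum_over_characters)
  qed (use a in \<open>simp add: char_one\<close>)
  finally show ?thesis .
qed

lemma card_characters_pos: "card (characters G) > 0"
  using finite_characters principal_char_in card_gt_0_iff by blast

end

section \<open>Multisets of normed primes\<close>

text \<open>Each step adjoins one prime with its full multiplicity, that is, one local factor; this
  is the induction that fits multiplicative functions.\<close>

lemma multiset_prime_power_induct [case_names empty add]:
  assumes "Q {#}"
    and "\<And>D P k. P \<notin># D \<Longrightarrow> k \<ge> 1 \<Longrightarrow> Q D \<Longrightarrow> Q (D + replicate_mset k P)"
  shows "Q D"
proof (induction "card (set_mset D)" arbitrary: D)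
  case 0 thus ?case using assms(1) by simp
next
  case (Suc n)
  then obtain P where P: "P \<in># D" by (metis card.empty ex_in_conv Suc_not_Zero)
  define E where "E = filter_mset (\<lambda>x. x \<noteq> P) D"
  have E: "D = E + replicate_mset (count D P) P"
    by (rule multiset_eqI) (simp add: E_def)
  have "set_mset E = set_mset D - {P}" by (auto simp: E_def)
  hence "card (set_mset E) = n" using Suc P by simp
  hence "Q E" using Suc by blast
  moreover have "P \<notin># E" "count D P \<ge> 1" using P by (auto simp: E_def Suc_le_eq)
  ultimately show ?case using assms(2) E by metis
qed

text \<open>The source of the product formulas below: a divisor sum acquires an inner sum over the
  exponent of the new prime.\<close>

lemma submset_add_replicate:
  assumes "P \<notin># D"
  shows "bij_betw (\<lambda>(c, j). c + replicate_mset j P) ({c. c \<subseteq># D} \<times> {..k}) {c. c \<subseteq># D + replicate_mset k P}"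
proof (rule bij_betwI)
  let ?g = "\<lambda>c. (filter_mset (\<lambda>x. x \<noteq> P) c, count c P)"
  have D0: "count D P = 0" using assms by (simp add: count_eq_zero_iff)
  show "(\<lambda>(c, j). c + replicate_mset j P) \<in> {c. c \<subseteq># D} \<times> {..k} \<rightarrow> {c. c \<subseteq># D + replicate_mset k P}"
    by (auto simp: subseteq_mset_def intro!: add_mono)
  show "?g \<in> {c. c \<subseteq># D + replicate_mset k P} \<rightarrow> {c. c \<subseteq># D} \<times> {..k}"
  proof (intro Pi_I, clarsimp, intro conjI)
    fix c assume c: "c \<subseteq># D + replicate_mset k P"
    show "filter_mset (\<lambda>x. x \<noteq> P) c \<subseteq># D"
      unfolding subseteq_mset_def
    proof
      fix a show "count (filter_mset (\<lambda>x. x \<noteq> P) c) a \<le> count D a"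
        using c[unfolded subseteq_mset_def, rule_format, of a] by (auto split: if_splits)
    qed
    show "count c P \<le> k" using c[unfolded subseteq_mset_def, rule_format, of P] D0 by simp
  qed
  show "?g (case x of (c, j) \<Rightarrow> c + replicate_mset j P) = x" if "x \<in> {c. c \<subseteq># D} \<times> {..k}" for x
  proof -
    obtain c j where x: "x = (c, j)" "c \<subseteq># D" using \<open>x \<in> _\<close> by auto
    have c0: "count c P = 0" using x(2) D0 by (metis le_zero_eq subseteq_mset_def)
    have "filter_mset (\<lambda>x. x \<noteq> P) (c + replicate_mset j P) = c"
      by (rule multiset_eqI) (use c0 in auto)
    thus ?thesis using x c0 by simp
  qed
  show "(case ?g y of (c, j) \<Rightarrow> c + replicate_mset j P) = y" for y
    by (auto intro!: multiset_eqI)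
qed

lemma finite_submsets: "finite {c. c \<subseteq># D}"
proof (induction D rule: multiset_prime_power_induct)
  case (add D P k)
  thus ?case using bij_betw_finite[OF submset_add_replicate[OF add(1), of k]] by simp
qed simp

lemma sum_submset_add_replicate:
  assumes "P \<notin># D"
  shows "(\<Sum>c\<in>{c. c \<subseteq># D + replicate_mset k P}. f c) = (\<Sum>c\<in>{c. c \<subseteq># D}. \<Sum>j\<le>k. f (c + replicate_mset j P))"
proof -
  have "(\<Sum>c\<in>{c. c \<subseteq># D + replicate_mset k P}. f c)
      = (\<Sum>(c, j)\<in>{c. c \<subseteq># D} \<times> {..k}. f (c + replicate_mset j P))"
    by (subst sum.reindex_bij_betw[OF submset_add_replicate[OF assms], symmetric]) (auto intro: sum.cong)
  thus ?thesis by (simp add: sum.cartesian_product)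
qed

section \<open>The Moebius function and multiplicative divisor sums\<close>

definition mset_moebius :: "'p multiset \<Rightarrow> real" where
  "mset_moebius D = (if \<forall>x. count D x \<le> 1 then (-1) ^ size D else 0)"

lemma abs_mset_moebius_le: "\<bar>mset_moebius D\<bar> \<le> 1"
  by (simp add: mset_moebius_def power_abs)

text \<open>Of the exponents of the last prime only 0 and 1 survive, with opposite signs.\<close>

lemma sum_mset_moebius: "(\<Sum>c\<in>{c. c \<subseteq># D}. mset_moebius c) = (if D = {#} then 1 else 0)"
proof (induction D rule: multiset_prime_power_induct)
  case empty
  thus ?case by (simp add: mset_moebius_def)
next
  case (add D P k)
  have "(\<Sum>j\<le>k. mset_moebius (c + replicate_mset j P)) = 0" if c: "c \<subseteq># D" for c
  proof -
    have c0: "count c P = 0" using c add(1) by (metis count_eq_zero_iff mset_subset_eqD)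
    have z: "mset_moebius (c + replicate_mset j P) = 0" if "j \<ge> 2" for j
      using that c0 unfolding mset_moebius_def by (auto intro!: exI[of _ P])
    have s: "mset_moebius (c + replicate_mset 1 P) = - mset_moebius c"
    proof -
      have "(\<forall>x. count (c + replicate_mset 1 P) x \<le> 1) \<longleftrightarrow> (\<forall>x. count c x \<le> 1)"
      proof -
        have "count (c + replicate_mset 1 P) x = (if x = P then 1 else count c x)" for x
          using c0 by simp
        thus ?thesis using c0 by (metis le_refl zero_le)
      qed
      thus ?thesis unfolding mset_moebius_def by simp
    qed
    have "(\<Sum>j\<le>k. mset_moebius (c + replicate_mset j P)) = (\<Sum>j\<in>{0,1}. mset_moebius (c + replicate_mset j P))"
      using add(2) z by (intro sum.mono_neutral_right) auto
    also have "\<dots> = 0" using s by simp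
    finally show ?thesis .
  qed
  moreover have "D + replicate_mset k P \<noteq> {#}" using add by auto
  ultimately show ?case using add by (simp add: sum_submset_add_replicate)
qed

text \<open>Over one prime the sum of \<open>f {#P#} ^ j\<close> for \<open>j \<le> k\<close> is
  \<open>k + 1\<close> if the value is 1, and 1 or 0 by the parity of \<open>k\<close> if it is -1.
  So every local factor is nonnegative, and at least 1 for even \<open>k\<close>. For a real
  character these divisor sums are the coefficients of zeta times L.\<close>

lemma sum_submset_multiplicative:
  fixes f :: "'p multiset \<Rightarrow> real"
  assumes mult: "\<And>D E. set_mset D \<subseteq> A \<Longrightarrow> set_mset E \<subseteq> A \<Longrightarrow> f (D + E) = f D * f E"
    and one: "f {#} = 1" and val: "\<And>D. set_mset D \<subseteq> A \<Longrightarrow> f D \<in> {-1, 1}"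
    and D: "set_mset D \<subseteq> A"
  shows "(\<Sum>c\<in>{c. c \<subseteq># D}. f c) \<ge> 0 \<and> ((\<forall>x. even (count D x)) \<longrightarrow> (\<Sum>c\<in>{c. c \<subseteq># D}. f c) \<ge> 1)"
  using D
proof (induction D rule: multiset_prime_power_induct)
  case empty
  thus ?case using one by simp
next
  case (add D P k)
  have DA: "set_mset D \<subseteq> A" "P \<in> A" using add.prems add.hyps by (auto split: if_splits)
  have fj: "f (replicate_mset j P) = f {#P#} ^ j" for j
  proof (induction j)
    case (Suc j)
    have "f (replicate_mset (Suc j) P) = f ({#P#} + replicate_mset j P)" by simp
    also have "\<dots> = f {#P#} * f (replicate_mset j P)" using DA by (intro mult) (auto split: if_splits)
    finally show ?case using Suc by simp
  qed (use one in auto)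
  have "(\<Sum>c\<in>{c. c \<subseteq># D + replicate_mset k P}. f c) = (\<Sum>c\<in>{c. c \<subseteq># D}. \<Sum>j\<le>k. f c * f {#P#} ^ j)"
    unfolding sum_submset_add_replicate[OF add.hyps(1)]
  proof (intro sum.cong refl)
    fix c j assume "c \<in> {c. c \<subseteq># D}"
    hence "set_mset c \<subseteq> A" using DA set_mset_mono by fastforce
    thus "f (c + replicate_mset j P) = f c * f {#P#} ^ j"
      using DA fj by (subst mult) (auto split: if_splits)
  qed
  also have "\<dots> = (\<Sum>c\<in>{c. c \<subseteq># D}. f c) * (\<Sum>j\<le>k. f {#P#} ^ j)"
    by (simp add: sum_product)
  finally have eq: "(\<Sum>c\<in>{c. c \<subseteq># D + replicate_mset k P}. f c) = \<dots>" .
  have P1: "f {#P#} \<in> {-1, 1}" using val DA by simp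
  have geo: "(\<Sum>j\<le>k. (-1::real) ^ j) = (if even k then 1 else 0)" by (induction k) auto
  have nn: "(\<Sum>j\<le>k. f {#P#} ^ j) \<ge> 0" using P1 geo by auto
  have ge1: "(\<Sum>j\<le>k. f {#P#} ^ j) \<ge> 1" if "even k" using P1 geo that by auto
  have IH: "(\<Sum>c\<in>{c. c \<subseteq># D}. f c) \<ge> 0" "(\<forall>x. even (count D x)) \<Longrightarrow> (\<Sum>c\<in>{c. c \<subseteq># D}. f c) \<ge> 1"
    using add.IH DA by auto
  have "(\<Sum>c\<in>{c. c \<subseteq># D}. f c) * (\<Sum>j\<le>k. f {#P#} ^ j) \<ge> 1" if ev: "\<forall>x. even (count (D + replicate_mset k P) x)"
  proof -
    have P0: "count D P = 0" using add.hyps by (simp add: count_eq_zero_iff)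
    have "even k" using ev[rule_format, of P] P0 by simp
    moreover have "even (count D x)" for x using ev[rule_format, of x] P0 by (auto split: if_splits)
    ultimately have "1 * 1 \<le> (\<Sum>c\<in>{c. c \<subseteq># D}. f c) * (\<Sum>j\<le>k. f {#P#} ^ j)"
      using IH(2) ge1 by (intro mult_mono) auto
    thus ?thesis by simp
  qed
  thus ?case unfolding eq using IH(1) nn by simp
qed

section \<open>Norms, Dirichlet convolution and the von Mangoldt function\<close>

locale normed_primes =
  fixes Pr :: "'p set" and nm :: "'p \<Rightarrow> nat"
  assumes nm_ge2: "P \<in> Pr \<Longrightarrow> nm P \<ge> 2"
    and finite_nm: "finite {P \<in> Pr. nm P \<le> n}"
begin

text \<open>Beurling integers over the generalised primes \<open>Pr\<close>, written additively;
  later they are the ideals prime to the modulus.\<close>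

definition Divs :: "'p multiset set" where "Divs = {D. set_mset D \<subseteq> Pr}"

definition N :: "'p multiset \<Rightarrow> nat" where "N D = prod_mset (image_mset nm D)"

definition Ile :: "real \<Rightarrow> 'p multiset set" where "Ile x = {D \<in> Divs. real (N D) \<le> x}"

text \<open>The von Mangoldt function. On a prime power \<open>SOME P. P \<in># D\<close> is its
  only prime; the condition \<open>k \<ge> 1\<close> gives the empty multiset the value 0.\<close>

definition mangoldt :: "'p multiset \<Rightarrow> real" where
  "mangoldt D = (if \<exists>P k. k \<ge> 1 \<and> D = replicate_mset k P then ln (real (nm (SOME P. P \<in># D))) else 0)"

lemma N_empty [simp]: "N {#} = 1" and N_single [simp]: "N {#P#} = nm P"
  and N_add [simp]: "N (D + E) = N D * N E"
  by (simp_all add: N_def)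

lemma N_replicate [simp]: "N (replicate_mset k P) = nm P ^ k"
  by (induction k) (simp_all add: N_def)

lemma Divs_empty [simp]: "{#} \<in> Divs" and Divs_add [simp]: "D + E \<in> Divs \<longleftrightarrow> D \<in> Divs \<and> E \<in> Divs"
  and Divs_single [simp]: "{#P#} \<in> Divs \<longleftrightarrow> P \<in> Pr"
  by (auto simp: Divs_def)

lemma Divs_subset: "D \<in> Divs \<Longrightarrow> E \<subseteq># D \<Longrightarrow> E \<in> Divs"
  by (auto simp: Divs_def dest: mset_subset_eqD)

lemma N_ge_two_power: "D \<in> Divs \<Longrightarrow> N D \<ge> 2 ^ size D"
proof (induction D)
  case (add P D)
  hence "nm P \<ge> 2" "N D \<ge> 2 ^ size D" by (auto simp: Divs_def nm_ge2)
  hence "2 * 2 ^ size D \<le> nm P * N D" by (intro mult_mono) auto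
  thus ?case by (simp add: N_def)
qed auto

lemma N_pos: "D \<in> Divs \<Longrightarrow> N D > 0"
  using N_ge_two_power[of D] by (metis less_le_trans zero_less_power zero_less_numeral)

lemma N_ge1: "D \<in> Divs \<Longrightarrow> real (N D) \<ge> 1"
  using N_pos[of D] by simp

lemma nm_le_N: "D \<in> Divs \<Longrightarrow> P \<in># D \<Longrightarrow> nm P \<le> N D"
proof -
  assume *: "D \<in> Divs" "P \<in># D"
  then obtain E where E: "D = {#P#} + E" by (metis add_mset_add_single mset_add union_commute)
  have "N D = nm P * N E" "N E > 0" using * N_pos[of E] unfolding E Divs_add by (auto simp only: N_add N_single)
  thus ?thesis by simp
qed

lemma finite_Ile: "finite (Ile x)"
proof -
  define n where "n = nat \<lfloor>x\<rfloor>"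
  define B where "B = {P \<in> Pr. nm P \<le> n}"
  have finB: "finite B" unfolding B_def by (rule finite_nm)
  \<comment> \<open>As every prime norm is at least 2, \<open>N D \<le> n\<close> bounds both the
    norms of the primes in \<open>D\<close> and their multiplicities by \<open>n\<close>, so all
    such \<open>D\<close> divide one multiset.\<close>
  have "Ile x \<subseteq> {D. D \<subseteq># (\<Sum>P\<in>B. replicate_mset n P)}"
  proof
    fix D assume "D \<in> Ile x"
    hence D: "D \<in> Divs" "N D \<le> n" by (auto simp: Ile_def n_def le_nat_floor)
    have c: "count D P \<le> n" for P
    proof -
      have "count D P \<le> size D" by (rule count_le_size)
      also have "\<dots> < 2 ^ size D" by (rule less_exp)
      also have "\<dots> \<le> N D" by (rule N_ge_two_power[OF D(1)])
      finally show ?thesis using D by simp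
    qed
    have "count D P \<le> count (\<Sum>P\<in>B. replicate_mset n P) P" for P
    proof (cases "P \<in># D")
      case True
      hence "P \<in> B" using D nm_le_N[OF D(1)] by (fastforce simp: B_def Divs_def)
      thus ?thesis using c finB by (simp add: count_sum)
    qed (simp add: not_in_iff)
    thus "D \<in> {D. D \<subseteq># (\<Sum>P\<in>B. replicate_mset n P)}" by (simp add: subseteq_mset_def)
  qed
  thus ?thesis by (rule finite_subset) (rule finite_submsets)
qed

lemma Ile_subset_Divs: "D \<in> Ile x \<Longrightarrow> D \<in> Divs" by (simp add: Ile_def)

text \<open>Pairs with \<open>N b * N c \<le> x\<close> are the decompositions
  \<open>D = b + c\<close> with \<open>N D \<le> x\<close>; the Moebius inversions and the hyperbola
  sum below pass through this reindexing.\<close>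

lemma sum_convolution:
  fixes h :: "'p multiset \<Rightarrow> 'p multiset \<Rightarrow> 'c::comm_monoid_add"
  shows "(\<Sum>b\<in>Ile x. \<Sum>c\<in>Ile (x / N b). h b c) = (\<Sum>D\<in>Ile x. \<Sum>b\<in>{b. b \<subseteq># D}. h b (D - b))"
proof -
  have "(\<Sum>b\<in>Ile x. \<Sum>c\<in>Ile (x / N b). h b c) = (\<Sum>(b,c)\<in>Sigma (Ile x) (\<lambda>b. Ile (x / N b)). h b c)"
    by (intro sum.Sigma) (auto simp: finite_Ile)
  also have "\<dots> = (\<Sum>(D,b)\<in>Sigma (Ile x) (\<lambda>D. {b. b \<subseteq># D}). h b (D - b))"
  proof (rule sum.reindex_bij_witness[of _ "\<lambda>(D,b). (b, D - b)" "\<lambda>(b,c). (b + c, b)"])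
    fix a assume "a \<in> Sigma (Ile x) (\<lambda>b. Ile (x / N b))"
    then obtain b c where a: "a = (b, c)" "b \<in> Divs" "c \<in> Divs" "real (N c) \<le> x / N b" by (auto simp: Ile_def)
    have "real (N (b + c)) \<le> x" using a N_pos[of b] by (simp add: field_simps)
    thus "(case a of (b, c) \<Rightarrow> (b + c, b)) \<in> Sigma (Ile x) (\<lambda>D. {b. b \<subseteq># D})" using a by (simp add: Ile_def)
  next
    fix a assume "a \<in> Sigma (Ile x) (\<lambda>D. {b. b \<subseteq># D})"
    then obtain D b where a: "a = (D, b)" "D \<in> Divs" "real (N D) \<le> x" "b \<subseteq># D" by (auto simp: Ile_def)
    define c where "c = D - b"
    have D: "D = b + c" using a by (simp add: c_def)
    have bc: "b \<in> Divs" "c \<in> Divs" using a D by auto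
    have le: "real (N b) * real (N c) \<le> x" using a D by simp
    have "real (N b) * 1 \<le> real (N b) * real (N c)" using N_ge1[OF bc(2)] by (intro mult_left_mono) auto
    hence "real (N b) \<le> x" using le by linarith
    thus "(case a of (D, b) \<Rightarrow> (b, D - b)) \<in> Sigma (Ile x) (\<lambda>b. Ile (x / N b))"
      using a bc le N_pos[OF bc(1)] by (simp add: Ile_def c_def[symmetric] field_simps)
  qed auto
  also have "\<dots> = (\<Sum>D\<in>Ile x. \<Sum>b\<in>{b. b \<subseteq># D}. h b (D - b))"
    by (rule sum.Sigma[symmetric]) (auto simp: finite_Ile finite_submsets)
  finally show ?thesis .
qed

lemma mangoldt_replicate: "k \<ge> 1 \<Longrightarrow> mangoldt (replicate_mset k P) = ln (real (nm P))"
proof -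
  assume k: "k \<ge> 1"
  have "(SOME Q. Q \<in># replicate_mset k P) = P"
    using k by (intro some_equality) (auto split: if_splits)
  thus ?thesis using k by (auto simp: mangoldt_def)
qed

lemma mangoldt_empty [simp]: "mangoldt {#} = 0"
  by (auto simp: mangoldt_def)

lemma mangoldt_nonneg: "D \<in> Divs \<Longrightarrow> mangoldt D \<ge> 0"
proof (cases "\<exists>P k. k \<ge> 1 \<and> D = replicate_mset k P")
  case True
  assume D: "D \<in> Divs"
  from True obtain P k where *: "k \<ge> 1" "D = replicate_mset k P" by blast
  hence "P \<in> Pr" using D by (auto simp: Divs_def)
  from nm_ge2[OF this] show ?thesis using * by (simp add: mangoldt_replicate)
next
  case False
  thus ?thesis unfolding mangoldt_def by (simp only: if_False)
qed

text \<open>Only divisors supported on a single prime count, so adjoining \<open>k\<close> copies of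
  \<open>P\<close> adds \<open>ln (nm P)\<close> exactly \<open>k\<close> times, all coming from the
  divisor \<open>{#}\<close> of \<open>D\<close>.\<close>

lemma sum_mangoldt:
  assumes "D \<in> Divs"
  shows "(\<Sum>c\<in>{c. c \<subseteq># D}. mangoldt c) = ln (real (N D))"
  using assms
proof (induction D rule: multiset_prime_power_induct)
  case (add D P k)
  have D: "D \<in> Divs" "P \<in> Pr" using add by (auto simp: Divs_def split: if_splits)
  have "(\<Sum>j\<le>k. mangoldt (c + replicate_mset j P)) = mangoldt c + (if c = {#} then k * ln (real (nm P)) else 0)"
    if c: "c \<subseteq># D" for c
  proof -
    have "(\<Sum>j\<le>k. mangoldt (c + replicate_mset j P)) = mangoldt c + (\<Sum>j\<in>{1..k}. mangoldt (c + replicate_mset j P))"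
    proof -
      have "{..k} = insert 0 {1..k}" by auto
      thus ?thesis by simp
    qed
    also have "(\<Sum>j\<in>{1..k}. mangoldt (c + replicate_mset j P)) = (if c = {#} then k * ln (real (nm P)) else 0)"
    proof (cases "c = {#}")
      case False
      then obtain R where R: "R \<in># c" by auto
      have "R \<noteq> P" using R c add.hyps by (metis mset_subset_eqD)
      have "mangoldt (c + replicate_mset j P) = 0" if "j \<in> {1..k}" for j
      proof -
        have "\<nexists>S i. i \<ge> 1 \<and> c + replicate_mset j P = replicate_mset i S"
        proof (intro notI, elim exE conjE)
          fix S i assume e: "c + replicate_mset j P = replicate_mset i S"
          have "R \<in># c + replicate_mset j P" "P \<in># c + replicate_mset j P" using R that by auto
          thus False using e \<open>R \<noteq> P\<close> by (auto split: if_splits)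
        qed
        thus ?thesis unfolding mangoldt_def by (simp only: if_False)
      qed
      thus ?thesis using False by simp
    qed (simp add: mangoldt_replicate)
    finally show ?thesis .
  qed
  hence "(\<Sum>c\<in>{c. c \<subseteq># D + replicate_mset k P}. mangoldt c)
    = (\<Sum>c\<in>{c. c \<subseteq># D}. mangoldt c + (if c = {#} then k * ln (real (nm P)) else 0))"
    unfolding sum_submset_add_replicate[OF add.hyps(1)] by (intro sum.cong) auto
  also have "\<dots> = ln (real (N D)) + k * ln (real (nm P))"
    using add.IH D by (simp add: sum.distrib sum.delta finite_submsets)
  also have "\<dots> = ln (real (N D) * real (nm P) ^ k)"
    using N_pos[OF D(1)] nm_ge2[OF D(2)] by (subst ln_mult) (auto simp: ln_realpow)
  finally show ?case by simp
qed simp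

end

section \<open>Partial summation\<close>

text \<open>Mean value theorem. Dividing by \<open>b\<close> keeps the direction of the inequality
  for either sign of \<open>b\<close>, so one estimate telescopes both to tails of convergent sums
  and to the growth of divergent ones.\<close>

lemma powr_increment_ge:
  fixes x b :: real
  assumes "x > 0" "b < 1" "b \<noteq> 0"
  shows "(x + 1) powr (b - 1) \<le> ((x + 1) powr b - x powr b) / b"
proof -
  have "\<exists>z>x. z < x + 1 \<and> (x + 1) powr b - x powr b = (x + 1 - x) * (b * z powr (b - 1))"
    using assms by (intro MVT2) (auto intro!: derivative_eq_intros simp: powr_diff)
  then obtain z where z: "z > x" "z < x + 1" "(x + 1) powr b - x powr b = b * z powr (b - 1)" by auto
  have "(x + 1) powr (b - 1) \<le> z powr (b - 1)" using z assms by (intro powr_mono2') auto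
  thus ?thesis using z assms by (simp add: field_simps)
qed

lemma sum_powr_tail:
  assumes "b < 0" "m \<ge> 1"
  shows "(\<Sum>n=m+1..m+k. real n powr (b - 1)) \<le> real m powr b / (-b)"
proof -
  have "(\<Sum>n=m+1..m+k. real n powr (b - 1)) \<le> (real m powr b - real (m + k) powr b) / (-b)"
  proof (induction k)
    case (Suc k)
    have "real (m + k + 1) powr (b - 1) \<le> (real (m + k) powr b - real (m + k + 1) powr b) / (-b)"
      using powr_increment_ge[of "real (m + k)" b] assms by (simp add: field_simps)
    thus ?case using Suc by (simp add: diff_divide_distrib)
  qed simp
  also have "\<dots> \<le> real m powr b / (-b)" using assms by (intro divide_right_mono) auto
  finally show ?thesis .
qed

lemma sum_powr_le:
  assumes "0 < b" "b < 1"
  shows "(\<Sum>n=1..m. real n powr (b - 1)) \<le> real m powr b / b"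
proof (induction m)
  case (Suc m)
  show ?case
  proof (cases "m = 0")
    case True thus ?thesis using assms by (simp add: field_simps)
  next
    case False
    thus ?thesis using Suc powr_increment_ge[of "real m" b] assms by (simp add: field_simps)
  qed
qed simp

lemma abel_identity:
  fixes s w :: "nat \<Rightarrow> 'a::comm_ring_1"
  defines "S \<equiv> \<lambda>m. \<Sum>n=1..m. s n"
  shows "(\<Sum>n=m+1..m+k. s n * w n) = S (m + k) * w (m + k + 1) - S m * w (m + 1)
           + (\<Sum>n=m+1..m+k. S n * (w n - w (n + 1)))"
proof (induction k)
  case (Suc k)
  have "S (m + Suc k) = S (m + k) + s (m + k + 1)" by (simp add: S_def)
  thus ?case using Suc by (simp add: algebra_simps)
qed simp

text \<open>The exponent 3/4 leaves room for both \<open>1 / n\<close> and \<open>ln n / n\<close>.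
  Each of the two boundary terms costs \<open>B * c * m powr (-1/4)\<close>, and the remaining sum
  over \<open>n powr (-5/4)\<close> at most 4 times that, whence the 6.\<close>

lemma abel_bound:
  fixes s :: "nat \<Rightarrow> complex" and w :: "nat \<Rightarrow> real"
  assumes S: "\<And>m. m \<ge> 1 \<Longrightarrow> norm (\<Sum>n=1..m. s n) \<le> B * sqrt m"
    and w: "\<And>n. n \<ge> 1 \<Longrightarrow> \<bar>w n\<bar> \<le> c * real n powr (-3/4)"
    and dw: "\<And>n. n \<ge> 1 \<Longrightarrow> \<bar>w n - w (n + 1)\<bar> \<le> c * real n powr (-7/4)"
    and pos: "B \<ge> 0" "c \<ge> 0" and m: "m \<ge> 1"
  shows "norm (\<Sum>n=m+1..m+k. s n * of_real (w n)) \<le> 6 * B * c * real m powr (-1/4)"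
proof -
  define T where "T = (\<lambda>m. \<Sum>n=1..m. s n)"
  have bd: "norm (T j * of_real (w (j + 1))) \<le> B * c * real m powr (-1/4)" if "j \<ge> m" for j
  proof -
    have "norm (T j * of_real (w (j + 1))) \<le> (B * sqrt j) * (c * real (j + 1) powr (-3/4))"
      unfolding norm_mult T_def using S[of j] w[of "j + 1"] that m pos by (intro mult_mono) auto
    also have "\<dots> \<le> (B * sqrt j) * (c * real j powr (-3/4))"
      using pos that m by (intro mult_left_mono powr_mono2') auto
    also have "\<dots> = B * c * real j powr (-1/4)"
      using that m by (simp add: powr_half_sqrt[symmetric] powr_add[symmetric])
    also have "\<dots> \<le> B * c * real m powr (-1/4)"
      using pos that m by (intro mult_left_mono powr_mono2') auto
    finally show ?thesis .
  qed
  have "norm (\<Sum>n=m+1..m+k. T n * (of_real (w n) - of_real (w (n + 1))))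
      \<le> (\<Sum>n=m+1..m+k. B * c * real n powr (-1/4 - 1))"
  proof (rule sum_norm_le)
    fix n assume n: "n \<in> {m+1..m+k}"
    have "norm (T n * (of_real (w n) - of_real (w (n + 1)))) = norm (T n) * \<bar>w n - w (n + 1)\<bar>"
      by (simp add: norm_mult flip: of_real_diff)
    also have "\<dots> \<le> (B * sqrt n) * (c * real n powr (-7/4))"
      unfolding T_def using S[of n] dw[of n] n pos by (intro mult_mono) auto
    also have "\<dots> = B * c * real n powr (-1/4 - 1)"
      using n by (simp add: powr_half_sqrt[symmetric] powr_add[symmetric])
    finally show "norm (T n * (of_real (w n) - of_real (w (n + 1)))) \<le> B * c * real n powr (-1/4 - 1)" .
  qed
  also have "\<dots> = B * c * (\<Sum>n=m+1..m+k. real n powr (-1/4 - 1))" by (simp add: sum_distrib_left)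
  also have "\<dots> \<le> B * c * (real m powr (-1/4) / (-(-1/4)))"
    using pos m by (intro mult_left_mono sum_powr_tail) auto
  finally have t3: "norm (\<Sum>n=m+1..m+k. T n * (of_real (w n) - of_real (w (n + 1)))) \<le> 4 * (B * c * real m powr (-1/4))"
    by simp
  have "(\<Sum>n=m+1..m+k. s n * of_real (w n)) = T (m + k) * of_real (w (m + k + 1)) - T m * of_real (w (m + 1))
           + (\<Sum>n=m+1..m+k. T n * (of_real (w n) - of_real (w (n + 1))))"
    unfolding T_def by (rule abel_identity)
  also have "norm \<dots> \<le> norm (T (m + k) * of_real (w (m + k + 1))) + norm (T m * of_real (w (m + 1)))
           + norm (\<Sum>n=m+1..m+k. T n * (of_real (w n) - of_real (w (n + 1))))"
    by (rule order.trans[OF norm_triangle_ineq add_right_mono[OF norm_triangle_ineq4]])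
  finally show ?thesis using bd[of "m + k"] bd[of m] t3 by simp
qed

lemma abel_limit:
  fixes s :: "nat \<Rightarrow> complex" and w :: "nat \<Rightarrow> real"
  assumes S: "\<And>m. m \<ge> 1 \<Longrightarrow> norm (\<Sum>n=1..m. s n) \<le> B * sqrt m"
    and w: "\<And>n. n \<ge> 1 \<Longrightarrow> \<bar>w n\<bar> \<le> c * real n powr (-3/4)"
    and dw: "\<And>n. n \<ge> 1 \<Longrightarrow> \<bar>w n - w (n + 1)\<bar> \<le> c * real n powr (-7/4)"
    and pos: "B \<ge> 0" "c \<ge> 0"
  shows "\<exists>L. \<forall>m\<ge>1. norm ((\<Sum>n=1..m. s n * of_real (w n)) - L) \<le> 6 * B * c * real m powr (-1/4)"
proof -
  define F where "F m = (\<Sum>n=1..m. s n * of_real (w n))" for m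
  define K where "K = 6 * B * c"
  have K0: "K \<ge> 0" using pos by (simp add: K_def)
  have diff: "norm (F m' - F m) \<le> K * real m powr (-1/4)" if "m \<ge> 1" "m' \<ge> m" for m m'
  proof -
    have "F m' = F m + (\<Sum>n=m+1..m+(m'-m). s n * of_real (w n))"
    proof -
      have "{1..m'} = {1..m} \<union> {m+1..m+(m'-m)}" "{1..m} \<inter> {m+1..m+(m'-m)} = {}" using that by auto
      thus ?thesis unfolding F_def by (simp add: sum.union_disjoint)
    qed
    thus ?thesis using abel_bound[OF S w dw pos that(1), of "m' - m"] by (simp add: K_def)
  qed
  have lim0: "(\<lambda>m. K * real m powr (-1/4)) \<longlonglongrightarrow> 0"
  proof -
    have "(\<lambda>m. real m powr (-1/4)) \<longlonglongrightarrow> 0"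
      by (intro tendsto_neg_powr filterlim_real_sequentially) auto
    from tendsto_mult[OF tendsto_const[of K] this] show ?thesis by simp
  qed
  have "Cauchy F"
  proof (rule CauchyI)
    fix e :: real assume e: "e > 0"
    have "\<forall>\<^sub>F m in sequentially. K * real m powr (-1/4) < e / 2"
      using lim0 e by (intro order_tendstoD(2)) auto
    then obtain M where M: "\<And>m. m \<ge> M \<Longrightarrow> K * real m powr (-1/4) < e / 2"
      by (auto simp: eventually_sequentially)
    define M' where "M' = max 1 M"
    have "norm (F m - F n) < e" if "m \<ge> M'" "n \<ge> M'" for m n
    proof -
      have "norm (F m - F M') < e / 2" "norm (F n - F M') < e / 2"
        using diff[of M' m] diff[of M' n] M[of M'] that by (auto simp: M'_def)
      thus ?thesis using norm_triangle_ineq4[of "F m - F M'" "F n - F M'"] by simp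
    qed
    thus "\<exists>M. \<forall>m\<ge>M. \<forall>n\<ge>M. norm (F m - F n) < e" by blast
  qed
  then obtain L where L: "F \<longlonglongrightarrow> L" using Cauchy_convergent_iff convergent_def by blast
  have "norm (F m - L) \<le> K * real m powr (-1/4)" if "m \<ge> 1" for m
  proof -
    have "(\<lambda>m'. norm (F m' - F m)) \<longlonglongrightarrow> norm (L - F m)" by (intro tendsto_intros L)
    moreover have "\<forall>\<^sub>F m' in sequentially. norm (F m' - F m) \<le> K * real m powr (-1/4)"
      using eventually_ge_at_top[of m] by eventually_elim (rule diff[OF that])
    ultimately have "norm (L - F m) \<le> K * real m powr (-1/4)"
      by (rule tendsto_upperbound) simp
    thus ?thesis by (simp add: norm_minus_commute)
  qed
  thus ?thesis unfolding F_def K_def by blast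
qed

text \<open>Summation by parts twice: once for \<open>s\<close>, with its partial sums replaced by
  \<open>C * m\<close>, and once backwards for the constant sequence 1.\<close>

lemma abel_majorize:
  fixes s w :: "nat \<Rightarrow> real"
  assumes S: "\<And>m. m \<ge> 1 \<Longrightarrow> (\<Sum>n=1..m. s n) \<le> C * m"
    and w: "\<And>n. n \<ge> 1 \<Longrightarrow> w n \<ge> 0" and dw: "\<And>n. n \<ge> 1 \<Longrightarrow> w (n + 1) \<le> w n"
  shows "(\<Sum>n=1..m. s n * w n) \<le> C * (\<Sum>n=1..m. w n)"
proof (cases "m = 0")
  case False
  have "(\<Sum>n=1..m. s n * w n) = (\<Sum>n=1..m. s n) * w (m + 1) + (\<Sum>n=1..m. (\<Sum>i=1..n. s i) * (w n - w (n + 1)))"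
    using abel_identity[of s w 0 m] by simp
  also have "\<dots> \<le> (C * m) * w (m + 1) + (\<Sum>n=1..m. (C * n) * (w n - w (n + 1)))"
    using False w dw S by (intro add_mono mult_right_mono sum_mono) auto
  also have "\<dots> = C * ((\<Sum>n=1..m. 1) * w (m + 1) + (\<Sum>n=1..m. (\<Sum>i=1..n. 1) * (w n - w (n + 1))))"
    by (simp add: algebra_simps sum_distrib_left)
  also have "(\<Sum>n=1..m. 1) * w (m + 1) + (\<Sum>n=1..m. (\<Sum>i=1..n. 1) * (w n - w (n + 1))) = (\<Sum>n=1..m. 1 * w n)"
    using abel_identity[of "\<lambda>_. 1" w 0 m] by simp
  finally show ?thesis by simp
qed simp

lemma inverse_weight:
  assumes "n \<ge> (1::nat)"
  shows "\<bar>1 / real n\<bar> \<le> 1 * real n powr (-3/4)" "\<bar>1 / real n - 1 / real (n + 1)\<bar> \<le> 1 * real n powr (-7/4)"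
proof -
  have "1 / real n = real n powr (-1)" using assms by (simp add: powr_minus_divide)
  also have "\<dots> \<le> real n powr (-3/4)" using assms by (intro powr_mono) auto
  finally show "\<bar>1 / real n\<bar> \<le> 1 * real n powr (-3/4)" by simp
  have "\<bar>1 / real n - 1 / real (n + 1)\<bar> = 1 / (real n * real (n + 1))" using assms by (simp add: field_simps)
  also have "\<dots> \<le> 1 / (real n * real n)" using assms by (intro divide_left_mono mult_left_mono) auto
  also have "\<dots> = real n powr (-2)" using assms by (simp add: powr_minus_divide powr_numeral power2_eq_square)
  also have "\<dots> \<le> real n powr (-7/4)" using assms by (intro powr_mono) auto
  finally show "\<bar>1 / real n - 1 / real (n + 1)\<bar> \<le> 1 * real n powr (-7/4)" by simp
qed

lemma ln_le_powr: 
  assumes "x \<ge> (1::real)" "e > 0" shows "ln x \<le> x powr e / e"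
proof -
  have "e * ln x = ln (x powr e)" using assms by (simp add: ln_powr)
  also have "\<dots> \<le> x powr e" using assms ln_le_minus_one[of "x powr e"] by simp
  finally show ?thesis using assms by (simp add: field_simps)
qed

text \<open>The constant comes from \<open>ln x + 1 \<le> 5 * x powr (1/4)\<close>, that is, from
  \<open>ln x \<le> 4 * x powr (1/4)\<close>.\<close>

lemma log_weight:
  assumes "n \<ge> (1::nat)"
  shows "\<bar>ln (real n) / real n\<bar> \<le> 5 * real n powr (-3/4)"
    "\<bar>ln (real n) / real n - ln (real (n + 1)) / real (n + 1)\<bar> \<le> 5 * real n powr (-7/4)"
proof -
  let ?x = "real n"
  have x: "?x \<ge> 1" using assms by simp
  have ln: "ln ?x \<le> 4 * ?x powr (1/4)" using ln_le_powr[OF x, of "1/4"] by simp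
  have "\<bar>ln ?x / ?x\<bar> = ln ?x / ?x" using x by simp
  also have "\<dots> \<le> (4 * ?x powr (1/4)) / ?x" using ln x by (intro divide_right_mono) auto
  also have "\<dots> = 4 * ?x powr (-3/4)"
    using x powr_diff[of ?x "1/4" 1] by simp
  also have "\<dots> \<le> 5 * ?x powr (-3/4)" by simp
  finally show "\<bar>ln ?x / ?x\<bar> \<le> 5 * ?x powr (-3/4)" .
  have "ln (?x + 1) = ln ?x + ln (1 + 1 / ?x)" 
    using x ln_mult[of ?x "1 + 1 / ?x"] by (simp add: distrib_left) (metis add_pos_nonneg divide_nonneg_nonneg less_irrefl of_nat_0_le_iff zero_le_one zero_less_one)
  moreover have l1: "ln (1 + 1 / ?x) \<le> 1 / ?x" "ln (1 + 1 / ?x) \<ge> 0"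
    using x ln_add_one_self_le_self[of "1 / ?x"] by auto
  ultimately have "ln ?x / ?x - ln (?x + 1) / (?x + 1) = (ln ?x - ?x * ln (1 + 1 / ?x)) / (?x * (?x + 1))"
    using x by (simp add: divide_simps) (simp add: algebra_simps)
  also have "\<bar>\<dots>\<bar> \<le> (ln ?x + 1) / (?x * (?x + 1))"
  proof -
    have "0 \<le> ?x * ln (1 + 1 / ?x)" "?x * ln (1 + 1 / ?x) \<le> 1" using l1 x by (auto simp: field_simps)
    moreover have "ln ?x \<ge> 0" using x by simp
    ultimately have "\<bar>ln ?x - ?x * ln (1 + 1 / ?x)\<bar> \<le> ln ?x + 1" by linarith
    thus ?thesis using x by (simp add: abs_mult divide_right_mono)
  qed
  also have "\<dots> \<le> (5 * ?x powr (1/4)) / (?x * ?x)"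
  proof -
    have "1 \<le> ?x powr (1/4)" using x by (simp add: ge_one_powr_ge_zero)
    hence "ln ?x + 1 \<le> 5 * ?x powr (1/4)" using ln by simp
    thus ?thesis using x by (intro frac_le mult_left_mono) auto
  qed
  also have "\<dots> = 5 * ?x powr (-7/4)"
    using x powr_diff[of ?x "1/4" 2] by (simp add: powr_numeral power2_eq_square)
  finally show "\<bar>ln (real n) / real n - ln (real (n + 1)) / real (n + 1)\<bar> \<le> 5 * real n powr (-7/4)"
    by (simp add: add.commute)
qed

section \<open>Partial summation over multisets ordered by norm\<close>

context normed_primes
begin

lemma finite_fiber: "finite {D \<in> Divs. N D = n}"
  by (rule finite_subset[OF _ finite_Ile[of n]]) (auto simp: Ile_def)

lemma sum_Ile_fibers:
  fixes f :: "'p multiset \<Rightarrow> 'b::comm_ring_1"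
  shows "(\<Sum>D\<in>Ile x. f D * g (N D)) = (\<Sum>n=1..nat \<lfloor>x\<rfloor>. (\<Sum>D | D \<in> Divs \<and> N D = n. f D) * g n)"
proof -
  have eq: "Ile x = (\<Union>n\<in>{1..nat \<lfloor>x\<rfloor>}. {D \<in> Divs. N D = n})"
  proof -
    have "real (N D) \<le> x \<longleftrightarrow> N D \<in> {1..nat \<lfloor>x\<rfloor>}" if "D \<in> Divs" for D
    proof
      show "real (N D) \<le> x \<Longrightarrow> N D \<in> {1..nat \<lfloor>x\<rfloor>}"
        using N_pos[OF that] le_nat_floor by auto
      show "N D \<in> {1..nat \<lfloor>x\<rfloor>} \<Longrightarrow> real (N D) \<le> x"
        using N_pos[OF that] by (simp add: nat_le_iff le_floor_iff le_nat_iff) linarith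
    qed
    thus ?thesis by (auto simp: Ile_def)
  qed
  show ?thesis unfolding eq
    by (subst sum.UNION_disjoint) (auto simp: finite_fiber sum_distrib_right intro!: sum.cong)
qed

lemma powr_floor_le:
  assumes "x \<ge> (1::real)"
  shows "real (nat \<lfloor>x\<rfloor>) powr (-1/4) \<le> 2 * x powr (-1/4)"
proof -
  have "real_of_int \<lfloor>x\<rfloor> \<ge> 1" "real_of_int \<lfloor>x\<rfloor> > x - 1" 
    using assms real_of_int_floor_gt_diff_one[of x] by simp_all
  moreover have "real (nat \<lfloor>x\<rfloor>) = real_of_int \<lfloor>x\<rfloor>" using assms by simp
  ultimately have "x / 2 \<le> real (nat \<lfloor>x\<rfloor>)" by argo
  hence "real (nat \<lfloor>x\<rfloor>) powr (-1/4) \<le> (x / 2) powr (-1/4)" using assms by (intro powr_mono2') auto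
  also have "\<dots> = x powr (-1/4) * 2 powr (1/4)" using assms by (simp add: powr_divide powr_minus field_simps)
  also have "\<dots> \<le> x powr (-1/4) * 2 powr 1" by (intro mult_left_mono powr_mono) auto
  finally show ?thesis by simp
qed

text \<open>\<open>abel_limit\<close> for the sums over the fibres of \<open>N\<close>; passing from
  the integer part of \<open>x\<close> to \<open>x\<close> doubles the 6 to 12.\<close>

lemma partial_summation:
  fixes f :: "'p multiset \<Rightarrow> complex" and w :: "nat \<Rightarrow> real"
  assumes S: "\<And>x. x \<ge> 1 \<Longrightarrow> norm (\<Sum>D\<in>Ile x. f D) \<le> B * sqrt x"
    and w: "\<And>n. n \<ge> 1 \<Longrightarrow> \<bar>w n\<bar> \<le> c * real n powr (-3/4)"
    and dw: "\<And>n. n \<ge> 1 \<Longrightarrow> \<bar>w n - w (n + 1)\<bar> \<le> c * real n powr (-7/4)"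
    and pos: "B \<ge> 0" "c \<ge> 0"
  shows "\<exists>L. \<forall>x\<ge>1. norm ((\<Sum>D\<in>Ile x. f D * of_real (w (N D))) - L) \<le> 12 * B * c * x powr (-1/4)"
proof -
  let ?s = "\<lambda>n. \<Sum>D | D \<in> Divs \<and> N D = n. f D"
  have "norm (\<Sum>n=1..m. ?s n) \<le> B * sqrt m" if "m \<ge> 1" for m
    using S[of "real m"] sum_Ile_fibers[where f = f and g = "\<lambda>_. 1" and x = "real m"] that by simp
  from abel_limit[OF this w dw pos] obtain L
    where L: "\<And>m. m \<ge> 1 \<Longrightarrow> norm ((\<Sum>n=1..m. ?s n * of_real (w n)) - L) \<le> 6 * B * c * real m powr (-1/4)" by blast
  have "norm ((\<Sum>D\<in>Ile x. f D * of_real (w (N D))) - L) \<le> 12 * B * c * x powr (-1/4)" if "x \<ge> 1" for x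
  proof -
    have "norm ((\<Sum>D\<in>Ile x. f D * of_real (w (N D))) - L) \<le> 6 * B * c * real (nat \<lfloor>x\<rfloor>) powr (-1/4)"
      using L[of "nat \<lfloor>x\<rfloor>"] sum_Ile_fibers[where f = f and g = "\<lambda>n. of_real (w n)" and x = x] that
      by (simp add: le_nat_floor)
    also have "\<dots> \<le> 6 * B * c * (2 * x powr (-1/4))"
      using powr_floor_le[OF that] pos by (intro mult_left_mono) auto
    finally show ?thesis by simp
  qed
  thus ?thesis by blast
qed

lemma majorize_sum:
  fixes w :: "nat \<Rightarrow> real"
  assumes A: "\<And>x. x \<ge> 1 \<Longrightarrow> real (card (Ile x)) \<le> C * x"
    and w: "\<And>n. n \<ge> 1 \<Longrightarrow> w n \<ge> 0" and dw: "\<And>n. n \<ge> 1 \<Longrightarrow> w (n + 1) \<le> w n"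
  shows "(\<Sum>D\<in>Ile x. w (N D)) \<le> C * (\<Sum>n=1..nat \<lfloor>x\<rfloor>. w n)"
proof -
  let ?s = "\<lambda>n. \<Sum>D | D \<in> Divs \<and> N D = n. (1::real)"
  have "(\<Sum>n=1..m. ?s n) \<le> C * m" if "m \<ge> 1" for m
    using A[of "real m"] sum_Ile_fibers[where f = "\<lambda>_. 1::real" and g = "\<lambda>_. 1" and x = "real m"] that by simp
  from abel_majorize[where s = ?s and w = w and C = C and m = "nat \<lfloor>x\<rfloor>", OF this w dw]
  show ?thesis using sum_Ile_fibers[where f = "\<lambda>_. 1::real" and g = w and x = x] by simp
qed

end

section \<open>Character sums over a semigroup with finitely many classes\<close>

lemma sum_submset_swap:
  fixes f :: "'p multiset \<Rightarrow> 'p multiset \<Rightarrow> 'c::comm_monoid_add"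
  shows "(\<Sum>b\<in>{b. b \<subseteq># D}. \<Sum>e\<in>{e. e \<subseteq># D - b}. f b e) = (\<Sum>e\<in>{e. e \<subseteq># D}. \<Sum>b\<in>{b. b \<subseteq># D - e}. f b e)"
proof -
  have iff: "b \<subseteq># D \<and> e \<subseteq># D - b \<longleftrightarrow> e \<subseteq># D \<and> b \<subseteq># D - e" for b e
  proof -
    have "b \<subseteq># D \<and> e \<subseteq># D - b \<longleftrightarrow> b + e \<subseteq># D" for b e
    proof -
      have "b \<subseteq># D \<and> e \<subseteq># D - b \<longleftrightarrow> (\<forall>a. count b a \<le> count D a \<and> count e a \<le> count D a - count b a)"
        by (auto simp: subseteq_mset_def)
      also have "\<dots> \<longleftrightarrow> (\<forall>a. count (b + e) a \<le> count D a)" by (rule iff_allI) auto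
      finally show ?thesis by (simp add: subseteq_mset_def)
    qed
    from this[of b e] this[of e b] show ?thesis by (metis add.commute)
  qed
  have "(\<Sum>b\<in>{b. b \<subseteq># D}. \<Sum>e\<in>{e. e \<subseteq># D - b}. f b e)
      = (\<Sum>(b,e)\<in>Sigma {b. b \<subseteq># D} (\<lambda>b. {e. e \<subseteq># D - b}). f b e)"
    by (rule sum.Sigma) (auto simp: finite_submsets)
  also have "\<dots> = (\<Sum>(e,b)\<in>Sigma {e. e \<subseteq># D} (\<lambda>e. {b. b \<subseteq># D - e}). f b e)"
    by (rule sum.reindex_bij_witness[of _ prod.swap prod.swap]) (use iff in auto)
  also have "\<dots> = (\<Sum>e\<in>{e. e \<subseteq># D}. \<Sum>b\<in>{b. b \<subseteq># D - e}. f b e)"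
    by (rule sum.Sigma[symmetric]) (auto simp: finite_submsets)
  finally show ?thesis .
qed

text \<open>The Moebius inverse of \<open>sum_mangoldt\<close>: after exchanging the sums only
  \<open>e = D\<close> survives.\<close>

lemma (in normed_primes) moebius_log:
  assumes "D \<in> Divs"
  shows "(\<Sum>b\<in>{b. b \<subseteq># D}. mset_moebius b * ln (real (N (D - b)))) = mangoldt D"
proof -
  have "(\<Sum>b\<in>{b. b \<subseteq># D}. mset_moebius b * ln (real (N (D - b))))
      = (\<Sum>b\<in>{b. b \<subseteq># D}. \<Sum>e\<in>{e. e \<subseteq># D - b}. mset_moebius b * mangoldt e)"
  proof (intro sum.cong refl)
    fix b
    have "D - b \<in> Divs" using assms by (rule Divs_subset) (rule diff_subset_eq_self)
    thus "mset_moebius b * ln (real (N (D - b))) = (\<Sum>e\<in>{e. e \<subseteq># D - b}. mset_moebius b * mangoldt e)"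
      by (simp add: sum_mangoldt[symmetric] sum_distrib_left)
  qed
  also have "\<dots> = (\<Sum>e\<in>{e. e \<subseteq># D}. \<Sum>b\<in>{b. b \<subseteq># D - e}. mset_moebius b * mangoldt e)"
    by (rule sum_submset_swap)
  also have "\<dots> = (\<Sum>e\<in>{e. e \<subseteq># D}. if e = D then mangoldt D else 0)"
  proof (intro sum.cong refl)
    fix e assume e: "e \<in> {e. e \<subseteq># D}"
    hence "D - e = {#} \<longleftrightarrow> e = D"
      by (metis Diff_eq_empty_iff_mset mem_Collect_eq subset_mset.antisym subset_mset.order_refl)
    thus "(\<Sum>b\<in>{b. b \<subseteq># D - e}. mset_moebius b * mangoldt e) = (if e = D then mangoldt D else 0)"
      by (simp add: sum_distrib_right[symmetric] sum_mset_moebius)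
  qed
  also have "\<dots> = mangoldt D" by (simp add: finite_submsets)
  finally show ?thesis .
qed

text \<open>The axiom \<open>riesz\<close> holds the whole arithmetic input: the damped count is
  \<open>\<kappa> * x\<close> up to a bounded error, with the same \<open>\<kappa>\<close> in every
  class. The rest is analysis over the finite group \<open>G\<close>.\<close>

locale class_semigroup = normed_primes Pr nm + finite_comm_group G
  for Pr :: "'p set" and nm and G :: "('g, 'b) monoid_scheme" (structure) +
  fixes cls :: "'p multiset \<Rightarrow> 'g" and \<kappa> C :: real
  assumes cls_closed: "D \<in> Divs \<Longrightarrow> cls D \<in> carrier G"
    and cls_add: "D \<in> Divs \<Longrightarrow> E \<in> Divs \<Longrightarrow> cls (D + E) = cls D \<otimes> cls E"
    and cls_empty: "cls {#} = \<one>"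
    and \<kappa>_pos: "\<kappa> > 0" and C_nonneg: "C \<ge> 0"
    and riesz: "A \<in> carrier G \<Longrightarrow> x \<ge> 1 \<Longrightarrow>
        \<bar>(\<Sum>D\<in>{D \<in> Ile x. cls D = A}. 1 - real (N D) / x) - \<kappa> * x\<bar> \<le> C"
begin

definition h :: real where "h = real (card (carrier G))"
text \<open>The error constant of \<open>class_count\<close>. The differencing itself produces
  \<open>\<kappa> + 3 * C\<close>; the factor 4 covers the small \<open>x\<close> for which the
  difference interval would leave the range of \<open>riesz\<close>.\<close>

definition C2 :: real where "C2 = 4 * \<kappa> + 3 * C"

lemma h_pos: "h \<ge> 1"
  using fin one_closed unfolding h_def by (simp add: card_gt_0_iff Suc_le_eq) blast

lemma C2_pos: "C2 > 0" using \<kappa>_pos C_nonneg by (simp add: C2_def)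

text \<open>\<open>U\<close> is the integral of the counting function, and the monotone count is
  squeezed between difference quotients of \<open>U\<close>. The error \<open>C * x\<close> of
  \<open>U\<close> is divided by the step length, while the curvature of the main term contributes a
  multiple of that length; the two balance at \<open>sqrt x\<close>.\<close>

lemma class_count:
  assumes A: "A \<in> carrier G" and x: "x \<ge> 1"
  shows "\<bar>real (card {D \<in> Ile x. cls D = A}) - 2 * \<kappa> * x\<bar> \<le> C2 * sqrt x"
proof -
  define a where "a x = real (card {D \<in> Ile x. cls D = A})" for x
  define U where "U x = (\<Sum>D\<in>{D \<in> Ile x. cls D = A}. x - real (N D))" for x
  have fin': "finite {D \<in> Ile x. cls D = A}" for x using finite_Ile by simp
  have U: "\<bar>U x - \<kappa> * x\<^sup>2\<bar> \<le> C * x" if "x \<ge> 1" for x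
  proof -
    have "U x = x * (\<Sum>D\<in>{D \<in> Ile x. cls D = A}. 1 - real (N D) / x)"
      unfolding U_def sum_distrib_left using that by (intro sum.cong) (auto simp: field_simps)
    hence "U x - \<kappa> * x\<^sup>2 = x * ((\<Sum>D\<in>{D \<in> Ile x. cls D = A}. 1 - real (N D) / x) - \<kappa> * x)"
      by (simp add: algebra_simps power2_eq_square)
    hence "\<bar>U x - \<kappa> * x\<^sup>2\<bar> = x * \<bar>(\<Sum>D\<in>{D \<in> Ile x. cls D = A}. 1 - real (N D) / x) - \<kappa> * x\<bar>"
      using that by (simp add: abs_mult)
    also have "\<dots> \<le> x * C" using riesz[OF A that] that by (intro mult_left_mono) auto
    finally show ?thesis by (simp add: mult.commute)
  qed
  have dU: "(y - x) * a x \<le> U y - U x \<and> U y - U x \<le> (y - x) * a y" if "x \<le> y" for x y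
  proof -
    let ?X = "{D \<in> Ile x. cls D = A}" and ?Y = "{D \<in> Ile y. cls D = A}"
    have sub: "?X \<subseteq> ?Y" using that by (auto simp: Ile_def)
    have "U y = (\<Sum>D\<in>?Y - ?X. y - real (N D)) + (\<Sum>D\<in>?X. y - real (N D))"
      unfolding U_def by (rule sum.subset_diff[OF sub fin'])
    hence e: "U y - U x = (\<Sum>D\<in>?Y - ?X. y - real (N D)) + (y - x) * a x"
      unfolding U_def a_def by (simp add: sum_subtractf algebra_simps)
    have "(\<Sum>D\<in>?Y - ?X. y - real (N D)) \<ge> 0" by (rule sum_nonneg) (auto simp: Ile_def)
    moreover have "(\<Sum>D\<in>?Y - ?X. y - real (N D)) \<le> (\<Sum>D\<in>?Y - ?X. y - x)"
      by (rule sum_mono) (auto simp: Ile_def)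
    moreover have "(\<Sum>D\<in>?Y - ?X. y - x) = (y - x) * (a y - a x)"
      using sub fin' by (simp add: a_def card_Diff_subset of_nat_diff card_mono)
    ultimately show ?thesis using e by (simp add: algebra_simps)
  qed
  define t where "t = sqrt x"
  have t: "t \<ge> 1" "x = t\<^sup>2" using x by (auto simp: t_def)
  have "a x * t \<le> (2 * \<kappa> * x + C2 * t) * t"
  proof -
    have "t * a x \<le> U (x + t) - U x" using dU[of x "x + t"] t by simp
    also have "\<dots> \<le> (\<kappa> * (x + t)\<^sup>2 + C * (x + t)) - (\<kappa> * x\<^sup>2 - C * x)"
      using U[of x] U[of "x + t"] x t by linarith
    also have "\<dots> = 2 * \<kappa> * x * t + \<kappa> * t\<^sup>2 + C * (2 * t\<^sup>2 + t)"
      using t by (simp add: power2_eq_square algebra_simps)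
    also have "\<dots> \<le> 2 * \<kappa> * x * t + 4 * \<kappa> * t\<^sup>2 + C * (3 * t\<^sup>2)"
      using t \<kappa>_pos C_nonneg self_le_power[of t 2] by (intro add_mono mult_left_mono) auto
    also have "\<dots> = (2 * \<kappa> * x + C2 * t) * t" by (simp add: C2_def power2_eq_square algebra_simps)
    finally show ?thesis by (simp add: mult.commute)
  qed
  hence up: "a x \<le> 2 * \<kappa> * x + C2 * t" using t by simp
  have low: "a x \<ge> 2 * \<kappa> * x - C2 * t"
  proof (cases "x - t \<ge> 1")
    case True
    have "2 * \<kappa> * x * t - \<kappa> * t\<^sup>2 - C * (2 * t\<^sup>2) \<le> (\<kappa> * x\<^sup>2 - C * x) - (\<kappa> * (x - t)\<^sup>2 + C * (x - t))"
      using t C_nonneg by (simp add: power2_eq_square algebra_simps)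
    also have "\<dots> \<le> U x - U (x - t)"
      using U[of x] U[of "x - t"] x True by linarith
    also have "\<dots> \<le> t * a x" using dU[of "x - t" x] t by simp
    finally have "2 * \<kappa> * x * t - \<kappa> * t\<^sup>2 - C * (2 * t\<^sup>2) \<le> t * a x" .
    moreover have "(2 * \<kappa> * x - C2 * t) * t \<le> 2 * \<kappa> * x * t - \<kappa> * t\<^sup>2 - C * (2 * t\<^sup>2)"
      using \<kappa>_pos C_nonneg t by (simp add: C2_def power2_eq_square algebra_simps)
    ultimately have "(2 * \<kappa> * x - C2 * t) * t \<le> a x * t" by (simp add: mult.commute)
    thus ?thesis using t by simp
  next
    \<comment> \<open>Here \<open>t < 2\<close>, and the claimed lower bound is not
      positive.\<close>
    case False
    have "t < 2"
    proof (rule ccontr)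
      assume "\<not> t < 2"
      hence "2 * 1 \<le> t * (t - 1)" by (intro mult_mono) auto
      thus False using False t by (simp add: power2_eq_square algebra_simps)
    qed
    hence "2 * \<kappa> * t * t \<le> 4 * \<kappa> * t" using \<kappa>_pos t by simp
    moreover have "2 * \<kappa> * x = 2 * \<kappa> * t * t" "C2 * t = 4 * \<kappa> * t + 3 * (C * t)"
      using t by (simp_all add: C2_def power2_eq_square algebra_simps)
    moreover have "C * t \<ge> 0" using C_nonneg t by simp
    ultimately have "2 * \<kappa> * x - C2 * t \<le> 0" by linarith
    moreover have "a x \<ge> 0" by (simp add: a_def)
    ultimately show ?thesis by linarith
  qed
  show ?thesis using up low unfolding a_def t_def by linarith
qed

lemma sum_Ile_classes:
  fixes f :: "'p multiset \<Rightarrow> 'c::comm_monoid_add"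
  shows "(\<Sum>D\<in>Ile x. f D) = (\<Sum>A\<in>carrier G. \<Sum>D\<in>{D \<in> Ile x. cls D = A}. f D)"
  by (rule sum.group[symmetric]) (auto simp: finite_Ile fin cls_closed Ile_subset_Divs)

text \<open>A nonprincipal character sums to 0 over the group, so the common main term
  \<open>m\<close> may be subtracted in every class and only the errors remain.\<close>

lemma char_sum_bound:
  assumes \<psi>: "\<psi> \<in> characters G" "\<psi> \<noteq> principal_char G"
    and f: "\<And>A. A \<in> carrier G \<Longrightarrow> \<bar>(\<Sum>D\<in>{D \<in> Ile x. cls D = A}. f D) - m\<bar> \<le> e"
  shows "norm (\<Sum>D\<in>Ile x. \<psi> (cls D) * of_real (f D)) \<le> h * e"
proof -
  have "(\<Sum>D\<in>Ile x. \<psi> (cls D) * of_real (f D))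
      = (\<Sum>A\<in>carrier G. \<psi> A * of_real (\<Sum>D\<in>{D \<in> Ile x. cls D = A}. f D))"
    unfolding sum_Ile_classes[where f = "\<lambda>D. \<psi> (cls D) * of_real (f D)"]
    by (intro sum.cong refl) (auto simp: sum_distrib_left)
  also have "\<dots> = (\<Sum>A\<in>carrier G. \<psi> A * of_real ((\<Sum>D\<in>{D \<in> Ile x. cls D = A}. f D) - m))"
    using sum_over_group[OF \<psi>] by (simp add: algebra_simps sum_subtractf flip: sum_distrib_left)
  also have "norm \<dots> \<le> (\<Sum>A\<in>carrier G. e)"
    by (intro sum_norm_le) (use f char_norm[OF \<psi>(1)] in \<open>auto simp: norm_mult simp flip: of_real_sum of_real_diff\<close>)
  finally show ?thesis by (simp add: h_def)
qed

lemma total_sum_bound: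
  assumes f: "\<And>A. A \<in> carrier G \<Longrightarrow> \<bar>(\<Sum>D\<in>{D \<in> Ile x. cls D = A}. f D) - m\<bar> \<le> (e::real)"
  shows "\<bar>(\<Sum>D\<in>Ile x. f D) - h * m\<bar> \<le> h * e"
proof -
  have "(\<Sum>D\<in>Ile x. f D) - h * m = (\<Sum>A\<in>carrier G. (\<Sum>D\<in>{D \<in> Ile x. cls D = A}. f D) - m)"
    unfolding sum_Ile_classes[of f] by (simp add: h_def sum_subtractf)
  also have "\<bar>\<dots>\<bar> \<le> (\<Sum>A\<in>carrier G. e)" by (rule order.trans[OF sum_abs sum_mono]) (use f in auto)
  finally show ?thesis by (simp add: h_def)
qed

lemma char_count:
  assumes "\<psi> \<in> characters G" "\<psi> \<noteq> principal_char G" "x \<ge> 1"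
  shows "norm (\<Sum>D\<in>Ile x. \<psi> (cls D)) \<le> h * C2 * sqrt x"
  using char_sum_bound[OF assms(1,2), where x = x and f = "\<lambda>_. 1" and m = "2 * \<kappa> * x" and e = "C2 * sqrt x"] class_count[OF _ assms(3)]
  by (simp add: mult.assoc)

lemma char_riesz:
  assumes "\<psi> \<in> characters G" "\<psi> \<noteq> principal_char G" "x \<ge> 1"
  shows "norm (\<Sum>D\<in>Ile x. \<psi> (cls D) * of_real (1 - real (N D) / x)) \<le> h * C"
  using char_sum_bound[OF assms(1,2), where x = x and f = "\<lambda>D. 1 - real (N D) / x" and m = "\<kappa> * x" and e = C] riesz[OF _ assms(3)]
  by blast

lemma total_riesz:
  assumes "x \<ge> 1"
  shows "\<bar>(\<Sum>D\<in>Ile x. 1 - real (N D) / x) - h * \<kappa> * x\<bar> \<le> h * C"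
  using total_sum_bound[where x = x and f = "\<lambda>D. 1 - real (N D) / x" and m = "\<kappa> * x" and e = C] riesz[OF _ assms] by (simp add: mult.assoc)

lemma total_count:
  assumes "x \<ge> 1"
  shows "\<bar>real (card (Ile x)) - 2 * h * \<kappa> * x\<bar> \<le> h * C2 * sqrt x"
  using total_sum_bound[where x = x and f = "\<lambda>D. 1" and m = "2 * \<kappa> * x" and e = "C2 * sqrt x"] class_count[OF _ assms] by (simp add: mult_ac)

definition C4 :: real where "C4 = h * (2 * \<kappa> + C2)"

lemma C4_pos: "C4 > 0" using h_pos \<kappa>_pos C2_pos by (simp add: C4_def)

lemma count_le: "x \<ge> 1 \<Longrightarrow> real (card (Ile x)) \<le> C4 * x"
proof -
  assume x: "x \<ge> 1"
  have "sqrt x * 1 \<le> sqrt x * sqrt x" using x by (intro mult_left_mono) auto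
  hence "sqrt x \<le> x" using x by simp
  hence "h * C2 * sqrt x \<le> h * C2 * x" using h_pos C2_pos by (intro mult_left_mono) auto
  thus ?thesis using total_count[OF x] by (simp add: C4_def algebra_simps)
qed

text \<open>An error \<open>y powr (-1/8)\<close> at \<open>y = x / N b\<close> stays bounded when
  summed against \<open>1 / N b\<close>; this is why a power saving is carried along in all
  limits.\<close>

lemma error_sum:
  assumes "x \<ge> 1"
  shows "(\<Sum>b\<in>Ile x. 1 / real (N b) * (x / real (N b)) powr (-1/8)) \<le> 8 * C4"
proof -
  have "(\<Sum>b\<in>Ile x. 1 / real (N b) * (x / real (N b)) powr (-1/8)) = x powr (-1/8) * (\<Sum>b\<in>Ile x. real (N b) powr (1/8 - 1))"
    unfolding sum_distrib_left
  proof (intro sum.cong refl)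
    fix b assume "b \<in> Ile x"
    hence b: "real (N b) > 0" using N_pos[of b] by (auto simp: Ile_def)
    have "real (N b) powr (1/8 - 1) = real (N b) powr (1/8) / real (N b)" 
      using b powr_diff[of "real (N b)" "1/8" 1] by simp
    moreover have "(x / real (N b)) powr (-1/8) = x powr (-1/8) * real (N b) powr (1/8)"
      using b assms by (simp add: powr_divide powr_minus field_simps)
    ultimately show "1 / real (N b) * (x / real (N b)) powr (-1/8) = x powr (-1/8) * real (N b) powr (1/8 - 1)"
      by (simp add: mult_ac)
  qed
  also have "\<dots> \<le> x powr (-1/8) * (C4 * (\<Sum>n=1..nat \<lfloor>x\<rfloor>. real n powr (1/8 - 1)))"
    using count_le by (intro mult_left_mono majorize_sum) (auto intro: powr_mono2')
  also have "\<dots> \<le> x powr (-1/8) * (C4 * (real (nat \<lfloor>x\<rfloor>) powr (1/8) / (1/8)))"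
    using C4_pos by (intro mult_left_mono sum_powr_le) auto
  also have "\<dots> \<le> x powr (-1/8) * (C4 * (x powr (1/8) / (1/8)))"
    using C4_pos assms by (intro mult_left_mono divide_right_mono powr_mono2) auto
  also have "\<dots> = 8 * C4" using assms by (simp add: powr_minus field_simps)
  finally show ?thesis .
qed

text \<open>\<open>S\<close>, \<open>K\<close> and \<open>F\<close> are the truncations at
  \<open>x\<close> of the Dirichlet series at 1 for \<open>L\<close>, for \<open>- L'\<close> and
  for \<open>- L' / L\<close>.\<close>

definition S :: "('g \<Rightarrow> complex) \<Rightarrow> real \<Rightarrow> complex" where
  "S \<psi> x = (\<Sum>D\<in>Ile x. \<psi> (cls D) * of_real (1 / real (N D)))"
definition K :: "('g \<Rightarrow> complex) \<Rightarrow> real \<Rightarrow> complex" where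
  "K \<psi> x = (\<Sum>D\<in>Ile x. \<psi> (cls D) * of_real (ln (real (N D)) / real (N D)))"
definition F :: "('g \<Rightarrow> complex) \<Rightarrow> real \<Rightarrow> complex" where
  "F \<psi> x = (\<Sum>D\<in>Ile x. \<psi> (cls D) * of_real (mangoldt D / real (N D)))"
text \<open>For nonprincipal \<open>\<psi>\<close> such a limit exists by \<open>S_asymp\<close> and equals \<open>L(1, \<psi>)\<close>; otherwise the choice is
  meaningless.\<close>
definition Lval :: "('g \<Rightarrow> complex) \<Rightarrow> complex" where
  "Lval \<psi> = (SOME L. \<forall>x\<ge>1. norm (S \<psi> x - L) \<le> 12 * (h * C2) * 1 * x powr (-1/4))"

lemma S_asymp:
  assumes "\<psi> \<in> characters G" "\<psi> \<noteq> principal_char G" "x \<ge> 1"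
  shows "norm (S \<psi> x - Lval \<psi>) \<le> 12 * (h * C2) * x powr (-1/4)"
proof -
  have "\<exists>L. \<forall>x\<ge>1. norm (S \<psi> x - L) \<le> 12 * (h * C2) * 1 * x powr (-1/4)"
    unfolding S_def using h_pos C2_pos
    by (intro partial_summation[where w = "\<lambda>n. 1 / real n"] inverse_weight) (use char_count[OF assms(1,2)] in auto)
  from someI_ex[OF this] show ?thesis using assms(3) by (simp add: Lval_def)
qed

lemma K_asymp:
  assumes "\<psi> \<in> characters G" "\<psi> \<noteq> principal_char G"
  shows "\<exists>k. \<forall>x\<ge>1. norm (K \<psi> x - k) \<le> 12 * (h * C2) * 5 * x powr (-1/4)"
  unfolding K_def using h_pos C2_pos
  by (intro partial_summation[where w = "\<lambda>n. ln (real n) / real n"] log_weight) (use char_count[OF assms] in auto)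

lemma cls_char_mult:
  assumes "\<psi> \<in> characters G" "D \<in> Divs" "E \<in> Divs"
  shows "\<psi> (cls (D + E)) = \<psi> (cls D) * \<psi> (cls E)"
  using assms by (simp add: cls_add char_mult cls_closed)

text \<open>The weight \<open>t\<close> may depend on both factors because the logarithm in
  \<open>moebius_H\<close> is that of the product \<open>N b * N c\<close>.\<close>

lemma moebius_convolution:
  assumes \<psi>: "\<psi> \<in> characters G"
  shows "(\<Sum>b\<in>Ile x. of_real (mset_moebius b / real (N b)) * \<psi> (cls b) *
            (\<Sum>c\<in>Ile (x / N b). \<psi> (cls c) * of_real (t b c / real (N c))))
       = (\<Sum>D\<in>Ile x. \<psi> (cls D) / of_nat (N D) * of_real (\<Sum>b\<in>{b. b \<subseteq># D}. mset_moebius b * t b (D - b)))"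
  unfolding sum_distrib_left sum_convolution of_real_sum
proof (intro sum.cong refl)
  fix D b assume D: "D \<in> Ile x" and b: "b \<in> {b. b \<subseteq># D}"
  define c where "c = D - b"
  have Dc: "D = b + c" using b by (simp add: c_def)
  have "b \<in> Divs" "c \<in> Divs" using D Dc by (auto simp: Ile_def)
  hence "\<psi> (cls D) = \<psi> (cls b) * \<psi> (cls c)" unfolding Dc by (rule cls_char_mult[OF \<psi>])
  moreover have "N D = N b * N c" by (simp add: Dc)
  ultimately show "of_real (mset_moebius b / real (N b)) * \<psi> (cls b) * (\<psi> (cls (D - b)) * of_real (t b (D - b) / real (N (D - b))))
      = \<psi> (cls D) / of_nat (N D) * of_real (mset_moebius b * t b (D - b))"
    by (simp add: c_def[symmetric])
qed

text \<open>The truncation at \<open>x\<close> of the series for \<open>1 / L\<close> at 1.\<close>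

definition M :: "('g \<Rightarrow> complex) \<Rightarrow> real \<Rightarrow> complex" where
  "M \<psi> x = (\<Sum>b\<in>Ile x. of_real (mset_moebius b / real (N b)) * \<psi> (cls b))"

lemma sum_only_empty:
  assumes "x \<ge> 1"
  shows "(\<Sum>D\<in>Ile x. if D = {#} then f D else 0) = f {#}"
  using assms by (simp add: finite_Ile sum.delta) (simp add: Ile_def)

lemma moebius_S:
  assumes \<psi>: "\<psi> \<in> characters G" and x: "x \<ge> 1"
  shows "(\<Sum>b\<in>Ile x. of_real (mset_moebius b / real (N b)) * \<psi> (cls b) * S \<psi> (x / N b)) = 1"
proof -
  have "(\<Sum>b\<in>Ile x. of_real (mset_moebius b / real (N b)) * \<psi> (cls b) * S \<psi> (x / N b))
      = (\<Sum>D\<in>Ile x. \<psi> (cls D) / of_nat (N D) * of_real (\<Sum>b\<in>{b. b \<subseteq># D}. mset_moebius b))"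
    unfolding S_def using moebius_convolution[OF \<psi>, where t = "\<lambda>_ _. 1"] by simp
  also have "\<dots> = (\<Sum>D\<in>Ile x. if D = {#} then \<psi> (cls D) / of_nat (N D) else 0)"
    by (intro sum.cong) (auto simp: sum_mset_moebius)
  also have "\<dots> = 1" using x \<psi> by (simp add: sum_only_empty cls_empty char_one)
  finally show ?thesis .
qed

lemma moebius_K:
  assumes \<psi>: "\<psi> \<in> characters G"
  shows "(\<Sum>b\<in>Ile x. of_real (mset_moebius b / real (N b)) * \<psi> (cls b) * K \<psi> (x / N b)) = F \<psi> x"
  unfolding K_def F_def moebius_convolution[OF \<psi>, where t = "\<lambda>_ c. ln (real (N c))"]
  by (intro sum.cong refl) (simp add: moebius_log Ile_subset_Divs)

text \<open>In \<open>ln (x / N b) * S - K\<close> the term of \<open>c\<close> carries the weight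
  \<open>ln x - ln (N b * N c)\<close>, a function of the product alone, so Moebius inversion leaves
  only the empty product and its weight \<open>ln x\<close>.\<close>

lemma moebius_H:
  assumes \<psi>: "\<psi> \<in> characters G" and x: "x \<ge> 1"
  shows "(\<Sum>b\<in>Ile x. of_real (mset_moebius b / real (N b)) * \<psi> (cls b) *
      (of_real (ln (x / N b)) * S \<psi> (x / N b) - K \<psi> (x / N b))) = of_real (ln x)"
proof -
  have *: "of_real (ln (x / N b)) * S \<psi> (x / N b) - K \<psi> (x / N b)
      = (\<Sum>c\<in>Ile (x / N b). \<psi> (cls c) * of_real ((ln x - ln (real (N b * N c))) / real (N c)))" if "b \<in> Ile x" for b
    unfolding S_def K_def sum_distrib_left sum_subtractf[symmetric]
  proof (intro sum.cong refl)
    fix c assume "c \<in> Ile (x / N b)"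
    hence "N c > 0" "N b > 0" using that N_pos by (auto simp: Ile_def)
    hence eq: "ln x - ln (real (N b * N c)) = ln (x / N b) - ln (real (N c))"
      using x by (simp add: ln_mult ln_div)
    show "of_real (ln (x / N b)) * (\<psi> (cls c) * of_real (1 / real (N c))) - \<psi> (cls c) * of_real (ln (real (N c)) / real (N c))
      = \<psi> (cls c) * of_real ((ln x - ln (real (N b * N c))) / real (N c))"
      unfolding eq by (simp add: diff_divide_distrib right_diff_distrib)
  qed
  have "(\<Sum>b\<in>Ile x. of_real (mset_moebius b / real (N b)) * \<psi> (cls b) *
      (of_real (ln (x / N b)) * S \<psi> (x / N b) - K \<psi> (x / N b)))
      = (\<Sum>D\<in>Ile x. \<psi> (cls D) / of_nat (N D) *
          of_real (\<Sum>b\<in>{b. b \<subseteq># D}. mset_moebius b * (ln x - ln (real (N b * N (D - b))))))"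
    by (subst moebius_convolution[OF \<psi>, symmetric]) (intro sum.cong refl, simp only: *)
  also have "\<dots> = (\<Sum>D\<in>Ile x. if D = {#} then \<psi> (cls D) / of_nat (N D) * of_real (ln x) else 0)"
  proof (intro sum.cong refl)
    fix D assume "D \<in> Ile x"
    have "(\<Sum>b\<in>{b. b \<subseteq># D}. mset_moebius b * (ln x - ln (real (N b * N (D - b)))))
        = (\<Sum>b\<in>{b. b \<subseteq># D}. mset_moebius b * (ln x - ln (real (N D))))"
    proof (intro sum.cong refl)
      fix b assume "b \<in> {b. b \<subseteq># D}"
      hence "N D = N b * N (D - b)" by (metis N_add mem_Collect_eq subset_mset.add_diff_inverse)
      thus "mset_moebius b * (ln x - ln (real (N b * N (D - b)))) = mset_moebius b * (ln x - ln (real (N D)))" by simp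
    qed
    also have "\<dots> = (if D = {#} then ln x else 0)"
      by (simp add: sum_distrib_right[symmetric] sum_mset_moebius)
    finally show "\<psi> (cls D) / of_nat (N D) * of_real (\<Sum>b\<in>{b. b \<subseteq># D}. mset_moebius b * (ln x - ln (real (N b * N (D - b)))))
      = (if D = {#} then \<psi> (cls D) / of_nat (N D) * of_real (ln x) else 0)" by simp
  qed
  also have "\<dots> = of_real (ln x)" using x \<psi> by (simp add: sum_only_empty cls_empty char_one)
  finally show ?thesis .
qed

text \<open>By \<open>error_sum\<close>, replacing \<open>g\<close> by its limit inside a Moebius
  sum costs only a bounded amount.\<close>

lemma moebius_error:
  assumes \<psi>: "\<psi> \<in> characters G" and x: "x \<ge> 1" and E: "E \<ge> 0"
    and g: "\<And>y. y \<ge> 1 \<Longrightarrow> norm (g y - l) \<le> E * y powr (-1/8)"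
  shows "norm ((\<Sum>b\<in>Ile x. of_real (mset_moebius b / real (N b)) * \<psi> (cls b) * g (x / N b)) - l * M \<psi> x) \<le> 8 * C4 * E"
proof -
  have "(\<Sum>b\<in>Ile x. of_real (mset_moebius b / real (N b)) * \<psi> (cls b) * g (x / N b)) - l * M \<psi> x
     = (\<Sum>b\<in>Ile x. of_real (mset_moebius b / real (N b)) * \<psi> (cls b) * (g (x / N b) - l))"
    unfolding M_def sum_distrib_left sum_subtractf[symmetric]
    by (intro sum.cong refl) (simp only: right_diff_distrib mult.commute[of l])
  also have "norm \<dots> \<le> (\<Sum>b\<in>Ile x. E * (1 / real (N b) * (x / real (N b)) powr (-1/8)))"
  proof (rule sum_norm_le)
    fix b assume b: "b \<in> Ile x"
    hence bD: "b \<in> Divs" "x / N b \<ge> 1" using N_pos[of b] by (auto simp: Ile_def)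
    have "norm (of_real (mset_moebius b / real (N b)) * \<psi> (cls b) * (g (x / N b) - l))
       = \<bar>mset_moebius b\<bar> / real (N b) * norm (g (x / N b) - l)"
      using char_norm[OF \<psi> cls_closed[OF bD(1)]] by (simp add: norm_mult norm_divide)
    also have "\<dots> \<le> 1 / real (N b) * (E * (x / real (N b)) powr (-1/8))"
      using g[OF bD(2)] abs_mset_moebius_le by (intro mult_mono divide_right_mono) auto
    finally show "norm (of_real (mset_moebius b / real (N b)) * \<psi> (cls b) * (g (x / N b) - l))
      \<le> E * (1 / real (N b) * (x / real (N b)) powr (-1/8))" by (simp add: mult_ac)
  qed
  also have "\<dots> = E * (\<Sum>b\<in>Ile x. 1 / real (N b) * (x / real (N b)) powr (-1/8))"
    by (simp only: sum_distrib_left)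
  also have "\<dots> \<le> E * (8 * C4)" using error_sum[OF x] E by (intro mult_left_mono) auto
  finally show ?thesis by (simp add: mult_ac)
qed

lemma powr_quarter_le: "y \<ge> 1 \<Longrightarrow> y powr (-1/4) \<le> y powr (-1/8::real)"
  by (intro powr_mono) auto

text \<open>The exponent drops from 1/4 to 1/8 in order to absorb a logarithm.\<close>

lemma ln_powr_quarter_le: "y \<ge> 1 \<Longrightarrow> ln y * y powr (-1/4) \<le> 8 * y powr (-1/8::real)"
proof -
  assume y: "y \<ge> 1"
  have "ln y * y powr (-1/4) \<le> (8 * y powr (1/8)) * y powr (-1/4)"
    using ln_le_powr[OF y, of "1/8"] by (intro mult_right_mono) auto
  also have "\<dots> = 8 * y powr (-1/8)" using powr_add[of y "1/8" "-1/4"] by simp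
  finally show ?thesis .
qed

text \<open>Moebius inversion of \<open>S\<close> shows that \<open>L\<close> times \<open>M x\<close> is bounded, and inversion of \<open>K\<close> gives \<open>F\<close> as
  \<open>k\<close> times \<open>M x\<close> up to a bounded error, where \<open>k\<close> is the limit of \<open>K\<close>. When \<open>L\<close> vanishes, inverting
  \<open>ln y S y - K y\<close> gives \<open>ln x\<close> as \<open>-k\<close> times \<open>M x\<close>, again up to a bounded error.\<close>
lemma F_dichotomy:
  assumes \<psi>: "\<psi> \<in> characters G" "\<psi> \<noteq> principal_char G"
  shows "\<exists>B. \<forall>x\<ge>1. norm (F \<psi> x + of_real (if Lval \<psi> = 0 then ln x else 0)) \<le> B"
proof -
  define E where "E = 12 * (h * C2)"
  have E: "E \<ge> 0" using h_pos C2_pos by (simp add: E_def)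
  obtain k where k: "\<And>x. x \<ge> 1 \<Longrightarrow> norm (K \<psi> x - k) \<le> E * 5 * x powr (-1/4)"
    using K_asymp[OF \<psi>] unfolding E_def by blast
  have k8: "norm (K \<psi> x - k) \<le> (5 * E) * x powr (-1/8)" if "x \<ge> 1" for x
  proof -
    have "E * 5 * x powr (-1/4) \<le> E * 5 * x powr (-1/8)"
      using powr_quarter_le[OF that] E by (intro mult_left_mono) auto
    thus ?thesis using k[OF that] by simp
  qed
  have FM: "norm (F \<psi> x - k * M \<psi> x) \<le> 8 * C4 * (5 * E)" if "x \<ge> 1" for x
    using moebius_error[OF \<psi>(1) that _ k8] E moebius_K[OF \<psi>(1)] by simp
  have S4: "norm (S \<psi> x - Lval \<psi>) \<le> E * x powr (-1/4)" if "x \<ge> 1" for x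
    using S_asymp[OF \<psi> that] by (simp add: E_def)
  show ?thesis
  proof (cases "Lval \<psi> = 0")
    case False
    have S8: "norm (S \<psi> x - Lval \<psi>) \<le> E * x powr (-1/8)" if "x \<ge> 1" for x
      using S4[OF that] powr_quarter_le[OF that] E by (meson mult_left_mono order_trans)
    have LM: "norm (1 - Lval \<psi> * M \<psi> x) \<le> 8 * C4 * E" if "x \<ge> 1" for x
      using moebius_error[OF \<psi>(1) that E S8] moebius_S[OF \<psi>(1) that] by simp
    have Mb: "norm (M \<psi> x) \<le> (1 + 8 * C4 * E) / norm (Lval \<psi>)" if "x \<ge> 1" for x
    proof -
      have "norm (Lval \<psi> * M \<psi> x) \<le> norm (1::complex) + norm (1 - Lval \<psi> * M \<psi> x)"
        using norm_triangle_ineq4[of 1 "1 - Lval \<psi> * M \<psi> x"] by simp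
      hence "norm (Lval \<psi>) * norm (M \<psi> x) \<le> 1 + 8 * C4 * E" using LM[OF that] by (simp add: norm_mult)
      thus ?thesis using False by (simp add: field_simps)
    qed
    have "norm (F \<psi> x) \<le> 8 * C4 * (5 * E) + norm k * ((1 + 8 * C4 * E) / norm (Lval \<psi>))" if "x \<ge> 1" for x
    proof -
      have "norm (F \<psi> x) \<le> norm (F \<psi> x - k * M \<psi> x) + norm (k * M \<psi> x)"
        using norm_triangle_ineq[of "F \<psi> x - k * M \<psi> x" "k * M \<psi> x"] by simp
      also have "\<dots> \<le> 8 * C4 * (5 * E) + norm k * ((1 + 8 * C4 * E) / norm (Lval \<psi>))"
        using FM[OF that] mult_left_mono[OF Mb[OF that] norm_ge_zero[of k]]
        by (intro add_mono) (simp_all only: norm_mult)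
      finally show ?thesis .
    qed
    thus ?thesis using False by auto
  next
    case True
    \<comment> \<open>\<open>S\<close> tends to 0 here, fast enough to beat the factor
      \<open>ln y\<close>; 13 is 8 from this product plus 5 from \<open>K\<close>.\<close>
    have H8: "norm ((of_real (ln y) * S \<psi> y - K \<psi> y) - (- k)) \<le> (13 * E) * y powr (-1/8)" if y: "y \<ge> 1" for y
    proof -
      have "norm ((of_real (ln y) * S \<psi> y - K \<psi> y) - (- k)) \<le> norm (of_real (ln y) * S \<psi> y) + norm (K \<psi> y - k)"
        using norm_triangle_ineq4[of "of_real (ln y) * S \<psi> y" "K \<psi> y - k"] by (simp add: algebra_simps)
      also have "norm (of_real (ln y) * S \<psi> y) = ln y * norm (S \<psi> y)" using y by (simp add: norm_mult)
      also have "\<dots> \<le> ln y * (E * y powr (-1/4))" using S4[OF y] True y by (intro mult_left_mono) auto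
      also have "\<dots> = E * (ln y * y powr (-1/4))" by simp
      also have "\<dots> \<le> E * (8 * y powr (-1/8))" using ln_powr_quarter_le[OF y] E by (intro mult_left_mono) auto
      finally show ?thesis using k8[OF y] by (simp add: algebra_simps)
    qed
    have LM: "norm (of_real (ln x) - (- k) * M \<psi> x) \<le> 8 * C4 * (13 * E)" if "x \<ge> 1" for x
      using moebius_error[OF \<psi>(1) that _ H8] E unfolding moebius_H[OF \<psi>(1) that] by simp
    have "norm (F \<psi> x + of_real (ln x)) \<le> 8 * C4 * (5 * E) + 8 * C4 * (13 * E)" if "x \<ge> 1" for x
    proof -
      have "F \<psi> x + of_real (ln x) = (F \<psi> x - k * M \<psi> x) + (of_real (ln x) - (- k) * M \<psi> x)" by simp
      thus ?thesis using norm_triangle_le[OF add_mono[OF FM[OF that] LM[OF that]]] by simp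
    qed
    thus ?thesis using True by auto
  qed
qed

end

section \<open>Weights for the hyperbola method\<close>

definition pp :: "real \<Rightarrow> real" where "pp t = max 0 (1 - t)"

text \<open>The integral of \<open>(1 - z / q) * (1 - 1 / z) / z\<close> over
  \<open>{1..q}\<close>.\<close>

definition hyp_weight :: "real \<Rightarrow> real" where "hyp_weight q = (1 + 1/q) * ln q - 2 * (1 - 1/q)"

text \<open>The integrand vanishes unless \<open>v \<le> z \<le> X / u\<close>, and there it has the
  elementary primitive \<open>\<Phi>\<close>.\<close>

lemma has_integral_hyp_weight:
  assumes "X \<ge> 1" "u \<ge> 1" "v \<ge> 1" "u * v \<le> X"
  shows "((\<lambda>z. pp (u * z / X) * pp (v / z) / z) has_integral hyp_weight (X / (u * v))) {1..X}"
proof -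
  have vX: "v \<le> X / u" using assms by (simp add: field_simps)
  have Xu: "X / u \<le> X" using assms by (simp add: field_simps mult_le_cancel_left1)
  have z1: "((\<lambda>z. pp (u * z / X) * pp (v / z) / z) has_integral 0) {1..v}"
    by (rule has_integral_is_0) (use assms in \<open>auto simp: pp_def field_simps\<close>)
  have z2: "((\<lambda>z. pp (u * z / X) * pp (v / z) / z) has_integral 0) {X/u..X}"
    by (rule has_integral_is_0) (use assms in \<open>auto simp: pp_def field_simps\<close>)
  define \<Phi> where "\<Phi> z = (1 + u * v / X) * ln z + v / z - u * z / X" for z
  have "((\<lambda>z. (1 - u * z / X) * (1 - v / z) / z) has_integral (\<Phi> (X / u) - \<Phi> v)) {v..X/u}"
  proof (rule fundamental_theorem_of_calculus[OF vX])
    fix z assume "z \<in> {v..X / u}"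
    hence z: "z > 0" using assms by auto
    have "(\<Phi> has_real_derivative (1 + u * v / X) * (1 / z) + (0 * z - v * 1) / (z * z) - u * 1 / X) (at z within {v..X / u})"
      unfolding \<Phi>_def using z by (intro derivative_intros DERIV_cdivide DERIV_cmult DERIV_divide) (auto intro!: derivative_eq_intros)
    moreover have "(1 + u * v / X) * (1 / z) + (0 * z - v * 1) / (z * z) - u * 1 / X = (1 - u * z / X) * (1 - v / z) / z"
      using z assms by (simp add: divide_simps) (simp add: algebra_simps)
    ultimately show "(\<Phi> has_vector_derivative (1 - u * z / X) * (1 - v / z) / z) (at z within {v..X / u})"
      by (simp only: has_real_derivative_iff_has_vector_derivative)
  qed
  moreover have "\<Phi> (X / u) - \<Phi> v = hyp_weight (X / (u * v))"
  proof -
    have "ln (X / (u * v)) = ln (X / u) - ln v" using assms by (simp add: ln_div ln_mult)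
    moreover have "v / (X / u) = u * v / X" "v / v = 1" "u * (X / u) / X = 1" "1 / (X / (u * v)) = u * v / X"
      using assms by simp_all
    ultimately show ?thesis unfolding \<Phi>_def hyp_weight_def by (simp only:) (simp add: algebra_simps)
  qed
  moreover have "pp (u * z / X) * pp (v / z) / z = (1 - u * z / X) * (1 - v / z) / z" if "z \<in> {v..X/u}" for z
  proof -
    have "z > 0" "u * z / X \<le> 1" "v / z \<le> 1" using that assms by (auto simp: field_simps)
    thus ?thesis by (simp add: pp_def)
  qed
  ultimately have "((\<lambda>z. pp (u * z / X) * pp (v / z) / z) has_integral hyp_weight (X / (u * v))) {v..X/u}"
    by (metis (no_types, lifting) has_integral_cong)
  from has_integral_combine[OF assms(3) vX z1 this]
  have "((\<lambda>z. pp (u * z / X) * pp (v / z) / z) has_integral (0 + hyp_weight (X / (u * v)))) {1..X/u}" .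
  from has_integral_combine[OF _ Xu this z2] show ?thesis using assms(3) vX by simp
qed

lemma has_integral_hyp_zero:
  assumes "X \<ge> 1" "u \<ge> 1" "v \<ge> 1" "u * v > X"
  shows "((\<lambda>z. pp (u * z / X) * pp (v / z) / z) has_integral 0) {1..X}"
proof (rule has_integral_is_0)
  fix z assume z: "z \<in> {1..X}"
  show "pp (u * z / X) * pp (v / z) / z = 0"
  proof (cases "v \<le> z")
    case True
    have "X < u * z" using assms True mult_left_mono[OF True, of u] by linarith
    hence "u * z / X > 1" using assms by simp
    thus ?thesis by (simp add: pp_def)
  qed (use z in \<open>auto simp: pp_def\<close>)
qed

lemma hyp_weight_nonneg: "q \<ge> 1 \<Longrightarrow> hyp_weight q \<ge> 0"
proof -
  assume "q \<ge> 1"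
  hence "((\<lambda>z. pp (1 * z / q) * pp (1 / z) / z) has_integral hyp_weight (q / (1 * 1))) {1..q}"
    by (intro has_integral_hyp_weight) auto
  hence "hyp_weight (q / (1 * 1)) \<ge> 0" by (rule has_integral_nonneg) (auto simp: pp_def)
  thus ?thesis by simp
qed

text \<open>27 is an upper bound for \<open>exp 3\<close>, so the logarithm is at least 3 and
  exceeds the subtracted term, which is at most 2, by 1.\<close>

lemma hyp_weight_ge1: "q \<ge> 27 \<Longrightarrow> hyp_weight q \<ge> 1"
proof -
  assume q: "q \<ge> 27"
  have "exp 3 = exp (1::real) ^ 3" by (simp add: exp_of_nat_mult[symmetric])
  also have "\<dots> \<le> 3 ^ 3" using exp_le by (intro power_mono) auto
  finally have "exp (3::real) \<le> 27" by simp
  hence "ln q \<ge> 3" using q by (subst ln_ge_iff) auto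
  moreover have "(1 / q) * ln q \<ge> 0" using q by simp
  ultimately have "(1 + 1 / q) * ln q \<ge> 3" by (simp add: distrib_right)
  moreover have "1 / q \<ge> 0" using q by simp
  ultimately show ?thesis unfolding hyp_weight_def by argo
qed

text \<open>The weight tends to \<open>1 / (2 * v)\<close> as \<open>X\<close> grows, which ties the
  integral of the damped character sum over \<open>z^2\<close> to the value of \<open>L\<close> at
  1.\<close>

lemma has_integral_pp_square:
  assumes "1 \<le> v" "v \<le> X"
  shows "((\<lambda>z. pp (v / z) / z^2) has_integral (1 - v / X)^2 / (2 * v)) {1..X}"
proof -
  have z1: "((\<lambda>z. pp (v / z) / z^2) has_integral 0) {1..v}"
    by (rule has_integral_is_0) (use assms in \<open>auto simp: pp_def field_simps\<close>)
  define \<Phi> where "\<Phi> z = v / (2 * z^2) - 1 / z" for z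
  have "((\<lambda>z. (1 - v / z) / z^2) has_integral (\<Phi> X - \<Phi> v)) {v..X}"
  proof (rule fundamental_theorem_of_calculus[OF assms(2)])
    fix z assume "z \<in> {v..X}"
    hence z: "z > 0" using assms by auto
    have "(\<Phi> has_real_derivative (0 * (2 * z^2) - v * (4 * z)) / (2 * z^2 * (2 * z^2)) - (0 * z - 1 * 1) / (z * z)) (at z within {v..X})"
      unfolding \<Phi>_def using z by (intro derivative_intros DERIV_divide) (auto intro!: derivative_eq_intros)
    moreover have "(0 * (2 * z^2) - v * (4 * z)) / (2 * z^2 * (2 * z^2)) - (0 * z - 1 * 1) / (z * z) = (1 - v / z) / z^2"
      using z by (simp add: divide_simps) (simp add: algebra_simps power2_eq_square power4_eq_xxxx)
    ultimately show "(\<Phi> has_vector_derivative (1 - v / z) / z^2) (at z within {v..X})"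
      by (simp only: has_real_derivative_iff_has_vector_derivative)
  qed
  moreover have "\<Phi> X - \<Phi> v = (1 - v / X)^2 / (2 * v)"
    unfolding \<Phi>_def using assms by (simp add: field_simps power2_eq_square)
  moreover have "pp (v / z) / z^2 = (1 - v / z) / z^2" if "z \<in> {v..X}" for z
    using that assms by (auto simp: field_simps pp_def)
  ultimately have "((\<lambda>z. pp (v / z) / z^2) has_integral (1 - v / X)^2 / (2 * v)) {v..X}"
    by (metis (no_types, lifting) has_integral_cong)
  from has_integral_combine[OF assms z1 this] show ?thesis by simp
qed

section \<open>Mertens-type estimates and the number of vanishing L-values\<close>

context class_semigroup
begin

definition F1 :: "real \<Rightarrow> real" where "F1 x = (\<Sum>D\<in>Ile x. mangoldt D / real (N D))"

lemma sum_log_mangoldt: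
  assumes "x \<ge> 1"
  shows "(\<Sum>D\<in>Ile x. ln (real (N D))) = (\<Sum>b\<in>Ile x. mangoldt b * real (card (Ile (x / N b))))"
proof -
  have "(\<Sum>b\<in>Ile x. mangoldt b * real (card (Ile (x / N b)))) = (\<Sum>b\<in>Ile x. \<Sum>c\<in>Ile (x / N b). mangoldt b)"
    by (simp add: mult.commute)
  also have "\<dots> = (\<Sum>D\<in>Ile x. \<Sum>b\<in>{b. b \<subseteq># D}. mangoldt b)"
    by (rule sum_convolution)
  also have "\<dots> = (\<Sum>D\<in>Ile x. ln (real (N D)))"
    by (intro sum.cong refl) (simp add: sum_mangoldt Ile_subset_Divs)
  finally show ?thesis by simp
qed

lemma sqrt_ln_le: "x \<ge> 1 \<Longrightarrow> sqrt x * ln x \<le> 2 * x"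
proof -
  assume x: "x \<ge> 1"
  have "ln x \<le> 2 * sqrt x" using ln_le_powr[of x "1/2"] x by (simp add: powr_half_sqrt)
  hence "sqrt x * ln x \<le> sqrt x * (2 * sqrt x)" using x by (intro mult_left_mono) auto
  also have "\<dots> = 2 * (sqrt x * sqrt x)" by simp
  also have "sqrt x * sqrt x = x" using x by simp
  finally show ?thesis .
qed

text \<open>The sum of \<open>ln (N D)\<close> over \<open>N D \<le> x\<close> is at most
  \<open>C4 * x * F1 x\<close>. The divisors of norm above \<open>sqrt x\<close> alone make it of
  order \<open>x * ln x\<close>, as each contributes at least \<open>ln x / 2\<close>.\<close>

lemma F1_lower: "\<exists>c>0. \<exists>B. \<forall>x\<ge>1. F1 x \<ge> c * ln x - B"
proof -
  define k where "k = 2 * h * \<kappa>"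
  define C3 where "C3 = h * C2"
  have pos: "k > 0" "C3 > 0" using h_pos \<kappa>_pos C2_pos by (simp_all add: k_def C3_def)
  have "F1 x \<ge> (k / (2 * C4)) * ln x - (C3 + C4) / C4" if x: "x \<ge> 1" for x
  proof -
    have "(\<Sum>D\<in>Ile x. ln (real (N D))) \<le> (\<Sum>b\<in>Ile x. mangoldt b * (C4 * (x / N b)))"
      unfolding sum_log_mangoldt[OF x]
    proof (intro sum_mono mult_left_mono)
      fix b assume b: "b \<in> Ile x"
      hence "x / N b \<ge> 1" using N_pos[of b] by (auto simp: Ile_def)
      thus "real (card (Ile (x / N b))) \<le> C4 * (x / N b)" by (rule count_le)
      show "0 \<le> mangoldt b" using b by (simp add: mangoldt_nonneg Ile_subset_Divs)
    qed
    also have "\<dots> = C4 * x * F1 x" by (simp add: F1_def sum_distrib_left mult_ac)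
    finally have up: "(\<Sum>D\<in>Ile x. ln (real (N D))) \<le> C4 * x * F1 x" .
    have sx: "sqrt x \<ge> 1" using x by simp
    have sub: "Ile (sqrt x) \<subseteq> Ile x"
    proof -
      have "sqrt x * 1 \<le> sqrt x * sqrt x" using sx by (intro mult_left_mono) auto
      hence "sqrt x \<le> x" using x by simp
      thus ?thesis by (auto simp: Ile_def)
    qed
    have "(k * x - C3 * sqrt x - C4 * sqrt x) * (ln x / 2) \<le> (real (card (Ile x)) - real (card (Ile (sqrt x)))) * (ln x / 2)"
      using total_count[OF x] count_le[OF sx] x by (intro mult_right_mono) (auto simp: k_def C3_def)
    also have "\<dots> = (\<Sum>D\<in>Ile x - Ile (sqrt x). ln x / 2)"
      using sub finite_Ile by (simp add: card_Diff_subset of_nat_diff card_mono)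
    also have "\<dots> \<le> (\<Sum>D\<in>Ile x - Ile (sqrt x). ln (real (N D)))"
    proof (rule sum_mono)
      fix D assume D: "D \<in> Ile x - Ile (sqrt x)"
      hence "sqrt x \<le> real (N D)" by (auto simp: Ile_def)
      moreover have "real (N D) > 0" "sqrt x > 0" using x sx calculation by linarith+
      ultimately have "ln (sqrt x) \<le> ln (real (N D))" by (metis ln_le_cancel_iff)
      thus "ln x / 2 \<le> ln (real (N D))" using x by (simp add: ln_sqrt)
    qed
    also have "\<dots> \<le> (\<Sum>D\<in>Ile x. ln (real (N D)))"
      using N_ge1 by (intro sum_mono2 finite_Ile) (auto simp: Ile_def)
    finally have "(k * x - C3 * sqrt x - C4 * sqrt x) * (ln x / 2) \<le> C4 * x * F1 x" using up by linarith
    hence "k * x * ln x / 2 - (C3 + C4) * (sqrt x * ln x / 2) \<le> C4 * x * F1 x" by argo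
    moreover have "sqrt x * ln x / 2 \<le> x"
      using sqrt_ln_le[OF x] by simp
    hence "(C3 + C4) * (sqrt x * ln x / 2) \<le> (C3 + C4) * x" using pos C4_pos by (intro mult_left_mono) auto
    ultimately have "k * x * ln x / 2 - (C3 + C4) * x \<le> C4 * x * F1 x" by linarith
    hence "x * (k * ln x / 2 - (C3 + C4)) \<le> x * (C4 * F1 x)" by (simp add: algebra_simps)
    hence "k * ln x / 2 - (C3 + C4) \<le> C4 * F1 x" using x by simp
    thus ?thesis using C4_pos by (simp add: field_simps)
  qed
  moreover have "k / (2 * C4) > 0" using pos C4_pos by simp
  ultimately show ?thesis by blast
qed

text \<open>The factor of \<open>ln x\<close> must stay below 2 for \<open>card_zeros_le\<close>.
  Giving away a tenth of the count costs 10/9, which is rounded up to 5/4.\<close>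

lemma F1_upper: "\<exists>B. \<forall>x\<ge>1. F1 x \<le> 5/4 * ln x + B"
proof -
  define k where "k = 2 * h * \<kappa>"
  define C3 where "C3 = h * C2"
  have pos: "k > 0" "C3 > 0" using h_pos \<kappa>_pos C2_pos by (simp_all add: k_def C3_def)
  \<comment> \<open>Beyond this point the error \<open>C3 * sqrt y\<close> is at most a tenth of the
    main term \<open>k * y\<close>.\<close>
  define y0 where "y0 = max 1 ((10 * C3 / k)\<^sup>2)"
  have y0: "y0 \<ge> 1" by (simp add: y0_def)
  have Alow: "real (card (Ile y)) \<ge> 9/10 * k * y" if y: "y \<ge> y0" for y
  proof -
    have y1: "y \<ge> 1" using y y0 by simp
    have "(10 * C3 / k)\<^sup>2 \<le> y" using y by (simp add: y0_def)
    hence "10 * C3 / k \<le> sqrt y" by (rule real_le_rsqrt)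
    hence "C3 * 10 \<le> k * sqrt y" using pos by (simp add: field_simps)
    hence "C3 * 10 * sqrt y \<le> k * sqrt y * sqrt y" using y1 by (intro mult_right_mono) auto
    moreover have "k * sqrt y * sqrt y = k * y" using y1 by (simp add: mult.assoc)
    ultimately have "C3 * sqrt y \<le> k * y / 10" by (simp only: mult_ac)
    thus ?thesis using total_count[OF y1] unfolding k_def C3_def by linarith
  qed
  have "F1 x \<le> 5/4 * ln x + (5/4 * ln y0 + 20/9 * (C3 / k))" if x: "x \<ge> 1" for x
  proof -
    \<comment> \<open>Stretching the range makes \<open>X / N b \<ge> y0\<close> for all
      \<open>b\<close> with \<open>N b \<le> x\<close>, so the lower bound \<open>Alow\<close>
      applies to each of them; the price is the constant \<open>ln y0\<close>.\<close>
    define X where "X = y0 * x"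
    have X: "X \<ge> 1" unfolding X_def using mult_mono[OF y0 x] y0 by simp
    have xX: "x \<le> X" unfolding X_def using mult_right_mono[OF y0, of x] x by simp
    have "9/10 * k * X * F1 x = (\<Sum>b\<in>Ile x. mangoldt b * (9/10 * k * (X / N b)))"
      by (simp add: F1_def sum_distrib_left mult_ac)
    also have "\<dots> \<le> (\<Sum>b\<in>Ile x. mangoldt b * real (card (Ile (X / N b))))"
    proof (intro sum_mono mult_left_mono)
      fix b assume b: "b \<in> Ile x"
      hence nb: "real (N b) \<le> x" "N b > 0" using N_pos[of b] by (auto simp: Ile_def)
      have "y0 * real (N b) \<le> X" unfolding X_def using nb y0 by (intro mult_left_mono) auto
      hence "y0 \<le> X / N b" using nb by (simp add: field_simps)
      thus "9/10 * k * (X / N b) \<le> real (card (Ile (X / N b)))" by (rule Alow)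
      show "0 \<le> mangoldt b" using b by (simp add: mangoldt_nonneg Ile_subset_Divs)
    qed
    also have "\<dots> \<le> (\<Sum>b\<in>Ile X. mangoldt b * real (card (Ile (X / N b))))"
      using xX by (intro sum_mono2 finite_Ile) (auto simp: Ile_def mangoldt_nonneg)
    also have "\<dots> = (\<Sum>D\<in>Ile X. ln (real (N D)))" by (rule sum_log_mangoldt[OF X, symmetric])
    also have "\<dots> \<le> (\<Sum>D\<in>Ile X. ln X)" using N_pos X by (intro sum_mono) (auto simp: Ile_def)
    also have "\<dots> = real (card (Ile X)) * ln X" by simp
    also have "\<dots> \<le> (k * X + C3 * sqrt X) * ln X"
      using total_count[OF X] X by (intro mult_right_mono) (auto simp: k_def C3_def)
    also have "\<dots> = k * X * ln X + C3 * (sqrt X * ln X)" by (simp add: algebra_simps)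
    also have "\<dots> \<le> k * X * ln X + C3 * (2 * X)"
      using sqrt_ln_le[OF X] pos
      by (intro add_left_mono mult_left_mono) auto
    finally have "X * (9/10 * k * F1 x) \<le> X * (k * ln X + 2 * C3)" by (simp add: algebra_simps)
    hence "9/10 * k * F1 x \<le> k * ln X + 2 * C3" using X by simp
    hence "F1 x \<le> 10/9 * ln X + 20/9 * (C3 / k)" using pos by (simp add: field_simps)
    moreover have "10/9 * ln X \<le> 5/4 * ln X" using X by simp
    moreover have "ln X = ln x + ln y0" using x y0 by (simp add: X_def ln_mult)
    ultimately show ?thesis by argo
  qed
  thus ?thesis by blast
qed

lemma F_principal: "F (principal_char G) x = of_real (F1 x)"
  by (auto simp: F_def F1_def principal_char_def cls_closed Ile_subset_Divs of_real_sum intro!: sum.cong)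

lemma sum_F_class:
  assumes A: "A \<in> carrier G"
  shows "(\<Sum>\<psi>\<in>characters G. cnj (\<psi> A) * F \<psi> x)
    = of_nat (card (characters G)) * of_real (\<Sum>D\<in>{D \<in> Ile x. cls D = A}. mangoldt D / real (N D))"
proof -
  have "(\<Sum>\<psi>\<in>characters G. cnj (\<psi> A) * F \<psi> x)
      = (\<Sum>D\<in>Ile x. (\<Sum>\<psi>\<in>characters G. cnj (\<psi> A) * \<psi> (cls D)) * of_real (mangoldt D / real (N D)))"
    unfolding F_def sum_distrib_left sum_distrib_right by (subst sum.swap) (simp add: mult_ac)
  also have "\<dots> = (\<Sum>D\<in>Ile x. if cls D = A then of_nat (card (characters G)) * of_real (mangoldt D / real (N D)) else 0)"
    using A by (intro sum.cong refl) (auto simp: sum_over_characters_quotient cls_closed Ile_subset_Divs)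
  also have "\<dots> = (\<Sum>D\<in>{D \<in> Ile x. cls D = A}. of_nat (card (characters G)) * of_real (mangoldt D / real (N D)))"
    by (rule sum.inter_filter[symmetric]) (rule finite_Ile)
  finally show ?thesis by (simp add: sum_distrib_left)
qed

definition zeros :: "('g \<Rightarrow> complex) set" where
  "zeros = {\<psi> \<in> characters G. \<psi> \<noteq> principal_char G \<and> Lval \<psi> = 0}"

text \<open>The bound is uniform in the coefficients \<open>a\<close>, which are 1 when zeros are
  counted and \<open>cnj (\<psi> A)\<close> when a class is singled out.\<close>

lemma nonprincipal_bound:
  "\<exists>B. \<forall>x\<ge>1. \<forall>a. (\<forall>\<psi>\<in>characters G. norm (a \<psi>) \<le> 1) \<longrightarrow>
     norm ((\<Sum>\<psi>\<in>characters G - {principal_char G}. a \<psi> * F \<psi> x) + (\<Sum>\<psi>\<in>zeros. a \<psi>) * of_real (ln x)) \<le> B"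
proof -
  let ?X = "characters G - {principal_char G}"
  have "\<forall>\<psi>\<in>?X. \<exists>B. \<forall>x\<ge>1. norm (F \<psi> x + of_real (if Lval \<psi> = 0 then ln x else 0)) \<le> B"
    using F_dichotomy by auto
  from bchoice[OF this] obtain B where "\<forall>\<psi>\<in>?X. \<forall>x\<ge>1. norm (F \<psi> x + of_real (if Lval \<psi> = 0 then ln x else 0)) \<le> B \<psi>"
    by blast
  hence B: "\<And>\<psi> x. \<psi> \<in> ?X \<Longrightarrow> x \<ge> 1 \<Longrightarrow> norm (F \<psi> x + of_real (if Lval \<psi> = 0 then ln x else 0)) \<le> B \<psi>"
    by blast
  have "norm ((\<Sum>\<psi>\<in>?X. a \<psi> * F \<psi> x) + (\<Sum>\<psi>\<in>zeros. a \<psi>) * of_real (ln x)) \<le> (\<Sum>\<psi>\<in>?X. B \<psi>)"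
    if x: "x \<ge> 1" and a: "\<forall>\<psi>\<in>characters G. norm (a \<psi>) \<le> 1" for x a
  proof -
    have zeros: "zeros = {\<psi> \<in> ?X. Lval \<psi> = 0}" by (auto simp: zeros_def)
    have "(\<Sum>\<psi>\<in>zeros. a \<psi>) * of_real (ln x) = (\<Sum>\<psi>\<in>?X. if Lval \<psi> = 0 then a \<psi> * of_real (ln x) else 0)"
      unfolding zeros sum_distrib_right using finite_characters by (intro sum.inter_filter) auto
    hence "(\<Sum>\<psi>\<in>?X. a \<psi> * F \<psi> x) + (\<Sum>\<psi>\<in>zeros. a \<psi>) * of_real (ln x)
      = (\<Sum>\<psi>\<in>?X. a \<psi> * (F \<psi> x + of_real (if Lval \<psi> = 0 then ln x else 0)))"
      by (simp add: sum.distrib[symmetric] distrib_left if_distrib cong: if_cong)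
    also have "norm \<dots> \<le> (\<Sum>\<psi>\<in>?X. B \<psi>)"
    proof (rule sum_norm_le)
      fix \<psi> assume p: "\<psi> \<in> ?X"
      have "norm (a \<psi>) * norm (F \<psi> x + of_real (if Lval \<psi> = 0 then ln x else 0)) \<le> 1 * B \<psi>"
        using a p B[OF p x] by (intro mult_mono) auto
      thus "norm (a \<psi> * (F \<psi> x + of_real (if Lval \<psi> = 0 then ln x else 0))) \<le> B \<psi>"
        by (simp only: norm_mult mult_1)
    qed
    finally show ?thesis .
  qed
  thus ?thesis by blast
qed

lemma finite_zeros: "finite zeros"
  using finite_characters by (simp add: zeros_def)

text \<open>By orthogonality the sum of all \<open>F \<psi>\<close> is nonnegative; the principal character contributes at most
  \<open>5/4 ln x\<close>, and every zero contributes \<open>- ln x\<close>.\<close>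
lemma card_zeros_le: "card zeros \<le> 1"
proof (rule ccontr)
  assume "\<not> card zeros \<le> 1"
  hence c2: "real (card zeros) \<ge> 2" by simp
  obtain B1 where B1: "\<And>x. x \<ge> 1 \<Longrightarrow> F1 x \<le> 5/4 * ln x + B1" using F1_upper by blast
  obtain B where B: "\<And>x a. x \<ge> 1 \<Longrightarrow> (\<forall>\<psi>\<in>characters G. norm (a \<psi>) \<le> 1) \<Longrightarrow>
     norm ((\<Sum>\<psi>\<in>characters G - {principal_char G}. a \<psi> * F \<psi> x) + (\<Sum>\<psi>\<in>zeros. a \<psi>) * of_real (ln x)) \<le> B"
    using nonprincipal_bound by blast
  have "3/4 * ln x \<le> B1 + B" if x: "x \<ge> 1" for x
  proof -
    let ?T = "\<Sum>\<psi>\<in>characters G - {principal_char G}. F \<psi> x"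
    have "norm (?T + of_nat (card zeros) * of_real (ln x)) \<le> B"
      using B[OF x, of "\<lambda>_. 1"] by simp
    hence "Re (?T + of_nat (card zeros) * of_real (ln x)) \<le> B"
      using complex_Re_le_cmod order_trans by blast
    hence 1: "Re ?T + real (card zeros) * ln x \<le> B" by simp
    have "(\<Sum>\<psi>\<in>characters G. F \<psi> x) = (\<Sum>\<psi>\<in>characters G. cnj (\<psi> \<one>) * F \<psi> x)"
      by (intro sum.cong) (auto simp: char_one)
    also have "\<dots> = of_nat (card (characters G)) * of_real (\<Sum>D\<in>{D \<in> Ile x. cls D = \<one>}. mangoldt D / real (N D))"
      by (rule sum_F_class) simp
    finally have "Re (\<Sum>\<psi>\<in>characters G. F \<psi> x) = card (characters G) * (\<Sum>D\<in>{D \<in> Ile x. cls D = \<one>}. mangoldt D / real (N D))"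
      by simp
    also have "\<dots> \<ge> 0" by (intro mult_nonneg_nonneg sum_nonneg) (auto simp: Ile_def mangoldt_nonneg)
    finally have "0 \<le> Re (\<Sum>\<psi>\<in>characters G. F \<psi> x)" .
    also have "(\<Sum>\<psi>\<in>characters G. F \<psi> x) = F (principal_char G) x + ?T"
      using finite_characters principal_char_in by (intro sum.remove) auto
    finally have "0 \<le> F1 x + Re ?T" by (simp add: F_principal)
    moreover have "2 * ln x \<le> real (card zeros) * ln x" using c2 x by (intro mult_right_mono) auto
    ultimately show ?thesis using 1 B1[OF x] by linarith
  qed
  moreover have "eventually (\<lambda>x::real. 3/4 * ln x > B1 + B \<and> x \<ge> 1) at_top"
    by (intro eventually_conj eventually_ge_at_top) real_asymp
  ultimately show False by (auto simp: eventually_at_top_linorder not_le[symmetric])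
qed

end

section \<open>Nonvanishing at real characters\<close>

context class_semigroup
begin

lemma Re_char_values:
  assumes \<psi>: "\<psi> \<in> characters G" and real: "\<And>A. cnj (\<psi> A) = \<psi> A" and D: "D \<in> Divs"
  shows "\<psi> (cls D) = of_real (Re (\<psi> (cls D)))" "Re (\<psi> (cls D)) \<in> {-1, 1}"
proof -
  show eq: "\<psi> (cls D) = of_real (Re (\<psi> (cls D)))"
    using real[of "cls D"] by (simp add: complex_eq_iff)
  have "norm (\<psi> (cls D)) = 1" using char_norm[OF \<psi> cls_closed[OF D]] .
  hence "\<bar>Re (\<psi> (cls D))\<bar> = 1" using eq by (metis norm_of_real)
  thus "Re (\<psi> (cls D)) \<in> {-1, 1}" by auto
qed

text \<open>The hyperbola method with smooth weights: the integral of \<open>\<theta> (X / z) \<theta>f z / z\<close> over \<open>{1..X}\<close> is a sum of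
  the nonnegative coefficients of the convolution of \<open>1\<close> and \<open>\<psi>\<close>, at least of order \<open>sqrt X\<close> because squares
  have coefficient at least 1. But it is \<open>h \<kappa> X \<Psi> X\<close> up to \<open>O(ln X)\<close>, where \<open>\<Psi>\<close> converges to
  \<open>L / 2\<close> with an error \<open>O(1 / X)\<close>.\<close>
lemma real_nonvanishing:
  assumes \<psi>: "\<psi> \<in> characters G" "\<psi> \<noteq> principal_char G" and real: "\<And>A. cnj (\<psi> A) = \<psi> A"
  shows "Lval \<psi> \<noteq> 0"
proof
  assume L0: "Lval \<psi> = 0"
  define f where "f D = Re (\<psi> (cls D))" for D
  have f_of: "\<psi> (cls D) = of_real (f D)" and fval: "f D \<in> {-1, 1}" if "D \<in> Divs" for D
    using Re_char_values[OF \<psi>(1) real that] by (simp_all add: f_def)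
  define \<theta> where "\<theta> y = (\<Sum>b\<in>Ile y. 1 - real (N b) / y)" for y
  define \<theta>f where "\<theta>f z = (\<Sum>c\<in>Ile z. f c * (1 - real (N c) / z))" for z
  define H where "H = h * C"
  have H0: "H \<ge> 0" using h_pos C_nonneg by (simp add: H_def)
  have \<theta>f_bound: "\<bar>\<theta>f z\<bar> \<le> H" if "z \<ge> 1" for z
  proof -
    have "(\<Sum>D\<in>Ile z. \<psi> (cls D) * of_real (1 - real (N D) / z)) = of_real (\<theta>f z)"
      unfolding \<theta>f_def of_real_sum by (intro sum.cong refl) (simp add: f_of Ile_subset_Divs)
    thus ?thesis using char_riesz[OF \<psi> that] by (simp add: H_def)
  qed
  have \<theta>_bound: "\<bar>\<theta> y - h * \<kappa> * y\<bar> \<le> H" if "y \<ge> 1" for y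
    using total_riesz[OF that] by (simp add: \<theta>_def H_def)
  have pp0: "pp (real n / y) = 0" if "y \<ge> 1" "\<not> real n \<le> y" for n y
    using that by (simp add: pp_def)
  have pp1: "pp (real n / y) = 1 - real n / y" if "y \<ge> 1" "real n \<le> y" for n y
    using that by (simp add: pp_def)
  have \<theta>_pp: "\<theta> y = (\<Sum>b\<in>Ile X. pp (real (N b) / y))" if "1 \<le> y" "y \<le> X" for y X
    unfolding \<theta>_def using that by (intro sum.mono_neutral_cong_left finite_Ile) (auto simp: Ile_def pp0 pp1)
  have \<theta>f_pp: "\<theta>f y = (\<Sum>b\<in>Ile X. f b * pp (real (N b) / y))" if "1 \<le> y" "y \<le> X" for y X
    unfolding \<theta>f_def using that by (intro sum.mono_neutral_cong_left finite_Ile) (auto simp: Ile_def pp0 pp1)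

  define \<Psi> where "\<Psi> X = (\<Sum>c\<in>Ile X. f c * ((1 - real (N c) / X)\<^sup>2 / (2 * real (N c))))" for X
  have int\<Psi>: "((\<lambda>z. \<theta>f z / z\<^sup>2) has_integral \<Psi> X) {1..X}" if "X \<ge> 1" for X
  proof -
    have "((\<lambda>z. \<Sum>c\<in>Ile X. f c * (pp (real (N c) / z) / z\<^sup>2)) has_integral \<Psi> X) {1..X}"
      unfolding \<Psi>_def
      by (intro has_integral_sum finite_Ile has_integral_mult_right has_integral_pp_square)
        (use N_ge1 in \<open>auto simp: Ile_def\<close>)
    moreover have "(\<Sum>c\<in>Ile X. f c * (pp (real (N c) / z) / z\<^sup>2)) = \<theta>f z / z\<^sup>2" if "z \<in> {1..X}" for z
      using \<theta>f_pp[of z X] that by (simp add: sum_divide_distrib)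
    ultimately show ?thesis by (metis (no_types, lifting) has_integral_cong)
  qed
  have \<Psi>_diff: "\<bar>\<Psi> Y - \<Psi> X\<bar> \<le> H / X" if X: "1 \<le> X" "X \<le> Y" for X Y
  proof -
    have iY: "(\<lambda>z. \<theta>f z / z\<^sup>2) integrable_on {1..Y}" using int\<Psi>[of Y] X by (auto intro: has_integral_integrable)
    have "(\<lambda>z. \<theta>f z / z\<^sup>2) integrable_on {X..Y}"
      by (rule integrable_on_subinterval[OF iY]) (use X in auto)
    then obtain J where J: "((\<lambda>z. \<theta>f z / z\<^sup>2) has_integral J) {X..Y}" by blast
    have "((\<lambda>z. \<theta>f z / z\<^sup>2) has_integral (\<Psi> X + J)) {1..Y}"
      by (rule has_integral_combine[OF X int\<Psi>[OF X(1)] J])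
    moreover have "((\<lambda>z. \<theta>f z / z\<^sup>2) has_integral \<Psi> Y) {1..Y}" by (rule int\<Psi>) (use X in simp)
    ultimately have "\<Psi> X + J = \<Psi> Y" by (rule has_integral_unique)
    hence eq: "\<Psi> Y - \<Psi> X = J" by simp
    have i2: "((\<lambda>z. H / z\<^sup>2) has_integral (- H / Y - (- H / X))) {X..Y}"
    proof (rule fundamental_theorem_of_calculus[OF X(2)])
      fix z assume "z \<in> {X..Y}"
      hence "z > 0" using X by auto
      thus "((\<lambda>z. - H / z) has_vector_derivative H / z\<^sup>2) (at z within {X..Y})"
        unfolding has_real_derivative_iff_has_vector_derivative[symmetric]
        by (auto intro!: derivative_eq_intros simp: power2_eq_square)
    qed
    have bd: "\<theta>f z / z\<^sup>2 \<le> H / z\<^sup>2" "- (H / z\<^sup>2) \<le> \<theta>f z / z\<^sup>2" if "z \<in> {X..Y}" for z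
      using \<theta>f_bound[of z] that X by (auto simp: field_simps abs_le_iff)
    have "J \<le> - H / Y - (- H / X)" by (rule has_integral_le[OF J i2]) (rule bd(1))
    moreover have "- (- H / Y - (- H / X)) \<le> J" by (rule has_integral_le[OF has_integral_neg[OF i2] J]) (rule bd(2))
    moreover have "H / Y \<ge> 0" using H0 X by simp
    ultimately show ?thesis unfolding eq by (simp add: abs_le_iff)
  qed
  \<comment> \<open>Expanding the square expresses \<open>\<Psi> Y\<close> through the truncation of
    \<open>L\<close>, which tends to 0 by assumption, and sums of order at most
    \<open>sqrt Y\<close> divided by \<open>Y\<close>. The rate is poor, but it identifies the limit
    of \<open>\<Psi>\<close> as 0.\<close>
  have \<Psi>_lim: "\<bar>\<Psi> Y\<bar> \<le> 6 * (h * C2) * Y powr (-1/4) + (H + h * C2 * sqrt Y) / Y" if Y: "Y \<ge> 1" for Y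
  proof -
    define s where "s = (\<Sum>c\<in>Ile Y. f c / real (N c))"
    define s0 where "s0 = (\<Sum>c\<in>Ile Y. f c)"
    have "S \<psi> Y = of_real s"
      unfolding S_def s_def of_real_sum by (intro sum.cong refl) (simp add: f_of Ile_subset_Divs)
    hence sb: "\<bar>s\<bar> \<le> 12 * (h * C2) * Y powr (-1/4)" using S_asymp[OF \<psi> Y] L0 by simp
    have "(\<Sum>D\<in>Ile Y. \<psi> (cls D)) = of_real s0"
      unfolding s0_def of_real_sum by (intro sum.cong refl) (simp add: f_of Ile_subset_Divs)
    hence s0b: "\<bar>s0\<bar> \<le> h * C2 * sqrt Y" using char_count[OF \<psi> Y] by simp
    have \<Psi>_eq: "\<Psi> Y = (s - (\<theta>f Y + s0) / Y) / 2"
      unfolding \<Psi>_def s_def \<theta>f_def s0_def sum.distrib[symmetric] sum_divide_distrib sum_subtractf[symmetric]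
    proof (intro sum.cong refl)
      fix c assume "c \<in> Ile Y"
      hence "real (N c) > 0" using N_pos[of c] by (auto simp: Ile_def)
      thus "f c * ((1 - real (N c) / Y)\<^sup>2 / (2 * real (N c)))
        = (f c / real (N c) - (f c * (1 - real (N c) / Y) + f c) / Y) / 2"
        using Y by (simp add: field_simps power2_eq_square)
    qed
    hence "\<bar>\<Psi> Y\<bar> \<le> (\<bar>s\<bar> + (\<bar>\<theta>f Y\<bar> + \<bar>s0\<bar>) / Y) / 2"
    proof -
      have "\<bar>s - (\<theta>f Y + s0) / Y\<bar> \<le> \<bar>s\<bar> + \<bar>(\<theta>f Y + s0) / Y\<bar>" by (rule abs_triangle_ineq4)
      also have "\<bar>(\<theta>f Y + s0) / Y\<bar> \<le> (\<bar>\<theta>f Y\<bar> + \<bar>s0\<bar>) / Y" using Y by (simp add: divide_right_mono abs_triangle_ineq)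
      finally show ?thesis using \<Psi>_eq by simp
    qed
    also have "\<dots> \<le> (12 * (h * C2) * Y powr (-1/4) + (H + h * C2 * sqrt Y) / Y) / 2"
      using sb s0b \<theta>f_bound[OF Y] Y by (intro divide_right_mono add_mono) auto
    also have "\<dots> \<le> 6 * (h * C2) * Y powr (-1/4) + (H + h * C2 * sqrt Y) / Y"
    proof -
      have "(H + h * C2 * sqrt Y) / Y \<ge> 0" using H0 h_pos C2_pos Y by simp
      thus ?thesis by (simp add: add_divide_distrib)
    qed
    finally show ?thesis .
  qed
  \<comment> \<open>The limit being known, \<open>Y\<close> goes to infinity in
    \<open>\<Psi>_diff\<close>, which has the sharp rate \<open>H / X\<close>.\<close>
  have \<Psi>_bound: "\<bar>\<Psi> X\<bar> \<le> H / X" if X: "X \<ge> 1" for X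
  proof -
    let ?e = "\<lambda>Y. 6 * (h * C2) * Y powr (-1/4) + (H + h * C2 * sqrt Y) / Y"
    have "(?e \<longlongrightarrow> 0) at_top" by real_asymp
    hence lim: "((\<lambda>Y. H / X + ?e Y) \<longlongrightarrow> H / X + 0) at_top" by (intro tendsto_intros)
    have "eventually (\<lambda>Y. \<bar>\<Psi> X\<bar> \<le> H / X + ?e Y) at_top"
      using eventually_ge_at_top[of X]
    proof eventually_elim
      case (elim Y)
      thus ?case using \<Psi>_diff[OF X elim] \<Psi>_lim[of Y] X by linarith
    qed
    from tendsto_lowerbound[OF lim this] show ?thesis by simp
  qed

  have main: "real (card (Ile t)) \<le> h * \<kappa> * H + H\<^sup>2 * ln (27 * t\<^sup>2)" if t: "t \<ge> 1" for t
  proof -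
    \<comment> \<open>The factor 27 puts \<open>X / N (E + E)\<close> into the range of
      \<open>hyp_weight_ge1\<close> whenever \<open>N E \<le> t\<close>.\<close>
    define X where "X = 27 * t\<^sup>2"
    have X: "X \<ge> 27" using t by (simp add: X_def)
    hence X1: "X \<ge> 1" by simp
    define W where "W b c = (if real (N b) * real (N c) \<le> X then hyp_weight (X / (real (N b) * real (N c))) else 0)" for b c
    define R where "R = (\<Sum>c\<in>Ile X. \<Sum>b\<in>Ile X. f c * W b c)"
    have "((\<lambda>z. \<Sum>c\<in>Ile X. \<Sum>b\<in>Ile X. f c * (pp (real (N b) * z / X) * pp (real (N c) / z) / z)) has_integral R) {1..X}"
      unfolding R_def
    proof (intro has_integral_sum finite_Ile has_integral_mult_right)
      fix b c assume "c \<in> Ile X" "b \<in> Ile X"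
      hence "real (N b) \<ge> 1" "real (N c) \<ge> 1" using N_ge1 by (auto simp: Ile_def)
      thus "((\<lambda>z. pp (real (N b) * z / X) * pp (real (N c) / z) / z) has_integral W b c) {1..X}"
        unfolding W_def using X1 has_integral_hyp_weight[of X "real (N b)" "real (N c)"]
          has_integral_hyp_zero[of X "real (N b)" "real (N c)"] by auto
    qed
    moreover have "(\<Sum>c\<in>Ile X. \<Sum>b\<in>Ile X. f c * (pp (real (N b) * z / X) * pp (real (N c) / z) / z)) = \<theta> (X / z) * \<theta>f z / z"
      if z: "z \<in> {1..X}" for z
    proof -
      have "1 \<le> X / z" "X / z \<le> X" using z X1 by (auto simp: field_simps mult_le_cancel_left1)
      hence "\<theta> (X / z) = (\<Sum>b\<in>Ile X. pp (real (N b) / (X / z)))" by (rule \<theta>_pp)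
      moreover have "\<theta>f z = (\<Sum>c\<in>Ile X. f c * pp (real (N c) / z))" using \<theta>f_pp z by simp
      ultimately have "\<theta> (X / z) * \<theta>f z / z = (\<Sum>b\<in>Ile X. pp (real (N b) * z / X)) * (\<Sum>c\<in>Ile X. f c * pp (real (N c) / z)) / z"
        by simp
      also have "\<dots> = (\<Sum>c\<in>Ile X. \<Sum>b\<in>Ile X. f c * (pp (real (N b) * z / X) * pp (real (N c) / z) / z))"
        unfolding sum_product by (subst sum.swap) (simp add: sum_divide_distrib mult_ac)
      finally show ?thesis by simp
    qed
    ultimately have intR: "((\<lambda>z. \<theta> (X / z) * \<theta>f z / z) has_integral R) {1..X}"
      by (metis (no_types, lifting) has_integral_cong)
    \<comment> \<open>\<open>\<theta> (X / z)\<close> is replaced by its main term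
      \<open>h * \<kappa> * X / z\<close>. The error of this and \<open>\<theta>f z\<close> are both
      at most \<open>H\<close> in absolute value, so the difference is at most
      \<open>H^2 / z\<close> and integrates to \<open>H^2 * ln X\<close>.\<close>
    have "((\<lambda>z. \<theta> (X / z) * \<theta>f z / z - h * \<kappa> * X * (\<theta>f z / z\<^sup>2)) has_integral (R - h * \<kappa> * X * \<Psi> X)) {1..X}"
      by (intro has_integral_diff intR has_integral_mult_right int\<Psi> X1)
    moreover have "((\<lambda>z. H\<^sup>2 / z) has_integral (H\<^sup>2 * ln X - H\<^sup>2 * ln 1)) {1..X}"
    proof (rule fundamental_theorem_of_calculus[OF X1])
      fix z assume "z \<in> {1..X}"
      thus "((\<lambda>z. H\<^sup>2 * ln z) has_vector_derivative H\<^sup>2 / z) (at z within {1..X})"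
        unfolding has_real_derivative_iff_has_vector_derivative[symmetric]
        by (auto intro!: derivative_eq_intros)
    qed
    moreover have "\<theta> (X / z) * \<theta>f z / z - h * \<kappa> * X * (\<theta>f z / z\<^sup>2) \<le> H\<^sup>2 / z" if z: "z \<in> {1..X}" for z
    proof -
      have "1 \<le> X / z" using z X1 by (auto simp: field_simps)
      hence "\<bar>\<theta> (X / z) - h * \<kappa> * (X / z)\<bar> * \<bar>\<theta>f z\<bar> \<le> H * H"
        using \<theta>_bound[of "X / z"] \<theta>f_bound[of z] z H0 by (intro mult_mono) auto
      hence "(\<theta> (X / z) - h * \<kappa> * (X / z)) * \<theta>f z \<le> H * H"
        by (metis abs_ge_self abs_mult order_trans)
      hence "(\<theta> (X / z) - h * \<kappa> * (X / z)) * \<theta>f z / z \<le> H * H / z" using z by (intro divide_right_mono) auto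
      thus ?thesis using z by (simp add: field_simps power2_eq_square)
    qed
    ultimately have "R - h * \<kappa> * X * \<Psi> X \<le> H\<^sup>2 * ln X - H\<^sup>2 * ln 1" by (rule has_integral_le)
    moreover have "h * \<kappa> * X * \<Psi> X \<le> h * \<kappa> * H"
    proof -
      have "X * \<Psi> X \<le> H" using \<Psi>_bound[OF X1] X1 by (simp add: abs_le_iff field_simps)
      thus ?thesis using h_pos \<kappa>_pos by (simp add: mult.assoc)
    qed
    ultimately have upper: "R \<le> h * \<kappa> * H + H\<^sup>2 * ln X" by simp

    have "R = (\<Sum>c\<in>Ile X. \<Sum>b\<in>Ile (X / N c). f c * hyp_weight (X / real (N (c + b))))"
      unfolding R_def
    proof (rule sum.cong[OF refl])
      fix c assume "c \<in> Ile X"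
      hence Nc: "real (N c) \<ge> 1" using N_ge1 by (auto simp: Ile_def)
      have Xc: "X / N c \<le> X" using Nc X1 by (simp add: field_simps mult_le_cancel_left1)
      show "(\<Sum>b\<in>Ile X. f c * W b c) = (\<Sum>b\<in>Ile (X / N c). f c * hyp_weight (X / real (N (c + b))))"
      proof (rule sum.mono_neutral_cong_right[OF finite_Ile])
        show "Ile (X / N c) \<subseteq> Ile X" using Xc by (auto simp: Ile_def)
      qed (use Nc in \<open>auto simp: Ile_def W_def field_simps\<close>)
    qed
    also have "\<dots> = (\<Sum>D\<in>Ile X. \<Sum>c\<in>{c. c \<subseteq># D}. f c * hyp_weight (X / real (N (c + (D - c)))))"
      by (rule sum_convolution)
    also have "\<dots> = (\<Sum>D\<in>Ile X. hyp_weight (X / real (N D)) * (\<Sum>c\<in>{c. c \<subseteq># D}. f c))"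
      unfolding sum_distrib_left by (intro sum.cong refl) (auto simp: mult.commute simp del: N_add)
    finally have Req: "R = (\<Sum>D\<in>Ile X. hyp_weight (X / real (N D)) * (\<Sum>c\<in>{c. c \<subseteq># D}. f c))" .
    have conv: "(\<Sum>c\<in>{c. c \<subseteq># D}. f c) \<ge> 0 \<and> ((\<forall>x. even (count D x)) \<longrightarrow> (\<Sum>c\<in>{c. c \<subseteq># D}. f c) \<ge> 1)" if "D \<in> Divs" for D
    proof (rule sum_submset_multiplicative[where A = Pr])
      fix D E :: "'p multiset" assume "set_mset D \<subseteq> Pr" "set_mset E \<subseteq> Pr"
      hence DE: "D \<in> Divs" "E \<in> Divs" by (auto simp: Divs_def)
      have "complex_of_real (f (D + E)) = of_real (f D * f E)"
        using cls_char_mult[OF \<psi>(1) DE] f_of DE by simp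
      thus "f (D + E) = f D * f E" by (simp only: of_real_eq_iff)
    next
      show "f {#} = 1" using \<psi>(1) by (simp add: f_def cls_empty char_one)
    next
      show "set_mset D \<subseteq> Pr" using that by (simp add: Divs_def)
    qed (use fval in \<open>auto simp: Divs_def\<close>)
    have w0: "hyp_weight (X / real (N D)) \<ge> 0" if "D \<in> Ile X" for D
      using that N_pos[of D] by (intro hyp_weight_nonneg) (auto simp: Ile_def)
    have "real (card (Ile t)) = real (card ((\<lambda>E. E + E) ` Ile t))"
    proof -
      have "inj (\<lambda>E :: 'p multiset. E + E)"
        by (rule injI) (metis count_union mult_2 mult_cancel1 multiset_eqI zero_neq_numeral)
      thus ?thesis by (metis card_image inj_on_subset subset_UNIV)
    qed
    also have "\<dots> = (\<Sum>D\<in>(\<lambda>E. E + E) ` Ile t. 1)" by simp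
    also have "\<dots> \<le> (\<Sum>D\<in>(\<lambda>E. E + E) ` Ile t. hyp_weight (X / real (N D)) * (\<Sum>c\<in>{c. c \<subseteq># D}. f c))"
    proof (rule sum_mono)
      fix D assume "D \<in> (\<lambda>E. E + E) ` Ile t"
      then obtain E where E: "D = E + E" "E \<in> Divs" "real (N E) \<le> t" by (auto simp: Ile_def)
      have ND: "real (N D) = (real (N E))\<^sup>2" by (simp add: E power2_eq_square)
      have "(real (N E))\<^sup>2 \<le> t\<^sup>2" using E by (intro power_mono) auto
      hence "hyp_weight (X / real (N D)) \<ge> 1"
        unfolding ND X_def using N_pos[OF E(2)] by (intro hyp_weight_ge1) (auto simp: field_simps)
      moreover have "(\<Sum>c\<in>{c. c \<subseteq># D}. f c) \<ge> 1" using conv[of D] E by auto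
      ultimately show "1 \<le> hyp_weight (X / real (N D)) * (\<Sum>c\<in>{c. c \<subseteq># D}. f c)"
        using mult_mono[of 1 "hyp_weight (X / real (N D))" 1 "\<Sum>c\<in>{c. c \<subseteq># D}. f c"] by simp
    qed
    also have "\<dots> \<le> R"
      unfolding Req
    proof (rule sum_mono2[OF finite_Ile])
      show "(\<lambda>E. E + E) ` Ile t \<subseteq> Ile X"
      proof safe
        fix E assume E: "E \<in> Ile t"
        have "real (N E) * real (N E) \<le> t * t" using E by (intro mult_mono) (auto simp: Ile_def)
        moreover have "t * t \<le> X" by (simp add: X_def power2_eq_square)
        ultimately show "E + E \<in> Ile X" using E by (auto simp: Ile_def)
      qed
    qed (use w0 conv in \<open>auto intro!: mult_nonneg_nonneg simp: Ile_subset_Divs\<close>)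
    finally show ?thesis using upper by (simp add: X_def)
  qed
  define k where "k = h * \<kappa>"
  define C3 where "C3 = h * C2"
  have k0: "k > 0" using h_pos \<kappa>_pos by (simp add: k_def)
  have "eventually (\<lambda>t::real. 2 * k * t - C3 * sqrt t > k * H + H\<^sup>2 * ln (27 * t\<^sup>2)) at_top"
    using k0 by real_asymp
  hence "eventually (\<lambda>t::real. 2 * k * t - C3 * sqrt t > k * H + H\<^sup>2 * ln (27 * t\<^sup>2) \<and> t \<ge> 1) at_top"
    by (intro eventually_conj eventually_ge_at_top)
  then obtain t :: real where t: "2 * k * t - C3 * sqrt t > k * H + H\<^sup>2 * ln (27 * t\<^sup>2)" "t \<ge> 1"
    by (auto simp: eventually_at_top_linorder)
  have "2 * k * t - C3 * sqrt t \<le> real (card (Ile t))"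
    using total_count[OF t(2)] by (simp add: k_def C3_def mult_ac abs_le_iff)
  thus False using main[OF t(2)] t(1) by (simp add: k_def)
qed

text \<open>The conjugate of a zero is again a zero, so a unique one is a real character, and those
  have been excluded.\<close>

lemma zeros_empty: "zeros = {}"
proof (rule ccontr)
  assume "zeros \<noteq> {}"
  then obtain \<psi> where z: "\<psi> \<in> zeros" by blast
  hence \<psi>: "\<psi> \<in> characters G" "\<psi> \<noteq> principal_char G" "Lval \<psi> = 0" by (auto simp: zeros_def)
  define \<psi>' where "\<psi>' = (\<lambda>x. cnj (\<psi> x))"
  have \<psi>': "\<psi>' \<in> characters G" using char_cnj[OF \<psi>(1)] by (simp add: \<psi>'_def)
  have np: "\<psi>' \<noteq> principal_char G"
  proof
    assume "\<psi>' = principal_char G"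
    hence "cnj (\<psi> x) = principal_char G x" for x by (metis \<psi>'_def)
    hence "\<psi> x = principal_char G x" for x by (metis complex_cnj_cnj complex_cnj_one complex_cnj_zero principal_char_def)
    thus False using \<psi>(2) by blast
  qed
  \<comment> \<open>\<open>Lval\<close> is a chosen limit, so its vanishing at the conjugate
    character is read off from the sums \<open>S\<close> themselves.\<close>
  have "S \<psi>' x = cnj (S \<psi> x)" for x by (simp add: S_def \<psi>'_def cnj_sum)
  hence "norm (S \<psi>' x - 0) \<le> 12 * (h * C2) * x powr (-1/4)" if "x \<ge> 1" for x
    using S_asymp[OF \<psi>(1,2) that] \<psi>(3) by simp
  moreover have "norm (S \<psi>' x - Lval \<psi>') \<le> 12 * (h * C2) * x powr (-1/4)" if "x \<ge> 1" for x
    using S_asymp[OF \<psi>' np that] .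
  ultimately have bd: "norm (Lval \<psi>') \<le> 24 * (h * C2) * x powr (-1/4)" if "x \<ge> 1" for x
    using norm_triangle_ineq4[of "S \<psi>' x" "S \<psi>' x - Lval \<psi>'"] that by fastforce
  have "((\<lambda>x. 24 * (h * C2) * x powr (-1/4)) \<longlongrightarrow> 0) at_top" by real_asymp
  moreover have "eventually (\<lambda>x. norm (Lval \<psi>') \<le> 24 * (h * C2) * x powr (-1/4)) at_top"
    using eventually_ge_at_top[of 1] by eventually_elim (rule bd)
  ultimately have "norm (Lval \<psi>') \<le> 0" by (rule tendsto_lowerbound) simp
  hence "\<psi>' \<in> zeros" using \<psi>' np by (simp add: zeros_def)
  hence "\<psi>' = \<psi>" using card_zeros_le z finite_zeros by (metis One_nat_def card_le_Suc0_iff_eq)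
  hence "cnj (\<psi> A) = \<psi> A" for A by (metis \<psi>'_def)
  from real_nonvanishing[OF \<psi>(1,2) this] \<psi>(3) show False by blast
qed

section \<open>Primes in a given class\<close>

lemma mangoldt_class_lower:
  assumes A: "A \<in> carrier G"
  shows "\<exists>c>0. \<exists>B. \<forall>x\<ge>1. (\<Sum>D\<in>{D \<in> Ile x. cls D = A}. mangoldt D / real (N D)) \<ge> c * ln x - B"
proof -
  obtain c B1 where c: "c > 0" "\<And>x. x \<ge> 1 \<Longrightarrow> F1 x \<ge> c * ln x - B1" using F1_lower by blast
  obtain B where B: "\<And>x a. x \<ge> 1 \<Longrightarrow> (\<forall>\<psi>\<in>characters G. norm (a \<psi>) \<le> 1) \<Longrightarrow>
     norm ((\<Sum>\<psi>\<in>characters G - {principal_char G}. a \<psi> * F \<psi> x) + (\<Sum>\<psi>\<in>zeros. a \<psi>) * of_real (ln x)) \<le> B"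
    using nonprincipal_bound by blast
  define n where "n = real (card (characters G))"
  have n: "n > 0" using card_characters_pos by (simp add: n_def)
  have "(\<Sum>D\<in>{D \<in> Ile x. cls D = A}. mangoldt D / real (N D)) \<ge> (c / n) * ln x - (B1 + B) / n" if x: "x \<ge> 1" for x
  proof -
    let ?T = "\<Sum>\<psi>\<in>characters G - {principal_char G}. cnj (\<psi> A) * F \<psi> x"
    let ?M = "\<Sum>D\<in>{D \<in> Ile x. cls D = A}. mangoldt D / real (N D)"
    \<comment> \<open>With \<open>zeros\<close> empty the nonprincipal characters together stay
      bounded, so every class shares in the growth \<open>c * ln x\<close> of the principal
      one.\<close>
    have "norm ?T \<le> B" using B[OF x, of "\<lambda>\<psi>. cnj (\<psi> A)"] char_norm A by (simp add: zeros_empty)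
    hence T: "Re ?T \<ge> - B" using abs_Re_le_cmod[of ?T] by linarith
    have "of_nat (card (characters G)) * of_real ?M = (\<Sum>\<psi>\<in>characters G. cnj (\<psi> A) * F \<psi> x)"
      by (rule sum_F_class[OF A, symmetric])
    also have "\<dots> = cnj (principal_char G A) * F (principal_char G) x + ?T"
      using finite_characters principal_char_in by (intro sum.remove) auto
    also have "\<dots> = of_real (F1 x) + ?T" using A by (simp add: F_principal) (simp add: principal_char_def)
    finally have "Re (of_nat (card (characters G)) * of_real ?M) = F1 x + Re ?T" by simp
    hence "n * ?M = F1 x + Re ?T" by (simp add: n_def)
    hence "n * ?M \<ge> c * ln x - (B1 + B)" using T c(2)[OF x] by linarith
    thus ?thesis using n by (simp add: field_simps)
  qed
  moreover have "c / n > 0" using c n by simp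
  ultimately show ?thesis by blast
qed

text \<open>Geometric series reduce the prime powers to the sum of \<open>ln q / q^2\<close> over
  prime norms \<open>q\<close>, and the primes are among all divisors, whose number grows linearly.
  The outer 2 comes from the geometric series; 6 is \<open>g 1 = 2\<close> plus the tail 4.\<close>

lemma prime_power_sum_bounded:
  "\<exists>B. \<forall>x. (\<Sum>D\<in>{D \<in> Ile x. size D \<noteq> 1}. mangoldt D / real (N D)) \<le> B"
proof -
  define g where "g n = 2 * real n powr (-1/2 - 1)" for n :: nat
  have lng: "ln (real n) / (real n)\<^sup>2 \<le> g n" if "n \<ge> 1" for n
  proof -
    have "ln (real n) \<le> 2 * real n powr (1/2)" using ln_le_powr[of "real n" "1/2"] that by simp
    hence "ln (real n) / (real n)\<^sup>2 \<le> 2 * real n powr (1/2) / (real n)\<^sup>2" by (intro divide_right_mono) auto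
    also have "\<dots> = g n" using that powr_diff[of "real n" "1/2" 2] by (simp add: g_def powr_numeral)
    finally show ?thesis .
  qed
  have "(\<Sum>D\<in>{D \<in> Ile x. size D \<noteq> 1}. mangoldt D / real (N D)) \<le> 2 * (C4 * 6)" for x
  proof -
    define m where "m = nat \<lfloor>x\<rfloor>"
    define Q where "Q = {P \<in> Pr. real (nm P) \<le> x}"
    have Qeq: "Q \<subseteq> {P \<in> Pr. nm P \<le> m}" by (auto simp: Q_def m_def le_nat_floor)
    have finQ: "finite Q" by (rule finite_subset[OF Qeq finite_nm])
    have "(\<Sum>D\<in>{D \<in> Ile x. size D \<noteq> 1}. mangoldt D / real (N D))
        \<le> (\<Sum>D\<in>(\<lambda>(P, k). replicate_mset k P) ` (Q \<times> {2..m}). mangoldt D / real (N D))"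
    proof -
      have "(\<Sum>D\<in>{D \<in> Ile x. size D \<noteq> 1}. mangoldt D / real (N D))
         = (\<Sum>D\<in>{D \<in> Ile x. size D \<noteq> 1 \<and> mangoldt D \<noteq> 0}. mangoldt D / real (N D))"
        by (intro sum.mono_neutral_right) (auto simp: finite_Ile)
      also have "\<dots> \<le> (\<Sum>D\<in>(\<lambda>(P, k). replicate_mset k P) ` (Q \<times> {2..m}). mangoldt D / real (N D))"
      proof (rule sum_mono2)
        show "finite ((\<lambda>(P, k). replicate_mset k P) ` (Q \<times> {2..m}))" using finQ by simp
        show "{D \<in> Ile x. size D \<noteq> 1 \<and> mangoldt D \<noteq> 0} \<subseteq> (\<lambda>(P, k). replicate_mset k P) ` (Q \<times> {2..m})"
        proof
          fix D assume "D \<in> {D \<in> Ile x. size D \<noteq> 1 \<and> mangoldt D \<noteq> 0}"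
          hence D: "D \<in> Divs" "real (N D) \<le> x" "size D \<noteq> 1" "mangoldt D \<noteq> 0" by (auto simp: Ile_def)
          then obtain P k where P: "k \<ge> 1" "D = replicate_mset k P" unfolding mangoldt_def by (metis (no_types, lifting))
          have k2: "k \<ge> 2" using P D(3) by simp
          have PP: "P \<in> Pr" "P \<in># D" using D(1) P by (auto simp: Divs_def split: if_splits)
          have "real (nm P) \<le> x" using nm_le_N[OF D(1) PP(2)] D(2) by linarith
          moreover have "k \<le> m"
          proof -
            have "k < 2 ^ k" by (rule less_exp)
            also have "2 ^ k \<le> N D" using N_ge_two_power[OF D(1)] P by simp
            finally show ?thesis using D(2) by (simp add: m_def le_nat_floor)
          qed
          ultimately show "D \<in> (\<lambda>(P, k). replicate_mset k P) ` (Q \<times> {2..m})"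
            using k2 P PP by (auto simp: Q_def intro!: image_eqI[of _ _ "(P, k)"])
        qed
        fix D assume "D \<in> (\<lambda>(P, k). replicate_mset k P) ` (Q \<times> {2..m}) - {D \<in> Ile x. size D \<noteq> 1 \<and> mangoldt D \<noteq> 0}"
        hence "D \<in> Divs" by (auto simp: Q_def Divs_def split: if_splits)
        thus "0 \<le> mangoldt D / real (N D)" by (simp add: mangoldt_nonneg)
      qed
      finally show ?thesis .
    qed
    also have "\<dots> = (\<Sum>(P, k)\<in>Q \<times> {2..m}. mangoldt (replicate_mset k P) / real (N (replicate_mset k P)))"
    proof (subst sum.reindex)
      show "inj_on (\<lambda>(P, k). replicate_mset k P) (Q \<times> {2..m})"
        by (rule inj_onI) (auto simp: replicate_mset_eq_iff)
    qed (auto intro!: sum.cong)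
    also have "\<dots> = (\<Sum>P\<in>Q. \<Sum>k=2..m. ln (real (nm P)) / real (nm P) ^ k)"
      unfolding sum.cartesian_product[symmetric] by (intro sum.cong refl) (simp add: mangoldt_replicate)
    also have "\<dots> \<le> (\<Sum>P\<in>Q. 2 * g (nm P))"
    proof (rule sum_mono)
      fix P assume P: "P \<in> Q"
      define q where "q = 1 / real (nm P)"
      have nm: "nm P \<ge> 2" using P nm_ge2 by (simp add: Q_def)
      hence q: "0 < q" "q \<le> 1/2" by (auto simp: q_def field_simps)
      \<comment> \<open>The last term, subtracted with factor 2, is what makes the induction go
        through.\<close>
      have geo: "(\<Sum>k=2..m. q ^ k) \<le> 2 * q\<^sup>2 - (if m \<ge> 1 then 2 * q ^ (m + 1) else 0)"
      proof (induction m)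
        case (Suc m)
        have "q * q ^ (m + 1) \<le> 1/2 * q ^ (m + 1)" using q by (intro mult_right_mono) auto
        thus ?case using Suc by (cases "m = 0") (auto simp: power2_eq_square)
      qed (use q in auto)
      also have "\<dots> \<le> 2 * q\<^sup>2" using q by simp
      finally have "(\<Sum>k=2..m. q ^ k) \<le> 2 * q\<^sup>2" .
      hence "ln (real (nm P)) * (\<Sum>k=2..m. q ^ k) \<le> ln (real (nm P)) * (2 * q\<^sup>2)" using nm by (intro mult_left_mono) auto
      hence "(\<Sum>k=2..m. ln (real (nm P)) / real (nm P) ^ k) \<le> 2 * (ln (real (nm P)) / (real (nm P))\<^sup>2)"
        by (simp add: sum_distrib_left q_def power_divide mult.commute)
      also have "\<dots> \<le> 2 * g (nm P)" using lng[of "nm P"] nm by simp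
      finally show "(\<Sum>k=2..m. ln (real (nm P)) / real (nm P) ^ k) \<le> 2 * g (nm P)" .
    qed
    also have "\<dots> = 2 * (\<Sum>P\<in>Q. g (N {#P#}))" by (simp add: sum_distrib_left)
    also have "(\<Sum>P\<in>Q. g (N {#P#})) = (\<Sum>D\<in>(\<lambda>P. {#P#}) ` Q. g (N D))"
      by (subst sum.reindex) (auto simp: inj_on_def)
    also have "\<dots> \<le> (\<Sum>D\<in>Ile x. g (N D))"
      by (rule sum_mono2[OF finite_Ile]) (auto simp: Ile_def Q_def g_def)
    also have "\<dots> \<le> C4 * (\<Sum>n=1..m. g n)"
      unfolding m_def using count_le by (intro majorize_sum) (auto simp: g_def intro: powr_mono2')
    also have "\<dots> \<le> C4 * 6"
    proof (intro mult_left_mono)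
      have "(\<Sum>n=1..m. g n) \<le> g 1 + (\<Sum>n=1+1..1+m. g n)"
      proof -
        have "(\<Sum>n=1..m. g n) \<le> (\<Sum>n\<in>insert 1 {1+1..1+m}. g n)" by (intro sum_mono2) (auto simp: g_def)
        thus ?thesis by simp
      qed
      also have "(\<Sum>n=1+1..1+m. g n) \<le> 2 * (real 1 powr (-1/2) / (-(-1/2)))"
        unfolding g_def sum_distrib_left[symmetric] by (intro mult_left_mono sum_powr_tail) auto
      finally show "(\<Sum>n=1..m. g n) \<le> 6" by (simp add: g_def)
    qed (use C4_pos in simp)
    finally show ?thesis by simp
  qed
  thus ?thesis by blast
qed

text \<open>With finitely many primes of the class outside \<open>T\<close>, its logarithmic sum
  would be bounded: by these, by \<open>T\<close>, and by the higher prime powers. \<open>T\<close>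
  will be the set of inert primes.\<close>

theorem infinite_primes_in_class:
  assumes A: "A \<in> carrier G"
    and thin: "\<And>Z. finite Z \<Longrightarrow> Z \<subseteq> T \<inter> Pr \<Longrightarrow> (\<Sum>P\<in>Z. ln (real (nm P)) / real (nm P)) \<le> b"
  shows "infinite {P \<in> Pr - T. cls {#P#} = A}"
proof
  assume fin': "finite {P \<in> Pr - T. cls {#P#} = A}" (is "finite ?Z")
  obtain c B where c: "c > 0" "\<And>x. x \<ge> 1 \<Longrightarrow> (\<Sum>D\<in>{D \<in> Ile x. cls D = A}. mangoldt D / real (N D)) \<ge> c * ln x - B"
    using mangoldt_class_lower[OF A] by blast
  obtain B2 where B2: "\<And>x. (\<Sum>D\<in>{D \<in> Ile x. size D \<noteq> 1}. mangoldt D / real (N D)) \<le> B2"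
    using prime_power_sum_bounded by blast
  define t where "t P = ln (real (nm P)) / real (nm P)" for P
  have t0: "t P \<ge> 0" if "P \<in> Pr" for P using nm_ge2[OF that] by (simp add: t_def)
  define B3 where "B3 = (\<Sum>P\<in>?Z. t P)"
  have "c * ln x - B \<le> B3 + b + B2" if x: "x \<ge> 1" for x
  proof -
    define Q where "Q = {P \<in> Pr. real (nm P) \<le> x}"
    have "Q \<subseteq> {P \<in> Pr. nm P \<le> nat \<lfloor>x\<rfloor>}" by (auto simp: Q_def le_nat_floor)
    hence finQ: "finite Q" by (rule finite_subset[OF _ finite_nm])
    have "(\<Sum>D\<in>{D \<in> Ile x. cls D = A}. mangoldt D / real (N D))
      \<le> (\<Sum>D\<in>(\<lambda>P. {#P#}) ` {P \<in> Q. cls {#P#} = A} \<union> {D \<in> Ile x. size D \<noteq> 1}. mangoldt D / real (N D))"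
    proof (rule sum_mono2)
      show "{D \<in> Ile x. cls D = A} \<subseteq> (\<lambda>P. {#P#}) ` {P \<in> Q. cls {#P#} = A} \<union> {D \<in> Ile x. size D \<noteq> 1}"
      proof
        fix D assume D: "D \<in> {D \<in> Ile x. cls D = A}"
        show "D \<in> (\<lambda>P. {#P#}) ` {P \<in> Q. cls {#P#} = A} \<union> {D \<in> Ile x. size D \<noteq> 1}"
        proof (cases "size D = 1")
          case True
          then obtain P where "D = {#P#}" using size_1_singleton_mset by blast
          thus ?thesis using D by (auto simp: Ile_def Q_def)
        qed (use D in auto)
      qed
      show "finite ((\<lambda>P. {#P#}) ` {P \<in> Q. cls {#P#} = A} \<union> {D \<in> Ile x. size D \<noteq> 1})"
        using finQ finite_Ile[of x] by simp
    qed (auto simp: Ile_def Q_def mangoldt_nonneg)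
    also have "\<dots> = (\<Sum>D\<in>(\<lambda>P. {#P#}) ` {P \<in> Q. cls {#P#} = A}. mangoldt D / real (N D))
        + (\<Sum>D\<in>{D \<in> Ile x. size D \<noteq> 1}. mangoldt D / real (N D))"
      using finQ finite_Ile by (intro sum.union_disjoint) auto
    also have "(\<Sum>D\<in>(\<lambda>P. {#P#}) ` {P \<in> Q. cls {#P#} = A}. mangoldt D / real (N D)) = (\<Sum>P\<in>{P \<in> Q. cls {#P#} = A}. t P)"
    proof (subst sum.reindex)
      have "mangoldt {#P#} = ln (real (nm P))" for P using mangoldt_replicate[of 1 P] by simp
      thus "sum ((\<lambda>D. mangoldt D / real (N D)) \<circ> (\<lambda>P. {#P#})) {P \<in> Q. cls {#P#} = A} = (\<Sum>P\<in>{P \<in> Q. cls {#P#} = A}. t P)"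
        by (simp add: t_def)
    qed (simp add: inj_on_def)
    also have "(\<Sum>P\<in>{P \<in> Q. cls {#P#} = A}. t P) \<le> (\<Sum>P\<in>?Z \<union> (Q \<inter> T). t P)"
      using fin' finQ t0 by (intro sum_mono2) (auto simp: Q_def)
    also have "\<dots> = (\<Sum>P\<in>?Z. t P) + (\<Sum>P\<in>Q \<inter> T. t P)"
      using fin' finQ by (intro sum.union_disjoint) auto
    also have "(\<Sum>P\<in>Q \<inter> T. t P) \<le> b" unfolding t_def using finQ by (intro thin) (auto simp: Q_def)
    finally show ?thesis using c(2)[OF x] B2[of x] by (simp add: B3_def)
  qed
  moreover have "eventually (\<lambda>x::real. c * ln x - B > B3 + b + B2 \<and> x \<ge> 1) at_top"
    using c(1) by (intro eventually_conj eventually_ge_at_top) real_asymp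
  ultimately show False by (auto simp: eventually_at_top_linorder not_le[symmetric])
qed

end

section \<open>Riesz means over lattice points\<close>

definition sq :: "nat \<Rightarrow> complex" where "sq d = \<i> * complex_of_real (sqrt (real d))"

definition emb :: "nat \<Rightarrow> int \<Rightarrow> int \<Rightarrow> complex" where "emb d x y = of_int x + of_int y * sq d"

text \<open>The order \<open>\<int>[\<surd>-d]\<close>. For squarefree \<open>d\<close> it has index
  2 in the ring of integers if \<open>d mod 4 = 3\<close> and is equal to it otherwise.\<close>

definition Rg :: "nat \<Rightarrow> complex set" where "Rg d = {emb d x y | x y. True}"

definition multiples :: "nat \<Rightarrow> nat \<Rightarrow> complex set" where "multiples d m = {of_nat m * v | v. v \<in> Rg d}"

lemma sq_square: "sq d * sq d = - of_nat d"
  by (simp add: sq_def complex_eq_iff flip: of_real_mult)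

lemma cnj_sq: "cnj (sq d) = - sq d"
  by (simp add: sq_def)

lemma emb_mult: "emb d x y * emb d a b = emb d (x * a - int d * (y * b)) (x * b + y * a)"
proof -
  have "emb d x y * emb d a b = of_int (x * a) + of_int (y * b) * (sq d * sq d) + of_int (x * b + y * a) * sq d"
    by (simp add: emb_def algebra_simps)
  also have "\<dots> = emb d (x * a - int d * (y * b)) (x * b + y * a)"
    by (simp add: sq_square emb_def)
  finally show ?thesis .
qed

lemma emb_add: "emb d x y + emb d a b = emb d (x + a) (y + b)"
  and emb_diff: "emb d x y - emb d a b = emb d (x - a) (y - b)"
  and emb_uminus: "- emb d x y = emb d (- x) (- y)"
  and cnj_emb: "cnj (emb d x y) = emb d x (- y)"
  and emb_of_int: "of_int n = emb d n 0"
  by (simp_all add: emb_def cnj_sq algebra_simps)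

lemma emb_scale: "of_int n * emb d x y = emb d (n * x) (n * y)"
  by (simp add: emb_def algebra_simps)

lemma norm_emb: "(cmod (emb d x y))\<^sup>2 = of_int (x\<^sup>2 + int d * y\<^sup>2)"
  by (simp add: emb_def sq_def cmod_power2 power_mult_distrib)

lemma emb_inj:
  assumes "d > 0" "emb d x y = emb d a b" shows "x = a \<and> y = b"
proof -
  have "Re (emb d x y) = Re (emb d a b)" "Im (emb d x y) = Im (emb d a b)" using assms by simp_all
  thus ?thesis using assms(1) by (simp add: emb_def sq_def)
qed

lemma Rg_emb [intro, simp]: "emb d x y \<in> Rg d" by (auto simp: Rg_def)

lemma Rg_cases: assumes "v \<in> Rg d" obtains x y where "v = emb d x y"
  using assms by (auto simp: Rg_def)

lemma Rg_add [intro, simp]: "u \<in> Rg d \<Longrightarrow> v \<in> Rg d \<Longrightarrow> u + v \<in> Rg d"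
  and Rg_diff [intro, simp]: "u \<in> Rg d \<Longrightarrow> v \<in> Rg d \<Longrightarrow> u - v \<in> Rg d"
  and Rg_mult [intro, simp]: "u \<in> Rg d \<Longrightarrow> v \<in> Rg d \<Longrightarrow> u * v \<in> Rg d"
  and Rg_uminus [intro, simp]: "u \<in> Rg d \<Longrightarrow> - u \<in> Rg d"
  and Rg_cnj [intro, simp]: "u \<in> Rg d \<Longrightarrow> cnj u \<in> Rg d"
  by (auto elim!: Rg_cases simp: emb_add emb_diff emb_mult emb_uminus cnj_emb)

lemma Rg_of_int [intro, simp]: "of_int n \<in> Rg d" by (simp add: emb_of_int[of n d])
lemma Rg_of_nat [intro, simp]: "of_nat n \<in> Rg d" using Rg_of_int[of "int n" d] by (simp del: Rg_of_int)
lemma Rg_0 [intro, simp]: "0 \<in> Rg d" and Rg_1 [intro, simp]: "1 \<in> Rg d"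
  using Rg_of_int[of 0 d] Rg_of_int[of 1 d] by (simp_all del: Rg_of_int)
lemma Rg_power [intro, simp]: "u \<in> Rg d \<Longrightarrow> u ^ n \<in> Rg d" by (induction n) auto

lemma emb_in_multiples:
  assumes "d > 0"
  shows "emb d x y \<in> multiples d m \<longleftrightarrow> int m dvd x \<and> int m dvd y"
proof
  assume "emb d x y \<in> multiples d m"
  then obtain a b where "emb d x y = of_int (int m) * emb d a b" by (auto simp: multiples_def elim!: Rg_cases)
  hence "x = int m * a \<and> y = int m * b" unfolding emb_scale by (rule emb_inj[OF assms])
  thus "int m dvd x \<and> int m dvd y" by auto
next
  assume "int m dvd x \<and> int m dvd y"
  then obtain a b where "x = int m * a" "y = int m * b" by (auto elim!: dvdE)
  hence "emb d x y = of_nat m * emb d a b" by (simp add: emb_def algebra_simps)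
  thus "emb d x y \<in> multiples d m" by (auto simp: multiples_def)
qed

lemma multiples_subset: "multiples d m \<subseteq> Rg d" by (auto simp: multiples_def)

definition add_subgroup :: "complex set \<Rightarrow> bool" where
  "add_subgroup \<Lambda> \<longleftrightarrow> 0 \<in> \<Lambda> \<and> (\<forall>u\<in>\<Lambda>. \<forall>v\<in>\<Lambda>. u - v \<in> \<Lambda>)"

lemma add_subgroupD:
  assumes "add_subgroup \<Lambda>"
  shows "0 \<in> \<Lambda>" "u \<in> \<Lambda> \<Longrightarrow> v \<in> \<Lambda> \<Longrightarrow> u - v \<in> \<Lambda>" "v \<in> \<Lambda> \<Longrightarrow> - v \<in> \<Lambda>" "u \<in> \<Lambda> \<Longrightarrow> v \<in> \<Lambda> \<Longrightarrow> u + v \<in> \<Lambda>"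
proof -
  show 1: "0 \<in> \<Lambda>" and 2: "u \<in> \<Lambda> \<Longrightarrow> v \<in> \<Lambda> \<Longrightarrow> u - v \<in> \<Lambda>" for u v using assms by (auto simp: add_subgroup_def)
  show 3: "v \<in> \<Lambda> \<Longrightarrow> - v \<in> \<Lambda>" for v using 2[OF 1, of v] by simp
  show "u \<in> \<Lambda> \<Longrightarrow> v \<in> \<Lambda> \<Longrightarrow> u + v \<in> \<Lambda>" using 2[of u "- v"] 3[of v] by simp
qed

lemma add_subgroup_Rg: "add_subgroup (Rg d)" by (simp add: add_subgroup_def)

lemma add_subgroup_multiples: "add_subgroup (multiples d m)"
  unfolding add_subgroup_def multiples_def
  by (auto simp flip: right_diff_distrib intro: exI[of _ 0])

definition pts :: "nat \<Rightarrow> complex set \<Rightarrow> complex \<Rightarrow> real \<Rightarrow> complex set" where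
  "pts d \<Lambda> v0 X = {v \<in> Rg d. v - v0 \<in> \<Lambda> \<and> (cmod v)\<^sup>2 \<le> X}"

text \<open>The damping factor vanishes on the boundary circle, which makes these sums nearly
  insensitive to translation.\<close>

definition rsum :: "nat \<Rightarrow> complex set \<Rightarrow> complex \<Rightarrow> real \<Rightarrow> real" where
  "rsum d \<Lambda> v0 X = (\<Sum>v\<in>pts d \<Lambda> v0 X. 1 - (cmod v)\<^sup>2 / X)"

lemma card_residue_interval:
  fixes t :: real and x0 :: int
  assumes "m \<ge> 1" "t \<ge> 0"
  shows "finite {x::int. \<bar>of_int x\<bar> \<le> t \<and> int m dvd x - x0} \<and> real (card {x::int. \<bar>of_int x\<bar> \<le> t \<and> int m dvd x - x0}) \<le> 2 * t / m + 1"
proof -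
  let ?A = "{x::int. \<bar>of_int x\<bar> \<le> t \<and> int m dvd x - x0}"
  have sub: "?A \<subseteq> {-\<lfloor>t\<rfloor>..\<lfloor>t\<rfloor>}"
  proof
    fix x assume "x \<in> ?A"
    hence "of_int x \<le> t" "of_int (- x) \<le> t" by auto
    hence "x \<le> \<lfloor>t\<rfloor>" "- x \<le> \<lfloor>t\<rfloor>" using le_floor_iff by blast+
    thus "x \<in> {-\<lfloor>t\<rfloor>..\<lfloor>t\<rfloor>}" by simp
  qed
  have fin: "finite ?A" by (rule finite_subset[OF sub]) simp
  show ?thesis
  proof (cases "?A = {}")
    case False
    define a where "a = Min ?A"
    have a: "a \<in> ?A" "\<And>x. x \<in> ?A \<Longrightarrow> a \<le> x"
      unfolding a_def using Min_in[OF fin False] Min_le[OF fin] by blast+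
    define k where "k = \<lfloor>2 * t / m\<rfloor>"
    have "?A \<subseteq> (\<lambda>i. a + int m * i) ` {0..k}"
    proof
      fix x assume x: "x \<in> ?A"
      have "int m dvd x - x0" "int m dvd a - x0" using x a(1) by auto
      from dvd_diff[OF this] have "int m dvd x - a" by simp
      then obtain i where i: "x = a + int m * i" by (auto simp: dvd_def algebra_simps)
      have "int m * i \<ge> 0" using a(2)[OF x] i by simp
      hence i0: "i \<ge> 0" using assms(1) by (simp add: zero_le_mult_iff)
      have "of_int (int m * i) = of_int x - (of_int a :: real)" using i by simp
      also have "\<dots> \<le> 2 * t" using x a(1) by auto
      finally have "of_int i \<le> 2 * t / m" using assms by (simp add: field_simps)
      hence "i \<le> k" unfolding k_def by (simp add: le_floor_iff)
      thus "x \<in> (\<lambda>i. a + int m * i) ` {0..k}" using i i0 by auto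
    qed
    hence "card ?A \<le> card {0..k}" by (rule surj_card_le[rotated]) simp
    hence "real (card ?A) \<le> real (nat (k + 1))" by simp
    also have "k \<ge> 0" using assms by (simp add: k_def)
    hence "real (nat (k + 1)) = of_int k + 1" by simp
    also have "\<dots> \<le> 2 * t / m + 1" by (simp add: k_def)
    finally show ?thesis using fin by simp
  next
    case True
    thus ?thesis using assms by (simp only: True) simp
  qed
qed

text \<open>As \<open>d \<ge> 1\<close>, both coordinates are at most \<open>sqrt X\<close> in
  absolute value. The crude box bound has the right order in \<open>X\<close> and in
  \<open>m\<close> at once.\<close>

lemma pts_bound:
  assumes d: "d > 0" and m: "m \<ge> 1" and X: "X \<ge> 0" and v0: "v0 \<in> Rg d"
  shows "finite (pts d (multiples d m) v0 X) \<and> real (card (pts d (multiples d m) v0 X)) \<le> (2 * sqrt X / m + 1)\<^sup>2"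
proof -
  obtain x0 y0 where v0e: "v0 = emb d x0 y0" using v0 by (rule Rg_cases)
  let ?A = "\<lambda>x0. {x::int. \<bar>of_int x\<bar> \<le> sqrt X \<and> int m dvd x - x0}"
  have sub: "pts d (multiples d m) v0 X \<subseteq> (\<lambda>(x, y). emb d x y) ` (?A x0 \<times> ?A y0)"
  proof
    fix v assume v: "v \<in> pts d (multiples d m) v0 X"
    then obtain x y where ve: "v = emb d x y" by (auto simp: pts_def elim: Rg_cases)
    have dv: "int m dvd x - x0" "int m dvd y - y0"
      using v emb_in_multiples[OF d] by (auto simp: pts_def ve v0e emb_diff)
    have le: "of_int (x\<^sup>2 + int d * y\<^sup>2) \<le> X" using v by (simp add: pts_def ve norm_emb)
    have "x\<^sup>2 \<le> x\<^sup>2 + int d * y\<^sup>2" by simp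
    moreover have "y\<^sup>2 \<le> x\<^sup>2 + int d * y\<^sup>2"
      using d mult_right_mono[of 1 "int d" "y\<^sup>2"] by (smt (verit) mult_1 of_nat_0_less_iff zero_le_power2)
    ultimately have "(of_int x)\<^sup>2 \<le> X" "(of_int y)\<^sup>2 \<le> X"
      using le by (smt (verit) of_int_le_iff of_int_power)+
    hence "\<bar>of_int x\<bar> \<le> sqrt X" "\<bar>of_int y\<bar> \<le> sqrt X" by (metis real_sqrt_abs real_sqrt_le_mono)+
    thus "v \<in> (\<lambda>(x, y). emb d x y) ` (?A x0 \<times> ?A y0)" using dv ve by auto
  qed
  have A: "finite (?A x0)" "finite (?A y0)" "real (card (?A x0)) \<le> 2 * sqrt X / m + 1" "real (card (?A y0)) \<le> 2 * sqrt X / m + 1"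
    using card_residue_interval[OF m, of "sqrt X"] X by auto
  have fin: "finite (pts d (multiples d m) v0 X)" by (rule finite_subset[OF sub]) (use A in auto)
  have "card (pts d (multiples d m) v0 X) \<le> card (?A x0 \<times> ?A y0)"
    by (rule surj_card_le[OF _ sub]) (use A in auto)
  also have "\<dots> = card (?A x0) * card (?A y0)" by (rule card_cartesian_product)
  finally have "real (card (pts d (multiples d m) v0 X)) \<le> real (card (?A x0)) * real (card (?A y0))"
    by (simp only: of_nat_le_iff flip: of_nat_mult)
  also have "\<dots> \<le> (2 * sqrt X / m + 1) * (2 * sqrt X / m + 1)"
    using A X by (intro mult_mono) auto
  finally show ?thesis using fin by (simp add: power2_eq_square)
qed

lemma multiples_1: "multiples d 1 = Rg d" by (auto simp: multiples_def)

lemma finite_ball: "d > 0 \<Longrightarrow> finite {v \<in> Rg d. (cmod v)\<^sup>2 \<le> X}"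
proof (cases "X \<ge> 0")
  case True
  assume "d > 0"
  from pts_bound[OF this _ True, of 1 0] have "finite (pts d (Rg d) 0 X)" using multiples_1[of d] by simp
  thus ?thesis by (simp add: pts_def cong: conj_cong)
next
  case False
  hence "{v \<in> Rg d. (cmod v)\<^sup>2 \<le> X} = {}" using zero_le_power2 order_trans by blast
  thus ?thesis by (simp only: finite.emptyI)
qed

lemma finite_pts: "d > 0 \<Longrightarrow> finite (pts d \<Lambda> v0 X)"
  by (rule finite_subset[OF _ finite_ball[of d X]]) (auto simp: pts_def)

lemma rsum_nonneg: "rsum d \<Lambda> v0 X \<ge> 0"
  unfolding rsum_def
proof (rule sum_nonneg)
  fix v assume "v \<in> pts d \<Lambda> v0 X"
  hence "(cmod v)\<^sup>2 \<le> X" by (simp add: pts_def)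
  moreover from this have "X \<ge> 0" by (rule order_trans[OF zero_le_power2])
  ultimately show "0 \<le> 1 - (cmod v)\<^sup>2 / X" by (cases "X = 0") (auto simp: field_simps)
qed

lemma rsum_le_card: "X > 0 \<Longrightarrow> rsum d \<Lambda> v0 X \<le> real (card (pts d \<Lambda> v0 X))"
  unfolding rsum_def by (rule order.trans[OF sum_mono[of _ _ "\<lambda>_. 1"]]) auto

lemma rsum_cong_class:
  assumes "add_subgroup \<Lambda>" "v0 - v1 \<in> \<Lambda>"
  shows "rsum d \<Lambda> v0 X = rsum d \<Lambda> v1 X"
proof -
  have "v - v0 \<in> \<Lambda> \<longleftrightarrow> v - v1 \<in> \<Lambda>" for v
    using add_subgroupD(4)[OF assms(1), of "v - v0" "v0 - v1"] add_subgroupD(2)[OF assms(1), of "v - v1" "v0 - v1"] assms(2)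
    by auto
  thus ?thesis by (simp add: rsum_def pts_def)
qed

definition resbox :: "nat \<Rightarrow> nat \<Rightarrow> complex set" where
  "resbox d m = (\<lambda>(x, y). emb d x y) ` ({0..<int m} \<times> {0..<int m})"

lemma resbox_finite: "finite (resbox d m)" and resbox_Rg: "resbox d m \<subseteq> Rg d"
  by (auto simp: resbox_def)

lemma resbox_card: "d > 0 \<Longrightarrow> card (resbox d m) = m\<^sup>2"
  unfolding resbox_def by (subst card_image) (auto simp: inj_on_def power2_eq_square dest: emb_inj)

lemma resbox_norm:
  assumes "v \<in> resbox d m" shows "(cmod v)\<^sup>2 \<le> (1 + real d) * (real m)\<^sup>2"
proof -
  obtain x y where xy: "0 \<le> x" "x < int m" "0 \<le> y" "y < int m" "v = emb d x y" using assms by (auto simp: resbox_def)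
  have "x\<^sup>2 \<le> (int m)\<^sup>2" "y\<^sup>2 \<le> (int m)\<^sup>2" using xy by (auto intro!: power_mono)
  hence "x\<^sup>2 + int d * y\<^sup>2 \<le> (int m)\<^sup>2 + int d * (int m)\<^sup>2" by (intro add_mono mult_left_mono) auto
  hence "of_int (x\<^sup>2 + int d * y\<^sup>2) \<le> (of_int ((int m)\<^sup>2 + int d * (int m)\<^sup>2) :: real)" by (simp only: of_int_le_iff)
  thus ?thesis unfolding xy norm_emb by (simp add: algebra_simps)
qed

lemma resbox_ex1:
  assumes d: "d > 0" and m: "m \<ge> 1" and v: "v \<in> Rg d"
  shows "\<exists>!t. t \<in> resbox d m \<and> v - t \<in> multiples d m"
proof -
  obtain x y where ve: "v = emb d x y" using v by (rule Rg_cases)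
  show ?thesis
  proof (rule ex1I)
    show "emb d (x mod int m) (y mod int m) \<in> resbox d m \<and> v - emb d (x mod int m) (y mod int m) \<in> multiples d m"
      using m by (auto simp: resbox_def ve emb_diff emb_in_multiples[OF d])
    fix t assume "t \<in> resbox d m \<and> v - t \<in> multiples d m"
    then obtain a b where ab: "t = emb d a b" "0 \<le> a" "a < int m" "0 \<le> b" "b < int m" "int m dvd x - a" "int m dvd y - b"
      by (auto simp: resbox_def ve emb_diff emb_in_multiples[OF d])
    hence "x mod int m = a" "y mod int m = b" by (metis mod_eq_dvd_iff mod_pos_pos_trivial)+
    thus "t = emb d (x mod int m) (y mod int m)" using ab by simp
  qed
qed

text \<open>The second difference of \<open>v \<mapsto> max 0 (1 - |v|\<^sup>2 / X)\<close> in direction \<open>w\<close> is at least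
  \<open>-2 |w|\<^sup>2 / X\<close> by the parallelogram law, and only points of the disc contribute. At a coset where the
  sum is maximal this bounds the drop towards every other coset.\<close>
lemma rsum_oscillation:
  assumes d: "d > 0" and m: "m \<ge> 1" and \<Lambda>: "add_subgroup \<Lambda>" "\<Lambda> \<subseteq> Rg d" "multiples d m \<subseteq> \<Lambda>" and X: "X > 0"
    and K: "\<And>v0. v0 \<in> Rg d \<Longrightarrow> real (card (pts d \<Lambda> v0 X)) \<le> K"
    and v: "v0 \<in> Rg d" "v1 \<in> Rg d"
  shows "\<bar>rsum d \<Lambda> v0 X - rsum d \<Lambda> v1 X\<bar> \<le> 2 * (1 + real d) * (real m)\<^sup>2 * K / X"
proof -
  define F where "F v = rsum d \<Lambda> v X" for v
  have Fcong: "F u = F v" if "u - v \<in> \<Lambda>" for u v unfolding F_def using rsum_cong_class[OF \<Lambda>(1) that] .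
  have "F ` Rg d = F ` resbox d m"
  proof
    show "F ` Rg d \<subseteq> F ` resbox d m"
    proof
      fix z assume "z \<in> F ` Rg d"
      then obtain v where v: "v \<in> Rg d" "z = F v" by auto
      obtain t where "t \<in> resbox d m" "v - t \<in> multiples d m" using resbox_ex1[OF d m v(1)] by blast
      thus "z \<in> F ` resbox d m" using Fcong[of v t] \<Lambda>(3) v by auto
    qed
  qed (use resbox_Rg in auto)
  \<comment> \<open>\<open>F\<close> depends only on the residue modulo \<open>m\<close>, so it
    attains a maximum.\<close>
  hence "finite (F ` Rg d)" "F ` Rg d \<noteq> {}" using resbox_finite by auto
  hence "Max (F ` Rg d) \<in> F ` Rg d" by (rule Max_in)
  then obtain u where u: "u \<in> Rg d" "F u = Max (F ` Rg d)" by auto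
  have umax: "F v \<le> F u" if "v \<in> Rg d" for v using u that \<open>finite (F ` Rg d)\<close> by simp
  have K0: "K \<ge> 0" using K[OF v(1)] by (meson of_nat_0_le_iff order_trans)
  have step: "F u - F v \<le> 2 * (1 + real d) * (real m)\<^sup>2 * K / X" if v: "v \<in> Rg d" for v
  proof -
    obtain t where t: "t \<in> resbox d m" "(v - u) - t \<in> multiples d m" using resbox_ex1[OF d m, of "v - u"] v u by blast
    have tR: "t \<in> Rg d" using t resbox_Rg by blast
    \<comment> \<open>Points that the translation pushes out of the disc only add nonpositive terms
      to the right side, while \<open>F (u + s)\<close> may have further nonnegative ones.\<close>
    have shift: "F (u + s) \<ge> (\<Sum>v\<in>pts d \<Lambda> u X. 1 - (cmod (v + s))\<^sup>2 / X)" if s: "s \<in> Rg d" for s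
    proof -
      let ?P = "{v \<in> pts d \<Lambda> u X. (cmod (v + s))\<^sup>2 \<le> X}"
      have "(\<Sum>v\<in>pts d \<Lambda> u X. 1 - (cmod (v + s))\<^sup>2 / X) = (\<Sum>v\<in>?P. 1 - (cmod (v + s))\<^sup>2 / X)
         + (\<Sum>v\<in>pts d \<Lambda> u X - ?P. 1 - (cmod (v + s))\<^sup>2 / X)"
        using sum.subset_diff[of ?P "pts d \<Lambda> u X"] finite_pts[OF d] by (simp add: add.commute)
      also have "(\<Sum>v\<in>pts d \<Lambda> u X - ?P. 1 - (cmod (v + s))\<^sup>2 / X) \<le> 0"
        using X by (intro sum_nonpos) auto
      also have "(\<Sum>v\<in>?P. 1 - (cmod (v + s))\<^sup>2 / X) = (\<Sum>v\<in>(\<lambda>v. v + s) ` ?P. 1 - (cmod v)\<^sup>2 / X)"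
        by (subst sum.reindex) (auto simp: inj_on_def)
      also have "\<dots> \<le> F (u + s)"
        unfolding F_def rsum_def
      proof (rule sum_mono2[OF finite_pts[OF d]])
        show "(\<lambda>v. v + s) ` ?P \<subseteq> pts d \<Lambda> (u + s) X" using s by (auto simp: pts_def)
      qed (use X in \<open>auto simp: pts_def\<close>)
      finally show ?thesis by simp
    qed
    have "2 * F u - 2 * (cmod t)\<^sup>2 / X * real (card (pts d \<Lambda> u X))
       = (\<Sum>v\<in>pts d \<Lambda> u X. 1 - (cmod (v + t))\<^sup>2 / X) + (\<Sum>v\<in>pts d \<Lambda> u X. 1 - (cmod (v + - t))\<^sup>2 / X)"
    proof -
      have pl: "(1 - (cmod (v + t))\<^sup>2 / X) + (1 - (cmod (v + - t))\<^sup>2 / X) = 2 * (1 - (cmod v)\<^sup>2 / X) - 2 * (cmod t)\<^sup>2 / X" for v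
      proof -
        have "(cmod (v + t))\<^sup>2 + (cmod (v + - t))\<^sup>2 = 2 * (cmod v)\<^sup>2 + 2 * (cmod t)\<^sup>2"
          by (simp only: cmod_power2) (simp add: power2_eq_square algebra_simps)
        hence "(cmod (v + t))\<^sup>2 / X + (cmod (v + - t))\<^sup>2 / X = 2 * ((cmod v)\<^sup>2 / X) + 2 * (cmod t)\<^sup>2 / X"
          by (simp only: add_divide_distrib[symmetric]) (simp add: add_divide_distrib)
        thus ?thesis by simp
      qed
      show ?thesis unfolding sum.distrib[symmetric] pl
        by (simp add: F_def rsum_def sum_subtractf sum_distrib_left)
    qed
    also have "\<dots> \<le> F (u + t) + F (u + - t)" by (intro add_mono shift) (use tR in auto)
    \<comment> \<open>Maximality disposes of the backward translate; the forward one is the coset of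
      \<open>v\<close>.\<close>
    also have "F (u + - t) \<le> F u" using umax u tR by auto
    also have "F (u + t) = F v"
      using Fcong[of v "u + t"] t(2) \<Lambda>(3) by (auto simp: algebra_simps)
    finally have "F u - F v \<le> 2 * (cmod t)\<^sup>2 / X * real (card (pts d \<Lambda> u X))" by simp
    also have "\<dots> \<le> 2 * ((1 + real d) * (real m)\<^sup>2) / X * K"
      using resbox_norm[OF t(1)] K[OF u(1)] X K0 by (intro mult_mono divide_right_mono) auto
    also have "\<dots> = 2 * (1 + real d) * (real m)\<^sup>2 * K / X" by (simp add: algebra_simps)
    finally show ?thesis .
  qed
  show ?thesis using step[OF v(1)] step[OF v(2)] umax[OF v(1)] umax[OF v(2)] by (simp add: F_def abs_le_iff)
qed

lemma rsum_split:
  assumes d: "d > 0" and T: "finite T" "T \<subseteq> \<Lambda>" and \<Lambda>: "add_subgroup \<Lambda>" "\<Lambda>' \<subseteq> \<Lambda>"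
    and ex1: "\<And>v. v \<in> \<Lambda> \<Longrightarrow> \<exists>!t. t \<in> T \<and> v - t \<in> \<Lambda>'"
  shows "rsum d \<Lambda> v0 X = (\<Sum>t\<in>T. rsum d \<Lambda>' (v0 + t) X)"
proof -
  have "pts d \<Lambda> v0 X = (\<Union>t\<in>T. pts d \<Lambda>' (v0 + t) X)"
  proof (rule Set.set_eqI, rule iffI)
    fix v assume "v \<in> pts d \<Lambda> v0 X"
    thus "v \<in> (\<Union>t\<in>T. pts d \<Lambda>' (v0 + t) X)" using ex1[of "v - v0"] by (auto simp: pts_def diff_diff_eq)
  next
    fix v assume "v \<in> (\<Union>t\<in>T. pts d \<Lambda>' (v0 + t) X)"
    then obtain t where t: "t \<in> T" "v \<in> Rg d" "v - (v0 + t) \<in> \<Lambda>'" "(cmod v)\<^sup>2 \<le> X" by (auto simp: pts_def)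
    have "(v - (v0 + t)) + t \<in> \<Lambda>" by (rule add_subgroupD(4)[OF \<Lambda>(1)]) (use t T \<Lambda> in auto)
    thus "v \<in> pts d \<Lambda> v0 X" using t by (simp add: pts_def)
  qed
  moreover have "(\<Union>t\<in>T. pts d \<Lambda>' (v0 + t) X) = (\<Union>t\<in>T. pts d \<Lambda>' (v0 + t) X)" ..
  moreover have "pts d \<Lambda>' (v0 + s) X \<inter> pts d \<Lambda>' (v0 + t) X = {}" if st: "s \<in> T" "t \<in> T" "s \<noteq> t" for s t
  proof (rule ccontr)
    assume "pts d \<Lambda>' (v0 + s) X \<inter> pts d \<Lambda>' (v0 + t) X \<noteq> {}"
    then obtain v where v: "(v - v0) - s \<in> \<Lambda>'" "(v - v0) - t \<in> \<Lambda>'" by (auto simp: pts_def diff_diff_eq)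
    have "((v - v0) - s) + s \<in> \<Lambda>" by (rule add_subgroupD(4)[OF \<Lambda>(1)]) (use v st T \<Lambda> in auto)
    hence "v - v0 \<in> \<Lambda>" by simp
    from ex1[OF this] show False using v st by blast
  qed
  ultimately show ?thesis
    unfolding rsum_def using T finite_pts[OF d] by (simp add: sum.UNION_disjoint)
qed

section \<open>The linear asymptotics over the whole lattice\<close>

definition Gtot :: "nat \<Rightarrow> real \<Rightarrow> real" where "Gtot d X = rsum d (Rg d) 0 X"

text \<open>The bound is free of \<open>m\<close> and \<open>X\<close>: for
  \<open>X \<ge> m^2\<close> a coset has at most \<open>9 * X / m^2\<close> points, which cancels
  the factor \<open>m^2 / X\<close> of the oscillation estimate, and for smaller \<open>X\<close> it
  has at most 9 points.\<close>

lemma rsum_multiples_osc: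
  assumes d: "d > 0" and m: "m \<ge> 1" and X: "X > 0" and v: "v0 \<in> Rg d" "v1 \<in> Rg d"
  shows "\<bar>rsum d (multiples d m) v0 X - rsum d (multiples d m) v1 X\<bar> \<le> 18 * (1 + real d)"
proof (cases "X \<ge> (real m)\<^sup>2")
  case True
  have sX: "sqrt X / m \<ge> 1" using real_le_rsqrt[OF True] m by simp
  have "real (card (pts d (multiples d m) v X)) \<le> 9 * X / (real m)\<^sup>2" if "v \<in> Rg d" for v
  proof -
    have "real (card (pts d (multiples d m) v X)) \<le> (2 * sqrt X / m + 1)\<^sup>2"
      using pts_bound[OF d m _ that, of X] X by simp
    also have "\<dots> \<le> (3 * (sqrt X / m))\<^sup>2" using sX by (intro power_mono) auto
    also have "\<dots> = 9 * X / (real m)\<^sup>2" using X by (simp add: power_mult_distrib power_divide)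
    finally show ?thesis .
  qed
  from rsum_oscillation[OF d m add_subgroup_multiples multiples_subset order_refl X this v]
  show ?thesis using m X by simp
next
  case False
  have "real (card (pts d (multiples d m) v X)) \<le> 9" if "v \<in> Rg d" for v
  proof -
    have "sqrt X \<le> m" using False by (intro real_le_lsqrt) (use X in auto)
    hence s1: "sqrt X / m \<le> 1" "sqrt X / m \<ge> 0" using m X by auto
    have "real (card (pts d (multiples d m) v X)) \<le> (2 * sqrt X / m + 1)\<^sup>2"
      using pts_bound[OF d m _ that, of X] X by simp
    also have "\<dots> \<le> 3\<^sup>2" using s1 by (intro power_mono) auto
    finally show ?thesis by simp
  qed
  hence "rsum d (multiples d m) v X \<le> 9" if "v \<in> Rg d" for v
    using rsum_le_card[OF X] that order_trans by blast
  from this[OF v(1)] this[OF v(2)]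
  have "\<bar>rsum d (multiples d m) v0 X - rsum d (multiples d m) v1 X\<bar> \<le> 9"
    using rsum_nonneg[of d "multiples d m" v0 X] rsum_nonneg[of d "multiples d m" v1 X] by linarith
  thus ?thesis by simp
qed

lemma rsum_scale:
  assumes d: "d > 0" and m: "m \<ge> 1"
  shows "rsum d (multiples d m) 0 ((real m)\<^sup>2 * X) = Gtot d X"
  unfolding Gtot_def rsum_def
proof (rule sum.reindex_bij_witness[of _ "\<lambda>v. of_nat m * v" "\<lambda>v. v / of_nat m"])
  fix v assume "v \<in> pts d (multiples d m) 0 ((real m)\<^sup>2 * X)"
  then obtain u where u: "v = of_nat m * u" "u \<in> Rg d" "(cmod v)\<^sup>2 \<le> (real m)\<^sup>2 * X" by (auto simp: pts_def multiples_def)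
  show "of_nat m * (v / of_nat m) = v" using m by simp
  show "v / of_nat m \<in> pts d (Rg d) 0 X" using u m by (simp add: pts_def norm_mult power_mult_distrib)
  show "1 - (cmod (v / of_nat m))\<^sup>2 / X = 1 - (cmod v)\<^sup>2 / ((real m)\<^sup>2 * X)"
    using m by (simp add: norm_divide power_divide)
next
  fix v assume "v \<in> pts d (Rg d) 0 X"
  thus "of_nat m * v / of_nat m = v" "of_nat m * v \<in> pts d (multiples d m) 0 ((real m)\<^sup>2 * X)"
    using m by (auto simp: pts_def multiples_def norm_mult power_mult_distrib)
qed

lemma Gtot_multiples:
  assumes d: "d > 0" and m: "m \<ge> 1" and X: "X > 0" and v: "v \<in> Rg d"
  shows "\<bar>Gtot d X - (real m)\<^sup>2 * rsum d (multiples d m) v X\<bar> \<le> (real m)\<^sup>2 * (18 * (1 + real d))"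
proof -
  have "Gtot d X = (\<Sum>t\<in>resbox d m. rsum d (multiples d m) (0 + t) X)"
    unfolding Gtot_def by (intro rsum_split) (use d resbox_finite resbox_Rg add_subgroup_Rg multiples_subset resbox_ex1[OF d m] in auto)
  hence "Gtot d X - (real m)\<^sup>2 * rsum d (multiples d m) v X
     = (\<Sum>t\<in>resbox d m. rsum d (multiples d m) t X - rsum d (multiples d m) v X)"
    using resbox_card[OF d, of m] by (simp add: sum_subtractf)
  also have "\<bar>\<dots>\<bar> \<le> (\<Sum>t\<in>resbox d m. 18 * (1 + real d))"
    by (rule order.trans[OF sum_abs sum_mono], rule rsum_multiples_osc[OF d m X]) (use v resbox_Rg in auto)
  also have "\<dots> = (real m)\<^sup>2 * (18 * (1 + real d))" using resbox_card[OF d, of m] by simp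
  finally show ?thesis .
qed

lemma Gtot_mono:
  assumes d: "d > 0" and "0 < X" "X \<le> Y" shows "Gtot d X \<le> Gtot d Y"
proof -
  have "Gtot d X \<le> (\<Sum>v\<in>pts d (Rg d) 0 X. 1 - (cmod v)\<^sup>2 / Y)"
    unfolding Gtot_def rsum_def using assms by (intro sum_mono) (auto intro: divide_left_mono)
  also have "\<dots> \<le> Gtot d Y"
    unfolding Gtot_def rsum_def
    by (rule sum_mono2[OF finite_pts[OF d]]) (use assms in \<open>auto simp: pts_def\<close>)
  finally show ?thesis .
qed

text \<open>Dilation by \<open>m\<close> carries the lattice to \<open>multiples d m\<close>, and
  the sum over this sublattice is an equal share of the full sum up to a bounded error.\<close>

lemma Gtot_scale:
  assumes d: "d > 0" and m: "m \<ge> 1" and X: "X > 0"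
  shows "\<bar>Gtot d ((real m)\<^sup>2 * X) - (real m)\<^sup>2 * Gtot d X\<bar> \<le> (real m)\<^sup>2 * (18 * (1 + real d))"
  using Gtot_multiples[OF d m, of "(real m)\<^sup>2 * X" 0] rsum_scale[OF d m, of X] m X by simp

text \<open>\<open>Gtot_scale\<close> compares dilations with square factors only. So
  \<open>Y / X\<close> is approximated from above by \<open>(m / n)^2\<close>, monotonicity compares
  the dilates of \<open>X\<close> and \<open>Y\<close>, and \<open>n\<close> goes to
  infinity.\<close>

lemma Gtot_ratio:
  assumes d: "d > 0" and X: "X > 0" and Y: "Y > 0"
  defines "C \<equiv> 18 * (1 + real d)"
  shows "Gtot d Y / Y - C / Y \<le> Gtot d X / X + C / X"
proof -
  have sc: "\<bar>Gtot d ((real m)\<^sup>2 * X) / ((real m)\<^sup>2 * X) - Gtot d X / X\<bar> \<le> C / X" if "m \<ge> 1" "X > 0" for m X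
  proof -
    have "Gtot d ((real m)\<^sup>2 * X) / ((real m)\<^sup>2 * X) - Gtot d X / X
       = (Gtot d ((real m)\<^sup>2 * X) - (real m)\<^sup>2 * Gtot d X) / ((real m)\<^sup>2 * X)"
      using that by (simp add: field_simps)
    also have "\<bar>\<dots>\<bar> = \<bar>Gtot d ((real m)\<^sup>2 * X) - (real m)\<^sup>2 * Gtot d X\<bar> / ((real m)\<^sup>2 * X)"
      using that by (simp add: abs_mult)
    also have "\<dots> \<le> (real m)\<^sup>2 * C / ((real m)\<^sup>2 * X)"
      unfolding C_def using Gtot_scale[OF d that] that by (intro divide_right_mono) auto
    also have "\<dots> = C / X" using that by simp
    finally show ?thesis .
  qed
  have G0: "Gtot d X / X + C / X \<ge> 0" using X rsum_nonneg[of d "Rg d" 0 X] by (simp add: C_def Gtot_def)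
  have bd: "Gtot d Y / Y - C / Y \<le> (Gtot d X / X + C / X) * (1 + sqrt (X / Y) / real n)\<^sup>2" if n: "n \<ge> 1" for n
  proof -
    define m where "m = nat \<lceil>real n * sqrt (Y / X)\<rceil>"
    have pos: "real n * sqrt (Y / X) > 0" using n X Y by simp
    have m: "real n * sqrt (Y / X) \<le> real m" "real m < real n * sqrt (Y / X) + 1" "m \<ge> 1"
      using pos unfolding m_def by (linarith | simp)+
    have "(real n * sqrt (Y / X))\<^sup>2 \<le> (real m)\<^sup>2" using m pos by (intro power_mono) auto
    hence le: "(real n)\<^sup>2 * Y \<le> (real m)\<^sup>2 * X" using X Y by (simp add: power_mult_distrib field_simps)
    have "(real m)\<^sup>2 \<le> (real n * sqrt (Y / X) + 1)\<^sup>2" using m by (intro power_mono) auto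
    also have "\<dots> = ((real n * sqrt (Y / X)) * (1 + sqrt (X / Y) / real n))\<^sup>2"
    proof -
      have "sqrt (Y / X) * sqrt (X / Y) = 1" using X Y by (simp flip: real_sqrt_mult)
      thus ?thesis using n by (simp add: distrib_left)
    qed
    also have "\<dots> = (real n)\<^sup>2 * Y / X * (1 + sqrt (X / Y) / real n)\<^sup>2"
      using X Y by (simp add: power_mult_distrib)
    finally have m2: "(real m)\<^sup>2 * X / ((real n)\<^sup>2 * Y) \<le> (1 + sqrt (X / Y) / real n)\<^sup>2"
      using X Y n by (simp add: field_simps)
    have "Gtot d Y / Y - C / Y \<le> Gtot d ((real n)\<^sup>2 * Y) / ((real n)\<^sup>2 * Y)"
      using abs_le_D2[OF sc[OF n Y]] by argo
    also have "\<dots> \<le> Gtot d ((real m)\<^sup>2 * X) / ((real n)\<^sup>2 * Y)"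
      using Gtot_mono[OF d _ le] n Y by (intro divide_right_mono) auto
    also have "\<dots> = Gtot d ((real m)\<^sup>2 * X) / ((real m)\<^sup>2 * X) * ((real m)\<^sup>2 * X / ((real n)\<^sup>2 * Y))"
      using m X by simp
    also have "\<dots> \<le> (Gtot d X / X + C / X) * ((real m)\<^sup>2 * X / ((real n)\<^sup>2 * Y))"
      using sc[OF m(3) X] X Y by (intro mult_right_mono) auto
    also have "\<dots> \<le> (Gtot d X / X + C / X) * (1 + sqrt (X / Y) / real n)\<^sup>2"
      by (rule mult_left_mono[OF m2 G0])
    finally show ?thesis .
  qed
  have "(\<lambda>n. (Gtot d X / X + C / X) * (1 + sqrt (X / Y) / real n)\<^sup>2) \<longlonglongrightarrow> (Gtot d X / X + C / X) * (1 + 0)\<^sup>2"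
    by (intro tendsto_intros lim_const_over_n)
  hence "Gtot d Y / Y - C / Y \<le> (Gtot d X / X + C / X) * (1 + 0)\<^sup>2"
    by (rule tendsto_lowerbound) (auto simp: eventually_sequentially intro!: exI[of _ 1] bd)
  thus ?thesis by simp
qed

text \<open>By \<open>Gtot_ratio\<close> the quotients \<open>Gtot d X / X\<close> are Cauchy with
  error \<open>C / X\<close>; the density is their limit and does not come from an area
  computation.\<close>

lemma Gtot_asymp:
  assumes d: "d > 0"
  shows "\<exists>c>0. \<forall>X>0. \<bar>Gtot d X - c * X\<bar> \<le> 18 * (1 + real d)"
proof -
  define C where "C = 18 * (1 + real d)"
  define \<phi> where "\<phi> X = Gtot d X / X" for X
  have osc: "\<bar>\<phi> X - \<phi> Y\<bar> \<le> C / X + C / Y" if "X > 0" "Y > 0" for X Y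
    using Gtot_ratio[OF d that] Gtot_ratio[OF d that(2,1)] by (simp add: \<phi>_def C_def abs_le_iff)
  have Cn: "(\<lambda>n. C / real n) \<longlonglongrightarrow> 0" by (rule lim_const_over_n)
  have "Cauchy (\<lambda>n. \<phi> (real n))"
  proof (rule CauchyI)
    fix e :: real assume "e > 0"
    hence "\<forall>\<^sub>F n in sequentially. C / real n < e / 2" using Cn by (intro order_tendstoD(2)) auto
    then obtain n0 where n0: "\<And>n. n \<ge> n0 \<Longrightarrow> C / real n < e / 2" by (auto simp: eventually_sequentially)
    have "norm (\<phi> (real m) - \<phi> (real n)) < e" if "m \<ge> max 1 n0" "n \<ge> max 1 n0" for m n
    proof -
      have "C / real m < e / 2" "C / real n < e / 2" using n0 that by simp_all
      moreover have "\<bar>\<phi> (real m) - \<phi> (real n)\<bar> \<le> C / real m + C / real n" using that by (intro osc) auto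
      ultimately show ?thesis unfolding real_norm_def by linarith
    qed
    thus "\<exists>M. \<forall>m\<ge>M. \<forall>n\<ge>M. norm (\<phi> (real m) - \<phi> (real n)) < e" by blast
  qed
  then obtain c where c: "(\<lambda>n. \<phi> (real n)) \<longlonglongrightarrow> c" using Cauchy_convergent_iff convergent_def by blast
  have dev: "\<bar>\<phi> X - c\<bar> \<le> C / X" if "X > 0" for X
  proof -
    have "(\<lambda>n. \<bar>\<phi> X - \<phi> (real n)\<bar> - C / real n) \<longlonglongrightarrow> \<bar>\<phi> X - c\<bar> - 0" by (intro tendsto_intros c Cn)
    moreover have "\<forall>\<^sub>F n in sequentially. \<bar>\<phi> X - \<phi> (real n)\<bar> - C / real n \<le> C / X"
      using eventually_gt_at_top[of 0]
    proof eventually_elim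
      case (elim n)
      thus ?case using osc[OF that, of "real n"] by simp
    qed
    ultimately show ?thesis by (auto dest: tendsto_upperbound)
  qed
  have "c \<ge> 1 / (4 * (1 + real d))"
  proof -
    \<comment> \<open>With this radius every point of \<open>resbox d k\<close> satisfies
      \<open>(cmod v)^2 \<le> X k / 2\<close>. Each of the \<open>k^2\<close> points then
      contributes at least 1/2, which keeps the density away from 0.\<close>
    define X where "X k = 2 * (1 + real d) * (real k)\<^sup>2" for k
    have "1 / (4 * (1 + real d)) - C / X k \<le> c" if k: "k \<ge> 1" for k
    proof -
      have X0: "X k > 0" using k by (simp add: X_def)
      have v: "(cmod v)\<^sup>2 \<le> X k / 2" if "v \<in> resbox d k" for v
      proof -
        have "X k / 2 = (1 + real d) * (real k)\<^sup>2" by (simp add: X_def mult.assoc del: mult_numeral_left_semiring_numeral distrib_left_numeral distrib_right_numeral)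
        thus ?thesis using resbox_norm[OF that] by simp
      qed
      have "(real k)\<^sup>2 / 2 = (\<Sum>v\<in>resbox d k. 1 / 2)" by (simp add: resbox_card[OF d])
      also have "\<dots> \<le> (\<Sum>v\<in>resbox d k. 1 - (cmod v)\<^sup>2 / X k)"
      proof (rule sum_mono)
        fix u assume "u \<in> resbox d k"
        from v[OF this] show "1 / 2 \<le> 1 - (cmod u)\<^sup>2 / X k" using X0 by (simp add: field_simps)
      qed
      also have "\<dots> \<le> Gtot d (X k)"
        unfolding Gtot_def rsum_def
      proof (rule sum_mono2[OF finite_pts[OF d]])
        show "resbox d k \<subseteq> pts d (Rg d) 0 (X k)" using v X0 resbox_Rg[of d k] by (fastforce simp: pts_def)
      qed (use X0 in \<open>auto simp: pts_def\<close>)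
      finally have "(real k)\<^sup>2 / 2 / X k \<le> \<phi> (X k)" unfolding \<phi>_def using X0 by (intro divide_right_mono) auto
      moreover have "(real k)\<^sup>2 / 2 / X k = 1 / (4 * (1 + real d))" using k by (simp add: X_def)
      ultimately show ?thesis using dev[OF X0] by linarith
    qed
    moreover have "(\<lambda>k. 1 / (4 * (1 + real d)) - C / X k) \<longlonglongrightarrow> 1 / (4 * (1 + real d)) - 0"
      unfolding X_def by real_asymp
    moreover have "\<forall>\<^sub>F k in sequentially. 1 / (4 * (1 + real d)) - C / X k \<le> c"
      using eventually_ge_at_top[of 1] by eventually_elim (rule calculation(1))
    ultimately show ?thesis by (auto dest: tendsto_upperbound)
  qed
  moreover have "1 / (4 * (1 + real d)) > 0" by simp
  ultimately have "c > 0" by linarith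
  moreover have "\<bar>Gtot d X - c * X\<bar> \<le> C" if X: "X > 0" for X
  proof -
    have "Gtot d X - c * X = (\<phi> X - c) * X" using X by (simp add: \<phi>_def field_simps)
    hence "\<bar>Gtot d X - c * X\<bar> = \<bar>\<phi> X - c\<bar> * X" using X by (simp add: abs_mult)
    also have "\<dots> \<le> C / X * X" using dev[OF X] X by (intro mult_right_mono) auto
    finally show ?thesis using X by simp
  qed
  ultimately show ?thesis by (auto simp: C_def)
qed

section \<open>Norms of elements of the quadratic order\<close>

definition nq :: "complex \<Rightarrow> nat" where "nq v = nat \<lfloor>(cmod v)\<^sup>2\<rfloor>"

lemma nq_emb: "int (nq (emb d x y)) = x\<^sup>2 + int d * y\<^sup>2"
  by (simp only: nq_def norm_emb floor_of_int) simp

lemma real_nq: "v \<in> Rg d \<Longrightarrow> real (nq v) = (cmod v)\<^sup>2"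
proof (elim Rg_cases)
  fix x y assume v: "v = emb d x y"
  have "real (nq v) = of_int (int (nq v))" by simp
  also have "\<dots> = (cmod v)\<^sup>2" unfolding v nq_emb norm_emb ..
  finally show ?thesis .
qed

lemma mult_cnj_nq: "v \<in> Rg d \<Longrightarrow> v * cnj v = of_nat (nq v)"
  using real_nq[of v d] by (metis complex_norm_square of_real_of_nat_eq)

lemma nq_mult: "u \<in> Rg d \<Longrightarrow> v \<in> Rg d \<Longrightarrow> nq (u * v) = nq u * nq v"
proof -
  assume uv: "u \<in> Rg d" "v \<in> Rg d"
  have "real (nq (u * v)) = real (nq u * nq v)"
    using uv by (simp add: real_nq[of _ d] norm_mult power_mult_distrib)
  thus ?thesis by (simp only: of_nat_eq_iff)
qed

lemma nq_pos: "v \<in> Rg d \<Longrightarrow> v \<noteq> 0 \<Longrightarrow> nq v > 0"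
proof -
  assume v: "v \<in> Rg d" "v \<noteq> 0"
  have "real (nq v) > 0" unfolding real_nq[OF v(1)] using v(2) by simp
  thus ?thesis by simp
qed

lemma nq_of_nat: "nq (of_nat n) = n\<^sup>2"
proof -
  have "real (nq (of_nat n)) = real (n\<^sup>2)" using real_nq[of "of_nat n" 0] by simp
  thus ?thesis by (simp only: of_nat_eq_iff)
qed

section \<open>Valuations on the quadratic order\<close>

lemma multiples_mult: "u \<in> Rg d \<Longrightarrow> v \<in> multiples d m \<Longrightarrow> u * v \<in> multiples d m"
proof -
  assume u: "u \<in> Rg d" and "v \<in> multiples d m"
  then obtain a where a: "a \<in> Rg d" "v = of_nat m * a" by (auto simp: multiples_def)
  have "u * v = of_nat m * (u * a)" unfolding a by (rule mult.left_commute)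
  thus ?thesis using u a unfolding multiples_def by blast
qed

lemma multiples_add: "u \<in> multiples d m \<Longrightarrow> v \<in> multiples d m \<Longrightarrow> u + v \<in> multiples d m"
  and multiples_diff: "u \<in> multiples d m \<Longrightarrow> v \<in> multiples d m \<Longrightarrow> u - v \<in> multiples d m"
  using add_subgroupD[OF add_subgroup_multiples] by blast+

lemma multiples_times: "u \<in> multiples d m \<Longrightarrow> v \<in> multiples d n \<Longrightarrow> u * v \<in> multiples d (m * n)"
proof -
  assume "u \<in> multiples d m" "v \<in> multiples d n"
  then obtain a b where ab: "a \<in> Rg d" "b \<in> Rg d" "u = of_nat m * a" "v = of_nat n * b" by (auto simp: multiples_def)
  have "u * v = of_nat (m * n) * (a * b)" unfolding ab by simp
  thus ?thesis using ab unfolding multiples_def by blast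
qed

lemma multiples_cancel:
  assumes "m > 0" "of_nat m * v \<in> multiples d (m * n)" shows "v \<in> multiples d n"
proof -
  from assms(2) obtain u where "u \<in> Rg d" "of_nat m * v = of_nat m * (of_nat n * u)"
    by (auto simp: multiples_def mult.assoc)
  thus ?thesis using assms(1) by (auto simp: multiples_def)
qed

lemma multiples_cnj: "v \<in> multiples d m \<Longrightarrow> cnj v \<in> multiples d m"
  by (auto simp: multiples_def)

lemma multiples_uminus: "- v \<in> multiples d m \<longleftrightarrow> v \<in> multiples d m"
  using add_subgroupD(3)[OF add_subgroup_multiples] by fastforce

lemma of_nat_in_multiples:
  assumes "d > 0" shows "of_nat n \<in> multiples d m \<longleftrightarrow> m dvd n"
  using emb_in_multiples[OF assms, of "int n" 0 m] emb_of_int[of "int n" d] by simp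

text \<open>Every prime that ramifies or divides the index of \<open>Rg d\<close> in the ring of
  integers divides \<open>2 * d\<close>, so away from \<open>M\<close> the order behaves like a
  Dedekind ring. \<open>M \<ge> 3\<close> separates 1 from -1 modulo \<open>M\<close>.\<close>

locale imag_order =
  fixes d M :: nat
  assumes d_pos: "d > 0" and M_dvd: "2 * d dvd M" and M_ge3: "M \<ge> 3"
begin

text \<open>A prime \<open>(l, s)\<close> with \<open>s \<noteq> 0\<close> stands for the ideal generated by \<open>l\<close> and \<open>sq d - s\<close> above the split
  prime \<open>l\<close>, and \<open>(l, 0)\<close> for the inert prime \<open>l\<close>. Only primes not dividing \<open>M\<close> occur, so nothing ramifies.\<close>
definition Pr :: "(nat \<times> int) set" where
  "Pr = {(l, s). prime l \<and> \<not> l dvd M \<and> 2 * \<bar>s\<bar> < int l \<and>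
     (if s = 0 then (\<forall>t. \<not> int l dvd t\<^sup>2 + int d) else int l dvd s\<^sup>2 + int d)}"

definition nm :: "nat \<times> int \<Rightarrow> nat" where "nm P = (if snd P = 0 then (fst P)\<^sup>2 else fst P)"

text \<open>\<open>tau P\<close> lies in the conjugate of the prime \<open>P\<close> but not in \<open>P\<close>, so that \<open>v\<close> is divisible by the \<open>k\<close>-th
  power of \<open>P\<close> iff \<open>tau P ^ k * v\<close> is divisible by \<open>l ^ k\<close>.\<close>
definition tau :: "nat \<times> int \<Rightarrow> complex" where "tau P = (if snd P = 0 then 1 else emb d (snd P) 1)"

definition pdv :: "nat \<times> int \<Rightarrow> nat \<Rightarrow> complex \<Rightarrow> bool" where
  "pdv P k v \<longleftrightarrow> tau P ^ k * v \<in> multiples d (fst P ^ k)"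

definition inP :: "nat \<times> int \<Rightarrow> complex \<Rightarrow> bool" where
  "inP P v \<longleftrightarrow> tau P * v \<in> multiples d (fst P)"

lemma tau_Rg [simp, intro]: "tau P \<in> Rg d" by (simp add: tau_def)

lemma PrD:
  assumes "P \<in> Pr"
  shows "prime (fst P)" "\<not> fst P dvd M" "2 * \<bar>snd P\<bar> < int (fst P)" "\<not> int (fst P) dvd 2"
    "\<not> int (fst P) dvd int d" "coprime (fst P) M" "fst P > 0"
proof -
  show *: "prime (fst P)" "\<not> fst P dvd M" "2 * \<bar>snd P\<bar> < int (fst P)" using assms by (auto simp: Pr_def)
  have "2 dvd M" "d dvd M" using M_dvd dvd_trans by (metis dvd_triv_left, metis dvd_triv_right)
  thus "\<not> int (fst P) dvd 2" "\<not> int (fst P) dvd int d"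
    using *(2) by (metis dvd_trans int_dvd_int_iff of_nat_numeral, metis dvd_trans int_dvd_int_iff)
  show "coprime (fst P) M" using * by (simp add: prime_imp_coprime)
  show "fst P > 0" using *(1) prime_gt_0_nat by blast
qed

lemma split_root: "P \<in> Pr \<Longrightarrow> snd P \<noteq> 0 \<Longrightarrow> int (fst P) dvd (snd P)\<^sup>2 + int d"
  by (auto simp: Pr_def)

lemma inert_noroot: "P \<in> Pr \<Longrightarrow> snd P = 0 \<Longrightarrow> \<not> int (fst P) dvd t\<^sup>2 + int d"
  by (auto simp: Pr_def)

text \<open>Membership in \<open>P\<close> is the vanishing of the reduction modulo \<open>l\<close>
  that sends \<open>sq d\<close> to the root \<open>s\<close>.\<close>

lemma inP_split:
  assumes P: "P \<in> Pr" "snd P \<noteq> 0"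
  shows "inP P (emb d x y) \<longleftrightarrow> int (fst P) dvd x + snd P * y"
proof -
  let ?s = "snd P" and ?l = "int (fst P)"
  have "tau P * emb d x y = emb d (?s * x - int d * y) (x + ?s * y)"
    using P by (simp add: tau_def emb_mult algebra_simps)
  hence "inP P (emb d x y) \<longleftrightarrow> ?l dvd ?s * x - int d * y \<and> ?l dvd x + ?s * y"
    by (simp add: inP_def emb_in_multiples[OF d_pos])
  moreover have "?l dvd ?s * x - int d * y" if "?l dvd x + ?s * y"
  proof -
    have "?s * x - int d * y = ?s * (x + ?s * y) - (?s\<^sup>2 + int d) * y" by (simp add: algebra_simps power2_eq_square)
    thus ?thesis using that split_root[OF P] by (metis dvd_diff dvd_mult dvd_mult2)
  qed
  ultimately show ?thesis by blast
qed

lemma inP_inert: "snd P = 0 \<Longrightarrow> inP P v \<longleftrightarrow> v \<in> multiples d (fst P)"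
  by (simp add: inP_def tau_def)

lemma inP_diff: "inP P u \<Longrightarrow> inP P v \<Longrightarrow> inP P (u - v)"
  by (simp add: inP_def right_diff_distrib multiples_diff)

lemma inP_of_nat:
  assumes P: "P \<in> Pr" shows "inP P (of_nat n) \<longleftrightarrow> fst P dvd n"
proof (cases "snd P = 0")
  case True thus ?thesis by (simp add: inP_inert of_nat_in_multiples[OF d_pos])
next
  case False
  have "inP P (of_nat n) \<longleftrightarrow> inP P (emb d (int n) 0)" by (simp add: emb_def)
  thus ?thesis using inP_split[OF P False, of "int n" 0] by simp
qed

text \<open>In the split case \<open>tau P\<close> reduces to \<open>2 * s\<close>, a unit modulo
  the odd prime \<open>l\<close>.\<close>

lemma inP_tau:
  assumes P: "P \<in> Pr" shows "\<not> inP P (tau P)"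
proof (cases "snd P = 0")
  case True
  hence "\<not> inP P (of_nat 1)" using inP_of_nat[OF P, of 1] PrD[OF P] by auto
  thus ?thesis using True by (simp add: tau_def)
next
  case False
  have "\<not> int (fst P) dvd 2 * snd P"
  proof
    assume "int (fst P) dvd 2 * snd P"
    hence "int (fst P) dvd snd P" using PrD[OF P] prime_dvd_mult_iff[of "int (fst P)" 2 "snd P"] by simp
    hence "int (fst P) \<le> \<bar>snd P\<bar>" using False dvd_imp_le_int[of "snd P" "int (fst P)"] by simp
    thus False using PrD(3)[OF P] False by linarith
  qed
  thus ?thesis using inP_split[OF P False, of "snd P" 1] False by (simp add: tau_def)
qed

text \<open>For a split prime, reduction is multiplicative. For an inert one the norm decides: if
  \<open>l\<close> divides \<open>x^2 + d * y^2\<close>, then \<open>l\<close> divides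
  \<open>y\<close>, since otherwise \<open>- d\<close> would be a square modulo \<open>l\<close>,
  and hence it divides \<open>x\<close>.\<close>

lemma inP_prime:
  assumes P: "P \<in> Pr" and uv: "u \<in> Rg d" "v \<in> Rg d" and uvP: "inP P (u * v)"
  shows "inP P u \<or> inP P v"
proof -
  let ?l = "int (fst P)"
  have pl: "prime ?l" using PrD(1)[OF P] by simp
  obtain x y where u: "u = emb d x y" using uv(1) by (rule Rg_cases)
  obtain a b where v: "v = emb d a b" using uv(2) by (rule Rg_cases)
  show ?thesis
  proof (cases "snd P = 0")
    case False
    let ?s = "snd P"
    have "?l dvd (x * a - int d * (y * b)) + ?s * (x * b + y * a)"
      using uvP inP_split[OF P False] by (simp add: u v emb_mult)
    moreover have "(x + ?s * y) * (a + ?s * b) = ((x * a - int d * (y * b)) + ?s * (x * b + y * a)) + (?s\<^sup>2 + int d) * (y * b)"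
      by (simp add: algebra_simps power2_eq_square)
    ultimately have "?l dvd (x + ?s * y) * (a + ?s * b)"
      using split_root[OF P False] by (metis dvd_add dvd_mult2)
    thus ?thesis using pl inP_split[OF P False] by (simp add: u v prime_dvd_mult_iff)
  next
    case True
    have inert: "z \<in> multiples d (fst P)" if z: "z = emb d x y" and dv: "?l dvd int (nq z)" for z x y
    proof -
      have dvd: "?l dvd x\<^sup>2 + int d * y\<^sup>2" using dv unfolding z nq_emb .
      have ly: "?l dvd y"
      proof (rule ccontr)
        assume "\<not> ?l dvd y"
        hence "coprime y ?l" using pl prime_imp_coprime coprime_commute by blast
        then obtain c where "[y * c = 1] (mod ?l)" using cong_solve_coprime_int by blast
        then obtain k where k: "y * c = 1 + ?l * k" by (metis cong_iff_lin cong_sym)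
        have "(x * c)\<^sup>2 + int d = c\<^sup>2 * (x\<^sup>2 + int d * y\<^sup>2) - int d * ((y * c)\<^sup>2 - 1)"
          by (simp add: algebra_simps power2_eq_square)
        moreover have "(y * c)\<^sup>2 - 1 = ?l * (k * (2 + ?l * k))"
          unfolding k by (simp add: algebra_simps power2_eq_square)
        ultimately have "?l dvd (x * c)\<^sup>2 + int d" using dvd by (metis dvd_diff dvd_mult dvd_triv_left)
        thus False using inert_noroot[OF P True] by blast
      qed
      hence "?l dvd int d * y\<^sup>2" by (simp add: power2_eq_square)
      hence "?l dvd x\<^sup>2" using dvd by (metis dvd_add_left_iff)
      hence "?l dvd x" using pl prime_dvd_power by blast
      thus ?thesis using ly by (simp add: z emb_in_multiples[OF d_pos])
    qed
    from uvP True have "u * v \<in> multiples d (fst P)" by (simp add: inP_inert)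
    then obtain z where z: "z \<in> Rg d" "u * v = of_nat (fst P) * z" by (auto simp: multiples_def)
    have "nq u * nq v = (fst P)\<^sup>2 * nq z" using uv z by (metis Rg_of_nat nq_mult nq_of_nat)
    hence "fst P dvd nq u * nq v" by (simp add: power2_eq_square)
    hence "fst P dvd nq u \<or> fst P dvd nq v" using PrD(1)[OF P] prime_dvd_mult_iff by blast
    thus ?thesis using inert[OF u] inert[OF v] True by (auto simp: inP_inert)
  qed
qed

lemma inP_power: "P \<in> Pr \<Longrightarrow> u \<in> Rg d \<Longrightarrow> \<not> inP P u \<Longrightarrow> \<not> inP P (u ^ k)"
proof (induction k)
  case 0
  have "\<not> inP P (of_nat 1)" using 0 inP_of_nat[of P 1] PrD[of P] by auto
  thus ?case by simp
next
  case (Suc k) thus ?case using inP_prime[of P u "u ^ k"] by auto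
qed

lemma pdv_0 [simp]: "v \<in> Rg d \<Longrightarrow> pdv P 0 v" 
  by (simp add: pdv_def multiples_1 del: One_nat_def)

lemma pdv_mult: "u \<in> Rg d \<Longrightarrow> pdv P k v \<Longrightarrow> pdv P k (u * v)"
  unfolding pdv_def mult.left_commute[of _ u] by (rule multiples_mult)

lemma pdv_diff: "pdv P k u \<Longrightarrow> pdv P k v \<Longrightarrow> pdv P k (u - v)"
  by (simp add: pdv_def right_diff_distrib multiples_diff)

lemma pdv_decomp:
  assumes "pdv P k v" obtains u where "u \<in> Rg d" "tau P ^ k * v = of_nat (fst P ^ k) * u"
  using assms by (auto simp: pdv_def multiples_def)

lemma pdv_Suc:
  assumes eq: "tau P ^ k * v = of_nat (fst P ^ k) * u" and u: "inP P u"
  shows "pdv P (Suc k) v"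
proof -
  have "tau P ^ Suc k * v = tau P * (tau P ^ k * v)" by (simp add: mult.assoc)
  also have "\<dots> = of_nat (fst P ^ k) * (tau P * u)" unfolding eq by (rule mult.left_commute)
  also have "\<dots> \<in> multiples d (fst P ^ k * fst P)"
    using u by (auto simp: inP_def multiples_def mult.assoc)
  finally show ?thesis by (simp add: pdv_def mult.commute)
qed

text \<open>After cancelling \<open>l^k\<close> there remains a power of \<open>tau P\<close> times
  \<open>u\<close>, and both lie outside the prime ideal \<open>P\<close>.\<close>

lemma not_pdv_beyond:
  assumes P: "P \<in> Pr" and u: "u \<in> Rg d" "\<not> inP P u" and eq: "tau P ^ k * v = of_nat (fst P ^ k) * u" and j: "j > k"
  shows "\<not> pdv P j v"
proof
  assume "pdv P j v"
  hence "tau P ^ j * v \<in> multiples d (fst P ^ j)" by (simp add: pdv_def)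
  moreover have "tau P ^ j * v = of_nat (fst P ^ k) * (tau P ^ (j - k) * u)"
  proof -
    have "tau P ^ j = tau P ^ (j - k) * tau P ^ k" using j by (simp flip: power_add)
    thus ?thesis using eq by (simp add: mult_ac)
  qed
  moreover have "fst P ^ j = fst P ^ k * fst P ^ (j - k)" using j by (simp flip: power_add)
  ultimately have "tau P ^ (j - k) * u \<in> multiples d (fst P ^ (j - k))"
    using PrD(7)[OF P] by (metis multiples_cancel zero_less_power)
  moreover obtain i where i: "j - k = Suc i" using j by (metis Suc_diff_Suc)
  ultimately have "tau P * (tau P ^ i * u) \<in> multiples d (fst P)" by (auto simp: multiples_def mult.assoc)
  hence "inP P (tau P ^ i * u)" by (simp add: inP_def)
  thus False using inP_prime[OF P _ u(1), of "tau P ^ i"] inP_power[OF P tau_Rg inP_tau[OF P]] u(2) by auto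
qed

text \<open>Multiplication by the conjugate reduces the claim to the integer \<open>nq v\<close>,
  where divisibility by the \<open>k\<close>-th power of \<open>P\<close> is divisibility by
  \<open>l^k\<close>.\<close>

lemma pdv_bounded:
  assumes P: "P \<in> Pr" and v: "v \<in> Rg d" "v \<noteq> 0" and k: "pdv P k v"
  shows "fst P ^ k dvd nq v"
proof -
  let ?l = "fst P"
  have n0: "nq v \<noteq> 0" using nq_pos[OF v] by simp
  let ?j = "multiplicity ?l (nq v)"
  have "\<not> is_unit ?l" using PrD(1)[OF P] not_prime_unit by blast
  then obtain n' where n': "nq v = ?l ^ ?j * n'" "\<not> ?l dvd n'"
    using multiplicity_decompose'[OF n0] by blast
  have "pdv P k (cnj v * v)" using v k by (intro pdv_mult) auto
  moreover have "cnj v * v = of_nat (nq v)" using mult_cnj_nq[OF v(1)] by (simp add: mult.commute)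
  ultimately have m: "pdv P k (of_nat (nq v))" by simp
  have "\<not> inP P (tau P ^ ?j * of_nat n')"
    using inP_prime[OF P, of "tau P ^ ?j" "of_nat n'"] inP_power[OF P tau_Rg inP_tau[OF P]] inP_of_nat[OF P] n'(2) by auto
  moreover have "tau P ^ ?j * of_nat (nq v) = of_nat (?l ^ ?j) * (tau P ^ ?j * of_nat n')"
    unfolding mult.left_commute[of "of_nat (?l ^ ?j)"] of_nat_mult[symmetric] n'(1)[symmetric] ..
  ultimately have "k \<le> ?j" using not_pdv_beyond[OF P, of "tau P ^ ?j * of_nat n'" ?j "of_nat (nq v)" k] m
    by (meson Rg_mult Rg_of_nat Rg_power not_le tau_Rg)
  thus ?thesis by (rule multiplicity_dvd')
qed

text \<open>At \<open>v = 0\<close> every \<open>pdv\<close> holds and the value is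
  meaningless.\<close>

definition val :: "nat \<times> int \<Rightarrow> complex \<Rightarrow> nat" where "val P v = (LEAST k. \<not> pdv P (Suc k) v)"

lemma val_spec:
  assumes P: "P \<in> Pr" and v: "v \<in> Rg d" "v \<noteq> 0"
  shows "pdv P j v \<longleftrightarrow> j \<le> val P v"
proof -
  have "\<exists>k. \<not> pdv P (Suc k) v"
  proof (rule ccontr)
    assume "\<nexists>k. \<not> pdv P (Suc k) v"
    hence "fst P ^ Suc (nq v) dvd nq v" using pdv_bounded[OF P v] by blast
    hence "fst P ^ Suc (nq v) \<le> nq v" using nq_pos[OF v] by (rule dvd_imp_le)
    moreover have "Suc (nq v) < fst P ^ Suc (nq v)" using prime_gt_1_nat[OF PrD(1)[OF P]] by (metis One_nat_def power_gt_expt)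
    ultimately show False by linarith
  qed
  hence not: "\<not> pdv P (Suc (val P v)) v" unfolding val_def by (rule LeastI_ex)
  have low: "pdv P j v" if "j \<le> val P v" for j
  proof (cases j)
    case (Suc i)
    hence "i < val P v" using that by simp
    thus ?thesis unfolding Suc val_def using not_less_Least by blast
  qed (use v in simp)
  from pdv_decomp[OF low[OF order_refl]] obtain u
    where u: "u \<in> Rg d" "tau P ^ val P v * v = of_nat (fst P ^ val P v) * u" by blast
  have "\<not> inP P u"
  proof
    assume "inP P u"
    hence "pdv P (Suc (val P v)) v" by (rule pdv_Suc[OF u(2)])
    thus False using not by blast
  qed
  from not_pdv_beyond[OF P u(1) this u(2)] show ?thesis using low not_le by blast
qed

lemma val_eqI:
  assumes P: "P \<in> Pr" and v: "v \<in> Rg d" "v \<noteq> 0" and u: "u \<in> Rg d" "\<not> inP P u"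
    and eq: "tau P ^ k * v = of_nat (fst P ^ k) * u"
  shows "val P v = k"
proof -
  have "pdv P k v" using u eq by (auto simp: pdv_def multiples_def)
  moreover have "\<not> pdv P (Suc k) v" by (rule not_pdv_beyond[OF P u eq]) simp
  ultimately show ?thesis using val_spec[OF P v] by (metis le_antisym not_less_eq_eq)
qed

lemma val_decomp:
  assumes P: "P \<in> Pr" and v: "v \<in> Rg d" "v \<noteq> 0"
  obtains u where "u \<in> Rg d" "\<not> inP P u" "tau P ^ val P v * v = of_nat (fst P ^ val P v) * u"
proof -
  have "pdv P (val P v) v" using val_spec[OF P v] by blast
  from pdv_decomp[OF this] obtain u where u: "u \<in> Rg d" "tau P ^ val P v * v = of_nat (fst P ^ val P v) * u" by blast
  have "\<not> inP P u"
  proof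
    assume "inP P u"
    hence "pdv P (Suc (val P v)) v" by (rule pdv_Suc[OF u(2)])
    thus False using val_spec[OF P v] by (metis Suc_n_not_le_n)
  qed
  thus ?thesis using that u by blast
qed

text \<open>\<open>val_decomp\<close> gives each factor a cofactor outside \<open>P\<close>; the
  product of the cofactors is outside \<open>P\<close> by primality.\<close>

lemma val_mult:
  assumes P: "P \<in> Pr" and u: "u \<in> Rg d" "u \<noteq> 0" and v: "v \<in> Rg d" "v \<noteq> 0"
  shows "val P (u * v) = val P u + val P v"
proof -
  obtain a where a: "a \<in> Rg d" "\<not> inP P a" "tau P ^ val P u * u = of_nat (fst P ^ val P u) * a" by (rule val_decomp[OF P u])
  obtain b where b: "b \<in> Rg d" "\<not> inP P b" "tau P ^ val P v * v = of_nat (fst P ^ val P v) * b" by (rule val_decomp[OF P v])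
  have "tau P ^ (val P u + val P v) * (u * v) = (tau P ^ val P u * u) * (tau P ^ val P v * v)" by (simp add: power_add mult_ac)
  also have "\<dots> = of_nat (fst P ^ (val P u + val P v)) * (a * b)" unfolding a(3) b(3) by (simp add: power_add mult_ac)
  finally have eq: "tau P ^ (val P u + val P v) * (u * v) = of_nat (fst P ^ (val P u + val P v)) * (a * b)" .
  have "\<not> inP P (a * b)" using inP_prime[OF P a(1) b(1)] a b by blast
  from val_eqI[OF P _ _ _ this eq] show ?thesis using u v a b by auto
qed

lemma val_0: "P \<in> Pr \<Longrightarrow> v \<in> Rg d \<Longrightarrow> v \<noteq> 0 \<Longrightarrow> \<not> inP P v \<Longrightarrow> val P v = 0"
  using val_eqI[of P v v 0] by simp

lemma inP_iff_val: "P \<in> Pr \<Longrightarrow> v \<in> Rg d \<Longrightarrow> v \<noteq> 0 \<Longrightarrow> inP P v \<longleftrightarrow> val P v \<ge> 1"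
  using val_spec[of P v 1] by (simp add: pdv_def inP_def)

lemma val_prime: "P \<in> Pr \<Longrightarrow> val P (of_nat (fst P)) = 1"
  using val_eqI[of P "of_nat (fst P)" "tau P" 1] inP_tau[of P] PrD(7)[of P] by simp

text \<open>The absence of ramification shows here: \<open>l\<close> has valuation 1 at every prime
  above it, split or inert.\<close>

lemma val_of_nat:
  assumes P: "P \<in> Pr" and n: "n > 0" shows "val P (of_nat n) = multiplicity (fst P) n"
proof -
  let ?l = "fst P"
  obtain n' where n': "n = ?l ^ multiplicity ?l n * n'" "\<not> ?l dvd n'"
    using multiplicity_decompose'[of n ?l] n PrD(1)[OF P] by (metis not_prime_unit gr0_implies_Suc nat.simps(3))
  have n'0: "n' > 0" using n' by (auto intro: Nat.gr0I)
  have pow: "val P (of_nat (?l ^ k)) = k" for k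
  proof (induction k)
    case 0
    have "\<not> inP P (of_nat 1)" using inP_of_nat[OF P, of 1] PrD[OF P] by auto
    thus ?case using val_0[OF P, of "of_nat 1"] by simp
  next
    case (Suc k)
    have "val P (of_nat ?l * of_nat (?l ^ k)) = val P (of_nat ?l) + val P (of_nat (?l ^ k))"
      using PrD(7)[OF P] by (intro val_mult[OF P]) auto
    thus ?case using Suc val_prime[OF P] by simp
  qed
  have "val P (of_nat (?l ^ multiplicity ?l n) * of_nat n') = val P (of_nat (?l ^ multiplicity ?l n)) + val P (of_nat n')"
    using PrD(7)[OF P] n'0 by (intro val_mult[OF P]) auto
  also have "val P (of_nat n') = 0" using n'0 n'(2) inP_of_nat[OF P] by (intro val_0[OF P]) auto
  finally show ?thesis using pow n'(1) by (metis add.right_neutral of_nat_mult)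
qed

definition conj :: "nat \<times> int \<Rightarrow> nat \<times> int" where "conj P = (fst P, - snd P)"

lemma conj_Pr: "P \<in> Pr \<Longrightarrow> conj P \<in> Pr"
  by (auto simp: Pr_def conj_def)

lemma val_conj:
  assumes P: "P \<in> Pr" and v: "v \<in> Rg d" "v \<noteq> 0"
  shows "val (conj P) v = val P (cnj v)"
proof -
  have "pdv (conj P) k v \<longleftrightarrow> pdv P k (cnj v)" for k
  proof (cases "snd P = 0")
    case True
    hence "pdv (conj P) k v \<longleftrightarrow> v \<in> multiples d (fst P ^ k)" "pdv P k (cnj v) \<longleftrightarrow> cnj v \<in> multiples d (fst P ^ k)"
      by (simp_all add: pdv_def conj_def tau_def)
    thus ?thesis using multiples_cnj by (metis complex_cnj_cnj)
  next
    case False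
    have t: "tau (conj P) = - cnj (tau P)" using False by (simp add: tau_def conj_def cnj_emb emb_uminus)
    have "pdv (conj P) k v \<longleftrightarrow> (- 1) ^ k * (cnj (tau P) ^ k * v) \<in> multiples d (fst P ^ k)"
      unfolding pdv_def t by (simp add: conj_def power_minus[of "cnj (tau P)"] mult.assoc)
    also have "\<dots> \<longleftrightarrow> cnj (tau P) ^ k * v \<in> multiples d (fst P ^ k)"
      by (cases "even k") (simp_all add: multiples_uminus)
    also have "\<dots> \<longleftrightarrow> cnj (cnj (tau P) ^ k * v) \<in> multiples d (fst P ^ k)" using multiples_cnj by (metis complex_cnj_cnj)
    finally show ?thesis by (simp add: pdv_def)
  qed
  thus ?thesis by (simp add: val_def)
qed

text \<open>For an inert prime \<open>conj P = P\<close>, so the left side is twice the valuation,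
  in accordance with the norm \<open>l^2\<close>.\<close>

lemma val_nq:
  assumes P: "P \<in> Pr" and v: "v \<in> Rg d" "v \<noteq> 0"
  shows "val P v + val (conj P) v = multiplicity (fst P) (nq v)"
proof -
  have "val P v + val (conj P) v = val P (v * cnj v)" using val_mult[OF P v, of "cnj v"] v val_conj[OF P v] by simp
  thus ?thesis using mult_cnj_nq[OF v(1)] val_of_nat[OF P nq_pos[OF v]] by simp
qed

lemma primes_over:
  assumes l: "prime l" "\<not> l dvd M"
  shows "(\<exists>P. {P \<in> Pr. fst P = l} = {P} \<and> conj P = P \<and> nm P = l\<^sup>2) \<or>
         (\<exists>P. {P \<in> Pr. fst P = l} = {P, conj P} \<and> conj P \<noteq> P \<and> nm P = l \<and> nm (conj P) = l)"
proof (cases "\<exists>t. int l dvd t\<^sup>2 + int d")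
  case False
  hence "{P \<in> Pr. fst P = l} = {(l, 0)}" using l prime_gt_0_nat[OF l(1)] by (auto simp: Pr_def split: if_splits)
  thus ?thesis by (intro disjI1 exI[of _ "(l, 0)"]) (simp add: conj_def nm_def)
next
  case True
  then obtain t where t: "int l dvd t\<^sup>2 + int d" by blast
  have "2 dvd M" "d dvd M" using M_dvd dvd_trans by (metis dvd_triv_left, metis dvd_triv_right)
  hence ld: "\<not> int l dvd int d" and l2: "l \<noteq> 2" using l dvd_trans by (auto simp: int_dvd_int_iff)
  have odd: "odd l" using l l2 prime_odd_nat by (metis le_neq_implies_less prime_ge_2_nat)
  have l0: "int l > 0" using prime_gt_0_nat[OF l(1)] by simp
  \<comment> \<open>The residue of least absolute value, the normal form that \<open>Pr\<close>
    demands.\<close>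
  define s where "s = (if 2 * (t mod int l) < int l then t mod int l else t mod int l - int l)"
  have tm: "0 \<le> t mod int l" "t mod int l < int l" using l0 by simp_all
  have "odd (int l)" using odd by simp
  hence sb: "2 * \<bar>s\<bar> < int l" 
  proof -
    have "2 * \<bar>if 2 * r < L then r else r - L\<bar> < L" if "0 \<le> r" "r < L" "odd L" for r L :: int
      using that by (cases "2 * r < L") (auto simp: abs_if elim!: oddE)
    thus ?thesis using tm \<open>odd (int l)\<close> by (simp add: s_def)
  qed
  have "[s = t] (mod int l)"
  proof -
    have "t mod int l = t - int l * (t div int l)" by (simp add: minus_mult_div_eq_mod)
    hence "s - t = int l * (- (t div int l)) \<or> s - t = int l * (- (t div int l) - 1)"
      by (auto simp: s_def algebra_simps)
    thus ?thesis unfolding cong_iff_dvd_diff by (metis dvd_triv_left)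
  qed
  hence "[s\<^sup>2 + int d = t\<^sup>2 + int d] (mod int l)" by (intro cong_add cong_pow) auto
  hence root: "int l dvd s\<^sup>2 + int d" using t cong_dvd_iff by blast
  have s0: "s \<noteq> 0" using root ld by auto
  have P: "(l, s) \<in> Pr" using l sb root s0 by (simp add: Pr_def)
  have "{P \<in> Pr. fst P = l} = {(l, s), (l, - s)}"
  proof
    show "{(l, s), (l, - s)} \<subseteq> {P \<in> Pr. fst P = l}" using P conj_Pr[OF P] by (simp add: conj_def)
    show "{P \<in> Pr. fst P = l} \<subseteq> {(l, s), (l, - s)}"
    proof
      fix P assume "P \<in> {P \<in> Pr. fst P = l}"
      then obtain b where b: "P = (l, b)" "(l, b) \<in> Pr" by (cases P) auto
      have b0: "b \<noteq> 0" using b True by (auto simp: Pr_def)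
      hence bd: "int l dvd b\<^sup>2 + int d" "2 * \<bar>b\<bar> < int l" using b by (auto simp: Pr_def)
      have "int l dvd (b\<^sup>2 + int d) - (s\<^sup>2 + int d)" using root bd(1) by (intro dvd_diff)
      hence "int l dvd (b - s) * (b + s)" by (simp add: algebra_simps power2_eq_square)
      hence "int l dvd b - s \<or> int l dvd b + s" using l prime_dvd_mult_iff[of "int l"] by simp
      moreover have "\<bar>b - s\<bar> < int l" "\<bar>b + s\<bar> < int l" using sb bd(2) by linarith+
      ultimately have "b - s = 0 \<or> b + s = 0" using zdvd_not_zless[of "\<bar>b - s\<bar>" "int l"] zdvd_not_zless[of "\<bar>b + s\<bar>" "int l"] by auto
      thus "P \<in> {(l, s), (l, - s)}" using b by auto
    qed
  qed
  thus ?thesis using s0 by (intro disjI2 exI[of _ "(l, s)"]) (simp add: conj_def nm_def)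
qed

end

section \<open>Divisors of elements, ideals with given divisor, and their index\<close>

context imag_order
begin

lemma nm_ge_fst: "P \<in> Pr \<Longrightarrow> fst P \<le> nm P"
  using PrD(7)[of P] by (auto simp: nm_def power2_eq_square)

lemma finite_Pr_fst: "finite {P \<in> Pr. fst P \<le> n}"
proof (rule finite_subset)
  show "{P \<in> Pr. fst P \<le> n} \<subseteq> {..n} \<times> {-int n..int n}" using PrD(3) by (fastforce simp: mem_Times_iff)
qed simp

sublocale normed_primes Pr nm
proof
  fix P assume "P \<in> Pr"
  thus "nm P \<ge> 2" using nm_ge_fst prime_ge_2_nat[OF PrD(1)] le_trans by blast
next
  fix n show "finite {P \<in> Pr. nm P \<le> n}"
    by (rule finite_subset[OF _ finite_Pr_fst[of n]]) (use nm_ge_fst le_trans in blast)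
qed

lemma nm_power_dvd_N: "nm P ^ count D P dvd N D"
proof -
  have "D = replicate_mset (count D P) P + filter_mset (\<lambda>Q. Q \<noteq> P) D" by (rule multiset_eqI) simp
  hence "N D = nm P ^ count D P * N (filter_mset (\<lambda>Q. Q \<noteq> P) D)" by (metis N_add N_replicate)
  thus ?thesis by simp
qed

lemma fst_power_dvd_N: "fst P ^ count D P dvd N D"
proof -
  have "fst P dvd nm P" by (simp add: nm_def)
  thus ?thesis using nm_power_dvd_N dvd_power_same dvd_trans by blast
qed

lemma N_coprime:
  assumes "D \<in> Divs" shows "coprime (N D) M"
  using assms
proof (induction D)
  case (add P D)
  hence P: "P \<in> Pr" and D: "D \<in> Divs" by (auto simp: Divs_def)
  have "coprime (nm P) M" using PrD(6)[OF P] by (simp add: nm_def)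
  moreover have "N (add_mset P D) = nm P * N D" using N_add[of "{#P#}" D] by simp
  ultimately show ?case using add.IH[OF D] by simp
qed simp

text \<open>The divisor of \<open>v\<close> away from \<open>M\<close>. The range of summation
  catches every prime of positive valuation, since its \<open>l\<close> divides
  \<open>nq v\<close>.\<close>

definition dv :: "complex \<Rightarrow> (nat \<times> int) multiset" where
  "dv v = (\<Sum>P\<in>{P \<in> Pr. fst P \<le> nq v}. replicate_mset (val P v) P)"

lemma count_dv:
  assumes "v \<in> Rg d" "v \<noteq> 0"
  shows "count (dv v) P = (if P \<in> Pr then val P v else 0)"
proof -
  have "count (dv v) P = (if P \<in> Pr \<and> fst P \<le> nq v then val P v else 0)"
    by (simp add: dv_def count_sum finite_Pr_fst sum.delta)
  moreover have "val P v = 0" if "P \<in> Pr" "\<not> fst P \<le> nq v"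
  proof (rule ccontr)
    assume "val P v \<noteq> 0"
    hence "pdv P 1 v" using val_spec[OF that(1) assms] by simp
    hence "fst P ^ 1 dvd nq v" by (rule pdv_bounded[OF that(1) assms])
    thus False using that(2) nq_pos[OF assms] dvd_imp_le by simp
  qed
  ultimately show ?thesis by auto
qed

lemma dv_Divs: "v \<in> Rg d \<Longrightarrow> v \<noteq> 0 \<Longrightarrow> dv v \<in> Divs"
  using count_dv[of v] by (auto simp: Divs_def count_eq_zero_iff[symmetric] simp del: count_eq_zero_iff split: if_splits) (metis count_eq_zero_iff)

lemma dv_mult:
  assumes "u \<in> Rg d" "u \<noteq> 0" "v \<in> Rg d" "v \<noteq> 0"
  shows "dv (u * v) = dv u + dv v"
  using assms by (intro multiset_eqI) (simp add: count_dv val_mult)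

text \<open>By \<open>val_nq\<close> the primes above \<open>l\<close> together contribute the
  \<open>l\<close>-part of \<open>nq v\<close>; coprimality ensures that every prime factor of
  \<open>nq v\<close> has primes of \<open>Pr\<close> above it.\<close>

lemma N_dv:
  assumes v: "v \<in> Rg d" "v \<noteq> 0" and cop: "coprime (nq v) M"
  shows "N (dv v) = nq v"
proof -
  let ?S = "{P \<in> Pr. fst P \<le> nq v}" and ?n = "nq v"
  have n0: "?n > 0" by (rule nq_pos[OF v])
  have "N (dv v) = (\<Prod>P\<in>?S. nm P ^ val P v)"
  proof -
    have "N (sum g A) = (\<Prod>P\<in>A. N (g P))" if "finite A" for g A using that by (induction A) auto
    from this[OF finite_Pr_fst] show ?thesis unfolding dv_def by simp
  qed
  also have "\<dots> = (\<Prod>l\<in>{..?n}. \<Prod>P\<in>{P \<in> ?S. fst P = l}. nm P ^ val P v)"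
    by (rule prod.group[symmetric]) (auto simp: finite_Pr_fst)
  also have "\<dots> = (\<Prod>l\<in>{..?n}. if l \<in> prime_factors ?n then l ^ multiplicity l ?n else 1)"
  proof (rule prod.cong[OF refl])
    fix l assume "l \<in> {..?n}"
    hence S: "{P \<in> ?S. fst P = l} = {P \<in> Pr. fst P = l}" by auto
    show "(\<Prod>P\<in>{P \<in> ?S. fst P = l}. nm P ^ val P v) = (if l \<in> prime_factors ?n then l ^ multiplicity l ?n else 1)"
    proof (cases "prime l \<and> \<not> l dvd M")
      case False
      hence "{P \<in> Pr. fst P = l} = {}" using PrD(1,2) by blast
      moreover have "l \<notin> prime_factors ?n"
      proof
        assume "l \<in> prime_factors ?n"
        hence "prime l" "l dvd ?n" "l dvd M" using False by auto
        hence "l dvd 1" using cop coprime_common_divisor_nat by (metis One_nat_def nat_dvd_1_iff_1)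
        thus False using \<open>prime l\<close> by simp
      qed
      ultimately show ?thesis unfolding S by (simp only: prod.empty if_False)
    next
      case True
      have "(\<Prod>P\<in>{P \<in> Pr. fst P = l}. nm P ^ val P v) = l ^ multiplicity l ?n"
        using primes_over[OF True[THEN conjunct1] True[THEN conjunct2]]
      proof (elim disjE conjE exE)
        fix P assume P: "{P \<in> Pr. fst P = l} = {P}" "conj P = P" "nm P = l\<^sup>2"
        hence PP: "P \<in> Pr" "fst P = l" by auto
        have "multiplicity l ?n = 2 * val P v" using val_nq[OF PP(1) v] P(2) PP(2) by simp
        thus ?thesis using P by (simp add: power_mult)
      next
        fix P assume P: "{P \<in> Pr. fst P = l} = {P, conj P}" "conj P \<noteq> P" "nm P = l" "nm (conj P) = l"
        hence PP: "P \<in> Pr" "fst P = l" by auto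
        have "multiplicity l ?n = val P v + val (conj P) v" using val_nq[OF PP(1) v] PP(2) by simp
        thus ?thesis using P by (simp add: power_add)
      qed
      moreover have "l ^ multiplicity l ?n = (if l \<in> prime_factors ?n then l ^ multiplicity l ?n else 1)"
        using True n0 by (auto simp: prime_factors_dvd not_dvd_imp_multiplicity_0)
      ultimately show ?thesis unfolding S by simp
    qed
  qed
  also have "\<dots> = (\<Prod>l\<in>prime_factors ?n. l ^ multiplicity l ?n)"
  proof -
    have "prime_factors ?n \<subseteq> {..?n}" using n0 by (auto simp: prime_factors_dvd dest: dvd_imp_le)
    thus ?thesis by (subst prod.inter_restrict[symmetric]) (auto simp: Int_absorb1)
  qed
  also have "\<dots> = ?n" using prime_factorization_nat[of ?n] n0 by simp
  finally show ?thesis .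
qed

text \<open>Divisibility by an integer prime to \<open>M\<close> can be tested at the primes of
  \<open>Pr\<close>. One prime factor \<open>l\<close> of \<open>n\<close> is split off at a time:
  lying in all primes above \<open>l\<close> forces divisibility by \<open>l\<close>.\<close>

lemma multiples_of_val:
  assumes "n > 0" "coprime n M" "v \<in> Rg d" "v \<noteq> 0" "\<And>P. P \<in> Pr \<Longrightarrow> val P (of_nat n) \<le> val P v"
  shows "v \<in> multiples d n"
  using assms
proof (induction n arbitrary: v rule: prime_divisors_induct)
  case zero thus ?case by simp
next
  case (unit n)
  thus ?case using multiples_1 by simp
next
  case (factor l n)
  hence "coprime l M" by simp
  hence "\<not> l dvd M" using factor.hyps by (metis coprime_common_divisor dvd_refl not_prime_unit)
  hence l: "prime l" "\<not> l dvd M" "n > 0" "coprime n M" using factor by auto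
  have over: "inP P v" if P: "P \<in> Pr" "fst P = l" for P
  proof -
    have "val P (of_nat (l * n)) = val P (of_nat l) + val P (of_nat n)"
      unfolding of_nat_mult using l prime_gt_0_nat[OF l(1)] by (intro val_mult P) auto
    hence "1 \<le> val P v" using val_prime[OF P(1)] P factor.prems(5)[OF P(1)] by simp
    thus ?thesis using inP_iff_val[OF P(1) factor.prems(3,4)] by simp
  qed
  have "v \<in> multiples d l"
    using primes_over[OF l(1,2)]
  proof (elim disjE conjE exE)
    fix P assume P: "{P \<in> Pr. fst P = l} = {P}" "conj P = P"
    hence "P \<in> Pr" "fst P = l" "snd P = 0" by (auto simp: conj_def prod_eq_iff)
    thus ?thesis using over[of P] by (simp add: inP_inert)
  next
    fix P assume P: "{P \<in> Pr. fst P = l} = {P, conj P}" "conj P \<noteq> P"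
    hence PP: "P \<in> Pr" "fst P = l" "snd P \<noteq> 0" "conj P \<in> Pr" by (auto simp: conj_def prod_eq_iff)
    obtain x y where xy: "v = emb d x y" using factor.prems(3) by (rule Rg_cases)
    \<comment> \<open>Reduction at both roots \<open>s\<close> and \<open>- s\<close> kills
      \<open>v\<close>, so \<open>l\<close> divides \<open>2 * x\<close> and then
      \<open>s * y\<close>.\<close>
    have "int l dvd x + snd P * y" "int l dvd x + snd (conj P) * y"
      using inP_split[of P x y] inP_split[of "conj P" x y] over[of P] over[of "conj P"] PP by (auto simp: xy conj_def)
    hence e: "int l dvd x + snd P * y" "int l dvd x - snd P * y" by (simp_all add: conj_def)
    have l2: "\<not> int l dvd 2" "prime (int l)" using PrD(4)[OF PP(1)] PP(2) l(1) by auto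
    have "int l dvd 2 * x" using dvd_add[OF e] by simp
    hence lx: "int l dvd x" using l2 prime_dvd_mult_iff by blast
    hence "int l dvd snd P * y" using e(1) by (metis dvd_add_right_iff)
    moreover have "\<not> int l dvd snd P"
      using PrD(3)[OF PP(1)] PP(2,3) dvd_imp_le_int[of "snd P" "int l"] by auto
    ultimately have "int l dvd y" using l2 prime_dvd_mult_iff by blast
    thus ?thesis using lx by (simp add: xy emb_in_multiples[OF d_pos])
  qed
  then obtain u where u: "u \<in> Rg d" "v = of_nat l * u" by (auto simp: multiples_def)
  have u0: "u \<noteq> 0" using u factor.prems(4) by auto
  have "val P (of_nat n) \<le> val P u" if P: "P \<in> Pr" for P
  proof -
    have "val P (of_nat (l * n)) = val P (of_nat l) + val P (of_nat n)"
      unfolding of_nat_mult using l prime_gt_0_nat[OF l(1)] by (intro val_mult P) auto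
    moreover have "val P v = val P (of_nat l) + val P u"
      unfolding u(2) using prime_gt_0_nat[OF l(1)] u u0 by (intro val_mult P) auto
    ultimately show ?thesis using factor.prems(5)[OF P] by simp
  qed
  hence "u \<in> multiples d n" using factor.IH[OF l(3,4) u(1) u0] by blast
  thus ?case using u(2) by (auto simp: multiples_def mult.assoc)
qed

text \<open>Multiplying by \<open>cnj u\<close> turns divisibility by \<open>u\<close> into
  divisibility by the integer \<open>nq u\<close>, which valuations detect.\<close>

lemma dv_subset_imp_dvd:
  assumes u: "u \<in> Rg d" "u \<noteq> 0" "coprime (nq u) M" and v: "v \<in> Rg d" "v \<noteq> 0" and sub: "dv u \<subseteq># dv v"
  shows "\<exists>z\<in>Rg d. v = u * z"
proof -
  have n0: "nq u > 0" by (rule nq_pos[OF u(1,2)])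
  have "v * cnj u \<in> multiples d (nq u)"
  proof (rule multiples_of_val[OF n0 u(3)])
    fix P assume P: "P \<in> Pr"
    have "val P u \<le> val P v"
      using sub count_dv[OF u(1,2), of P] count_dv[OF v, of P] P by (metis subseteq_mset_def)
    moreover have "val P (of_nat (nq u)) = val P u + val P (cnj u)"
      using val_mult[OF P u(1,2), of "cnj u"] u mult_cnj_nq[OF u(1)] by simp
    moreover have "val P (v * cnj u) = val P v + val P (cnj u)"
      using u v by (intro val_mult P) auto
    ultimately show "val P (of_nat (nq u)) \<le> val P (v * cnj u)" by simp
  qed (use u v in auto)
  then obtain z where z: "z \<in> Rg d" "v * cnj u = of_nat (nq u) * z" by (auto simp: multiples_def)
  hence "v * cnj u = (u * z) * cnj u" using mult_cnj_nq[OF u(1)] by (simp add: mult_ac)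
  thus ?thesis using z(1) u(2) by auto
qed

text \<open>For \<open>D\<close> in \<open>Divs\<close> this is the ideal of \<open>Rg d\<close>
  with divisor \<open>D\<close>; it contains 0, where every \<open>pdv\<close> holds.\<close>

definition J :: "(nat \<times> int) multiset \<Rightarrow> complex set" where
  "J D = {v \<in> Rg d. \<forall>P. P \<in># D \<longrightarrow> pdv P (count D P) v}"

lemma J_Rg: "J D \<subseteq> Rg d" by (auto simp: J_def)

lemma J_mult: "u \<in> Rg d \<Longrightarrow> v \<in> J D \<Longrightarrow> u * v \<in> J D"
  by (simp add: J_def pdv_mult)

lemma J_diff: "u \<in> J D \<Longrightarrow> v \<in> J D \<Longrightarrow> u - v \<in> J D"
  by (simp add: J_def pdv_diff)

lemma J_iff_dv:
  assumes D: "D \<in> Divs" and v: "v \<in> Rg d" "v \<noteq> 0"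
  shows "v \<in> J D \<longleftrightarrow> D \<subseteq># dv v"
proof -
  have "v \<in> J D \<longleftrightarrow> (\<forall>P. P \<in># D \<longrightarrow> count D P \<le> count (dv v) P)"
  proof -
    have "pdv P (count D P) v \<longleftrightarrow> count D P \<le> count (dv v) P" if "P \<in># D" for P
      using that D v by (auto simp: Divs_def val_spec count_dv)
    thus ?thesis using v unfolding J_def by blast
  qed
  also have "\<dots> \<longleftrightarrow> D \<subseteq># dv v" unfolding subseteq_mset_def by (metis count_inI zero_le)
  finally show ?thesis .
qed

lemma of_nat_in_J: "N D dvd n \<Longrightarrow> of_nat n \<in> J D"
proof -
  assume n: "N D dvd n"
  have "pdv P (count D P) (of_nat n)" for P
  proof -
    have "fst P ^ count D P dvd n" using n fst_power_dvd_N dvd_trans by blast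
    hence "of_nat n \<in> multiples d (fst P ^ count D P)" using of_nat_in_multiples[OF d_pos] by blast
    thus ?thesis unfolding pdv_def by (intro multiples_mult) auto
  qed
  thus ?thesis by (simp add: J_def)
qed

definition MJ :: "(nat \<times> int) multiset \<Rightarrow> complex set" where "MJ D = {of_nat M * v | v. v \<in> J D}"

lemma MJ_subgroup: "add_subgroup (MJ D)"
  unfolding add_subgroup_def MJ_def
proof (intro conjI ballI)
  have "of_nat 0 \<in> J D" by (rule of_nat_in_J) simp
  thus "0 \<in> {of_nat M * v |v. v \<in> J D}" by (auto intro: exI[of _ 0])
qed (auto simp: right_diff_distrib[symmetric] intro: J_diff)

lemma MJ_Rg: "MJ D \<subseteq> Rg d" using J_Rg by (auto simp: MJ_def)

lemma multiples_subset_MJ: "multiples d (M * N D) \<subseteq> MJ D"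
proof
  fix v assume "v \<in> multiples d (M * N D)"
  then obtain u where u: "u \<in> Rg d" "v = of_nat M * (u * of_nat (N D))" by (auto simp: multiples_def mult_ac)
  have "u * of_nat (N D) \<in> J D" using u by (intro J_mult of_nat_in_J) auto
  thus "v \<in> MJ D" using u by (auto simp: MJ_def)
qed

text \<open>The residue field has \<open>l^2\<close> elements in the inert case and \<open>l\<close>
  in the split case, where integers represent it.\<close>

lemma residues_mod_prime:
  assumes P: "P \<in> Pr"
  shows "\<exists>T. finite T \<and> card T = nm P \<and> T \<subseteq> Rg d \<and> (\<forall>v\<in>Rg d. \<exists>!t. t \<in> T \<and> inP P (v - t))"
proof (cases "snd P = 0")
  case True
  have "card (resbox d (fst P)) = nm P" using True by (simp add: nm_def resbox_card[OF d_pos])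
  moreover have "\<forall>v\<in>Rg d. \<exists>!t. t \<in> resbox d (fst P) \<and> inP P (v - t)"
    using resbox_ex1[OF d_pos, of "fst P"] PrD(7)[OF P] True by (simp add: inP_inert)
  ultimately show ?thesis using resbox_finite resbox_Rg by (intro exI[of _ "resbox d (fst P)"]) auto
next
  case False
  let ?l = "int (fst P)"
  define T where "T = (\<lambda>x. emb d x 0) ` {0..<?l}"
  have l0: "?l > 0" using PrD(7)[OF P] by simp
  have "card T = nm P" unfolding T_def using False
    by (subst card_image) (auto simp: nm_def inj_on_def dest: emb_inj[OF d_pos])
  moreover have "\<exists>!t. t \<in> T \<and> inP P (v - t)" if vR: "v \<in> Rg d" for v
  proof -
    obtain x y where v: "v = emb d x y" using vR by (rule Rg_cases)
    have iff: "inP P (v - emb d t 0) \<longleftrightarrow> ?l dvd (x + snd P * y) - t" for t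
      using inP_split[OF P False, of "x - t" y] by (simp add: v emb_diff algebra_simps)
    show ?thesis
    proof (rule ex1I)
      show "emb d ((x + snd P * y) mod ?l) 0 \<in> T \<and> inP P (v - emb d ((x + snd P * y) mod ?l) 0)"
        using l0 by (auto simp: T_def iff)
      fix t assume "t \<in> T \<and> inP P (v - t)"
      then obtain a where a: "t = emb d a 0" "0 \<le> a" "a < ?l" "?l dvd (x + snd P * y) - a" by (auto simp: T_def iff)
      hence "(x + snd P * y) mod ?l = a" by (metis mod_eq_dvd_iff mod_pos_pos_trivial)
      thus "t = emb d ((x + snd P * y) mod ?l) 0" using a by simp
    qed
  qed
  ultimately show ?thesis unfolding T_def by (intro exI[of _ "(\<lambda>x. emb d x 0) ` {0..<?l}"]) auto
qed

lemma conj_cases: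
  assumes P: "P \<in> Pr" and Q: "Q \<in> Pr" "fst Q = fst P" "Q \<noteq> P"
  shows "Q = conj P \<and> snd P \<noteq> 0"
proof -
  let ?A = "{R \<in> Pr. fst R = fst P}"
  have A: "P \<in> ?A" "Q \<in> ?A" using P Q by auto
  from primes_over[OF PrD(1,2)[OF P]] show ?thesis
  proof (elim disjE exE conjE)
    fix R assume "?A = {R}"
    hence "P = R" "Q = R" using A by blast+
    thus ?thesis using Q(3) by simp
  next
    fix R assume R: "?A = {R, conj R}" "conj R \<noteq> R"
    hence "P = R \<or> P = conj R" "Q = R \<or> Q = conj R" using A by blast+
    moreover have "conj (conj R) = R" by (simp add: conj_def)
    moreover have "snd R \<noteq> 0" "snd (conj R) = - snd R" using R(2) by (auto simp: conj_def prod_eq_iff)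
    ultimately show ?thesis using Q(3) by auto
  qed
qed

text \<open>Three factors: the norm of the part of \<open>D\<close> away from \<open>l\<close> takes
  care of all other primes, \<open>l^k\<close> gives the exact order at \<open>P\<close>, and a high
  power of \<open>tau P\<close>, which has order 0 at \<open>P\<close>, supplies what the conjugate
  prime requires.\<close>

lemma exact_element:
  assumes D: "D \<in> Divs" and P: "P \<in> Pr"
  shows "\<exists>u\<in>J D. u \<noteq> 0 \<and> val P u = count D P"
proof -
  let ?l = "fst P" and ?k = "count D P"
  define n' where "n' = N (filter_mset (\<lambda>Q. fst Q \<noteq> ?l) D)"
  define u where "u = of_nat n' * (of_nat (?l ^ ?k) * tau P ^ size D)"
  have pl: "prime ?l" by (rule PrD(1)[OF P])
  have n'l: "\<not> ?l dvd n'"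
  proof -
    have nE: "\<not> ?l dvd N E" if "E \<in> Divs" "\<forall>Q. Q \<in># E \<longrightarrow> fst Q \<noteq> ?l" for E
      using that
    proof (induction E)
      case empty thus ?case using prime_gt_1_nat[OF pl] by simp
    next
      case (add Q E)
      hence Q: "Q \<in> Pr" "E \<in> Divs" "fst Q \<noteq> ?l" by (auto simp: Divs_def simp del: split_paired_All)
      have "\<not> ?l dvd nm Q"
      proof
        assume "?l dvd nm Q"
        hence "?l dvd fst Q" using pl by (auto simp: nm_def split: if_splits dest: prime_dvd_power)
        thus False using primes_dvd_imp_eq[OF pl PrD(1)[OF Q(1)]] Q(3) by simp
      qed
      moreover have "N (add_mset Q E) = nm Q * N E" using N_add[of "{#Q#}" E] by simp
      ultimately show ?case using add Q pl by (auto simp: prime_dvd_mult_iff)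
    qed
    show ?thesis unfolding n'_def by (rule nE) (use D in \<open>auto simp: Divs_def\<close>)
  qed
  have t0: "tau P \<noteq> 0"
  proof
    assume "tau P = 0"
    hence "inP P (tau P)" using of_nat_in_multiples[OF d_pos, of 0] by (simp add: inP_def)
    thus False using inP_tau[OF P] by blast
  qed
  have n'0: "n' > 0" using n'l by (auto intro: Nat.gr0I)
  have uR: "u \<in> Rg d" "u \<noteq> 0" using t0 n'0 PrD(7)[OF P] by (auto simp: u_def simp flip: of_nat_power)
  have "val P u = val P (of_nat n') + (val P (of_nat (?l ^ ?k)) + val P (tau P ^ size D))"
    unfolding u_def using t0 n'0 PrD(7)[OF P] by (subst val_mult[OF P] | auto)+
  also have "val P (of_nat n') = 0" using n'0 n'l inP_of_nat[OF P] by (intro val_0[OF P]) auto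
  also have "val P (tau P ^ size D) = 0" using t0 inP_power[OF P tau_Rg inP_tau[OF P]] by (intro val_0[OF P]) auto
  also have "val P (of_nat (?l ^ ?k)) = ?k"
    using val_of_nat[OF P, of "?l ^ ?k"] PrD(7)[OF P] pl by (simp add: multiplicity_same_power prime_elem_not_unit)
  finally have valu: "val P u = ?k" by simp
  have "pdv Q (count D Q) u" if Q: "Q \<in># D" for Q
  proof -
    have QP: "Q \<in> Pr" using Q D by (auto simp: Divs_def)
    consider "fst Q \<noteq> ?l" | "Q = P" | "fst Q = ?l" "Q \<noteq> P" by blast
    thus ?thesis
    proof cases
      case 1
      have "count (filter_mset (\<lambda>Q. fst Q \<noteq> ?l) D) Q = count D Q" using 1 by simp
      hence "fst Q ^ count D Q dvd n'" using fst_power_dvd_N[of Q "filter_mset (\<lambda>Q. fst Q \<noteq> ?l) D"] by (simp add: n'_def)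
      hence "of_nat n' \<in> multiples d (fst Q ^ count D Q)" using of_nat_in_multiples[OF d_pos] by blast
      hence "pdv Q (count D Q) (of_nat n')" unfolding pdv_def by (intro multiples_mult) auto
      hence "pdv Q (count D Q) ((of_nat (?l ^ ?k) * tau P ^ size D) * of_nat n')" by (intro pdv_mult) auto
      thus ?thesis by (simp only: u_def mult.commute)
    next
      case 2
      thus ?thesis using val_spec[OF P uR] valu by simp
    next
      case 3
      have Q: "Q = conj P" "snd P \<noteq> 0"
        using conj_cases[OF P QP 3] by auto
      have "tau Q * tau P = emb d (- (snd P)\<^sup>2 - int d) 0"
        using Q by (simp add: tau_def conj_def emb_mult power2_eq_square)
      moreover have "?l dvd - (snd P)\<^sup>2 - int d"
      proof -
        have "- (snd P)\<^sup>2 - int d = - ((snd P)\<^sup>2 + int d)" by simp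
        thus ?thesis using split_root[OF P Q(2)] by (metis dvd_minus_iff)
      qed
      ultimately have tt: "tau Q * tau P \<in> multiples d ?l" by (simp add: emb_in_multiples[OF d_pos])
      have pw: "(tau Q * tau P) ^ j \<in> multiples d (?l ^ j)" for j
      proof (induction j)
        case 0 thus ?case using multiples_1[of d] by simp
      next
        case (Suc j) thus ?case using multiples_times[OF tt Suc] by simp
      qed
      have "pdv Q (count D Q) (tau P ^ count D Q)"
        using pw[of "count D Q"] 3 by (simp add: pdv_def power_mult_distrib)
      moreover have "u = (of_nat n' * of_nat (?l ^ ?k) * tau P ^ (size D - count D Q)) * tau P ^ count D Q"
      proof -
        have "tau P ^ size D = tau P ^ (size D - count D Q) * tau P ^ count D Q"
          using count_le_size[of D Q] by (simp flip: power_add)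
        thus ?thesis by (simp add: u_def mult_ac)
      qed
      ultimately show ?thesis using pdv_mult by (metis Rg_mult Rg_of_nat Rg_power tau_Rg)
    qed
  qed
  thus ?thesis using uR valu by (auto simp: J_def)
qed

lemma J_add_mset:
  assumes D: "D \<in> Divs" and P: "P \<in> Pr"
  shows "v \<in> J (add_mset P D) \<longleftrightarrow> v \<in> J D \<and> pdv P (Suc (count D P)) v"
proof -
  have "pdv P (count D P) v" if "v \<in> Rg d" "pdv P (Suc (count D P)) v"
  proof (cases "v = 0")
    case True thus ?thesis using of_nat_in_multiples[OF d_pos, of 0] by (simp add: pdv_def)
  next
    case False thus ?thesis using val_spec[OF P that(1)] that(2) by simp
  qed
  thus ?thesis by (auto simp: J_def simp del: split_paired_All split: if_splits)
qed

text \<open>An element \<open>u\<close> of exact order at \<open>P\<close> generates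
  \<open>J D\<close> modulo \<open>J (add_mset P D)\<close> over the residue field, so the multiples
  of \<open>u\<close> by a residue system modulo \<open>P\<close> represent the quotient.\<close>

lemma transversal_step:
  assumes D: "D \<in> Divs" and P: "P \<in> Pr"
  shows "\<exists>T. finite T \<and> card T = nm P \<and> T \<subseteq> J D \<and> (\<forall>v\<in>J D. \<exists>!t. t \<in> T \<and> v - t \<in> J (add_mset P D))"
proof -
  let ?k = "count D P"
  obtain T where T: "finite T" "card T = nm P" "T \<subseteq> Rg d" "\<forall>v\<in>Rg d. \<exists>!t. t \<in> T \<and> inP P (v - t)"
    using residues_mod_prime[OF P] by (elim exE conjE) (rule that)
  note T4 = bspec[OF T(4)]
  obtain u where u: "u \<in> J D" "u \<noteq> 0" "val P u = ?k" using exact_element[OF D P] by blast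
  have uR: "u \<in> Rg d" using u J_Rg by blast
  obtain u' where u': "u' \<in> Rg d" "\<not> inP P u'" "tau P ^ ?k * u = of_nat (fst P ^ ?k) * u'"
    using val_decomp[OF P uR u(2)] u(3) by metis
  define r where "r v = (THE t. t \<in> T \<and> inP P (v - t))" for v
  have r: "r v \<in> T" "inP P (v - r v)" if "v \<in> Rg d" for v
    using theI'[OF T4[OF that]] by (auto simp: r_def)
  have r_unique: "t = r v" if "v \<in> Rg d" "t \<in> T" "inP P (v - t)" for t v
    using T4[OF that(1)] r[OF that(1)] that by blast
  have eq_of_inP: "s = t" if st: "s \<in> T" "t \<in> T" "inP P ((s - t) * u')" for s t
  proof -
    have "inP P (s - t)" using inP_prime[OF P _ u'(1) st(3)] u'(2) st T(3) by blast
    moreover have "inP P (s - s)" using of_nat_in_multiples[OF d_pos, of 0] by (simp add: inP_def)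
    ultimately show ?thesis using r_unique[of s t] r_unique[of s s] st T(3) by blast
  qed
  \<comment> \<open>Multiplication by \<open>u'\<close>, a unit modulo \<open>P\<close>, is
    injective on residues, hence a permutation of the finite set \<open>T\<close>.\<close>
  have inj: "inj_on (\<lambda>c. r (c * u')) T"
  proof (rule inj_onI)
    fix s t assume st: "s \<in> T" "t \<in> T" "r (s * u') = r (t * u')"
    have "s * u' \<in> Rg d" "t * u' \<in> Rg d" using st T u' by auto
    from inP_diff[OF r(2)[OF this(1)] r(2)[OF this(2)]] have "inP P ((s - t) * u')"
      using st(3) by (simp add: left_diff_distrib)
    thus "s = t" by (rule eq_of_inP[OF st(1,2)])
  qed
  have surj: "(\<lambda>c. r (c * u')) ` T = T"
    by (rule endo_inj_surj[OF T(1) _ inj]) (use r T u' in auto)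
  have iff: "v - c * u \<in> J (add_mset P D) \<longleftrightarrow> inP P (v' - c * u')"
    if v: "v \<in> J D" "v' \<in> Rg d" "tau P ^ ?k * v = of_nat (fst P ^ ?k) * v'" and c: "c \<in> Rg d" for v v' c
  proof -
    have "v - c * u \<in> J D" using v c u by (intro J_diff J_mult)
    hence "v - c * u \<in> J (add_mset P D) \<longleftrightarrow> pdv P (Suc ?k) (v - c * u)" using J_add_mset[OF D P] by blast
    also have "tau P ^ Suc ?k * (v - c * u) = of_nat (fst P ^ ?k) * (tau P * (v' - c * u'))"
    proof -
      have "tau P ^ Suc ?k * (v - c * u) = tau P * (tau P ^ ?k * v - c * (tau P ^ ?k * u))" by (simp add: algebra_simps)
      also have "\<dots> = of_nat (fst P ^ ?k) * (tau P * (v' - c * u'))" unfolding v(3) u'(3) by (simp only: algebra_simps)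
      finally show ?thesis .
    qed
    hence "pdv P (Suc ?k) (v - c * u) \<longleftrightarrow> of_nat (fst P ^ ?k) * (tau P * (v' - c * u')) \<in> multiples d (fst P ^ ?k * fst P)"
      by (simp only: pdv_def power_Suc2)
    also have "\<dots> \<longleftrightarrow> tau P * (v' - c * u') \<in> multiples d (fst P)"
    proof
      assume "of_nat (fst P ^ ?k) * (tau P * (v' - c * u')) \<in> multiples d (fst P ^ ?k * fst P)"
      thus "tau P * (v' - c * u') \<in> multiples d (fst P)" by (rule multiples_cancel[rotated]) (use PrD(7)[OF P] in simp)
    next
      assume "tau P * (v' - c * u') \<in> multiples d (fst P)"
      thus "of_nat (fst P ^ ?k) * (tau P * (v' - c * u')) \<in> multiples d (fst P ^ ?k * fst P)"
        by (auto simp: multiples_def mult.assoc)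
    qed
    finally show ?thesis by (simp add: inP_def)
  qed
  have ex1: "\<exists>!t. t \<in> (\<lambda>c. c * u) ` T \<and> v - t \<in> J (add_mset P D)" if v: "v \<in> J D" for v
  proof -
    have "pdv P ?k v"
    proof (cases "P \<in># D")
      case True thus ?thesis using v unfolding J_def by blast
    next
      case False
      hence "?k = 0" by (simp add: count_eq_zero_iff)
      moreover have "v \<in> Rg d" using v J_Rg by blast
      ultimately show ?thesis by simp
    qed
    then obtain v' where v': "v' \<in> Rg d" "tau P ^ ?k * v = of_nat (fst P ^ ?k) * v'" by (rule pdv_decomp)
    note iff' = iff[OF v v']
    have "r v' \<in> (\<lambda>c. r (c * u')) ` T" using surj r(1)[OF v'(1)] by simp
    then obtain c where c: "c \<in> T" "r v' = r (c * u')" by blast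
    have cR: "c \<in> Rg d" "c * u' \<in> Rg d" using c T u' by auto
    have "inP P ((v' - r v') - (c * u' - r (c * u')))" using r(2)[OF v'(1)] r(2)[OF cR(2)] by (rule inP_diff)
    hence ic: "inP P (v' - c * u')" using c(2) by simp
    show ?thesis
    proof (rule ex1I[of _ "c * u"])
      show "c * u \<in> (\<lambda>c. c * u) ` T \<and> v - c * u \<in> J (add_mset P D)" using c iff'[OF cR(1)] ic by blast
      fix t assume "t \<in> (\<lambda>c. c * u) ` T \<and> v - t \<in> J (add_mset P D)"
      then obtain b where b: "b \<in> T" "t = b * u" "v - b * u \<in> J (add_mset P D)" by blast
      have "inP P (v' - b * u')" using iff' b T(3) by blast
      from inP_diff[OF this ic] have "inP P ((c - b) * u')" by (simp add: algebra_simps)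
      thus "t = c * u" using eq_of_inP c(1) b by blast
    qed
  qed
  have "card ((\<lambda>c. c * u) ` T) = nm P" using T(2) u(2) by (subst card_image) (auto simp: inj_on_def)
  moreover have "(\<lambda>c. c * u) ` T \<subseteq> J D" using T(3) u(1) J_mult by blast
  ultimately show ?thesis using T(1) ex1 by (intro exI[of _ "(\<lambda>c. c * u) ` T"] conjI ballI) simp_all
qed

text \<open>\<open>M^2 * N D\<close> is the index of \<open>MJ D\<close> in the order; it is built
  up by adjoining the primes of \<open>D\<close> one at a time.\<close>

lemma transversal:
  assumes "D \<in> Divs"
  shows "\<exists>T. finite T \<and> card T = M\<^sup>2 * N D \<and> T \<subseteq> Rg d \<and> (\<forall>v\<in>Rg d. \<exists>!t. t \<in> T \<and> v - t \<in> MJ D)"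
  using assms
proof (induction D)
  case empty
  have "MJ {#} = multiples d M" by (auto simp: MJ_def J_def multiples_def)
  thus ?case using resbox_finite resbox_card[OF d_pos] resbox_Rg resbox_ex1[OF d_pos, of M] M_ge3
    by (intro exI[of _ "resbox d M"]) auto
next
  case (add P D)
  hence P: "P \<in> Pr" and D: "D \<in> Divs" by (auto simp: Divs_def)
  obtain T where T: "finite T" "card T = M\<^sup>2 * N D" "T \<subseteq> Rg d" "\<forall>v\<in>Rg d. \<exists>!t. t \<in> T \<and> v - t \<in> MJ D"
    using add.IH[OF D] by (elim exE conjE) (rule that)
  note T4 = bspec[OF T(4)]
  obtain U where U: "finite U" "card U = nm P" "U \<subseteq> J D" "\<forall>v\<in>J D. \<exists>!t. t \<in> U \<and> v - t \<in> J (add_mset P D)"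
    using transversal_step[OF D P] by (elim exE conjE) (rule that)
  note U4 = bspec[OF U(4)]
  have M0: "(of_nat M :: complex) \<noteq> 0" using M_ge3 by simp
  have JD: "J (add_mset P D) \<subseteq> J D" using J_add_mset[OF D P] by blast
  define W where "W = (\<lambda>(t, c). t + of_nat M * c) ` (T \<times> U)"
  have uniq: "t1 = t2 \<and> c1 = c2"
    if *: "v \<in> Rg d" "t1 \<in> T" "t2 \<in> T" "c1 \<in> U" "c2 \<in> U"
      "v - (t1 + of_nat M * c1) \<in> MJ (add_mset P D)" "v - (t2 + of_nat M * c2) \<in> MJ (add_mset P D)" for v t1 t2 c1 c2
  proof -
    obtain z1 z2 where z: "z1 \<in> J (add_mset P D)" "v - t1 = of_nat M * (c1 + z1)" "z2 \<in> J (add_mset P D)" "v - t2 = of_nat M * (c2 + z2)"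
      using * by (auto simp: MJ_def algebra_simps)
    have cz: "c1 + z1 \<in> J D" "c2 + z2 \<in> J D"
      using J_diff[of c1 D "- z1"] J_diff[of c2 D "- z2"] J_mult[of "-1" z1 D] J_mult[of "-1" z2 D] z * U(3) JD by auto
    hence "v - t1 \<in> MJ D" "v - t2 \<in> MJ D" using z by (auto simp: MJ_def)
    hence t: "t1 = t2" using T4[OF *(1)] * by blast
    hence "c1 + z1 = c2 + z2" using z M0 by (metis mult_left_cancel)
    hence "(c1 + z1) - c2 = z2" by simp
    hence "(c1 + z1) - c1 \<in> J (add_mset P D)" "(c1 + z1) - c2 \<in> J (add_mset P D)" using z by simp_all
    thus ?thesis using U4[OF cz(1)] * t by blast
  qed
  have ex: "\<exists>t\<in>T. \<exists>c\<in>U. v - (t + of_nat M * c) \<in> MJ (add_mset P D)" if v: "v \<in> Rg d" for v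
  proof -
    obtain t where t: "t \<in> T" "v - t \<in> MJ D" using T4[OF v] by blast
    then obtain z where z: "z \<in> J D" "v - t = of_nat M * z" by (auto simp: MJ_def)
    obtain c where c: "c \<in> U" "z - c \<in> J (add_mset P D)" using U4[OF z(1)] by blast
    have "v - (t + of_nat M * c) = of_nat M * (z - c)" using z(2) by (simp add: algebra_simps)
    thus ?thesis using t c by (auto simp: MJ_def)
  qed
  have "0 \<in> MJ (add_mset P D)" using add_subgroupD(1)[OF MJ_subgroup] .
  hence "inj_on (\<lambda>(t, c). t + of_nat M * c) (T \<times> U)"
  proof (intro inj_onI, clarify)
    fix t1 c1 t2 c2 assume *: "0 \<in> MJ (add_mset P D)" "t1 \<in> T" "c1 \<in> U" "t2 \<in> T" "c2 \<in> U" "t1 + of_nat M * c1 = t2 + of_nat M * c2"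
    have "t1 + of_nat M * c1 \<in> Rg d" using * T(3) U(3) J_Rg by blast
    from uniq[OF this *(2,4,3,5)] show "t1 = t2 \<and> c1 = c2" using * by simp
  qed
  hence "card W = M\<^sup>2 * N (add_mset P D)"
    unfolding W_def using T(2) U(2) N_add[of "{#P#}" D] by (simp add: card_image card_cartesian_product)
  moreover have "W \<subseteq> Rg d" using T(3) U(3) J_Rg unfolding W_def by fastforce
  moreover have "\<exists>!t. t \<in> W \<and> v - t \<in> MJ (add_mset P D)" if v: "v \<in> Rg d" for v
  proof -
    obtain t c where tc: "t \<in> T" "c \<in> U" "v - (t + of_nat M * c) \<in> MJ (add_mset P D)" using ex[OF v] by blast
    show ?thesis
    proof (rule ex1I[of _ "t + of_nat M * c"])
      show "t + of_nat M * c \<in> W \<and> v - (t + of_nat M * c) \<in> MJ (add_mset P D)" using tc by (auto simp: W_def)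
      fix x assume "x \<in> W \<and> v - x \<in> MJ (add_mset P D)"
      then obtain a b where ab: "x = a + of_nat M * b" "a \<in> T" "b \<in> U" "v - (a + of_nat M * b) \<in> MJ (add_mset P D)"
        by (auto simp: W_def)
      have "a = t \<and> b = c" by (rule uniq[OF v ab(2) tc(1) ab(3) tc(2) ab(4) tc(3)])
      thus "x = t + of_nat M * c" using ab by simp
    qed
  qed
  ultimately show ?case using T(1) U(1) by (intro exI[of _ W]) (auto simp: W_def)
qed

end

section \<open>The ray class group\<close>

context imag_order
begin

text \<open>The elements that generate the trivial ideals of the ray class group.\<close>

definition R1 :: "complex set" where "R1 = {v \<in> Rg d. v - 1 \<in> multiples d M}"

lemma R1_Rg: "v \<in> R1 \<Longrightarrow> v \<in> Rg d" by (simp add: R1_def)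

lemma one_R1 [simp]: "1 \<in> R1"
  using add_subgroupD(1)[OF add_subgroup_multiples] by (simp add: R1_def)

lemma R1_mult: "u \<in> R1 \<Longrightarrow> v \<in> R1 \<Longrightarrow> u * v \<in> R1"
proof -
  assume uv: "u \<in> R1" "v \<in> R1"
  have "u * v - 1 = u * (v - 1) + (u - 1)" by (simp add: algebra_simps)
  also have "\<dots> \<in> multiples d M" using uv by (intro multiples_add multiples_mult) (auto simp: R1_def)
  finally show ?thesis using uv by (simp add: R1_def)
qed

lemma R1_cancel: "u \<in> R1 \<Longrightarrow> z \<in> Rg d \<Longrightarrow> u * z - v \<in> multiples d M \<Longrightarrow> z - v \<in> multiples d M"
proof -
  assume uz: "u \<in> R1" "z \<in> Rg d" "u * z - v \<in> multiples d M"
  have "z - v = (u * z - v) - z * (u - 1)" by (simp add: algebra_simps)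
  also have "\<dots> \<in> multiples d M"
    by (rule multiples_diff[OF uz(3) multiples_mult[OF uz(2)]]) (use uz(1) in \<open>simp add: R1_def\<close>)
  finally show ?thesis .
qed

lemma coprime_nq:
  assumes "v \<in> Rg d" "u \<in> Rg d" "u - v \<in> multiples d M" "coprime (nq v) M"
  shows "coprime (nq u) M"
proof -
  have "u * cnj u - v * cnj v = (u - v) * cnj u + v * cnj (u - v)" by (simp add: algebra_simps)
  also have "\<dots> \<in> multiples d M"
    using assms multiples_mult[of "cnj u" d "u - v" M] multiples_mult[of v d "cnj (u - v)" M] multiples_cnj[of "u - v" d M]
    by (intro multiples_add) (auto simp: mult.commute)
  finally have "of_int (int (nq u) - int (nq v)) \<in> multiples d M"
    using mult_cnj_nq[OF assms(1)] mult_cnj_nq[OF assms(2)] by simp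
  hence "int M dvd int (nq u) - int (nq v)" using emb_in_multiples[OF d_pos, of _ 0 M] by (simp add: emb_of_int[of _ d])
  hence "[nq u = nq v] (mod M)" by (simp add: cong_iff_dvd_diff flip: cong_int_iff)
  thus ?thesis using assms(4) by (metis cong_imp_coprime cong_sym)
qed

lemma R1_coprime: "u \<in> R1 \<Longrightarrow> coprime (nq u) M"
  using coprime_nq[of 1 u] nq_of_nat[of 1] by (simp add: R1_def)

lemma coprime_nonzero: "coprime (nq u) M \<Longrightarrow> u \<noteq> 0"
  using nq_of_nat[of 0] M_ge3 by auto

lemma R1_nonzero: "u \<in> R1 \<Longrightarrow> u \<noteq> 0"
  by (rule coprime_nonzero[OF R1_coprime])

lemma dv_div:
  assumes "u \<in> R1" "v \<in> Rg d" "v \<noteq> 0" "D + dv u = dv v"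
  shows "\<exists>z\<in>Rg d. v = u * z \<and> z \<noteq> 0 \<and> dv z = D"
proof -
  note u = R1_Rg[OF assms(1)] R1_nonzero[OF assms(1)] R1_coprime[OF assms(1)]
  have "dv u \<subseteq># dv v" using assms(4) by (metis mset_subset_eq_add_right)
  from dv_subset_imp_dvd[OF u assms(2,3) this] obtain z where z: "z \<in> Rg d" "v = u * z" by blast
  have z0: "z \<noteq> 0" using z assms(3) by auto
  have "dv v = dv u + dv z" unfolding z(2) by (rule dv_mult[OF u(1,2) z(1) z0])
  hence "dv z = D" using assms(4) by simp
  thus ?thesis using z z0 by blast
qed

text \<open>The power \<open>N D ^ totient M\<close> lies in \<open>J D\<close>, and Euler's theorem
  makes it congruent to 1.\<close>

lemma R1_in_J: "D \<in> Divs \<Longrightarrow> \<exists>n. of_nat n \<in> R1 \<inter> J D"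
proof -
  assume D: "D \<in> Divs"
  define n where "n = N D ^ totient M"
  have t: "totient M > 0" using M_ge3 by simp
  hence "N D dvd n" by (simp add: n_def dvd_power)
  hence J: "of_nat n \<in> J D" by (rule of_nat_in_J)
  have "[n = 1] (mod M)" unfolding n_def by (rule euler_theorem[OF N_coprime[OF D]])
  hence "int M dvd int n - 1" by (metis cong_iff_dvd_diff cong_int_iff of_nat_1)
  hence "emb d (int n - 1) 0 \<in> multiples d M" using emb_in_multiples[OF d_pos] by simp
  hence "of_nat n \<in> R1" by (simp add: R1_def emb_def)
  thus ?thesis using J by blast
qed

text \<open>Pigeonhole on the residues modulo \<open>M J\<close> yields a short vector; reducing an element of \<open>R1 \<inter> J\<close> modulo
  its multiples makes the element small.\<close>
lemma small_R1_in_J: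
  assumes D: "D \<in> Divs"
  shows "\<exists>v\<in>R1 \<inter> J D. real (nq v) \<le> (1 + real d)\<^sup>2 * (real M)\<^sup>2 * real (N D)"
proof -
  obtain T where T: "finite T" "card T = M\<^sup>2 * N D" "T \<subseteq> Rg d" "\<forall>v\<in>Rg d. \<exists>!t. t \<in> T \<and> v - t \<in> MJ D"
    using transversal[OF D] by (elim exE conjE) (rule that)
  define r where "r v = (THE t. t \<in> T \<and> v - t \<in> MJ D)" for v
  have r: "r v \<in> T" "v - r v \<in> MJ D" if "v \<in> Rg d" for v
    using theI'[OF bspec[OF T(4) that]] by (auto simp: r_def)
  \<comment> \<open>\<open>k + 1\<close> is the least side of a box with more points than the index
    \<open>M^2 * N D\<close>, and differences of its points have coordinates at most
    \<open>k\<close>.\<close>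
  define k where "k = nat \<lfloor>sqrt (real (M\<^sup>2 * N D))\<rfloor>"
  have k: "real k \<le> sqrt (real (M\<^sup>2 * N D))" "sqrt (real (M\<^sup>2 * N D)) < real k + 1"
    unfolding k_def by (simp, linarith)
  have "sqrt (real (M\<^sup>2 * N D)) ^ 2 < (real k + 1)\<^sup>2" using k by (intro power_strict_mono) auto
  hence "real (M\<^sup>2 * N D) < real ((k + 1)\<^sup>2)" by (simp add: add.commute)
  hence "card T < card (resbox d (k + 1))" unfolding resbox_card[OF d_pos] T(2) by (simp only: of_nat_less_iff)
  moreover have "r ` resbox d (k + 1) \<subseteq> T" using r resbox_Rg by blast
  ultimately have "card (r ` resbox d (k + 1)) < card (resbox d (k + 1))"
    using card_mono[OF T(1)] by (meson le_less_trans)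
  from pigeonhole[OF this] obtain a b where ab: "a \<in> resbox d (k + 1)" "b \<in> resbox d (k + 1)" "a \<noteq> b" "r a = r b"
    unfolding inj_on_def by blast
  have abR: "a \<in> Rg d" "b \<in> Rg d" using ab resbox_Rg by blast+
  define w where "w = a - b"
  have "(a - r a) - (b - r b) \<in> MJ D" using r(2)[OF abR(1)] r(2)[OF abR(2)] by (rule add_subgroupD(2)[OF MJ_subgroup])
  hence wMJ: "w \<in> MJ D" using ab by (simp add: w_def)
  have w0: "w \<noteq> 0" using ab by (simp add: w_def)
  have wR: "w \<in> Rg d" using abR by (simp add: w_def)
  have wn: "(cmod w)\<^sup>2 \<le> (1 + real d) * ((real M)\<^sup>2 * real (N D))"
  proof -
    obtain x y where xy: "0 \<le> x" "x < int (k + 1)" "0 \<le> y" "y < int (k + 1)" "a = emb d x y" using ab(1) by (auto simp: resbox_def)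
    obtain s t where st: "0 \<le> s" "s < int (k + 1)" "0 \<le> t" "t < int (k + 1)" "b = emb d s t" using ab(2) by (auto simp: resbox_def)
    have "\<bar>x - s\<bar> \<le> int k" "\<bar>y - t\<bar> \<le> int k" using xy st by linarith+
    hence "\<bar>x - s\<bar>\<^sup>2 \<le> (int k)\<^sup>2" "\<bar>y - t\<bar>\<^sup>2 \<le> (int k)\<^sup>2" by (intro power_mono; simp)+
    hence "(x - s)\<^sup>2 + int d * (y - t)\<^sup>2 \<le> (int k)\<^sup>2 + int d * (int k)\<^sup>2" by (intro add_mono mult_left_mono) auto
    hence "of_int ((x - s)\<^sup>2 + int d * (y - t)\<^sup>2) \<le> (of_int ((int k)\<^sup>2 + int d * (int k)\<^sup>2) :: real)" by (simp only: of_int_le_iff)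
    also have "\<dots> = (1 + real d) * (real k)\<^sup>2" by (simp add: algebra_simps)
    also have "\<dots> \<le> (1 + real d) * ((real M)\<^sup>2 * real (N D))"
    proof -
      have "(real k)\<^sup>2 \<le> (sqrt (real (M\<^sup>2 * N D)))\<^sup>2" using k by (intro power_mono) auto
      thus ?thesis by (intro mult_left_mono) auto
    qed
    finally show ?thesis unfolding w_def xy st emb_diff norm_emb .
  qed
  obtain n where n: "of_nat n \<in> R1" "of_nat n \<in> J D" using R1_in_J[OF D] by blast
  \<comment> \<open>Rounding \<open>n / w\<close> in both coordinates finds a multiple of
    \<open>w\<close> close to \<open>n\<close>.\<close>
  define z where "z = of_nat n / w"
  define q where "q = emb d (round (Re z)) (round (Im z / sqrt (real d)))"
  have sd: "sqrt (real d) > 0" using d_pos by simp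
  have "(cmod (z - q))\<^sup>2 \<le> 1 + real d"
  proof -
    have "\<bar>Re z - of_int (round (Re z))\<bar> \<le> 1 / 2" using of_int_round_abs_le[of "Re z"] by (simp add: abs_minus_commute)
    hence "\<bar>Re z - of_int (round (Re z))\<bar>\<^sup>2 \<le> 1\<^sup>2" by (intro power_mono) auto
    hence 1: "(Re z - of_int (round (Re z)))\<^sup>2 \<le> 1" by simp
    have "\<bar>Im z / sqrt (real d) - of_int (round (Im z / sqrt (real d)))\<bar> \<le> 1 / 2"
      using of_int_round_abs_le[of "Im z / sqrt (real d)"] by (simp add: abs_minus_commute)
    hence "\<bar>Im z / sqrt (real d) - of_int (round (Im z / sqrt (real d)))\<bar>\<^sup>2 \<le> 1\<^sup>2" by (intro power_mono) auto
    hence 2: "(Im z / sqrt (real d) - of_int (round (Im z / sqrt (real d))))\<^sup>2 \<le> 1" by simp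
    have "Im z - of_int (round (Im z / sqrt (real d))) * sqrt (real d)
        = sqrt (real d) * (Im z / sqrt (real d) - of_int (round (Im z / sqrt (real d))))"
      using sd by (simp add: right_diff_distrib)
    hence "(Im z - of_int (round (Im z / sqrt (real d))) * sqrt (real d))\<^sup>2
        = real d * (Im z / sqrt (real d) - of_int (round (Im z / sqrt (real d))))\<^sup>2"
      by (simp add: power_mult_distrib)
    also have "\<dots> \<le> real d * 1" using 2 by (intro mult_left_mono) auto
    finally have 3: "(Im z - of_int (round (Im z / sqrt (real d))) * sqrt (real d))\<^sup>2 \<le> real d" by simp
    have "(cmod (z - q))\<^sup>2 = (Re z - of_int (round (Re z)))\<^sup>2 + (Im z - of_int (round (Im z / sqrt (real d))) * sqrt (real d))\<^sup>2"
      by (simp add: cmod_power2 q_def emb_def sq_def)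
    thus ?thesis using 1 3 by linarith
  qed
  define v where "v = of_nat n - q * w"
  have "v = w * (z - q)" using w0 by (simp add: v_def z_def field_simps)
  hence "(cmod v)\<^sup>2 = (cmod w)\<^sup>2 * (cmod (z - q))\<^sup>2" by (simp add: norm_mult power_mult_distrib)
  also have "\<dots> \<le> ((1 + real d) * ((real M)\<^sup>2 * real (N D))) * (1 + real d)"
    using wn \<open>(cmod (z - q))\<^sup>2 \<le> _\<close> by (intro mult_mono) auto
  finally have bound: "(cmod v)\<^sup>2 \<le> (1 + real d)\<^sup>2 * (real M)\<^sup>2 * real (N D)" by (simp add: power2_eq_square mult_ac)
  have qR: "q \<in> Rg d" by (simp add: q_def)
  obtain u where u: "u \<in> J D" "w = of_nat M * u" using wMJ by (auto simp: MJ_def)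
  have uR: "u \<in> Rg d" using u J_Rg by blast
  have "w \<in> J D" using u J_mult by auto
  hence vJ: "v \<in> J D" unfolding v_def using n(2) qR by (intro J_diff J_mult)
  have "w \<in> multiples d M" using u uR by (auto simp: multiples_def)
  hence "(of_nat n - 1) - q * w \<in> multiples d M"
    by (intro multiples_diff[OF _ multiples_mult[OF qR]]) (use n(1) in \<open>auto simp: R1_def\<close>)
  moreover have "(of_nat n - 1) - q * w = v - 1" by (simp add: v_def)
  ultimately have "v \<in> R1" using vJ J_Rg by (auto simp: R1_def)
  thus ?thesis using vJ bound real_nq[OF R1_Rg] by (intro bexI[of _ v]) auto
qed

text \<open>Equality in the ray class group modulo \<open>M\<close>, written with two elements of
  \<open>R1\<close> so that no fractional ideals occur.\<close>

definition eqv :: "(nat \<times> int) multiset \<Rightarrow> (nat \<times> int) multiset \<Rightarrow> bool" where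
  "eqv D E \<longleftrightarrow> (\<exists>u\<in>R1. \<exists>v\<in>R1. D + dv u = E + dv v)"

lemma eqv_refl: "eqv D D" unfolding eqv_def using one_R1 by blast

lemma eqv_sym: "eqv D E \<Longrightarrow> eqv E D" unfolding eqv_def by metis

lemma dv_R1_mult: "u \<in> R1 \<Longrightarrow> v \<in> R1 \<Longrightarrow> dv (u * v) = dv u + dv v"
  by (simp add: dv_mult R1_Rg R1_nonzero)

lemma eqv_add: "eqv D E \<Longrightarrow> eqv D' E' \<Longrightarrow> eqv (D + D') (E + E')"
proof -
  assume "eqv D E" "eqv D' E'"
  then obtain u v u' v' where *: "u \<in> R1" "v \<in> R1" "D + dv u = E + dv v" "u' \<in> R1" "v' \<in> R1" "D' + dv u' = E' + dv v'"
    unfolding eqv_def by blast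
  have "(D + D') + dv (u * u') = (D + dv u) + (D' + dv u')" using *(1,4) by (simp add: dv_R1_mult add_ac)
  also have "\<dots> = (E + dv v) + (E' + dv v')" by (simp only: *)
  also have "\<dots> = (E + E') + dv (v * v')" using *(2,5) by (simp add: dv_R1_mult add_ac)
  finally show ?thesis unfolding eqv_def using * R1_mult by blast
qed

text \<open>Adding the two relations leaves \<open>E\<close> on both sides, and multisets
  cancel.\<close>

lemma eqv_trans: "eqv D E \<Longrightarrow> eqv E H \<Longrightarrow> eqv D H"
proof -
  assume "eqv D E" "eqv E H"
  from eqv_add[OF this] have "eqv (D + E) (E + H)" .
  then obtain u v where "u \<in> R1" "v \<in> R1" "(D + E) + dv u = (E + H) + dv v" unfolding eqv_def by blast
  hence "D + dv u = H + dv v" by (simp add: add_ac)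
  thus ?thesis unfolding eqv_def using \<open>u \<in> R1\<close> \<open>v \<in> R1\<close> by blast
qed

definition cls :: "(nat \<times> int) multiset \<Rightarrow> (nat \<times> int) multiset set" where
  "cls D = {E \<in> Divs. eqv D E}"

lemma cls_eq_iff: "D \<in> Divs \<Longrightarrow> E \<in> Divs \<Longrightarrow> cls D = cls E \<longleftrightarrow> eqv D E"
proof
  assume D: "D \<in> Divs" and E: "E \<in> Divs"
  show "eqv D E" if "cls D = cls E"
  proof -
    have "E \<in> cls D" unfolding that using E by (simp add: cls_def eqv_refl)
    thus ?thesis by (simp add: cls_def)
  qed
  show "cls D = cls E" if "eqv D E"
    unfolding cls_def using eqv_trans[OF that] eqv_trans[OF eqv_sym[OF that]] by auto
qed

definition rep :: "(nat \<times> int) multiset set \<Rightarrow> (nat \<times> int) multiset" where "rep A = (SOME D. D \<in> A)"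

text \<open>The product is formed on chosen representatives; by \<open>eqv_add\<close> its class
  does not depend on the choice.\<close>

definition CG :: "(nat \<times> int) multiset set monoid" where
  "CG = \<lparr>carrier = cls ` Divs, mult = (\<lambda>A B. cls (rep A + rep B)), one = cls {#}\<rparr>"

lemma rep_cls: "D \<in> Divs \<Longrightarrow> rep (cls D) \<in> Divs \<and> eqv D (rep (cls D))"
proof -
  assume D: "D \<in> Divs"
  hence "D \<in> cls D" by (simp add: cls_def eqv_refl)
  hence "rep (cls D) \<in> cls D" unfolding rep_def by (rule someI)
  thus ?thesis by (simp add: cls_def)
qed

lemma CG_mult: "D \<in> Divs \<Longrightarrow> E \<in> Divs \<Longrightarrow> cls D \<otimes>\<^bsub>CG\<^esub> cls E = cls (D + E)"
  using rep_cls[of D] rep_cls[of E] by (simp add: CG_def cls_eq_iff eqv_add eqv_sym)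

text \<open>A small element of \<open>R1\<close> in \<open>J D\<close> has divisor \<open>D\<close>
  plus a complement \<open>E\<close>. This provides inverses and, because the bound on
  \<open>N E\<close> is free of \<open>D\<close>, also the finiteness of the group.\<close>

lemma inverse_class:
  assumes D: "D \<in> Divs"
  shows "\<exists>E\<in>Divs. \<exists>v\<in>R1. D + E = dv v \<and> real (N E) \<le> (1 + real d)\<^sup>2 * (real M)\<^sup>2"
proof -
  obtain v where v: "v \<in> R1" "v \<in> J D" "real (nq v) \<le> (1 + real d)\<^sup>2 * (real M)\<^sup>2 * real (N D)"
    using small_R1_in_J[OF D] by blast
  note v' = R1_Rg[OF v(1)] R1_nonzero[OF v(1)]
  have "D \<subseteq># dv v" using J_iff_dv[OF D v'] v(2) by blast
  then obtain E where E: "dv v = D + E" by (metis subset_mset.le_iff_add)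
  have ED: "E \<in> Divs" using dv_Divs[OF v'] by (simp add: E)
  have "N D * N E = nq v" using N_dv[OF v' R1_coprime[OF v(1)]] by (simp add: E)
  hence "real (N D) * real (N E) \<le> real (N D) * ((1 + real d)\<^sup>2 * (real M)\<^sup>2)" using v(3) by (simp flip: of_nat_mult add: mult_ac)
  hence "real (N E) \<le> (1 + real d)\<^sup>2 * (real M)\<^sup>2" using N_pos[OF D] by simp
  thus ?thesis using ED E v(1) by metis
qed

lemma dv_one: "dv 1 = {#}"
proof (rule multiset_eqI)
  fix P
  have "val P 1 = 0" if "P \<in> Pr" using val_of_nat[OF that, of 1] by simp
  thus "count (dv 1) P = count {#} P" using count_dv[of 1 P] by simp
qed

lemma eqv_principal: "v \<in> R1 \<Longrightarrow> eqv (dv v) {#}"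
  unfolding eqv_def by (intro bexI[of _ 1] bexI[of _ v]) (auto simp: dv_one)

lemma CG_group: "comm_group CG"
proof (rule comm_groupI)
  fix A B assume "A \<in> carrier CG" "B \<in> carrier CG"
  then obtain D E where DE: "D \<in> Divs" "E \<in> Divs" "A = cls D" "B = cls E" by (auto simp: CG_def)
  thus "A \<otimes>\<^bsub>CG\<^esub> B \<in> carrier CG" by (simp add: CG_mult) (simp add: CG_def)
  show "A \<otimes>\<^bsub>CG\<^esub> B = B \<otimes>\<^bsub>CG\<^esub> A" using DE by (simp add: CG_mult add.commute)
  fix H assume "H \<in> carrier CG"
  then obtain F where F: "F \<in> Divs" "H = cls F" by (auto simp: CG_def)
  show "(A \<otimes>\<^bsub>CG\<^esub> B) \<otimes>\<^bsub>CG\<^esub> H = A \<otimes>\<^bsub>CG\<^esub> (B \<otimes>\<^bsub>CG\<^esub> H)" using DE F by (simp add: CG_mult add.assoc)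
next
  show "\<one>\<^bsub>CG\<^esub> \<in> carrier CG" by (simp add: CG_def)
  fix A assume "A \<in> carrier CG"
  then obtain D where D: "D \<in> Divs" "A = cls D" by (auto simp: CG_def)
  have one: "\<one>\<^bsub>CG\<^esub> = cls {#}" by (simp add: CG_def)
  show "\<one>\<^bsub>CG\<^esub> \<otimes>\<^bsub>CG\<^esub> A = A" unfolding one using D CG_mult[of "{#}" D] by simp
  obtain E v where E: "E \<in> Divs" "v \<in> R1" "D + E = dv v" using inverse_class[OF D(1)] by blast
  have "cls E \<otimes>\<^bsub>CG\<^esub> A = cls (dv v)" using D E CG_mult[of E D] by (simp add: add.commute)
  also have "\<dots> = \<one>\<^bsub>CG\<^esub>" unfolding one
    using cls_eq_iff[of "dv v" "{#}"] eqv_principal[OF E(2)] dv_Divs[OF R1_Rg R1_nonzero] E(2) by simp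
  finally show "\<exists>B\<in>carrier CG. B \<otimes>\<^bsub>CG\<^esub> A = \<one>\<^bsub>CG\<^esub>" using E by (auto simp: CG_def)
qed

lemma CG_finite: "finite (carrier CG)"
proof -
  interpret comm_group CG by (rule CG_group)
  have "carrier CG \<subseteq> (\<lambda>E. inv\<^bsub>CG\<^esub> (cls E)) ` Ile ((1 + real d)\<^sup>2 * (real M)\<^sup>2)"
  proof
    fix A assume A: "A \<in> carrier CG"
    then obtain D where D: "D \<in> Divs" "A = cls D" by (auto simp: CG_def)
    obtain E v where E: "E \<in> Divs" "v \<in> R1" "D + E = dv v" "real (N E) \<le> (1 + real d)\<^sup>2 * (real M)\<^sup>2"
      using inverse_class[OF D(1)] by blast
    have "A \<otimes>\<^bsub>CG\<^esub> cls E = cls (dv v)" using D E CG_mult[of D E] by simp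
    also have "\<dots> = \<one>\<^bsub>CG\<^esub>"
      using cls_eq_iff[of "dv v" "{#}"] eqv_principal[OF E(2)] dv_Divs[OF R1_Rg R1_nonzero] E(2) by (simp add: CG_def)
    finally have "A = inv\<^bsub>CG\<^esub> (cls E)" using A E by (intro inv_equality[symmetric]) (auto simp: CG_def)
    thus "A \<in> (\<lambda>E. inv\<^bsub>CG\<^esub> (cls E)) ` Ile ((1 + real d)\<^sup>2 * (real M)\<^sup>2)" using E by (auto simp: Ile_def)
  qed
  thus ?thesis by (rule finite_subset) (simp add: finite_Ile)
qed

text \<open>\<open>M\<close> is invertible modulo every power of a prime that occurs in
  \<open>D\<close>.\<close>

lemma mult_cancel_MJ:
  assumes D: "D \<in> Divs" and z: "z \<in> Rg d" "of_nat M * z \<in> J D"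
  shows "z \<in> J D"
proof -
  have "pdv P (count D P) z" if P: "P \<in># D" for P
  proof -
    have PP: "P \<in> Pr" using P D by (auto simp: Divs_def)
    have "pdv P (count D P) (of_nat M * z)" using z(2) P unfolding J_def by blast
    hence m: "of_nat M * (tau P ^ count D P * z) \<in> multiples d (fst P ^ count D P)" by (simp add: pdv_def mult_ac)
    have "coprime M (fst P ^ count D P)" using PrD(6)[OF PP] by (simp add: coprime_commute)
    then obtain a where "[M * a = Suc 0] (mod fst P ^ count D P)" using cong_solve_coprime_nat by metis
    hence "[M * a = 1] (mod fst P ^ count D P)" by simp
    hence "int (fst P ^ count D P) dvd int (M * a) - 1" by (metis cong_iff_dvd_diff cong_int_iff of_nat_1)
    hence "emb d (int (M * a) - 1) 0 \<in> multiples d (fst P ^ count D P)" using emb_in_multiples[OF d_pos] by simp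
    hence "of_nat (M * a) - 1 \<in> multiples d (fst P ^ count D P)" by (simp add: emb_def)
    hence "(tau P ^ count D P * z) * (of_nat (M * a) - 1) \<in> multiples d (fst P ^ count D P)" using z by (intro multiples_mult) auto
    moreover have "of_nat a * (of_nat M * (tau P ^ count D P * z)) \<in> multiples d (fst P ^ count D P)" by (rule multiples_mult[OF _ m]) simp
    ultimately have "of_nat a * (of_nat M * (tau P ^ count D P * z)) - (tau P ^ count D P * z) * (of_nat (M * a) - 1) \<in> multiples d (fst P ^ count D P)"
      by (rule multiples_diff[rotated])
    also have "of_nat a * (of_nat M * (tau P ^ count D P * z)) - (tau P ^ count D P * z) * (of_nat (M * a) - 1) = tau P ^ count D P * z"
      by (simp add: algebra_simps)
    finally show ?thesis by (simp add: pdv_def)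
  qed
  thus ?thesis using z unfolding J_def by blast
qed

text \<open>Ideals are traded for elements: as \<open>b\<close> lies in the inverse class of
  \<open>a0\<close>, an ideal \<open>D\<close> is in the class of \<open>a0\<close> when
  \<open>D + b\<close> has a generator congruent to 1.\<close>

lemma cls_iff:
  assumes "D \<in> Divs" "a0 \<in> Divs" "b \<in> Divs" "n \<in> R1" "a0 + b = dv n"
  shows "cls D = cls a0 \<longleftrightarrow> (\<exists>v\<in>R1. D + b = dv v)"
proof
  assume "cls D = cls a0"
  then obtain u v where uv: "u \<in> R1" "v \<in> R1" "D + dv u = a0 + dv v" using assms cls_eq_iff unfolding eqv_def by blast
  have "(D + b) + dv u = (a0 + b) + dv v" using uv(3) by (metis add.assoc add.commute)
  also have "\<dots> = dv (n * v)" using assms uv by (simp add: dv_R1_mult)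
  finally have "(D + b) + dv u = dv (n * v)" .
  from dv_div[OF uv(1) _ _ this] obtain z where z: "z \<in> Rg d" "n * v = u * z" "dv z = D + b"
    using R1_mult[OF assms(4) uv(2)] R1_Rg R1_nonzero by blast
  have "u * z - 1 \<in> multiples d M" using R1_mult[OF assms(4) uv(2)] z(2) by (simp add: R1_def)
  hence "z \<in> R1" using R1_cancel[OF uv(1) z(1)] z(1) by (simp add: R1_def)
  thus "\<exists>v\<in>R1. D + b = dv v" using z(3) by metis
next
  assume "\<exists>v\<in>R1. D + b = dv v"
  then obtain v where v: "v \<in> R1" "D + b = dv v" by blast
  have "D + dv n = a0 + dv v" using assms(5) v(2) by (metis add.assoc add.commute)
  thus "cls D = cls a0" using assms v cls_eq_iff unfolding eqv_def by blast
qed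

text \<open>\<open>M\<close> divides \<open>y\<close> and is at least 3, so norm 1 forces
  \<open>y = 0\<close>, and -1 is not congruent to 1 modulo \<open>M\<close>.\<close>

lemma R1_unit: assumes "z \<in> Rg d" "nq z = 1" "z - 1 \<in> multiples d M" shows "z = 1"
proof -
  obtain x y where z: "z = emb d x y" using assms(1) by (rule Rg_cases)
  have "emb d (x - 1) y \<in> multiples d M" 
  proof -
    have "z - 1 = emb d (x - 1) y" by (simp add: z emb_def)
    thus ?thesis using assms(3) by simp
  qed
  hence dv: "int M dvd x - 1" "int M dvd y" using emb_in_multiples[OF d_pos] by auto
  have n: "x\<^sup>2 + int d * y\<^sup>2 = 1" using assms(2) nq_emb[of d x y] by (simp add: z)
  have y: "y = 0"
  proof (rule ccontr)
    assume "y \<noteq> 0"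
    hence "\<bar>y\<bar> \<ge> 3" using dvd_imp_le_int[OF _ dv(2)] M_ge3 by simp
    hence "\<bar>y\<bar>\<^sup>2 \<ge> 3\<^sup>2" by (intro power_mono) auto
    hence "1 * 9 \<le> int d * y\<^sup>2" using d_pos by (intro mult_mono) auto
    moreover have "x\<^sup>2 \<ge> 0" by simp
    ultimately show False using n by linarith
  qed
  hence "x = 1 \<or> x = -1" using n by (simp add: power2_eq_1_iff)
  moreover have "x \<noteq> -1"
  proof
    assume "x = -1"
    hence "int M dvd -2" using dv by simp
    hence "int M \<le> 2" using dvd_imp_le_int[of "-2" "int M"] by simp
    thus False using M_ge3 by simp
  qed
  ultimately show ?thesis using y by (simp add: z emb_def)
qed

end

section \<open>Riesz means of ray classes and primes of the form \<open>nq v\<close>\<close>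

context imag_order
begin

text \<open>\<open>D\<close> corresponds to the generator \<open>v\<close> of \<open>D + b\<close>
  in \<open>R1\<close>, unique by \<open>R1_unit\<close>. These \<open>v\<close> run through
  \<open>R1 \<inter> J b\<close>, which is the single coset of \<open>v0\<close> modulo
  \<open>MJ b\<close>, and \<open>nq v = N D * N b\<close> matches the weights.\<close>

lemma class_riesz_eq:
  assumes b: "b \<in> Divs" and a0: "a0 \<in> Divs" "n \<in> R1" "a0 + b = dv n" and v0: "v0 \<in> R1" "v0 \<in> J b" and x: "x > 0"
  shows "(\<Sum>D\<in>{D \<in> Ile x. cls D = cls a0}. 1 - real (N D) / x) = rsum d (MJ b) v0 (x * real (N b))"
  unfolding rsum_def
proof (rule sum.reindex_bij_witness[of _ "\<lambda>v. dv v - b" "\<lambda>D. THE v. v \<in> R1 \<and> dv v = D + b"])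
  have Nb: "N b > 0" by (rule N_pos[OF b])
  have unique: "u = v" if uv: "u \<in> R1" "v \<in> R1" "dv u = dv v" for u v
  proof -
    obtain z where z: "z \<in> Rg d" "v = u * z" "dv z = {#}"
      using dv_div[OF uv(1) R1_Rg[OF uv(2)] R1_nonzero[OF uv(2)], of "{#}"] uv(3) by auto
    have "z - 1 \<in> multiples d M" using R1_cancel[OF uv(1) z(1), of 1] uv(2) by (simp add: z(2) R1_def)
    moreover from this have "z \<in> R1" using z(1) by (simp add: R1_def)
    hence "nq z = 1" using N_dv[OF z(1) R1_nonzero R1_coprime] z(3) by simp
    ultimately show ?thesis using R1_unit[OF z(1)] z(2) by simp
  qed
  have the_eq: "(THE u. u \<in> R1 \<and> dv u = dv v) = v" if "v \<in> R1" for v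
    using that unique by blast
  \<comment> \<open>The backward direction rests on \<open>mult_cancel_MJ\<close>: a difference
    divisible by \<open>M\<close> and lying in \<open>J b\<close> is \<open>M\<close> times an
    element of \<open>J b\<close>.\<close>
  have mem: "v \<in> pts d (MJ b) v0 (x * real (N b)) \<longleftrightarrow> v \<in> R1 \<and> v \<in> J b \<and> real (nq v) \<le> x * real (N b)" for v
  proof
    assume v: "v \<in> pts d (MJ b) v0 (x * real (N b))"
    hence vR: "v \<in> Rg d" and "v - v0 \<in> MJ b" by (auto simp: pts_def)
    then obtain u where u: "u \<in> J b" "v - v0 = of_nat M * u" by (auto simp: MJ_def)
    have "of_nat M * u \<in> J b" using u by (intro J_mult) auto
    moreover have "v = of_nat M * u - (-1) * v0" using u(2) by (simp add: algebra_simps)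
    moreover have "(-1) * v0 \<in> J b" by (intro J_mult v0) auto
    ultimately have "v \<in> J b" using J_diff by metis
    moreover have "v - 1 \<in> multiples d M"
    proof -
      have "v - 1 = of_nat M * u + (v0 - 1)" using u(2) by (simp add: algebra_simps)
      moreover have "of_nat M * u \<in> multiples d M" using u(1) J_Rg by (auto simp: multiples_def)
      moreover have "v0 - 1 \<in> multiples d M" using v0(1) by (simp add: R1_def)
      ultimately show ?thesis by (simp only: multiples_add)
    qed
    ultimately show "v \<in> R1 \<and> v \<in> J b \<and> real (nq v) \<le> x * real (N b)" using v vR by (simp add: R1_def real_nq pts_def)
  next
    assume v: "v \<in> R1 \<and> v \<in> J b \<and> real (nq v) \<le> x * real (N b)"
    have "(v - 1) - (v0 - 1) \<in> multiples d M" by (rule multiples_diff) (use v v0 in \<open>auto simp: R1_def\<close>)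
    then obtain z where z: "z \<in> Rg d" "v - v0 = of_nat M * z" by (auto simp: multiples_def)
    have "of_nat M * z \<in> J b" using J_diff[of v b v0] v v0 z by simp
    hence "z \<in> J b" by (rule mult_cancel_MJ[OF b z(1)])
    hence "v - v0 \<in> MJ b" using z by (auto simp: MJ_def)
    thus "v \<in> pts d (MJ b) v0 (x * real (N b))" using v real_nq[OF R1_Rg[of v]] R1_Rg[of v] by (simp add: pts_def)
  qed
  show "(THE v. v \<in> R1 \<and> dv v = D + b) \<in> pts d (MJ b) v0 (x * real (N b))"
    "dv (THE v. v \<in> R1 \<and> dv v = D + b) - b = D"
    "1 - (cmod (THE v. v \<in> R1 \<and> dv v = D + b))\<^sup>2 / (x * real (N b)) = 1 - real (N D) / x"
    if D: "D \<in> {D \<in> Ile x. cls D = cls a0}" for D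
  proof -
    have DD: "D \<in> Divs" "real (N D) \<le> x" using D by (auto simp: Ile_def)
    obtain v where v: "v \<in> R1" "D + b = dv v" using cls_iff[OF DD(1) a0(1) b a0(2,3)] D by auto
    have the: "(THE v. v \<in> R1 \<and> dv v = D + b) = v" unfolding v(2) by (rule the_eq[OF v(1)])
    note vR = R1_Rg[OF v(1)] R1_nonzero[OF v(1)]
    have "b \<subseteq># dv v" using v(2) by (metis mset_subset_eq_add_right)
    hence vJ: "v \<in> J b" using J_iff_dv[OF b vR] by blast
    have nv: "nq v = N D * N b" using N_dv[OF vR R1_coprime[OF v(1)]] by (simp flip: v(2))
    have "real (nq v) \<le> x * real (N b)" using DD(2) by (simp add: nv mult_right_mono)
    thus "(THE v. v \<in> R1 \<and> dv v = D + b) \<in> pts d (MJ b) v0 (x * real (N b))" unfolding the mem using v(1) vJ by blast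
    show "dv (THE v. v \<in> R1 \<and> dv v = D + b) - b = D" unfolding the v(2)[symmetric] by simp
    show "1 - (cmod (THE v. v \<in> R1 \<and> dv v = D + b))\<^sup>2 / (x * real (N b)) = 1 - real (N D) / x"
      unfolding the real_nq[OF vR(1), symmetric] nv using Nb by simp
  qed
  show "dv v - b \<in> {D \<in> Ile x. cls D = cls a0}" "(THE u. u \<in> R1 \<and> dv u = dv v - b + b) = v"
    if v: "v \<in> pts d (MJ b) v0 (x * real (N b))" for v
  proof -
    have v': "v \<in> R1" "v \<in> J b" "real (nq v) \<le> x * real (N b)" using v mem by auto
    note vR = R1_Rg[OF v'(1)] R1_nonzero[OF v'(1)]
    have sub: "b \<subseteq># dv v" using J_iff_dv[OF b vR] v'(2) by blast
    define D where "D = dv v - b"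
    have Db: "D + b = dv v" using sub by (simp add: D_def)
    have DD: "D \<in> Divs" using dv_Divs[OF vR] Db by (metis Divs_add)
    have nv: "nq v = N D * N b" using N_dv[OF vR R1_coprime[OF v'(1)]] by (simp flip: Db)
    have "real (N D) \<le> x" using v'(3) Nb by (simp add: nv)
    moreover have "cls D = cls a0" using cls_iff[OF DD a0(1) b a0(2,3)] Db v'(1) by blast
    ultimately show "dv v - b \<in> {D \<in> Ile x. cls D = cls a0}" using DD by (simp add: Ile_def flip: D_def)
    show "(THE u. u \<in> R1 \<and> dv u = dv v - b + b) = v" unfolding D_def[symmetric] Db by (rule the_eq[OF v'(1)])
  qed
qed

text \<open>The coset has density \<open>c / (M^2 * N b)\<close> and the norm bound is
  \<open>x * N b\<close>, so \<open>N b\<close> cancels and the main term is the same for all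
  classes. The constant \<open>C\<close> may vary with \<open>A\<close>, there being finitely many
  classes.\<close>

lemma class_riesz:
  assumes c: "\<And>X. X > 0 \<Longrightarrow> \<bar>Gtot d X - c * X\<bar> \<le> C0" and A: "A \<in> carrier CG"
  shows "\<exists>C. \<forall>x\<ge>1. \<bar>(\<Sum>D\<in>{D \<in> Ile x. cls D = A}. 1 - real (N D) / x) - c / (real M)\<^sup>2 * x\<bar> \<le> C"
proof -
  obtain a0 where a0: "a0 \<in> Divs" "A = cls a0" using A by (auto simp: CG_def)
  obtain b n where b: "b \<in> Divs" "n \<in> R1" "a0 + b = dv n" using inverse_class[OF a0(1)] by blast
  obtain k where v0: "of_nat k \<in> R1" "of_nat k \<in> J b" using R1_in_J[OF b(1)] by blast
  define v0 :: complex where "v0 = of_nat k"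
  have v0R: "v0 \<in> Rg d" by (simp add: v0_def)
  have Nb: "N b > 0" by (rule N_pos[OF b(1)])
  define m where "m = M * N b"
  have m: "m \<ge> 1" using Nb M_ge3 by (simp add: m_def)
  define n' where "n' = real (M\<^sup>2 * N b)"
  have n'0: "n' > 0" using Nb M_ge3 by (simp add: n'_def)
  obtain T where T: "finite T" "card T = M\<^sup>2 * N b" "T \<subseteq> Rg d" "\<forall>v\<in>Rg d. \<exists>!t. t \<in> T \<and> v - t \<in> MJ b"
    using transversal[OF b(1)] by (elim exE conjE) (rule that)
  define B where "B = 2 * (1 + real d) * (real m)\<^sup>2 * 9"
  have osc: "\<bar>rsum d (MJ b) u X - rsum d (MJ b) v X\<bar> \<le> B" if "X \<ge> 1" "u \<in> Rg d" "v \<in> Rg d" for u v X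
  proof -
    have "real (card (pts d (MJ b) z X)) \<le> 9 * X" if "z \<in> Rg d" for z
    proof -
      have "pts d (MJ b) z X \<subseteq> pts d (multiples d 1) z X" using MJ_Rg by (auto simp: pts_def multiples_1[simplified])
      hence "card (pts d (MJ b) z X) \<le> card (pts d (multiples d 1) z X)" by (rule card_mono[OF finite_pts[OF d_pos]])
      hence "real (card (pts d (MJ b) z X)) \<le> (2 * sqrt X / real 1 + 1)\<^sup>2"
        using pts_bound[OF d_pos le_refl _ that, of X] \<open>X \<ge> 1\<close> by linarith
      also have "\<dots> \<le> (3 * sqrt X)\<^sup>2" using \<open>X \<ge> 1\<close> by (intro power_mono) auto
      also have "\<dots> = 9 * X" using \<open>X \<ge> 1\<close> by (simp add: power_mult_distrib)
      finally show ?thesis .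
    qed
    from rsum_oscillation[OF d_pos m MJ_subgroup MJ_Rg multiples_subset_MJ[of b, folded m_def] _ this that(2,3)]
    show ?thesis using that(1) by (simp add: B_def)
  qed
  have "\<bar>(\<Sum>D\<in>{D \<in> Ile x. cls D = A}. 1 - real (N D) / x) - c / (real M)\<^sup>2 * x\<bar> \<le> B + C0 / n'" if x: "x \<ge> 1" for x
  proof -
    define X where "X = x * real (N b)"
    have X: "X \<ge> 1" unfolding X_def using x Nb mult_mono[of 1 x 1 "real (N b)"] by simp
    have "Gtot d X = (\<Sum>t\<in>T. rsum d (MJ b) (0 + t) X)"
      unfolding Gtot_def using T MJ_Rg by (intro rsum_split[OF d_pos]) (auto simp: add_subgroup_Rg)
    hence "Gtot d X - n' * rsum d (MJ b) v0 X = (\<Sum>t\<in>T. rsum d (MJ b) t X - rsum d (MJ b) v0 X)"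
      using T(2) by (simp add: sum_subtractf n'_def)
    also have "\<bar>\<dots>\<bar> \<le> (\<Sum>t\<in>T. B)"
      by (rule order.trans[OF sum_abs sum_mono]) (use osc[OF X _ v0R] T(3) in blast)
    also have "\<dots> = n' * B" using T(2) by (simp add: n'_def)
    finally have 1: "\<bar>Gtot d X - n' * rsum d (MJ b) v0 X\<bar> \<le> n' * B" .
    have 2: "\<bar>Gtot d X - c * X\<bar> \<le> C0" using c X by simp
    have "\<bar>n' * rsum d (MJ b) v0 X - c * X\<bar> \<le> n' * B + C0" using 1 2 by linarith
    hence "\<bar>n' * rsum d (MJ b) v0 X - c * X\<bar> / n' \<le> (n' * B + C0) / n'" using n'0 by (intro divide_right_mono) auto
    moreover have "\<bar>n' * rsum d (MJ b) v0 X - c * X\<bar> / n' = \<bar>(n' * rsum d (MJ b) v0 X - c * X) / n'\<bar>" using n'0 by simp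
    moreover have "(n' * rsum d (MJ b) v0 X - c * X) / n' = rsum d (MJ b) v0 X - c / (real M)\<^sup>2 * x"
    proof -
      have "c * X / n' = c / (real M)\<^sup>2 * x" using Nb by (simp add: X_def n'_def)
      thus ?thesis using n'0 by (simp add: diff_divide_distrib)
    qed
    moreover have "(n' * B + C0) / n' = B + C0 / n'" using n'0 by (simp add: add_divide_distrib)
    moreover have "(\<Sum>D\<in>{D \<in> Ile x. cls D = A}. 1 - real (N D) / x) = rsum d (MJ b) v0 X"
      unfolding a0(2) X_def v0_def using class_riesz_eq[OF b(1) a0(1) b(2,3) v0] x by simp
    ultimately show ?thesis by simp
  qed
  thus ?thesis by blast
qed

text \<open>Inert primes have norm \<open>l^2\<close>, and \<open>2 * ln l / l^2\<close> is summable
  over all integers; 12 is \<open>g 1 = 4\<close> plus the tail 8.\<close>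

lemma inert_sum_bounded:
  assumes "finite Z" "Z \<subseteq> {P. snd P = 0} \<inter> Pr"
  shows "(\<Sum>P\<in>Z. ln (real (nm P)) / real (nm P)) \<le> 12"
proof -
  define g where "g n = 4 * real n powr (-1/2 - 1)" for n :: nat
  have le: "ln (real (nm P)) / real (nm P) \<le> g (fst P)" if "P \<in> Z" for P
  proof -
    have n: "nm P = (fst P)\<^sup>2" "fst P > 0" using that assms(2) PrD(7)[of P] by (auto simp: nm_def)
    have "ln (real (fst P)) \<le> 2 * real (fst P) powr (1/2)" using ln_le_powr[of "real (fst P)" "1/2"] n by simp
    hence "2 * ln (real (fst P)) / (real (fst P))\<^sup>2 \<le> 4 * real (fst P) powr (1/2) / (real (fst P))\<^sup>2" by (intro divide_right_mono) auto
    also have "\<dots> = g (fst P)" using n powr_diff[of "real (fst P)" "1/2" 2] by (simp add: g_def powr_numeral)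
    finally show ?thesis using n by (simp add: ln_realpow)
  qed
  have inj: "inj_on fst Z" 
  proof (rule inj_onI)
    fix P Q assume "P \<in> Z" "Q \<in> Z" "fst P = fst Q"
    moreover from this have "snd P = 0" "snd Q = 0" using assms(2) by blast+
    ultimately show "P = Q" by (simp add: prod_eq_iff)
  qed
  obtain m where m: "\<And>P. P \<in> Z \<Longrightarrow> fst P \<le> m" using finite_nat_set_iff_bounded_le[of "fst ` Z"] assms(1) by auto
  have "(\<Sum>P\<in>Z. ln (real (nm P)) / real (nm P)) \<le> (\<Sum>P\<in>Z. g (fst P))" by (rule sum_mono) (rule le)
  also have "\<dots> = (\<Sum>n\<in>fst ` Z. g n)" using inj by (simp add: sum.reindex)
  also have "\<dots> \<le> (\<Sum>n\<in>insert 1 {1+1..1+m}. g n)"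
    using m assms(2) PrD(7) by (intro sum_mono2) (fastforce simp: g_def)+
  also have "\<dots> = g 1 + (\<Sum>n=1+1..1+m. g n)" by simp
  also have "(\<Sum>n=1+1..1+m. g n) \<le> 4 * (real 1 powr (-1/2) / (-(-1/2)))"
    unfolding g_def sum_distrib_left[symmetric] by (intro mult_left_mono sum_powr_tail) auto
  finally show ?thesis by (simp add: g_def)
qed

text \<open>A split prime \<open>P\<close> in the class of \<open>dv u\<close> satisfies
  \<open>{#P#} + dv a = dv (u * b)\<close> with \<open>a\<close> and \<open>b\<close> in
  \<open>R1\<close>. The quotient \<open>z = u * b / a\<close> has divisor \<open>P\<close>, is
  congruent to \<open>u\<close> modulo \<open>M\<close>, and has norm \<open>l\<close>.\<close>

theorem infinite_primes_of_norm_form: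
  assumes u: "u \<in> Rg d" "coprime (nq u) M"
  shows "infinite {l. prime l \<and> (\<exists>v\<in>Rg d. v - u \<in> multiples d M \<and> nq v = l)}"
proof -
  obtain c where c: "c > 0" "\<And>X. X > 0 \<Longrightarrow> \<bar>Gtot d X - c * X\<bar> \<le> 18 * (1 + real d)" using Gtot_asymp[OF d_pos] by blast
  have "\<forall>A\<in>carrier CG. \<exists>C. \<forall>x\<ge>1. \<bar>(\<Sum>D\<in>{D \<in> Ile x. cls D = A}. 1 - real (N D) / x) - c / (real M)\<^sup>2 * x\<bar> \<le> C"
    using class_riesz[OF c(2)] by blast
  from bchoice[OF this] obtain C where C: "\<forall>A\<in>carrier CG. \<forall>x\<ge>1. \<bar>(\<Sum>D\<in>{D \<in> Ile x. cls D = A}. 1 - real (N D) / x) - c / (real M)\<^sup>2 * x\<bar> \<le> C A"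
    by blast
  interpret CG: comm_group CG by (rule CG_group)
  interpret cs: class_semigroup Pr nm CG cls "c / (real M)\<^sup>2" "\<Sum>A\<in>carrier CG. \<bar>C A\<bar>"
  proof unfold_locales
    show "finite (carrier CG)" by (rule CG_finite)
    show "cls D \<in> carrier CG" if "D \<in> Divs" for D using that by (simp add: CG_def)
    show "cls (D + E) = cls D \<otimes>\<^bsub>CG\<^esub> cls E" if "D \<in> Divs" "E \<in> Divs" for D E using that by (simp add: CG_mult)
    show "cls {#} = \<one>\<^bsub>CG\<^esub>" by (simp add: CG_def)
    show "0 < c / (real M)\<^sup>2" using c(1) M_ge3 by simp
    show "0 \<le> (\<Sum>A\<in>carrier CG. \<bar>C A\<bar>)" by (simp add: sum_nonneg)
    fix A and x :: real assume A: "A \<in> carrier CG" and x: "1 \<le> x"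
    have "\<bar>(\<Sum>D\<in>{D \<in> Ile x. cls D = A}. 1 - real (N D) / x) - c / (real M)\<^sup>2 * x\<bar> \<le> \<bar>C A\<bar>" using C A x by fastforce
    also have "\<dots> \<le> (\<Sum>A\<in>carrier CG. \<bar>C A\<bar>)" using A CG_finite by (intro member_le_sum) auto
    finally show "\<bar>(\<Sum>D\<in>{D \<in> Ile x. cls D = A}. 1 - real (N D) / x) - c / (real M)\<^sup>2 * x\<bar> \<le> (\<Sum>A\<in>carrier CG. \<bar>C A\<bar>)" .
  qed
  note u0 = coprime_nonzero[OF u(2)]
  have uD: "dv u \<in> Divs" by (rule dv_Divs[OF u(1) u0])
  have inf: "infinite {P \<in> Pr - {P. snd P = 0}. cls {#P#} = cls (dv u)}"
    by (rule cs.infinite_primes_in_class[OF _ inert_sum_bounded]) (use uD in \<open>auto simp: CG_def\<close>)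
  have sub: "fst ` {P \<in> Pr - {P. snd P = 0}. cls {#P#} = cls (dv u)} \<subseteq> {l. prime l \<and> (\<exists>v\<in>Rg d. v - u \<in> multiples d M \<and> nq v = l)}"
  proof
    fix l assume "l \<in> fst ` {P \<in> Pr - {P. snd P = 0}. cls {#P#} = cls (dv u)}"
    then obtain P where P: "P \<in> Pr" "snd P \<noteq> 0" "cls {#P#} = cls (dv u)" "l = fst P" by auto
    have "eqv {#P#} (dv u)" using cls_eq_iff[of "{#P#}" "dv u"] P uD by simp
    then obtain a b where ab: "a \<in> R1" "b \<in> R1" "{#P#} + dv a = dv u + dv b" unfolding eqv_def by blast
    have "{#P#} + dv a = dv (u * b)" using ab(3) dv_mult[OF u(1) u0 R1_Rg[OF ab(2)] R1_nonzero[OF ab(2)]] by simp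
    from dv_div[OF ab(1) _ _ this] obtain z where z: "z \<in> Rg d" "u * b = a * z" "z \<noteq> 0" "dv z = {#P#}"
      using u(1) u0 R1_Rg[OF ab(2)] R1_nonzero[OF ab(2)] by auto
    have "a * z - u = u * (b - 1)" using z(2) by (simp add: algebra_simps)
    also have "\<dots> \<in> multiples d M" using ab(2) u(1) by (intro multiples_mult) (auto simp: R1_def)
    finally have zu: "z - u \<in> multiples d M" by (rule R1_cancel[OF ab(1) z(1)])
    have "nq z = N (dv z)" using N_dv[OF z(1,3) coprime_nq[OF u(1) z(1) zu u(2)]] by simp
    hence "nq z = l" using P(2,4) by (simp add: z(4) nm_def)
    moreover have "prime l" using PrD(1)[OF P(1)] P(4) by simp
    ultimately show "l \<in> {l. prime l \<and> (\<exists>v\<in>Rg d. v - u \<in> multiples d M \<and> nq v = l)}" using z(1) zu by auto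
  qed
  have "infinite (fst ` {P \<in> Pr - {P. snd P = 0}. cls {#P#} = cls (dv u)})"
  proof
    assume "finite (fst ` {P \<in> Pr - {P. snd P = 0}. cls {#P#} = cls (dv u)})"
    then obtain m where "\<forall>l\<in>fst ` {P \<in> Pr - {P. snd P = 0}. cls {#P#} = cls (dv u)}. l \<le> m"
      using finite_nat_set_iff_bounded_le by blast
    hence "{P \<in> Pr - {P. snd P = 0}. cls {#P#} = cls (dv u)} \<subseteq> {P \<in> Pr. fst P \<le> m}" by blast
    thus False using inf finite_subset finite_Pr_fst by blast
  qed
  thus ?thesis using sub infinite_super by blast
qed

end

section \<open>The ring of integers of the quadratic field\<close>

text \<open>\<open>trc\<close> and \<open>nrm\<close> are the trace and norm of \<open>om\<close>,
  the second element of an integral basis, which is half-integral in the case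
  \<open>d mod 4 = 3\<close>.\<close>

definition trc :: "nat \<Rightarrow> int" where "trc d = (if d mod 4 = 3 then 1 else 0)"
definition nrm :: "nat \<Rightarrow> int" where "nrm d = (if d mod 4 = 3 then (1 + int d) div 4 else int d)"
definition om :: "nat \<Rightarrow> complex" where "om d = (if d mod 4 = 3 then (1 + sq d) / 2 else sq d)"
definition el :: "nat \<Rightarrow> int \<Rightarrow> int \<Rightarrow> complex" where "el d a b = of_int a + of_int b * om d"

lemma nrm_4: "d mod 4 = 3 \<Longrightarrow> 4 * nrm d = 1 + int d"
  unfolding nrm_def by presburger

lemma om_square: "om d * om d = of_int (trc d) * om d - of_int (nrm d)"
proof (cases "d mod 4 = 3")
  case True
  have "of_int (4 * nrm d) = (1 + of_nat d :: complex)" unfolding nrm_4[OF True] by simp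
  hence n: "4 * of_int (nrm d) = (1 + of_nat d :: complex)" by simp
  have "4 * (om d * om d) = 1 + 2 * sq d + sq d * sq d"
    using True by (simp add: om_def algebra_simps)
  also have "\<dots> = 4 * (om d) - 4 * of_int (nrm d)"
    unfolding n sq_square using True by (simp add: om_def algebra_simps)
  finally have "4 * (om d * om d) = 4 * (om d - of_int (nrm d))" by (simp add: algebra_simps)
  hence "om d * om d = om d - of_int (nrm d)" by (metis mult_cancel_left zero_neq_numeral)
  thus ?thesis using True by (simp add: trc_def)
qed (simp add: om_def trc_def nrm_def sq_square)

lemma cnj_om: "cnj (om d) = of_int (trc d) - om d"
  by (simp add: om_def trc_def cnj_sq field_simps)

lemma sq_om: "sq d = (if d mod 4 = 3 then 2 * om d - 1 else om d)"
  by (simp add: om_def field_simps)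

lemma el_add: "el d a b + el d a' b' = el d (a + a') (b + b')"
  and el_uminus: "- el d a b = el d (- a) (- b)"
  and el_diff: "el d a b - el d a' b' = el d (a - a') (b - b')"
  and el_scale: "of_int n * el d a b = el d (n * a) (n * b)"
  and of_int_el: "of_int n = el d n 0"
  by (simp_all add: el_def algebra_simps)

lemma el_mult: "el d a b * el d a' b' = el d (a * a' - nrm d * (b * b')) (a * b' + b * a' + trc d * (b * b'))"
proof -
  have "el d a b * el d a' b' = of_int (a * a') + of_int (a * b' + b * a') * om d + of_int (b * b') * (om d * om d)"
    by (simp add: el_def algebra_simps)
  thus ?thesis unfolding om_square by (simp add: el_def algebra_simps)
qed

lemma cnj_el: "cnj (el d a b) = el d (a + trc d * b) (- b)"
  by (simp add: el_def cnj_om algebra_simps)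

lemma el_norm: "el d a b * cnj (el d a b) = of_int (a\<^sup>2 + trc d * (a * b) + nrm d * b\<^sup>2)"
  unfolding cnj_el el_mult of_int_el[of _ d] by (simp add: algebra_simps power2_eq_square)

lemma emb_el: "emb d x y = (if d mod 4 = 3 then el d (x - y) (2 * y) else el d x y)"
  by (simp add: emb_def el_def sq_om algebra_simps)

lemma two_el: "d mod 4 = 3 \<Longrightarrow> 2 * el d a b = emb d (2 * a + b) b"
  by (simp add: emb_el el_def algebra_simps)

lemma algebraic_int_el: "algebraic_int (el d a b)"
proof -
  define T where "T = 2 * a + trc d * b"
  define N where "N = a\<^sup>2 + trc d * (a * b) + nrm d * b\<^sup>2"
  define z where "z = el d a b"
  have s: "z + cnj z = of_int T" unfolding z_def cnj_el el_add T_def of_int_el[of _ d] by simp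
  have m: "z * cnj z = of_int N" unfolding z_def el_norm N_def ..
  have "z * z - of_int T * z + of_int N = 0" unfolding s[symmetric] m[symmetric] by (simp add: algebra_simps)
  moreover have "coeff [:of_int N, - of_int T, 1::complex:] i \<in> \<int>" for i
    by (auto simp: coeff_pCons split: nat.splits)
  ultimately show ?thesis unfolding z_def[symmetric]
    by (intro algebraic_int.intros[of "[:of_int N, - of_int T, 1:]"]) (auto simp: algebra_simps)
qed

lemma qfield_eq: "qfield d = {of_rat a + of_rat b * sq d | a b. True}"
  by (simp add: qfield_def sq_def)

lemma el_in_qfield: "el d a b \<in> qfield d"
proof (cases "d mod 4 = 3")
  case True
  have "el d a b = of_rat (of_int a + of_int b / 2) + of_rat (of_int b / 2) * sq d"
    using True by (simp add: el_def om_def of_rat_add of_rat_divide add_divide_distrib algebra_simps)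
  thus ?thesis unfolding qfield_eq by blast
next
  case False
  hence "el d a b = of_rat (of_int a) + of_rat (of_int b) * sq d" by (simp add: el_def om_def)
  thus ?thesis unfolding qfield_eq by blast
qed

lemma qfield_denominator:
  assumes "z \<in> qfield d" shows "\<exists>w>0. of_nat w * z \<in> Rg d"
proof -
  obtain a b :: rat where z: "z = of_rat a + of_rat b * sq d" using assms by (auto simp: qfield_eq)
  obtain a1 a2 where a: "a = of_int a1 / of_int a2" "a2 > 0"
    by (metis quotient_of_div quotient_of_denom_pos surj_pair)
  obtain b1 b2 where b: "b = of_int b1 / of_int b2" "b2 > 0"
    by (metis quotient_of_div quotient_of_denom_pos surj_pair)
  have "of_nat (nat (a2 * b2)) * z = emb d (a1 * b2) (b1 * a2)"
  proof -
    have "of_rat a * of_int a2 = (of_int a1 :: complex)" "of_rat b * of_int b2 = (of_int b1 :: complex)"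
      using a b by (simp_all add: of_rat_divide)
    moreover have "of_nat (nat (a2 * b2)) = (of_int (a2 * b2) :: complex)"
      using a(2) b(2) by (intro of_nat_nat) simp
    ultimately show ?thesis unfolding z emb_def by simp (metis (no_types, opaque_lifting) mult.assoc mult.commute distrib_left)
  qed
  thus ?thesis using a(2) b(2) by (intro exI[of _ "nat (a2 * b2)"]) auto
qed

lemma Rg_sum [intro]: "(\<And>i. i \<in> A \<Longrightarrow> f i \<in> Rg d) \<Longrightarrow> sum f A \<in> Rg d"
  by (induction A rule: infinite_finite_induct) auto

text \<open>The integral equation expresses all powers of \<open>z\<close> through those below its
  degree \<open>m\<close>, so \<open>w ^ m\<close> clears every denominator.\<close>

lemma alg_int_bounded_denominators:
  assumes "z \<in> qfield d" "algebraic_int z"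
  shows "\<exists>K>0. \<forall>k. of_nat K * z ^ k \<in> Rg d"
proof -
  obtain w where w: "w > 0" "of_nat w * z \<in> Rg d" using qfield_denominator[OF assms(1)] by auto
  obtain p where p: "lead_coeff p = 1" "\<And>i. coeff p i \<in> \<int>" "poly p z = 0"
    using assms(2) by (auto elim!: algebraic_int.cases)
  define m where "m = degree p"
  have "of_nat (w ^ m) * z ^ k \<in> Rg d" for k
  proof (induction k rule: less_induct)
    case (less k)
    show ?case
    proof (cases "k \<le> m")
      case True
      have "of_nat (w ^ m) * z ^ k = of_nat w ^ (m - k) * (of_nat w * z) ^ k"
        using True by (simp add: power_mult_distrib flip: power_add mult.assoc)
      thus ?thesis using w(2) by simp
    next
      case False
      have "0 = (\<Sum>i\<le>m. coeff p i * z ^ i)" using p(3) by (simp add: poly_altdef m_def)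
      also have "\<dots> = (\<Sum>i<m. coeff p i * z ^ i) + z ^ m"
        using p(1) by (simp add: m_def flip: lessThan_Suc_atMost)
      finally have zm: "z ^ m = - (\<Sum>i<m. coeff p i * z ^ i)" by (simp add: eq_neg_iff_add_eq_0 add.commute)
      have "z ^ k = z ^ (k - m) * z ^ m" using False by (simp flip: power_add)
      also have "\<dots> = - (\<Sum>i<m. coeff p i * z ^ (k - m + i))"
        unfolding zm by (simp add: sum_distrib_left power_add mult_ac)
      finally have "of_nat (w ^ m) * z ^ k = - (\<Sum>i<m. coeff p i * (of_nat (w ^ m) * z ^ (k - m + i)))"
        by (simp add: sum_distrib_left mult_ac)
      moreover have "coeff p i * (of_nat (w ^ m) * z ^ (k - m + i)) \<in> Rg d" if "i < m" for i
      proof -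
        obtain c where "coeff p i = of_int c" using p(2)[of i] by (auto elim: Ints_cases)
        thus ?thesis using less.IH[of "k - m + i"] that False by (simp del: of_nat_power)
      qed
      ultimately show ?thesis by (auto intro!: Rg_sum Rg_uminus)
    qed
  qed
  thus ?thesis using w(1) by (intro exI[of _ "w ^ m"]) auto
qed

text \<open>In lowest terms \<open>a / b\<close> every \<open>b ^ k\<close> divides
  \<open>K\<close>; taking \<open>k = K\<close> forces \<open>b = 1\<close>.\<close>

lemma rat_integral_of_powers:
  fixes q :: real
  assumes q: "q \<in> \<rat>" "q \<ge> 0" and K: "K > 0" "\<And>k. real K * q ^ k \<in> \<int>"
  shows "q \<in> \<nat>"
proof -
  obtain a b :: nat where ab: "b \<noteq> 0" "\<bar>q\<bar> = real a / real b" "coprime a b"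
    using Rats_abs_nat_div_natE[OF q(1)] by blast
  have "b ^ k dvd K" for k
  proof -
    obtain c where c: "real K * q ^ k = of_int c" using K(2)[of k] by (auto elim: Ints_cases)
    have "real K * real a ^ k = of_int c * real b ^ k"
    proof -
      have "q * real b = real a" using ab q(2) by simp
      hence "real K * real a ^ k = real K * q ^ k * real b ^ k"
        by (simp flip: power_mult_distrib)
      thus ?thesis using c by simp
    qed
    hence "real_of_int (int (K * a ^ k)) = of_int (c * int (b ^ k))" by simp
    hence "int (K * a ^ k) = c * int (b ^ k)" by (simp only: of_int_eq_iff)
    hence "b ^ k dvd K * a ^ k" by (metis dvd_triv_right int_dvd_int_iff)
    thus ?thesis using ab(3) by (simp add: coprime_commute coprime_dvd_mult_left_iff)
  qed
  hence "b ^ K \<le> K" using K(1) by (simp add: dvd_imp_le)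
  hence "b < 2" by (metis less_exp order.strict_trans1 power_mono zero_le not_less)
  hence "b = 1" using ab(1) by simp
  thus ?thesis using ab(2) q(2) by simp
qed

lemma nat_norm_of_bounded_denominators:
  assumes "d > 0" "z \<in> qfield d" "K > 0" "\<And>k. of_nat K * z ^ k \<in> Rg d"
  shows "(cmod z)\<^sup>2 \<in> \<nat>"
proof (rule rat_integral_of_powers)
  show "(cmod z)\<^sup>2 \<in> \<rat>"
  proof -
    obtain w where w: "w > 0" "of_nat w * z \<in> Rg d" using qfield_denominator[OF assms(2)] by auto
    have "(cmod z)\<^sup>2 = real (nq (of_nat w * z)) / real w ^ 2"
      using w(1) by (simp add: real_nq[OF w(2)] norm_mult power_mult_distrib)
    thus ?thesis by simp
  qed
  show "real (K\<^sup>2) * ((cmod z)\<^sup>2) ^ k \<in> \<int>" for k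
  proof -
    have "real (K\<^sup>2) * ((cmod z)\<^sup>2) ^ k = real (nq (of_nat K * z ^ k))"
      by (simp add: real_nq[OF assms(4)] norm_mult norm_power power_mult_distrib mult.commute flip: power_mult)
    thus ?thesis by (simp only: Ints_of_nat)
  qed
qed (use assms in auto)

lemma square_dvd_squarefree_mult:
  fixes a b n :: nat
  assumes "squarefree n" "coprime a b" "b\<^sup>2 dvd n * a\<^sup>2" shows "b = 1"
proof -
  have "b\<^sup>2 dvd n" using assms(2,3) by (simp add: coprime_commute coprime_dvd_mult_left_iff)
  thus ?thesis using assms(1) by (simp add: squarefree_def)
qed

text \<open>Integrality enters only through the absolute squares of \<open>z\<close> and
  \<open>z + 1\<close>, which are natural numbers; their difference gives an integral trace.\<close>

lemma OK_subset:
  assumes d: "d > 0" "squarefree d" and z: "z \<in> OK d"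
  shows "\<exists>a b. z = el d a b"
proof -
  have zq: "z \<in> qfield d" "algebraic_int z" using z by (auto simp: OK_def)
  obtain A B :: rat where AB: "z = of_rat A + of_rat B * sq d" using zq by (auto simp: qfield_eq)
  have cz: "cmod z ^ 2 = (real_of_rat A)\<^sup>2 + real d * (real_of_rat B)\<^sup>2"
    "cmod (z + 1) ^ 2 = (real_of_rat A + 1)\<^sup>2 + real d * (real_of_rat B)\<^sup>2"
  proof -
    have r: "of_rat c = complex_of_real (of_rat c)" for c
      by (cases c) (simp add: of_rat_rat)
    show "cmod z ^ 2 = (real_of_rat A)\<^sup>2 + real d * (real_of_rat B)\<^sup>2"
      "cmod (z + 1) ^ 2 = (real_of_rat A + 1)\<^sup>2 + real d * (real_of_rat B)\<^sup>2"
      unfolding AB r by (simp_all add: sq_def cmod_power2 power_mult_distrib)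
  qed
  have r: "of_rat c = complex_of_real (of_rat c)" for c
    by (cases c) (simp add: of_rat_rat)
  have "z + 1 = of_rat (A + 1) + of_rat B * sq d" unfolding AB by (simp add: of_rat_add)
  hence z1q: "z + 1 \<in> qfield d" unfolding qfield_eq by blast
  obtain K where K: "K > 0" "\<And>k. of_nat K * z ^ k \<in> Rg d"
    using alg_int_bounded_denominators[OF zq] by auto
  have K1: "of_nat K * (z + 1) ^ k \<in> Rg d" for k
  proof -
    have "of_nat K * (z + 1) ^ k = (\<Sum>i\<le>k. of_nat (k choose i) * (of_nat K * z ^ i))"
      by (simp add: binomial_ring sum_distrib_left mult_ac)
    thus ?thesis using K(2) by auto
  qed
  obtain q q1 where q: "(cmod z)\<^sup>2 = real q" "(cmod (z + 1))\<^sup>2 = real q1"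
    using nat_norm_of_bounded_denominators[OF d(1) zq(1) K] nat_norm_of_bounded_denominators[OF d(1) z1q K(1) K1]
    by (auto elim!: Nats_cases)
  \<comment> \<open>From \<open>(cmod (z + 1))^2 = (cmod z)^2 + 2 * Re z + 1\<close>.\<close>
  define x where "x = int q1 - int q - 1"
  have x: "2 * real_of_rat A = of_int x" using q cz by (simp add: x_def power2_eq_square algebra_simps)
  have B2: "2 * real_of_rat B \<in> \<rat>" by simp
  then obtain a b :: nat where ab: "b \<noteq> 0" "\<bar>2 * real_of_rat B\<bar> = real a / real b" "coprime a b"
    using Rats_abs_nat_div_natE[OF B2] by blast
  have e: "real d * (2 * real_of_rat B)\<^sup>2 = of_int (4 * int q - x\<^sup>2)"
    using q(1) cz(1) by (simp add: power2_eq_square algebra_simps flip: x)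
  have "(2 * real_of_rat B)\<^sup>2 = (real a / real b)\<^sup>2" using ab(2) by (metis power2_abs)
  hence "real d * (real a)\<^sup>2 = of_int (4 * int q - x\<^sup>2) * (real b)\<^sup>2"
  proof -
    have "(2 * real_of_rat B)\<^sup>2 * (real b)\<^sup>2 = (real a)\<^sup>2"
      using \<open>(2 * real_of_rat B)\<^sup>2 = (real a / real b)\<^sup>2\<close> ab(1) by (simp add: power_divide)
    thus ?thesis by (metis e mult.assoc)
  qed
  hence "real_of_int (int (d * a\<^sup>2)) = real_of_int ((4 * int q - x\<^sup>2) * int (b\<^sup>2))" by simp
  hence "int (d * a\<^sup>2) = (4 * int q - x\<^sup>2) * int (b\<^sup>2)" by (simp only: of_int_eq_iff)
  hence "b\<^sup>2 dvd d * a\<^sup>2" by (metis dvd_triv_right int_dvd_int_iff)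
  \<comment> \<open>Squarefreeness of \<open>d\<close> rules out a denominator in
    \<open>2 * B\<close>.\<close>
  hence b: "b = 1" by (rule square_dvd_squarefree_mult[OF d(2) ab(3)])
  define y where "y = (if real_of_rat B < 0 then - int a else int a)"
  have y: "2 * real_of_rat B = of_int y" using ab(2) b by (auto simp: y_def)
  have "real_of_int (int d * y\<^sup>2) = of_int (4 * int q - x\<^sup>2)" using e y by simp
  hence xy: "int d * y\<^sup>2 = 4 * int q - x\<^sup>2" by (simp only: of_int_eq_iff)
  have "2 * z = of_real (2 * real_of_rat A) + of_real (2 * real_of_rat B) * sq d" unfolding AB r by simp
  hence z2: "2 * z = of_int x + of_int y * sq d" unfolding x y by simp
  have d4: "d mod 4 \<noteq> 0"
  proof
    assume "d mod 4 = 0"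
    hence "2\<^sup>2 dvd d" by (simp add: dvd_eq_mod_eq_0)
    thus False using d(2) unfolding squarefree_def by (metis nat_dvd_1_iff_1 numeral_eq_one_iff semiring_norm(85))
  qed
  \<comment> \<open>The norm condition modulo 4 decides the parities: \<open>x\<close> and
    \<open>y\<close> have equal parity if \<open>d mod 4 = 3\<close> and are both even
    otherwise.\<close>
  have m4: "(x\<^sup>2 + int d * y\<^sup>2) mod 4 = 0" unfolding xy by simp
  show ?thesis
  proof (cases "d mod 4 = 3")
    case True
    have "even (x - y)"
    proof -
      have "odd d" using True by presburger
      have "even (x\<^sup>2 + int d * y\<^sup>2)" unfolding xy by simp
      thus ?thesis using \<open>odd d\<close> by simp
    qed
    then obtain c where "x - y = 2 * c" by blast
    hence "x = y + 2 * c" by simp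
    hence "2 * z = 2 * el d c y" using True z2 by (simp add: two_el emb_def algebra_simps)
    thus ?thesis by auto
  next
    case False
    have dd: "d mod 4 = 1 \<or> d mod 4 = 2" using d4 False by presburger
    have sqm: "n\<^sup>2 mod 4 = (if even n then 0 else 1)" for n :: int
    proof (cases "even n")
      case True
      then obtain k where "n = 2 * k" by blast
      thus ?thesis by (simp add: power2_eq_square)
    next
      case False
      then obtain k where "n = 2 * k + 1" by (elim oddE)
      hence "n\<^sup>2 = 4 * (k * k + k) + 1" by (simp add: power2_eq_square algebra_simps)
      thus ?thesis using False by presburger
    qed
    have "(x\<^sup>2 mod 4 + (int d mod 4) * (y\<^sup>2 mod 4)) mod 4 = 0"
      using m4 mod_add_cong[OF mod_mod_trivial mod_mult_cong[OF mod_mod_trivial mod_mod_trivial], of "x\<^sup>2" 4 "int d" "y\<^sup>2"]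
      by presburger
    moreover have "int d mod 4 = int (d mod 4)" by (simp add: zmod_int)
    ultimately have "even x \<and> even y" using dd by (auto simp: sqm split: if_splits)
    then obtain x' y' where "x = 2 * x'" "y = 2 * y'" by blast
    hence "2 * z = 2 * el d x' y'" using False z2 by (simp add: el_def om_def algebra_simps)
    thus ?thesis by auto
  qed
qed

lemma OK_el [intro, simp]: "el d a b \<in> OK d"
  using algebraic_int_el el_in_qfield by (simp add: OK_def)

lemma OK_cases:
  assumes "d > 0" "squarefree d" "z \<in> OK d" obtains a b where "z = el d a b"
  using OK_subset[OF assms] by blast

lemma Rg_subset_OK: "Rg d \<subseteq> OK d"
  by (auto elim!: Rg_cases simp: emb_el)

section \<open>Ideals and split primes\<close>

locale quad_field =
  fixes d :: nat
  assumes d_pos: "d > 0" and d_sqf: "squarefree d"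
begin

lemmas elE = OK_cases[OF d_pos d_sqf]

lemma OK_add [intro, simp]: "x \<in> OK d \<Longrightarrow> y \<in> OK d \<Longrightarrow> x + y \<in> OK d"
  and OK_diff [intro, simp]: "x \<in> OK d \<Longrightarrow> y \<in> OK d \<Longrightarrow> x - y \<in> OK d"
  and OK_mult [intro, simp]: "x \<in> OK d \<Longrightarrow> y \<in> OK d \<Longrightarrow> x * y \<in> OK d"
  and OK_uminus [intro, simp]: "x \<in> OK d \<Longrightarrow> - x \<in> OK d"
  and OK_cnj [intro, simp]: "x \<in> OK d \<Longrightarrow> cnj x \<in> OK d"
  by (auto elim!: elE simp: el_add el_mult el_diff el_uminus cnj_el)

lemma OK_of_int [intro, simp]: "of_int n \<in> OK d" by (simp add: of_int_el[of n d])
lemma OK_of_nat [intro, simp]: "of_nat n \<in> OK d" using OK_of_int[of "int n"] by (simp del: OK_of_int)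
lemma OK_0 [intro, simp]: "0 \<in> OK d" and OK_1 [intro, simp]: "1 \<in> OK d"
  using OK_of_int[of 0] OK_of_int[of 1] by (simp_all del: OK_of_int)
lemma OK_power [intro, simp]: "x \<in> OK d \<Longrightarrow> x ^ n \<in> OK d" by (induction n) auto
lemma OK_om [intro, simp]: "om d \<in> OK d" using OK_el[of d 0 1] by (simp add: el_def del: OK_el)

lemma OK_norm: "x \<in> OK d \<Longrightarrow> \<exists>n. x * cnj x = of_int n"
  by (elim elE) (metis el_norm)

lemma is_ideal_OK: "is_ideal d (OK d)" by (auto simp: is_ideal_def)

lemma is_ideal_mult: "is_ideal d (ideal_mult d I J)" if "I \<subseteq> OK d" "J \<subseteq> OK d"
proof -
  have "ideal_mult d I J \<subseteq> OK d"
    unfolding ideal_mult_def using that is_ideal_OK by (intro Inter_lower) auto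
  thus ?thesis unfolding is_ideal_def[of d "ideal_mult d I J"]
    by (auto simp: ideal_mult_def is_ideal_def)
qed

lemma ideal_multI: "x \<in> I \<Longrightarrow> y \<in> J \<Longrightarrow> x * y \<in> ideal_mult d I J"
  by (auto simp: ideal_mult_def)

lemma ideal_mult_least:
  "is_ideal d K \<Longrightarrow> (\<And>x y. x \<in> I \<Longrightarrow> y \<in> J \<Longrightarrow> x * y \<in> K) \<Longrightarrow> ideal_mult d I J \<subseteq> K"
  by (auto simp: ideal_mult_def)

lemma idealD:
  assumes "is_ideal d I"
  shows "I \<subseteq> OK d" "0 \<in> I" "x \<in> I \<Longrightarrow> y \<in> I \<Longrightarrow> x + y \<in> I" "x \<in> I \<Longrightarrow> - x \<in> I"
    "x \<in> I \<Longrightarrow> y \<in> I \<Longrightarrow> x - y \<in> I" "r \<in> OK d \<Longrightarrow> x \<in> I \<Longrightarrow> r * x \<in> I" "r \<in> OK d \<Longrightarrow> x \<in> I \<Longrightarrow> x * r \<in> I"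
proof -
  have "x \<in> I \<Longrightarrow> y \<in> I \<Longrightarrow> x + (- y) \<in> I" using assms unfolding is_ideal_def by blast
  thus "x \<in> I \<Longrightarrow> y \<in> I \<Longrightarrow> x - y \<in> I" by simp
  show "r \<in> OK d \<Longrightarrow> x \<in> I \<Longrightarrow> x * r \<in> I"
    using assms unfolding is_ideal_def by (subst mult.commute) blast
qed (use assms in \<open>auto simp: is_ideal_def\<close>)

lemma is_ideal_pow: "is_ideal d P \<Longrightarrow> is_ideal d (ideal_pow d P n)"
proof (induction n)
  case 0
  thus ?case by (simp add: ideal_pow_def is_ideal_OK)
next
  case (Suc n)
  thus ?case using is_ideal_mult[of P "ideal_pow d P n"] idealD(1) by (simp add: ideal_pow_def)
qed

lemma ideal_pow_Suc: "x \<in> P \<Longrightarrow> y \<in> ideal_pow d P n \<Longrightarrow> x * y \<in> ideal_pow d P (Suc n)"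
  by (simp add: ideal_pow_def ideal_multI)

lemma ideal_pow_power: "x \<in> P \<Longrightarrow> x ^ n \<in> ideal_pow d P n"
proof (induction n)
  case (Suc n)
  thus ?case using ideal_pow_Suc[of x P "x ^ n" n] by simp
qed (simp add: ideal_pow_def)

lemma is_ideal_principal: assumes "x \<in> OK d" shows "is_ideal d (principal_ideal d x)"
  unfolding is_ideal_def
proof (intro conjI ballI subsetI)
  show "0 \<in> principal_ideal d x" by (auto simp: principal_ideal_def intro: exI[of _ 0])
  fix u assume "u \<in> principal_ideal d x"
  then obtain r where r: "u = r * x" "r \<in> OK d" by (auto simp: principal_ideal_def)
  thus "u \<in> OK d" using assms by simp
  show "- u \<in> principal_ideal d x"
    unfolding principal_ideal_def using r by (auto intro: exI[of _ "- r"])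
  show "s * u \<in> principal_ideal d x" if "s \<in> OK d" for s
    unfolding principal_ideal_def using r that by (auto intro!: exI[of _ "s * r"])
  fix v assume "v \<in> principal_ideal d x"
  then obtain s where s: "v = s * x" "s \<in> OK d" by (auto simp: principal_ideal_def)
  have "u + v = (r + s) * x" using r s by (simp add: algebra_simps)
  thus "u + v \<in> principal_ideal d x" using r s by (auto simp: principal_ideal_def)
qed

lemma principalI: "r \<in> OK d \<Longrightarrow> r * x \<in> principal_ideal d x"
  by (auto simp: principal_ideal_def)

text \<open>By Bezout, an integer prime to \<open>p\<close> in \<open>P\<close> would put 1 into
  \<open>P\<close>.\<close>

lemma prime_ideal_of_int:
  assumes P: "prime_ideal d P" "of_nat p \<in> P" and p: "prime p"
  shows "of_int n \<in> P \<longleftrightarrow> int p dvd n"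
proof
  have I: "is_ideal d P" using P by (simp add: prime_ideal_def)
  note ID = idealD[OF I]
  have p_mult: "of_int (k * int p) \<in> P" for k
    using ID(6)[OF OK_of_int[of k] P(2)] by simp
  show "of_int n \<in> P" if "int p dvd n"
  proof -
    obtain k where "n = int p * k" using \<open>int p dvd n\<close> by blast
    thus ?thesis using p_mult[of k] by (simp add: mult.commute)
  qed
  show "int p dvd n" if n: "of_int n \<in> P"
  proof (rule ccontr)
    assume "\<not> int p dvd n"
    hence "coprime (int p) n" using p by (simp add: prime_imp_coprime)
    then obtain a b where ab: "a * int p + b * n = 1" using bezout_int[of "int p" n] by auto
    have "of_int (a * int p) + of_int b * of_int n \<in> P" by (intro ID(3,6) p_mult n) simp
    moreover have "of_int (a * int p) + of_int b * of_int n = (of_int (a * int p + b * n) :: complex)" by simp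
    ultimately have one: "1 \<in> P" unfolding ab by simp
    have "OK d \<subseteq> P" using ID(6)[OF _ one] by auto
    thus False using P(1) ID(1) by (auto simp: prime_ideal_def)
  qed
qed

section \<open>The minimal polynomial of \<open>om d\<close>, its roots modulo \<open>p\<close>, and
  powers of prime ideals\<close>

definition fpol :: "int \<Rightarrow> int" where "fpol s = s\<^sup>2 - trc d * s + nrm d"

lemma el_shift: "el d a b = of_int (a + b * s) + of_int b * (om d - of_int s)"
  by (simp add: el_def algebra_simps)

lemma om_root_mult: "(om d - of_int s) * (om d - of_int (trc d - s)) = of_int (- fpol s)"
proof -
  have "(om d - of_int s) * (om d - of_int (trc d - s)) = om d * om d - of_int (trc d) * om d + of_int (s * (trc d - s))"
    by (simp add: algebra_simps)
  thus ?thesis unfolding om_square by (simp add: fpol_def power2_eq_square algebra_simps)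
qed

lemma root_in_prime_ideal:
  assumes P: "prime_ideal d P" "of_nat p \<in> P" and p: "prime p" and s: "int p dvd fpol s"
  shows "om d - of_int s \<in> P \<or> om d - of_int (trc d - s) \<in> P"
proof -
  have "of_int (- fpol s) \<in> P" unfolding prime_ideal_of_int[OF P p] using s by simp
  hence "(om d - of_int s) * (om d - of_int (trc d - s)) \<in> P" by (simp only: om_root_mult)
  thus ?thesis using P(1) unfolding prime_ideal_def by (meson OK_diff OK_of_int OK_om)
qed

text \<open>Without a root, or with a double root, only one prime ideal contains \<open>p\<close>,
  against \<open>P \<noteq> Q\<close>. Without a root the norm form is anisotropic modulo
  \<open>p\<close>, so the ideal is generated by \<open>p\<close>; at a double root \<open>s\<close>
  it is the kernel of the reduction that sends \<open>om d\<close> to \<open>s\<close>.\<close>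

lemma splits_simple_root:
  assumes sp: "splits d p" and p: "prime p"
  shows "\<exists>s. int p dvd fpol s \<and> \<not> int p dvd 2 * s - trc d"
proof -
  obtain P Q where PQ: "prime_ideal d P" "prime_ideal d Q" "P \<noteq> Q" "ideal_mult d P Q = principal_ideal d (of_nat p)"
    using sp by (auto simp: splits_def)
  have I: "is_ideal d P" "is_ideal d Q" using PQ by (auto simp: prime_ideal_def)
  have "of_nat p \<in> principal_ideal d (of_nat p)" using principalI[of 1 "of_nat p"] by simp
  hence pPQ: "of_nat p \<in> ideal_mult d P Q" using PQ by simp
  have "ideal_mult d P Q \<subseteq> P" using idealD[OF I(1)] idealD(1)[OF I(2)] by (intro ideal_mult_least I) auto
  moreover have "ideal_mult d P Q \<subseteq> Q" using idealD[OF I(2)] idealD(1)[OF I(1)] by (intro ideal_mult_least I) auto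
  ultimately have pP: "of_nat p \<in> P" "of_nat p \<in> Q" using pPQ by auto
  have "\<exists>s. int p dvd fpol s"
  proof (rule ccontr)
    assume no: "\<nexists>s. int p dvd fpol s"
    have "R = principal_ideal d (of_nat p)" if R: "prime_ideal d R" "of_nat p \<in> R" for R
    proof
      have IR: "is_ideal d R" using R by (simp add: prime_ideal_def)
      show "principal_ideal d (of_nat p) \<subseteq> R" using idealD(6)[OF IR _ R(2)] by (auto simp: principal_ideal_def)
      show "R \<subseteq> principal_ideal d (of_nat p)"
      proof
        fix x assume x: "x \<in> R"
        then obtain a b where ab: "x = el d a b" using idealD(1)[OF IR] by (meson elE subsetD)
        have "x * cnj x \<in> R" using idealD(7)[OF IR _ x] idealD(1)[OF IR] x by auto
        hence nd: "int p dvd a\<^sup>2 + trc d * (a * b) + nrm d * b\<^sup>2"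
          unfolding ab el_norm by (simp only: prime_ideal_of_int[OF R p])
        have pb: "int p dvd b"
        proof (rule ccontr)
          assume "\<not> int p dvd b"
          hence "coprime (int p) b" using p by (simp add: prime_imp_coprime)
          then obtain u v where uv: "u * int p + v * b = 1" using bezout_int[of "int p" b] by auto
          have vb: "v * b = 1 - u * int p" using uv by simp
          have "v\<^sup>2 * (a\<^sup>2 + trc d * (a * b) + nrm d * b\<^sup>2)
            = (v * a)\<^sup>2 + trc d * (v * a) * (v * b) + nrm d * (v * b)\<^sup>2"
            by (simp add: power2_eq_square algebra_simps)
          also have "\<dots> = fpol (- (v * a)) + int p * (- trc d * (v * a) * u + nrm d * (- 2 * u + u\<^sup>2 * int p))"
            unfolding vb fpol_def by (simp add: power2_eq_square algebra_simps)
          finally have "int p dvd fpol (- (v * a))" using nd by (metis dvd_add_left_iff dvd_mult dvd_triv_left)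
          thus False using no by blast
        qed
        have "int p dvd a\<^sup>2"
        proof -
          have "int p dvd trc d * (a * b) + nrm d * b\<^sup>2" using pb by (simp add: power2_eq_square)
          thus ?thesis using nd by (simp add: add.assoc dvd_add_left_iff)
        qed
        hence "int p dvd a" using p by (simp add: prime_dvd_power_int_iff)
        then obtain a' b' where "a = int p * a'" "b = int p * b'" using pb by blast
        hence "x = el d a' b' * of_nat p" unfolding ab by (simp add: el_def algebra_simps)
        thus "x \<in> principal_ideal d (of_nat p)" by (simp add: principalI)
      qed
    qed
    thus False using PQ pP by blast
  qed
  then obtain s where s: "int p dvd fpol s" by blast
  have "\<not> int p dvd 2 * s - trc d"
  proof
    assume dbl: "int p dvd 2 * s - trc d"
    have "R = {el d a b | a b. int p dvd a + b * s}" if R: "prime_ideal d R" "of_nat p \<in> R" for R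
    proof -
      have IR: "is_ideal d R" using R by (simp add: prime_ideal_def)
      have "of_int (2 * s - trc d) \<in> R" unfolding prime_ideal_of_int[OF R p] by (rule dbl)
      moreover have "om d - of_int s = om d - of_int (trc d - s) - of_int (2 * s - trc d)" by simp
      ultimately have os: "om d - of_int s \<in> R" using root_in_prime_ideal[OF R p s] idealD(5)[OF IR] by metis
      have "el d a b \<in> R \<longleftrightarrow> int p dvd a + b * s" for a b
      proof -
        have o: "of_int b * (om d - of_int s) \<in> R" using idealD(6)[OF IR _ os] by simp
        have "el d a b \<in> R \<longleftrightarrow> of_int (a + b * s) \<in> R"
          using idealD(3)[OF IR _ o, of "of_int (a + b * s)"] idealD(5)[OF IR _ o, of "el d a b"]
          by (auto simp: el_shift[of a b s] simp del: of_int_add of_int_mult)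
        thus ?thesis unfolding prime_ideal_of_int[OF R p] .
      qed
      thus ?thesis using idealD(1)[OF IR] by (blast elim: elE)
    qed
    thus False using PQ pP by blast
  qed
  thus ?thesis using s by blast
qed

text \<open>Newton's step: \<open>2 * S - trc d\<close> is the derivative of \<open>fpol\<close> at
  \<open>S\<close> and stays invertible modulo \<open>p\<close>.\<close>

lemma hensel_fpol:
  assumes p: "prime p" and s: "int p dvd fpol s" "\<not> int p dvd 2 * s - trc d"
  shows "\<exists>S. int p ^ Suc n dvd fpol S \<and> int p dvd S - s"
proof (induction n)
  case 0
  show ?case using s by (auto intro: exI[of _ s])
next
  case (Suc n)
  then obtain S where S: "int p ^ Suc n dvd fpol S" "int p dvd S - s" by blast
  have "\<not> int p dvd 2 * S - trc d"
  proof
    assume "int p dvd 2 * S - trc d"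
    hence "int p dvd (2 * S - trc d) - 2 * (S - s)" by (rule dvd_diff) (rule dvd_mult[OF S(2)])
    thus False using s(2) by (simp add: algebra_simps)
  qed
  hence "coprime (int p) (2 * S - trc d)" using p by (simp add: prime_imp_coprime)
  then obtain u v where uv: "u * int p + v * (2 * S - trc d) = 1" using bezout_int[of "int p" "2 * S - trc d"] by auto
  obtain k where k: "fpol S = int p ^ Suc n * k" using S(1) by blast
  define h where "h = int p ^ Suc n"
  define S' where "S' = S - h * (k * v)"
  have "fpol S' = fpol S - h * (k * v) * (2 * S - trc d) + h\<^sup>2 * (k * v)\<^sup>2"
    unfolding S'_def fpol_def by (simp add: power2_eq_square algebra_simps)
  also have "\<dots> = h * k * (1 - v * (2 * S - trc d)) + h\<^sup>2 * (k * v)\<^sup>2"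
    unfolding k h_def by (simp add: algebra_simps)
  also have "1 - v * (2 * S - trc d) = u * int p" using uv by simp
  finally have "fpol S' = h * int p * (k * u) + h\<^sup>2 * (k * v)\<^sup>2" by (simp add: algebra_simps)
  moreover have "h * int p dvd h\<^sup>2" unfolding power2_eq_square by (intro mult_dvd_mono) (auto simp: h_def)
  ultimately have "h * int p dvd fpol S'" by simp
  moreover have "h * int p = int p ^ Suc (Suc n)" by (simp add: h_def)
  moreover have "int p dvd S' - s"
  proof -
    have "int p dvd (S - s) - h * (k * v)" by (rule dvd_diff[OF S(2)]) (simp add: h_def)
    thus ?thesis by (simp add: S'_def algebra_simps)
  qed
  ultimately show ?case by metis
qed

text \<open>For \<open>r = om d - S\<close> the relation \<open>r^2 = c * r - fpol S\<close> makes
  \<open>r ^ n\<close> congruent to \<open>c ^ (n - 1) * r\<close> modulo \<open>p ^ n\<close>. As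
  \<open>c\<close> is a unit modulo \<open>p\<close> and \<open>r ^ n\<close> lies in the
  \<open>n\<close>-th power of \<open>P\<close>, so does \<open>r\<close>.\<close>

lemma el_in_ideal_pow:
  assumes P: "prime_ideal d P" "of_nat p \<in> P" and p: "prime p"
    and S: "int p ^ n dvd fpol S" "\<not> int p dvd 2 * S - trc d" "om d - of_int S \<in> P"
    and ab: "int p ^ n dvd a + b * S"
  shows "el d a b \<in> ideal_pow d P n"
proof -
  have I: "is_ideal d P" using P by (simp add: prime_ideal_def)
  note IP = idealD[OF is_ideal_pow[OF I, of n]]
  have ppow: "of_int (int p ^ n * k) * z \<in> ideal_pow d P n" if "z \<in> OK d" for k z
    using IP(6)[OF OK_mult[OF OK_of_int[of k] that] ideal_pow_power[OF P(2)]] by (simp add: mult_ac)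
  define r where "r = om d - of_int S"
  define c where "c = trc d - 2 * S"
  have rO: "r \<in> OK d" by (simp add: r_def)
  have "r * r = r * (om d - of_int (trc d - S)) + of_int c * r" by (simp add: r_def c_def algebra_simps)
  hence rr: "r * r = of_int c * r - of_int (fpol S)" unfolding r_def om_root_mult by simp
  obtain f where f: "fpol S = int p ^ n * f" using S(1) by blast
  have pw: "r ^ Suc k - of_int (c ^ k) * r \<in> {of_int (int p ^ n) * z | z. z \<in> OK d}" for k
  proof (induction k)
    case 0
    show ?case by (auto intro: exI[of _ 0])
  next
    case (Suc k)
    then obtain z where z: "z \<in> OK d" "r ^ Suc k - of_int (c ^ k) * r = of_int (int p ^ n) * z" by blast
    have "r ^ Suc (Suc k) - of_int (c ^ Suc k) * r = (r ^ Suc k - of_int (c ^ k) * r) * r + of_int (c ^ k) * (r * r - of_int c * r)"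
      by (simp add: algebra_simps)
    also have "\<dots> = of_int (int p ^ n) * (z * r - of_int (c ^ k) * of_int f)"
      unfolding z(2) rr f by (simp add: algebra_simps)
    finally show ?case using z(1) rO by blast
  qed
  have "\<not> int p dvd c" using S(2) by (simp add: c_def dvd_diff_commute)
  hence "coprime c (int p)" using p by (subst coprime_commute) (simp add: prime_imp_coprime)
  hence "coprime (c ^ (n - 1)) (int p ^ n)" by simp
  then obtain u v where uv: "u * c ^ (n - 1) + v * int p ^ n = 1" using bezout_int[of "c ^ (n - 1)" "int p ^ n"] by auto
  have rI: "r \<in> ideal_pow d P n"
  proof (cases "n = 0")
    case True
    thus ?thesis using rO by (simp add: ideal_pow_def)
  next
    case False
    obtain z where z: "z \<in> OK d" "r ^ Suc (n - 1) - of_int (c ^ (n - 1)) * r = of_int (int p ^ n) * z"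
      using pw[of "n - 1"] by blast
    have "r ^ n \<in> ideal_pow d P n" using S(3) by (intro ideal_pow_power) (simp add: r_def)
    moreover have "of_int (c ^ (n - 1)) * r = r ^ n - of_int (int p ^ n * 1) * z"
      using z(2) False by (simp add: algebra_simps)
    ultimately have cr: "of_int (c ^ (n - 1)) * r \<in> ideal_pow d P n"
      using IP(5) ppow[OF z(1), of 1] by metis
    have "of_int u * (of_int (c ^ (n - 1)) * r) + of_int (int p ^ n * v) * r \<in> ideal_pow d P n"
      by (rule IP(3)[OF IP(6)[OF OK_of_int cr] ppow[OF rO]])
    moreover have "of_int u * (of_int (c ^ (n - 1)) * r) + of_int (int p ^ n * v) * r = of_int (u * c ^ (n - 1) + v * int p ^ n) * r"
      by (simp add: algebra_simps)
    ultimately show ?thesis unfolding uv by simp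
  qed
  obtain k where k: "a + b * S = int p ^ n * k" using ab by blast
  have "of_int (int p ^ n * k) * 1 + of_int b * r \<in> ideal_pow d P n" by (intro IP(3,6) ppow rI) auto
  thus ?thesis unfolding el_shift[of a b S] k r_def by simp
qed

text \<open>The integer \<open>r\<close> is the image of \<open>\<surd>-d\<close> in the completion at \<open>P\<close>, modulo \<open>p ^ n\<close>.\<close>

lemma prime_above_split_root:
  assumes P: "prime_ideal d P" "of_nat p \<in> P" and p: "prime p" and sp: "splits d p"
  shows "\<exists>r. \<not> int p dvd r \<and> int p ^ n dvd r\<^sup>2 + int d \<and>
    (\<forall>x y. int p ^ n dvd x + y * r \<longrightarrow> emb d x y \<in> ideal_pow d P n)"
proof -
  have I: "is_ideal d P" using P by (simp add: prime_ideal_def)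
  obtain s0 where s0: "int p dvd fpol s0" "\<not> int p dvd 2 * s0 - trc d"
    using splits_simple_root[OF sp p] by blast
  have "\<exists>s. int p dvd fpol s \<and> \<not> int p dvd 2 * s - trc d \<and> om d - of_int s \<in> P"
  proof -
    have "fpol (trc d - s0) = fpol s0" by (simp add: fpol_def power2_eq_square algebra_simps)
    moreover have "2 * (trc d - s0) - trc d = - (2 * s0 - trc d)" by simp
    ultimately have "int p dvd fpol (trc d - s0) \<and> \<not> int p dvd 2 * (trc d - s0) - trc d"
      using s0 by (simp only: dvd_minus_iff) simp
    thus ?thesis using root_in_prime_ideal[OF P p s0(1)] s0 by blast
  qed
  then obtain s where s: "int p dvd fpol s" "\<not> int p dvd 2 * s - trc d" "om d - of_int s \<in> P" by blast
  obtain S where S: "int p ^ Suc n dvd fpol S" "int p dvd S - s" using hensel_fpol[OF p s(1,2)] by blast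
  have Sn: "int p ^ n dvd fpol S" using S(1) by (meson dvd_trans le_imp_power_dvd le_SucI order_refl)
  have S2: "\<not> int p dvd 2 * S - trc d"
  proof
    assume "int p dvd 2 * S - trc d"
    hence "int p dvd (2 * S - trc d) - 2 * (S - s)" by (rule dvd_diff) (rule dvd_mult[OF S(2)])
    thus False using s(2) by (simp add: algebra_simps)
  qed
  have SP: "om d - of_int S \<in> P"
  proof -
    have "of_int (S - s) \<in> P" unfolding prime_ideal_of_int[OF P p] by (rule S(2))
    hence "(om d - of_int s) - of_int (S - s) \<in> P" using idealD(5)[OF I s(3)] by blast
    thus ?thesis by simp
  qed
  note elP = el_in_ideal_pow[OF P p Sn S2 SP]
  show ?thesis
  proof (cases "d mod 4 = 3")
    case True
    \<comment> \<open>In this case \<open>sq d = 2 * om d - 1\<close>, which also turns a root of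
      \<open>fpol\<close> into a square root of \<open>- d\<close>.\<close>
    define r where "r = 2 * S - 1"
    have r2: "r\<^sup>2 + int d = 4 * fpol S"
      using nrm_4[OF True] True by (simp add: r_def fpol_def trc_def power2_eq_square algebra_simps)
    have "int p ^ n dvd r\<^sup>2 + int d" using Sn unfolding r2 by simp
    moreover have "\<not> int p dvd r" using S2 True by (simp add: r_def trc_def)
    moreover have "emb d x y \<in> ideal_pow d P n" if "int p ^ n dvd x + y * r" for x y
      using elP[of "x - y" "2 * y"] that True by (simp add: emb_el r_def algebra_simps)
    ultimately show ?thesis by blast
  next
    case False
    hence t: "trc d = 0" by (simp add: trc_def)
    have "int p ^ n dvd S\<^sup>2 + int d" using Sn False by (simp add: fpol_def t nrm_def)
    moreover have "\<not> int p dvd S" using S2 t by auto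
    moreover have "emb d x y \<in> ideal_pow d P n" if "int p ^ n dvd x + y * S" for x y
      using elP[of x y] that False by (simp add: emb_el)
    ultimately show ?thesis by blast
  qed
qed

text \<open>Modulo \<open>\<delta>\<close> every element of \<open>OK d\<close> is congruent to an
  integer, and the integers in the ideal of \<open>\<delta>\<close> are the multiples of
  \<open>l\<close>; so that ideal is prime. Equality with the conjugate ideal would put
  \<open>\<delta> + cnj \<delta> = 2 * x\<close> into it.\<close>

lemma splits_norm_prime:
  assumes de: "\<delta> \<in> Rg d" and l: "l = nq \<delta>" "prime l" "\<not> l dvd 2 * d"
  shows "splits d l"
proof -
  obtain x y where xy: "\<delta> = emb d x y" using de by (rule Rg_cases)
  have lxy: "int l = x\<^sup>2 + int d * y\<^sup>2" unfolding l(1) xy nq_emb ..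
  have lodd: "odd l" using l(2,3) by (metis dvd_mult2 primes_dvd_imp_eq two_is_prime_nat)
  have l2: "\<not> int l dvd 2 * x" and ly: "\<not> int l dvd y"
  proof -
    have pl: "prime (int l)" using l(2) by simp
    show ly: "\<not> int l dvd y"
    proof
      assume y: "int l dvd y"
      hence "int l dvd int l - int d * y\<^sup>2" 
        by (intro dvd_diff dvd_refl dvd_mult) (simp add: power2_eq_square)
      hence "int l dvd x\<^sup>2" using lxy by simp
      hence "int l dvd x" using pl by (simp add: prime_dvd_power_int_iff)
      hence "(int l)\<^sup>2 dvd x\<^sup>2 + int d * y\<^sup>2" using y by (intro dvd_add dvd_mult) auto
      hence "int l * int l dvd int l * 1" using lxy by (simp add: power2_eq_square)
      hence "int l dvd 1" using l(2) by (subst (asm) dvd_mult_cancel_left) (auto dest: prime_gt_0_nat)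
      thus False using pl by (simp add: not_prime_unit)
    qed
    show "\<not> int l dvd 2 * x"
    proof
      assume "int l dvd 2 * x"
      moreover have "\<not> int l dvd 2" using l(2,3) by (metis dvd_mult2 int_dvd_int_iff of_nat_numeral)
      ultimately have "int l dvd x" using pl by (simp add: prime_dvd_mult_iff)
      hence "int l dvd int l - x\<^sup>2" by (intro dvd_diff) (auto simp: power2_eq_square)
      hence "int l dvd int d * y\<^sup>2" using lxy by simp
      hence "int l dvd int d" using pl ly by (simp add: prime_dvd_mult_iff prime_dvd_power_int_iff)
      thus False using l(3) by simp
    qed
  qed
  have gen: "prime_ideal d (principal_ideal d \<epsilon>) \<and> (\<forall>n. of_int n \<in> principal_ideal d \<epsilon> \<longrightarrow> int l dvd n)"
    if ep: "\<epsilon> = emb d x y'" "int l = x\<^sup>2 + int d * y'\<^sup>2" "\<not> int l dvd y'" for \<epsilon> y'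
  proof -
    have eO: "\<epsilon> \<in> OK d" using Rg_subset_OK ep(1) by auto
    define I where "I = principal_ideal d \<epsilon>"
    have II: "is_ideal d I" unfolding I_def by (rule is_ideal_principal[OF eO])
    note ID = idealD[OF II]
    have ee: "\<epsilon> * cnj \<epsilon> = of_nat l"
      using mult_cnj_nq[of \<epsilon> d] ep(1,2) nq_emb[of d x y'] by (metis Rg_emb of_nat_eq_iff)
    hence lI: "of_nat l \<in> I" using principalI[of "cnj \<epsilon>" \<epsilon>] eO by (simp add: I_def mult.commute)
    have int_I: "of_int n \<in> I \<longleftrightarrow> int l dvd n" for n
    proof
      assume "int l dvd n"
      then obtain k where "n = int l * k" by blast
      thus "of_int n \<in> I" using ID(6)[OF OK_of_int[of k] lI] by (simp add: mult.commute)
    next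
      assume "of_int n \<in> I"
      then obtain w where w: "w \<in> OK d" "of_int n = w * \<epsilon>" by (auto simp: I_def principal_ideal_def)
      obtain m where m: "w * cnj w = of_int m" using OK_norm[OF w(1)] by blast
      have "(of_int (n * n) :: complex) = of_int n * cnj (of_int n)" by simp
      also have "\<dots> = (w * cnj w) * (\<epsilon> * cnj \<epsilon>)" unfolding w(2) by simp
      also have "\<dots> = of_int (m * int l)" unfolding m ee by simp
      finally have "n * n = m * int l" by (simp only: of_int_eq_iff)
      hence "int l dvd n * n" by simp
      thus "int l dvd n" using l(2) by (auto simp: prime_dvd_mult_iff)
    qed
    have "coprime (int l) y'" using ep(3) l(2) by (simp add: prime_imp_coprime)
    then obtain u v where uv: "u * int l + v * y' = 1" using bezout_int[of "int l" y'] by auto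
    \<comment> \<open>\<open>v\<close> inverts \<open>y'\<close> modulo \<open>l\<close>, so the
      relation \<open>x + y' * sq d = 0\<close> modulo the ideal can be solved for
      \<open>sq d\<close>.\<close>
    have "sq d - of_int (- (x * v)) \<in> I"
    proof -
      have "sq d = of_int (u * int l + v * y') * sq d" unfolding uv by simp
      also have "\<dots> = (of_int u * sq d) * of_nat l + of_int v * \<epsilon> + of_int (- (x * v))"
        unfolding ep(1) emb_def by (simp add: algebra_simps)
      finally have "sq d - of_int (- (x * v)) = (of_int u * sq d) * of_nat l + of_int v * \<epsilon>" unfolding diff_eq_eq .
      moreover have "sq d \<in> OK d" using Rg_subset_OK Rg_emb[of d 0 1] by (auto simp: emb_def)
      moreover have "\<epsilon> \<in> I" using principalI[of 1 \<epsilon>] by (simp add: I_def)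
      ultimately show ?thesis using lI by (auto intro!: ID(3,6))
    qed
    then obtain k where k: "sq d - of_int k \<in> I" by blast
    have "\<exists>c. om d - of_int c \<in> I"
    proof (cases "d mod 4 = 3")
      case True
      \<comment> \<open>\<open>m + 1\<close> is an inverse of 2 modulo \<open>l\<close>.\<close>
      obtain m where m: "int l = 2 * m + 1" using lodd by (elim oddE) (auto intro: that[of "int _"])
      have "om d = of_int (2 * m + 2) * om d - of_int (int l) * om d" unfolding m by (simp add: algebra_simps)
      also have "of_int (2 * m + 2) * om d = of_int (m + 1) * (1 + sq d)"
        using True by (simp add: sq_om algebra_simps)
      finally have "om d - of_int ((m + 1) * (1 + k)) = of_int (m + 1) * (sq d - of_int k) - om d * of_nat l"
        by (simp add: algebra_simps)
      also have "\<dots> \<in> I" by (intro ID(5,6) k lI) auto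
      finally show ?thesis by blast
    next
      case False
      thus ?thesis using k by (auto simp: om_def)
    qed
    then obtain c where c: "om d - of_int c \<in> I" by blast
    have rep: "\<exists>n. z - of_int n \<in> I" if "z \<in> OK d" for z
    proof -
      obtain a b where ab: "z = el d a b" using elE[OF \<open>z \<in> OK d\<close>] by blast
      have "z - of_int (a + b * c) = of_int b * (om d - of_int c)"
        unfolding ab el_shift[of a b c] by simp
      also have "\<dots> \<in> I" by (intro ID(6) c) auto
      finally show ?thesis by blast
    qed
    have "prime_ideal d I" unfolding prime_ideal_def
    proof (intro conjI ballI impI II)
      have "\<not> int l dvd 1" using l(2) by auto
      hence "1 \<notin> I" using int_I[of 1] by simp
      thus "I \<noteq> OK d" using OK_1 by metis
      fix z w assume zw: "z \<in> OK d" "w \<in> OK d" "z * w \<in> I"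
      obtain m n where mn: "z - of_int m \<in> I" "w - of_int n \<in> I" using rep zw by meson
      have "of_int (m * n) = z * w - w * (z - of_int m) - of_int m * (w - of_int n)" by (simp add: algebra_simps)
      also have "\<dots> \<in> I" by (intro ID(5,6) mn zw) auto
      finally have "int l dvd m * n" by (simp only: int_I)
      hence "int l dvd m \<or> int l dvd n" using l(2) by (simp add: prime_dvd_mult_iff)
      hence "of_int m \<in> I \<or> of_int n \<in> I" by (simp only: int_I)
      thus "z \<in> I \<or> w \<in> I" using ID(3)[OF mn(1), of "of_int m"] ID(3)[OF mn(2), of "of_int n"] by auto
    qed
    thus ?thesis using int_I by (auto simp: I_def)
  qed
  have cd: "cnj \<delta> = emb d x (- y)" unfolding xy by (simp add: emb_def cnj_sq)
  have lxy': "int l = x\<^sup>2 + int d * (- y)\<^sup>2" and ly': "\<not> int l dvd - y" using lxy ly by simp_all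
  note g1 = gen[OF xy lxy ly] and g2 = gen[OF cd lxy' ly']
  have dO: "\<delta> \<in> OK d" using de Rg_subset_OK by auto
  have "principal_ideal d \<delta> \<noteq> principal_ideal d (cnj \<delta>)"
  proof
    assume "principal_ideal d \<delta> = principal_ideal d (cnj \<delta>)"
    hence "\<delta> + cnj \<delta> \<in> principal_ideal d \<delta>"
      using principalI[of 1 \<delta>] principalI[of 1 "cnj \<delta>"] idealD(3)[OF is_ideal_principal[OF dO]] by simp
    moreover have "\<delta> + cnj \<delta> = of_int (2 * x)" unfolding cd unfolding xy by (simp add: emb_def)
    ultimately show False using g1 l2 by metis
  qed
  moreover have "ideal_mult d (principal_ideal d \<delta>) (principal_ideal d (cnj \<delta>)) = principal_ideal d (of_nat l)"
  proof
    have dd: "\<delta> * cnj \<delta> = of_nat l" unfolding l(1) by (rule mult_cnj_nq[OF de])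
    show "ideal_mult d (principal_ideal d \<delta>) (principal_ideal d (cnj \<delta>)) \<subseteq> principal_ideal d (of_nat l)"
    proof (intro ideal_mult_least is_ideal_principal)
      fix z w assume "z \<in> principal_ideal d \<delta>" "w \<in> principal_ideal d (cnj \<delta>)"
      then obtain r s where "z = r * \<delta>" "w = s * cnj \<delta>" "r \<in> OK d" "s \<in> OK d"
        by (auto simp: principal_ideal_def)
      hence "z * w = (r * s) * of_nat l" "r * s \<in> OK d" unfolding dd[symmetric] by (auto simp: mult_ac)
      thus "z * w \<in> principal_ideal d (of_nat l)" by (simp add: principalI)
    qed simp
    show "principal_ideal d (of_nat l) \<subseteq> ideal_mult d (principal_ideal d \<delta>) (principal_ideal d (cnj \<delta>))"
    proof
      fix z assume "z \<in> principal_ideal d (of_nat l)"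
      then obtain r where r: "z = r * of_nat l" "r \<in> OK d" by (auto simp: principal_ideal_def)
      have "z = (r * \<delta>) * (1 * cnj \<delta>)" unfolding r(1) dd[symmetric] by simp
      thus "z \<in> ideal_mult d (principal_ideal d \<delta>) (principal_ideal d (cnj \<delta>))"
        using r(2) by (metis ideal_multI principalI OK_1)
    qed
  qed
  ultimately show ?thesis unfolding splits_def using g1 g2 by blast
qed

end

section \<open>Topological generators of the p-adic units and density\<close>

text \<open>A primitive root modulo \<open>p^2\<close> remains one modulo all higher powers of an
  odd \<open>p\<close>, so only the residue of \<open>h\<close> modulo \<open>p^2\<close> matters;
  this turns generation of the p-adic units into a single congruence.\<close>

lemma odd_prime_unit_generator:
  fixes p :: nat
  assumes p: "prime p" "odd p"
  shows "\<exists>g::int. coprime g (int p) \<and> (\<forall>h N a. [h = g] (mod (int p)\<^sup>2) \<and> N > 0 \<and> coprime a (int p) \<longrightarrow>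
    (\<exists>k. [h ^ k = a] (mod int p ^ N)))"
proof -
  obtain g where g: "\<forall>k>0. residue_primroot (p ^ k) g"
    using residue_primroot_odd_prime_power_exists[OF p] by blast
  have gp: "residue_primroot p g" using g[rule_format, of 1] by simp
  have "\<exists>k. [h ^ k = a] (mod int p ^ N)"
    if h: "[h = int g] (mod (int p)\<^sup>2)" and N: "N > 0" and a: "coprime a (int p)" for h a :: int and N
  proof -
    have p2: "(int p)\<^sup>2 > 0" "int p ^ N > 1" using prime_gt_1_nat[OF p(1)] N by (auto intro: one_less_power)
    \<comment> \<open>The modulus \<open>p ^ (2 + N)\<close> is a multiple of both
      \<open>p^2\<close> and \<open>p ^ N\<close>, so the natural representative keeps both
      residues.\<close>
    define h' where "h' = nat (h mod (int p ^ (2 + N)))"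
    have h': "int h' = h mod int p ^ (2 + N)" using prime_gt_1_nat[OF p(1)] by (simp add: h'_def)
    have "[int h' = h] (mod int p ^ (2 + N))" unfolding h' by simp
    hence hh: "[int h' = h] (mod int p ^ N)" "[int h' = h] (mod (int p)\<^sup>2)"
      by (rule cong_dvd_modulus; intro le_imp_power_dvd; simp)+
    have "[int h' = int g] (mod int (p\<^sup>2))" using hh(2) h by (simp add: cong_trans[of _ h])
    hence hg2: "[h' = g] (mod p\<^sup>2)" by (simp only: cong_int_iff)
    hence hg: "[h' = g] (mod p)" by (rule cong_dvd_modulus_nat) simp
    have hp: "residue_primroot p h'" using gp residue_primroot_cong[OF hg] by simp
    have "[g ^ (p - 1) \<noteq> 1] (mod p\<^sup>2)" using g residue_primroot_prime_lift_iff[OF p gp] by simp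
    hence "[h' ^ (p - 1) \<noteq> 1] (mod p\<^sup>2)" using cong_pow[OF hg2, of "p - 1"] by (metis cong_sym cong_trans)
    hence "residue_primroot (p ^ N) h'" using N residue_primroot_prime_lift_iff[OF p hp] by blast
    hence bij: "bij_betw (\<lambda>i. h' ^ i mod p ^ N) {..<totient (p ^ N)} (totatives (p ^ N))"
      using p2(2) N by (intro residue_primroot_is_generator) (metis of_nat_1 of_nat_less_iff of_nat_power, simp)
    define a' where "a' = nat (a mod int p ^ N)"
    have a': "int a' = a mod int p ^ N" 
  proof -
    have "a mod int p ^ N \<ge> 0" by (rule pos_mod_sign) (use p2(2) in linarith)
    thus ?thesis by (simp add: a'_def)
  qed
    have "coprime (a mod int p ^ N) (int p ^ N) \<longleftrightarrow> coprime a (int p ^ N)"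
      using prime_gt_0_nat[OF p(1)] by (intro coprime_mod_left_iff) simp
    hence "coprime (int a') (int (p ^ N))" unfolding a' using a by simp
    hence "coprime a' (p ^ N)" by (simp only: coprime_int_iff)
    moreover have "a' < p ^ N" using p2(2) a' pos_mod_bound[of "int p ^ N" a]
      by (metis of_nat_less_iff of_nat_power less_trans zero_less_one)
    moreover have "a' > 0" using calculation(1) p2(2) by (intro Nat.gr0I) auto
    ultimately have "a' \<in> totatives (p ^ N)" by (simp add: totatives_def)
    hence "a' \<in> (\<lambda>i. h' ^ i mod p ^ N) ` {..<totient (p ^ N)}" using bij by (simp only: bij_betw_def)
    then obtain i where "h' ^ i mod p ^ N = a'" by blast
    hence "[h' ^ i = a'] (mod p ^ N)" by (auto simp: unique_euclidean_semiring_class.cong_def)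
    hence "[int h' ^ i = int a'] (mod int p ^ N)" by (metis cong_int_iff of_nat_power)
    moreover have "[int a' = a] (mod int p ^ N)" unfolding a' by simp
    ultimately have "[h ^ i = a] (mod int p ^ N)" using cong_pow[OF hh(1), of i] by (meson cong_sym cong_trans)
    thus ?thesis by blast
  qed
  moreover have "coprime (int g) (int p)" using gp by (simp add: residue_primroot_def coprime_commute)
  ultimately show ?thesis by blast
qed

text \<open>The powers of \<open>h\<close> are congruent to 1 or 3 modulo 8 and there are
  \<open>2 ^ (N - 2)\<close> of them; their negatives are congruent to 7 or 5. Together they exhaust
  the \<open>2 ^ (N - 1)\<close> odd residues. This unit group is not cyclic, hence the
  sign.\<close>

lemma two_adic_unit_generator:
  fixes h a :: int
  assumes h: "[h = 3] (mod 8)" and N: "N \<ge> 3" and a: "odd a"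
  shows "\<exists>\<epsilon>\<in>{1, -1}. \<exists>k. [\<epsilon> * h ^ k = a] (mod 2 ^ N)"
proof -
  define m where "m = (2::nat) ^ N"
  have m8: "8 dvd m" unfolding m_def using le_imp_power_dvd[OF N, of "2::nat"] by simp
  hence m: "m > 0" "even m" using N by (auto simp: m_def)
  define h' where "h' = nat (h mod int m)"
  have h': "int h' = h mod int m" using m by (simp add: h'_def)
  hence hh: "[int h' = h] (mod int m)" by simp
  have "[int h' = h] (mod 8)" 
    by (rule cong_dvd_modulus[OF hh]) (use m8 int_dvd_int_iff[of 8 m] in simp)
  hence "[int h' = int 3] (mod int 8)" using h by (metis cong_trans of_nat_numeral)
  hence h3: "[h' = 3] (mod 8)" by (simp only: cong_int_iff)
  hence h8: "h' mod 8 = 3" by (simp add: unique_euclidean_semiring_class.cong_def)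
  have hpow: "h' ^ k mod 8 = 1 \<or> h' ^ k mod 8 = 3" for k
  proof (induction k)
    case (Suc k)
    have "h' ^ Suc k mod 8 = (3 * (h' ^ k mod 8)) mod 8" using h8 by (metis mod_mult_eq mod_mod_trivial power_Suc)
    thus ?case using Suc by auto
  qed simp
  define K where "K = {..<(2::nat) ^ (N - 2)}"
  define A where "A = (\<lambda>k. h' ^ k mod m) ` K"
  have oh: "odd h'" using h8 by presburger
  have "coprime m h'" using oh by (simp add: m_def coprime_left_2_iff_odd)
  hence inj: "inj_on (\<lambda>k. h' ^ k mod m) K"
    using inj_power_mod[of m h'] ord_twopow_3_5[OF N, of h'] h8 by (simp add: m_def K_def)
  hence cA: "card A = 2 ^ (N - 2)" by (simp add: A_def K_def card_image)
  have fA: "finite A" by (simp add: A_def K_def)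
  have A8: "x mod 8 = 1 \<or> x mod 8 = 3" if "x \<in> A" for x
  proof -
    obtain k where k: "x = h' ^ k mod m" using \<open>x \<in> A\<close> by (auto simp: A_def)
    have "x mod 8 = h' ^ k mod 8" unfolding k using m8 by (rule mod_mod_cancel)
    thus ?thesis using hpow by simp
  qed
  have Am: "x < m" if "x \<in> A" for x using that m by (auto simp: A_def)
  define B where "B = (\<lambda>x. m - x) ` A"
  have cB: "card B = card A" unfolding B_def
  proof (rule card_image, rule inj_onI)
    fix x y assume "x \<in> A" "y \<in> A" "m - x = m - y"
    thus "x = y" using Am[of x] Am[of y] by linarith
  qed
  have B8: "x mod 8 = 5 \<or> x mod 8 = 7" if "x \<in> B" for x
  proof -
    obtain y where y: "y \<in> A" "x = m - y" using \<open>x \<in> B\<close> by (auto simp: B_def)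
    obtain c where c: "m = 8 * c" using m8 by blast
    have "x + y = 8 * c" using y Am[OF y(1)] c by simp
    hence s: "(x mod 8 + y mod 8) mod 8 = 0" by (simp add: mod_add_eq)
    have "u = 5 \<or> u = 7" if "u < 8" "(u + w) mod 8 = 0" "w = 1 \<or> w = 3" for u w :: nat
    proof -
      obtain k where k: "u + w = 8 * k" using \<open>(u + w) mod 8 = 0\<close> by blast
      hence "k = 1" using that(1,3) by auto
      thus ?thesis using k that(3) by auto
    qed
    thus ?thesis using s A8[OF y(1)] by simp
  qed
  have "A \<inter> B = {}" using A8 B8 by fastforce
  hence cAB: "card (A \<union> B) = 2 ^ (N - 2) + 2 ^ (N - 2)"
    using cA cB fA by (subst card_Un_disjoint) (auto simp: B_def)
  have sub: "A \<union> B \<subseteq> totatives m"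
  proof
    fix x assume x: "x \<in> A \<union> B"
    hence "odd x" using A8[of x] B8[of x] by (auto; presburger)
    moreover from this have "x > 0" by (auto intro: Nat.gr0I)
    moreover have "x \<le> m" using x Am by (auto simp: B_def intro: less_imp_le)
    ultimately show "x \<in> totatives m" by (simp add: totatives_def m_def coprime_right_2_iff_odd)
  qed
  have "card (totatives m) = 2 ^ (N - 1)"
    using N totient_prime_power[of 2 N] by (simp add: totient_def m_def)
  also have "\<dots> = 2 ^ (N - 2) + 2 ^ (N - 2)" 
  proof -
    have "N - 1 = Suc (N - 2)" using N by simp
    thus ?thesis by (simp only: power_Suc)
  qed
  finally have AB: "A \<union> B = totatives m" using cAB sub by (intro card_subset_eq) auto
  define a' where "a' = nat (a mod int m)"
  have a': "int a' = a mod int m" using m by (simp add: a'_def)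
  have am: "[int a' = a] (mod int m)" using a' by simp
  have "odd (int a')" unfolding a' using a m(2) by (simp add: dvd_mod_iff)
  hence oa: "odd a'" by simp
  have "a' \<in> totatives m"
  proof -
    have "int a' < int m" unfolding a' using m by simp
    thus ?thesis using oa by (auto simp: totatives_def m_def coprime_right_2_iff_odd intro: Nat.gr0I)
  qed
  hence "a' \<in> A \<or> (\<exists>x\<in>A. a' = m - x)" using AB by (auto simp: B_def)
  then obtain x where x: "x \<in> A" "a' = x \<or> a' = m - x" by blast
  obtain k where k: "x = h' ^ k mod m" using x(1) by (auto simp: A_def)
  have "[int x = int h' ^ k] (mod int m)" unfolding k by (simp add: of_nat_mod)
  hence xk: "[int x = h ^ k] (mod int m)" using cong_pow[OF hh, of k] cong_trans by blast
  have im: "int m = 2 ^ N" by (simp add: m_def)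
  show ?thesis
  proof (cases "a' = x")
    case True
    hence "[1 * h ^ k = a] (mod 2 ^ N)" using xk am unfolding im by (metis cong_sym cong_trans mult_1)
    thus ?thesis by blast
  next
    case False
    hence "int a' = int m - int x" using x(2) Am[OF x(1)] by auto
    hence "[int a' = - int x] (mod int m)" by (simp add: cong_iff_dvd_diff)
    moreover have "[- int x = - (h ^ k)] (mod int m)" using xk by (simp add: cong_minus_minus_iff)
    ultimately have "[- 1 * h ^ k = a] (mod 2 ^ N)" using am unfolding im by (simp, meson cong_sym cong_trans)
    thus ?thesis by blast
  qed
qed

section \<open>Elements of the torus, their density, and the congruence conditions\<close>

context quad_field
begin

text \<open>Substituting for \<open>sq d\<close> a square root \<open>r\<close> of
  \<open>- d\<close> modulo \<open>q\<close> is multiplicative.\<close>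

lemma emb_power_residue:
  assumes "q dvd r\<^sup>2 + int d" "\<delta> = emb d x y"
  shows "\<exists>u v. \<delta> ^ k = emb d u v \<and> q dvd (u + v * r) - (x + y * r) ^ k"
proof (induction k)
  case 0
  show ?case by (intro exI[of _ 1] exI[of _ 0]) (simp add: emb_def)
next
  case (Suc k)
  then obtain u v where uv: "\<delta> ^ k = emb d u v" "q dvd (u + v * r) - (x + y * r) ^ k" by blast
  have "(x * u - int d * (y * v)) + (x * v + y * u) * r - (x + y * r) ^ Suc k
    = (x + y * r) * ((u + v * r) - (x + y * r) ^ k) - y * v * (r\<^sup>2 + int d)"
    by (simp add: algebra_simps power2_eq_square)
  also have "q dvd \<dots>" by (rule dvd_diff[OF dvd_mult[OF uv(2)] dvd_mult[OF assms(1)]])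
  finally show ?case using uv(1) assms(2) by (auto simp: emb_mult)
qed

lemma ideal_pow_antimono:
  assumes "is_ideal d P" "m \<le> n" shows "ideal_pow d P n \<subseteq> ideal_pow d P m"
  using assms(2)
proof (induction rule: dec_induct)
  case (step n)
  have "ideal_pow d P (Suc n) \<subseteq> ideal_pow d P n"
    using ideal_mult_least[OF is_ideal_pow[OF assms(1), of n], of P "ideal_pow d P n"]
      idealD(6)[OF is_ideal_pow[OF assms(1)]] idealD(1)[OF assms(1)]
    by (auto simp: ideal_pow_def)
  thus ?case using step by blast
qed simp

lemma emb_div_in_qfield: "v \<in> Rg d \<Longrightarrow> v / of_nat w \<in> qfield d"
proof (elim Rg_cases)
  fix x y assume "v = emb d x y"
  hence "v / of_nat w = of_rat (of_int x / of_nat w) + of_rat (of_int y / of_nat w) * sq d"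
    by (simp add: emb_def of_rat_divide add_divide_distrib)
  thus ?thesis unfolding qfield_eq by blast
qed

text \<open>\<open>\<delta> ^ (2 * k) / l ^ k\<close> is
  \<open>(\<delta> / cnj \<delta>) ^ k\<close>, written with a power of \<open>l\<close> as
  denominator.\<close>

lemma norm_quotient_in_T:
  assumes de: "\<delta> \<in> Rg d" "l = nq \<delta>" "l > 0" and ep: "\<epsilon> \<in> {1, -1 :: int}"
  shows "of_int \<epsilon> * \<delta> ^ (2 * k) / of_nat l ^ k \<in> T_points d l"
proof -
  have inv: "v \<in> Rg d \<Longrightarrow> v / of_nat l ^ k \<in> OK_inv d l" for v
    using emb_div_in_qfield[of v "l ^ k"] de(3) Rg_subset_OK[of d] by (auto simp: OK_inv_def intro!: exI[of _ k])
  define \<alpha> where "\<alpha> = of_int \<epsilon> * \<delta> ^ (2 * k) / of_nat l ^ k"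
  have "\<delta> * cnj \<delta> = of_nat l" unfolding de(2) by (rule mult_cnj_nq[OF de(1)])
  hence "(\<delta> * cnj \<delta>) ^ (2 * k) = of_nat l ^ k * of_nat l ^ k" by (simp add: mult_2 power_add)
  moreover have "\<alpha> * cnj \<alpha> = (of_int \<epsilon> * of_int \<epsilon>) * ((\<delta> * cnj \<delta>) ^ (2 * k)) / (of_nat l ^ k * of_nat l ^ k)"
    by (simp add: \<alpha>_def power_mult_distrib mult_ac)
  moreover have "(of_int \<epsilon> * of_int \<epsilon> :: complex) = 1" using ep by auto
  ultimately have 1: "\<alpha> * cnj \<alpha> = 1" using de(3) by simp
  have "\<alpha> \<in> OK_inv d l" unfolding \<alpha>_def using de by (intro inv) auto
  moreover have "cnj \<alpha> \<in> OK_inv d l"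
  proof -
    have "cnj \<delta> \<in> Rg d" using de(1) by auto
    hence "of_int \<epsilon> * cnj \<delta> ^ (2 * k) / of_nat l ^ k \<in> OK_inv d l" by (intro inv) auto
    thus ?thesis by (simp add: \<alpha>_def)
  qed
  ultimately show ?thesis using 1 unfolding \<alpha>_def[symmetric] by (auto simp: T_points_def)
qed

text \<open>A unit approximating a p-adic square root of \<open>- d\<close> up to
  \<open>p ^ N\<close>.\<close>

definition root_at :: "nat \<Rightarrow> nat \<Rightarrow> int \<Rightarrow> bool" where
  "root_at p N r \<longleftrightarrow> \<not> int p dvd r \<and> int p ^ N dvd r\<^sup>2 + int d"

text \<open>The elements \<open>\<epsilon> (\<delta> / cnj \<delta>) ^ k\<close> of the torus suffice: at a prime above \<open>p\<close> the quotient
  \<open>\<delta> / cnj \<delta>\<close> becomes \<open>(x + y r) / (x - y r)\<close>.\<close>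

lemma T_dense_atI:
  assumes p: "prime p" "splits d p" and de: "\<delta> = emb d x y" "l = nq \<delta>" "l > 0"
    and gen: "\<And>(N::nat) r a. N \<ge> 3 \<Longrightarrow> root_at p N r \<Longrightarrow> coprime a (int p) \<Longrightarrow>
      \<exists>\<epsilon>\<in>{1, -1}. \<exists>k. [\<epsilon> * (x + y * r) ^ k = a * (x - y * r) ^ k] (mod int p ^ N)"
  shows "T_dense_at d p l"
  unfolding T_dense_at_def
proof (intro allI impI)
  fix P and n :: nat and a :: int
  assume P: "prime_ideal d P \<and> of_nat p \<in> P" and a: "coprime a (int p)"
  hence P1: "prime_ideal d P" "of_nat p \<in> P" and I: "is_ideal d P" by (auto simp: prime_ideal_def)
  \<comment> \<open>The higher precision brings small \<open>n\<close> into the range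
    \<open>N \<ge> 3\<close> of \<open>gen\<close>; nothing is lost since the powers of
    \<open>P\<close> decrease.\<close>
  define N where "N = n + 3"
  obtain r where r: "\<not> int p dvd r" "int p ^ N dvd r\<^sup>2 + int d"
    "\<And>x y. int p ^ N dvd x + y * r \<Longrightarrow> emb d x y \<in> ideal_pow d P N"
    using prime_above_split_root[OF P1 p, of N] by blast
  have "root_at p N r" using r by (simp add: root_at_def)
  hence "\<exists>\<epsilon>\<in>{1, -1}. \<exists>k. [\<epsilon> * (x + y * r) ^ k = a * (x - y * r) ^ k] (mod int p ^ N)"
    by (intro gen a) (simp add: N_def)
  then obtain \<epsilon> k where ek: "\<epsilon> \<in> {1, -1 :: int}" "[\<epsilon> * (x + y * r) ^ k = a * (x - y * r) ^ k] (mod int p ^ N)"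
    by blast
  have deR: "\<delta> \<in> Rg d" using de(1) by simp
  have cd: "cnj \<delta> = emb d x (- y)" unfolding de by (simp add: emb_def cnj_sq)
  obtain u v where uv: "\<delta> ^ k = emb d u v" "int p ^ N dvd (u + v * r) - (x + y * r) ^ k"
    using emb_power_residue[OF r(2) de(1)] by blast
  obtain u' v' where uv': "cnj \<delta> ^ k = emb d u' v'" "int p ^ N dvd (u' + v' * r) - (x + - y * r) ^ k"
    using emb_power_residue[OF r(2) cd] by blast
  have "int p ^ N dvd \<epsilon> * ((u + v * r) - (x + y * r) ^ k) - a * ((u' + v' * r) - (x + - y * r) ^ k)
    + (\<epsilon> * (x + y * r) ^ k - a * (x - y * r) ^ k)"
    by (rule dvd_add[OF dvd_diff[OF dvd_mult[OF uv(2)] dvd_mult[OF uv'(2)]]]) (use ek(2) in \<open>simp add: cong_iff_dvd_diff\<close>)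
  also have "\<dots> = (\<epsilon> * u - a * u') + (\<epsilon> * v - a * v') * r" by (simp add: algebra_simps)
  finally have mem: "emb d (\<epsilon> * u - a * u') (\<epsilon> * v - a * v') \<in> ideal_pow d P n"
    using r(3) ideal_pow_antimono[OF I, of n N] by (auto simp: N_def)
  \<comment> \<open>Since \<open>l = \<delta> * cnj \<delta>\<close>, a factor
    \<open>\<delta> ^ k\<close> splits off, and the congruence from \<open>gen\<close> puts the
    other factor into the power of \<open>P\<close>.\<close>
  have "of_int \<epsilon> * \<delta> ^ (2 * k) - of_int a * of_nat l ^ k = \<delta> ^ k * (of_int \<epsilon> * \<delta> ^ k - of_int a * cnj \<delta> ^ k)"
  proof -
    have "of_nat l ^ k = \<delta> ^ k * cnj \<delta> ^ k"
      unfolding de(2) mult_cnj_nq[OF deR, symmetric] by (simp add: power_mult_distrib)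
    moreover have "\<delta> ^ (2 * k) = \<delta> ^ k * \<delta> ^ k" by (simp add: mult_2 power_add)
    ultimately show ?thesis by (simp add: algebra_simps)
  qed
  also have "of_int \<epsilon> * \<delta> ^ k - of_int a * cnj \<delta> ^ k = emb d (\<epsilon> * u - a * u') (\<epsilon> * v - a * v')"
    unfolding uv uv' emb_scale emb_diff ..
  also have "\<delta> ^ k * \<dots> \<in> ideal_pow d P n"
    using deR Rg_subset_OK by (intro idealD(6)[OF is_ideal_pow[OF I]] mem) auto
  finally have diff: "of_int \<epsilon> * \<delta> ^ (2 * k) - of_int a * of_nat l ^ k \<in> ideal_pow d P n" .
  have "of_int \<epsilon> * \<delta> ^ (2 * k) \<in> OK d" using deR Rg_subset_OK by auto
  thus "\<exists>\<alpha>\<in>T_points d l. \<exists>\<beta>\<in>OK d. \<exists>m. \<alpha> = \<beta> / of_nat l ^ m \<and> \<beta> - of_int a * of_nat l ^ m \<in> ideal_pow d P n"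
    using norm_quotient_in_T[OF deR de(2,3) ek(1), of k] diff by blast
qed

lemma splits_root:
  assumes "splits d p" "prime p" shows "\<exists>r. root_at p n r"
proof -
  obtain P Q where PQ: "prime_ideal d P" "prime_ideal d Q" "ideal_mult d P Q = principal_ideal d (of_nat p)"
    using assms by (auto simp: splits_def)
  have I: "is_ideal d P" "is_ideal d Q" using PQ by (auto simp: prime_ideal_def)
  have "of_nat p \<in> ideal_mult d P Q" using principalI[of 1 "of_nat p"] PQ by simp
  moreover have "ideal_mult d P Q \<subseteq> P" using idealD[OF I(1)] idealD(1)[OF I(2)] by (intro ideal_mult_least I) auto
  ultimately show ?thesis using prime_above_split_root[OF PQ(1) _ assms(2,1), of n] by (auto simp: root_at_def)
qed

definition gen_residue :: "nat \<Rightarrow> nat \<Rightarrow> int \<Rightarrow> int \<Rightarrow> bool" where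
  "gen_residue p M x0 y0 \<longleftrightarrow> (\<forall>x y N r a. [x = x0] (mod int M) \<and> [y = y0] (mod int M) \<and> N \<ge> 3 \<and> root_at p N r \<and>
    coprime a (int p) \<longrightarrow> (\<exists>\<epsilon>\<in>{1, -1}. \<exists>k. [\<epsilon> * (x + y * r) ^ k = a * (x - y * r) ^ k] (mod int p ^ N)))"

lemma cong_times_inverse:
  fixes A B m :: int
  assumes "coprime B m" shows "\<exists>h. [h * B = A] (mod m)"
proof -
  obtain c where "[B * c = 1] (mod m)" using cong_solve_coprime_int[OF assms] by blast
  hence "[(A * c) * B = A] (mod m)" using cong_mult[OF cong_refl[of A], of "B * c" 1] by (simp add: mult_ac)
  thus ?thesis by blast
qed

text \<open>Modulo \<open>p^2\<close>, \<open>x0 + y0 * r0\<close> is made the generator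
  \<open>g\<close> and \<open>x0 - y0 * r0\<close> is made 1, so the quotient is \<open>g\<close>,
  or its inverse at the other root \<open>- r0\<close>; either one generates. Taking
  \<open>x0\<close> as 1 and \<open>y0\<close> as 0 modulo \<open>2 * d\<close> makes the norm prime
  to \<open>2 * d\<close>.\<close>

lemma gen_residue_odd:
  assumes p: "prime p" "splits d p" "odd p"
  shows "\<exists>M x0 y0. M \<ge> 3 \<and> 2 * d dvd M \<and> p dvd M \<and> coprime (nq (emb d x0 y0)) M \<and> gen_residue p M x0 y0"
proof -
  define q where "q = (int p)\<^sup>2"
  define M where "M = 2 * d * p\<^sup>2"
  have pp: "prime (int p)" using p by simp
  obtain g where g: "coprime g (int p)"
    "\<And>h N a. [h = g] (mod (int p)\<^sup>2) \<Longrightarrow> N > 0 \<Longrightarrow> coprime a (int p) \<Longrightarrow> \<exists>k. [h ^ k = a] (mod int p ^ N)"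
    using odd_prime_unit_generator[OF p(1,3)] by blast
  obtain r0 where r0: "\<not> int p dvd r0" "int p ^ 2 dvd r0\<^sup>2 + int d"
    using splits_root[OF p(2,1), of 2] by (auto simp: root_at_def)
  have p2: "\<not> int p dvd 2" using p by (metis int_dvd_int_iff of_nat_numeral primes_dvd_imp_eq two_is_prime_nat dvd_refl)
  have pd: "\<not> int p dvd int d"
  proof
    assume "int p dvd int d"
    moreover have "int p dvd r0\<^sup>2 + int d" using r0(2) by (meson dvd_power dvd_trans pos2)
    ultimately have "int p dvd r0\<^sup>2" using dvd_add_left_iff by blast
    thus False using r0(1) pp prime_dvd_power by blast
  qed
  have cop: "coprime c q" if "\<not> int p dvd c" for c
    using prime_imp_coprime[OF pp that] unfolding q_def by (simp add: coprime_commute)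
  have c2d: "coprime (2 * int d) q" using pp p2 pd by (intro cop) (simp add: prime_dvd_mult_iff)
  have c2: "coprime 2 q" using p2 by (rule cop)
  have cr: "coprime (2 * r0) q" using pp p2 r0(1) by (intro cop) (simp add: prime_dvd_mult_iff)
  \<comment> \<open>The two linear conditions are solved by half the sum and half the difference of
    \<open>g\<close> and 1.\<close>
  obtain x1 where x1: "[x1 * 2 = g + 1] (mod q)" using cong_times_inverse[OF c2] by blast
  obtain y1 where y1: "[y1 * (2 * r0) = g - 1] (mod q)" using cong_times_inverse[OF cr] by blast
  obtain x0 where x0: "[x0 = 1] (mod 2 * int d)" "[x0 = x1] (mod q)"
    using binary_chinese_remainder_int[OF c2d] by blast
  obtain y0 where y0: "[y0 = 0] (mod 2 * int d)" "[y0 = y1] (mod q)"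
    using binary_chinese_remainder_int[OF c2d] by blast
  have s1: "[2 * (x0 + y0 * r0) = 2 * g] (mod q)"
  proof -
    have "[2 * x0 + y0 * (2 * r0) = x1 * 2 + y1 * (2 * r0)] (mod q)"
      unfolding mult.commute[of x1] by (intro cong_add cong_mult x0 y0 cong_refl)
    also have "[x1 * 2 + y1 * (2 * r0) = (g + 1) + (g - 1)] (mod q)" by (rule cong_add[OF x1 y1])
    finally show ?thesis by (simp add: algebra_simps)
  qed
  have s2: "[2 * (x0 - y0 * r0) = 2 * 1] (mod q)"
  proof -
    have "[2 * x0 - y0 * (2 * r0) = x1 * 2 - y1 * (2 * r0)] (mod q)"
      unfolding mult.commute[of x1] by (intro cong_diff cong_mult x0 y0 cong_refl)
    also have "[x1 * 2 - y1 * (2 * r0) = (g + 1) - (g - 1)] (mod q)" by (rule cong_diff[OF x1 y1])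
    finally show ?thesis by (simp add: algebra_simps)
  qed
  have e1: "[x0 + y0 * r0 = g] (mod q)" using s1 cong_mult_lcancel[OF c2] by blast
  have e2: "[x0 - y0 * r0 = 1] (mod q)" using s2 cong_mult_lcancel[OF c2] by blast
  have "coprime (nq (emb d x0 y0)) M"
  proof -
    have "q dvd y0\<^sup>2 * (r0\<^sup>2 + int d)" using r0(2) by (simp add: q_def)
    moreover have "x0\<^sup>2 + int d * y0\<^sup>2 - (x0 + y0 * r0) * (x0 - y0 * r0) = y0\<^sup>2 * (r0\<^sup>2 + int d)"
      by (simp add: power2_eq_square algebra_simps)
    ultimately have "[x0\<^sup>2 + int d * y0\<^sup>2 = (x0 + y0 * r0) * (x0 - y0 * r0)] (mod q)"
      by (simp add: cong_iff_dvd_diff)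
    also have "[(x0 + y0 * r0) * (x0 - y0 * r0) = g * 1] (mod q)" by (rule cong_mult[OF e1 e2])
    finally have "coprime (x0\<^sup>2 + int d * y0\<^sup>2) q"
      using g(1) cong_imp_coprime[OF cong_sym] by (force simp: q_def)
    moreover have "[x0\<^sup>2 + int d * y0\<^sup>2 = 1\<^sup>2 + int d * 0\<^sup>2] (mod 2 * int d)"
      using x0(1) y0(1) by (intro cong_add cong_mult cong_pow cong_refl)
    hence "coprime (x0\<^sup>2 + int d * y0\<^sup>2) (2 * int d)" using cong_imp_coprime[OF cong_sym] by force
    ultimately have "coprime (int (nq (emb d x0 y0))) (int M)"
      unfolding nq_emb M_def q_def by simp
    thus ?thesis by (simp only: coprime_int_iff)
  qed
  moreover have "gen_residue p M x0 y0" unfolding gen_residue_def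
  proof (intro allI impI)
    fix x y N r a
    assume H: "[x = x0] (mod int M) \<and> [y = y0] (mod int M) \<and> 3 \<le> N \<and> root_at p N r \<and> coprime a (int p)"
    have qM: "q dvd int M" by (simp add: q_def M_def)
    have xy: "[x = x0] (mod q)" "[y = y0] (mod q)" using H cong_dvd_modulus[OF _ qM] by auto
    have rr: "\<not> int p dvd r" "int p ^ N dvd r\<^sup>2 + int d" using H by (auto simp: root_at_def)
    define s where "s = int p ^ N"
    have qs: "q dvd s" unfolding q_def s_def using H by (intro le_imp_power_dvd) simp
    have "q dvd (r\<^sup>2 + int d) - (r0\<^sup>2 + int d)"
      using rr(2) qs r0(2) by (intro dvd_diff) (auto simp: q_def s_def intro: dvd_trans)
    hence qrr: "q dvd (r - r0) * (r + r0)" by (simp add: algebra_simps power2_eq_square)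
    have csa: "coprime a s" using H by (simp add: s_def)
    have cops: "coprime c s" if "[c = e] (mod q)" "coprime e (int p)" for c e
    proof -
      have "coprime e q" using that(2) by (simp add: q_def)
      hence "coprime c q" using that(1) cong_imp_coprime cong_sym by blast
      thus ?thesis by (simp add: q_def s_def)
    qed
    define A where "A = x + y * r"
    define B where "B = x - y * r"
    \<comment> \<open>Every admissible \<open>r\<close> is \<open>r0\<close> or \<open>- r0\<close>
      modulo \<open>p^2\<close>: \<open>p\<close> cannot divide both \<open>r - r0\<close> and
      \<open>r + r0\<close>, because it does not divide \<open>2 * r\<close>.\<close>
    have "[A = g] (mod q) \<and> [B = 1] (mod q) \<or> [A = 1] (mod q) \<and> [B = g] (mod q)"
    proof (cases "int p dvd r - r0")
      case False
      hence "q dvd r + r0" using qrr cop[OF False] by (metis coprime_commute coprime_dvd_mult_right_iff)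
      hence r: "[r = - r0] (mod q)" by (simp add: cong_iff_dvd_diff)
      have "[A = x0 + y0 * (- r0)] (mod q)" "[B = x0 - y0 * (- r0)] (mod q)"
        unfolding A_def B_def by (intro cong_add cong_diff cong_mult xy r)+
      thus ?thesis using e1 e2 by (auto intro: cong_trans)
    next
      case True
      have "\<not> int p dvd r + r0"
      proof
        assume "int p dvd r + r0"
        hence "int p dvd (r - r0) + (r + r0)" using True by (rule dvd_add[rotated])
        hence "int p dvd 2 * r" by simp
        thus False using pp p2 rr(1) by (simp add: prime_dvd_mult_iff)
      qed
      hence "q dvd r - r0" using qrr cop by (metis coprime_commute coprime_dvd_mult_left_iff)
      hence r: "[r = r0] (mod q)" by (simp add: cong_iff_dvd_diff)
      have "[A = x0 + y0 * r0] (mod q)" "[B = x0 - y0 * r0] (mod q)"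
        unfolding A_def B_def by (intro cong_add cong_diff cong_mult xy r)+
      thus ?thesis using e1 e2 by (auto intro: cong_trans)
    qed
    hence "\<exists>k. [A ^ k = a * B ^ k] (mod s)"
    proof
      assume AB: "[A = g] (mod q) \<and> [B = 1] (mod q)"
      hence "coprime B s" using cops[of B 1] by simp
      then obtain h where h: "[h * B = A] (mod s)" using cong_times_inverse by blast
      have "[h * 1 = h * B] (mod q)" using AB by (intro cong_mult) (auto intro: cong_sym)
      also have "[h * B = A] (mod q)" by (rule cong_dvd_modulus[OF h qs])
      also have "[A = g] (mod q)" using AB by simp
      finally have "[h = g] (mod q)" by simp
      then obtain k where k: "[h ^ k = a] (mod s)" using g(2)[of h N a] H by (auto simp: q_def s_def)
      have "[A ^ k = (h * B) ^ k] (mod s)" by (intro cong_pow cong_sym[OF h])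
      also have "[(h * B) ^ k = a * B ^ k] (mod s)" unfolding power_mult_distrib by (intro cong_mult k cong_refl)
      finally show ?thesis by blast
    next
      assume AB: "[A = 1] (mod q) \<and> [B = g] (mod q)"
      hence "coprime A s" using cops[of A 1] by simp
      then obtain h where h: "[h * A = B] (mod s)" using cong_times_inverse by blast
      have "[h * 1 = h * A] (mod q)" using AB by (intro cong_mult) (auto intro: cong_sym)
      also have "[h * A = B] (mod q)" by (rule cong_dvd_modulus[OF h qs])
      also have "[B = g] (mod q)" using AB by simp
      finally have hg: "[h = g] (mod q)" by simp
      \<comment> \<open>The roles of \<open>A\<close> and \<open>B\<close> are exchanged, so it is
        the inverse of \<open>a\<close> that must be a power of \<open>h\<close>.\<close>
      obtain a' where a': "[a * a' = 1] (mod s)" using cong_solve_coprime_int[OF csa] by blast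
      have "coprime (a * a') s" using a' cong_imp_coprime[OF cong_sym[OF a']] by simp
      hence "coprime a' (int p)" using H by (auto simp: s_def)
      then obtain k where k: "[h ^ k = a'] (mod s)" using g(2)[of h N a'] hg H by (auto simp: q_def s_def)
      have "[a * B ^ k = a * (h * A) ^ k] (mod s)" by (intro cong_mult cong_pow cong_refl cong_sym[OF h])
      also have "a * (h * A) ^ k = a * h ^ k * A ^ k" by (simp add: power_mult_distrib)
      also have "[a * h ^ k * A ^ k = a * a' * A ^ k] (mod s)" by (intro cong_mult k cong_refl)
      also have "[a * a' * A ^ k = 1 * A ^ k] (mod s)" by (intro cong_mult a' cong_refl)
      finally have "[A ^ k = a * B ^ k] (mod s)" by (simp add: cong_sym_eq)
      thus ?thesis by blast
    qed
    thus "\<exists>\<epsilon>\<in>{1, -1}. \<exists>k. [\<epsilon> * (x + y * r) ^ k = a * (x - y * r) ^ k] (mod int p ^ N)"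
      by (simp add: A_def B_def s_def)
  qed
  moreover have "M \<ge> 3"
  proof -
    have "p \<ge> 2" using p by (simp add: prime_ge_2_nat)
    hence "p\<^sup>2 \<ge> 2\<^sup>2" by (rule power_mono) simp
    hence "2 * d * p\<^sup>2 \<ge> 2 * 1 * 2\<^sup>2" using d_pos by (intro mult_mono) auto
    thus ?thesis by (simp add: M_def)
  qed
  moreover have "2 * d dvd M" "p dvd M" by (auto simp: M_def)
  ultimately show ?thesis by blast
qed

text \<open>With \<open>x\<close> and \<open>y\<close> congruent to 2 and 1 modulo 8, the quotient
  \<open>(2 + r) / (2 - r)\<close> is 3 modulo 8 for every odd \<open>r\<close>, hence at both
  primes above 2.\<close>

lemma gen_residue_two:
  assumes sp: "splits d 2"
  shows "\<exists>M x0 y0. M \<ge> 3 \<and> 2 * d dvd M \<and> 2 dvd M \<and> coprime (nq (emb d x0 y0)) M \<and> gen_residue 2 M x0 y0"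
proof -
  define M where "M = 8 * d"
  obtain r0 where "\<not> 2 dvd r0" "2 dvd r0\<^sup>2 + int d"
    using splits_root[OF sp two_is_prime_nat, of 1] by (auto simp: root_at_def)
  hence dodd: "odd d" by simp
  hence c8: "coprime 8 (int d)"
    using coprime_power_left_iff[of 2 3 "int d"] by simp
  obtain x0 where x0: "[x0 = 2] (mod 8)" "[x0 = 1] (mod int d)" using binary_chinese_remainder_int[OF c8] by blast
  obtain y0 where y0: "[y0 = 1] (mod 8)" "[y0 = 0] (mod int d)" using binary_chinese_remainder_int[OF c8] by blast
  have "coprime (nq (emb d x0 y0)) M"
  proof -
    have "[x0\<^sup>2 + int d * y0\<^sup>2 = 1\<^sup>2 + int d * 0\<^sup>2] (mod int d)"
      using x0(2) y0(2) by (intro cong_add cong_mult cong_pow cong_refl)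
    hence "coprime (x0\<^sup>2 + int d * y0\<^sup>2) (int d)" using cong_imp_coprime[OF cong_sym] by force
    moreover have "even x0 \<and> odd y0" using x0(1) y0(1) unfolding cong_iff_dvd_diff by presburger
    hence "odd (x0\<^sup>2 + int d * y0\<^sup>2)" using dodd by simp
    hence "coprime (x0\<^sup>2 + int d * y0\<^sup>2) (2 ^ 3)" by (simp add: coprime_right_2_iff_odd del: power_numeral)
    ultimately have "coprime (int (nq (emb d x0 y0))) (int M)"
      unfolding nq_emb M_def by simp
    thus ?thesis by (simp only: coprime_int_iff)
  qed
  moreover have "gen_residue 2 M x0 y0" unfolding gen_residue_def
  proof (intro allI impI)
    fix x y N r a
    assume H: "[x = x0] (mod int M) \<and> [y = y0] (mod int M) \<and> 3 \<le> N \<and> root_at 2 N r \<and> coprime a (int 2)"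
    have M8: "8 dvd int M" by (simp add: M_def)
    have "[x = x0] (mod 8)" "[y = y0] (mod 8)" using H cong_dvd_modulus[OF _ M8] by auto
    hence xy: "[x = 2] (mod 8)" "[y = 1] (mod 8)" using x0(1) y0(1) by (auto intro: cong_trans)
    have rodd: "odd r" using H by (simp add: root_at_def)
    define s :: int where "s = 2 ^ N"
    have s8: "8 dvd s" unfolding s_def using le_imp_power_dvd[of 3 N "2::int"] H by simp
    define A where "A = x + y * r"
    define B where "B = x - y * r"
    have A: "[A = 2 + 1 * r] (mod 8)" and B: "[B = 2 - 1 * r] (mod 8)"
      unfolding A_def B_def by (intro cong_add cong_diff cong_mult xy cong_refl)+
    have "odd B" using B rodd unfolding cong_iff_dvd_diff by presburger
    hence "coprime B s" by (simp add: s_def coprime_right_2_iff_odd)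
    then obtain h where h: "[h * B = A] (mod s)" using cong_times_inverse by blast
    have "[h * (2 - 1 * r) = h * B] (mod 8)" by (intro cong_mult cong_refl cong_sym[OF B])
    also have "[h * B = A] (mod 8)" by (rule cong_dvd_modulus[OF h s8])
    also note A
    finally have hr: "[h * (2 - r) = 2 + r] (mod 8)" by simp
    have "[h = 3] (mod 8)"
    proof -
      \<comment> \<open>\<open>t\<close> is odd, so \<open>t * t\<close> is 1 modulo 8, and
        multiplying \<open>h * t = 4 - t\<close> by \<open>t\<close> gives
        \<open>h = 4 * t - 1 = 3\<close> modulo 8.\<close>
      define t where "t = 2 - r"
      have t: "odd t" using rodd by (simp add: t_def)
      then obtain c where c: "t = 2 * c + 1" by (elim oddE)
      have "even (c * (c + 1))" by simp
      then obtain e where e: "c * (c + 1) = 2 * e" by blast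
      have tt: "t * t = 8 * e + 1" using e unfolding c by (simp add: algebra_simps)
      have "8 dvd h * t - (4 - t)" using hr by (simp add: cong_iff_dvd_diff t_def)
      hence "8 dvd (h * t - (4 - t)) * t" by (rule dvd_mult2)
      also have "(h * t - (4 - t)) * t = h - 3 + 8 * (h * e + e - c)"
      proof -
        have "(h * t - (4 - t)) * t = h * (t * t) - 4 * t + t * t" by (simp add: algebra_simps)
        thus ?thesis unfolding tt by (simp add: c algebra_simps)
      qed
      finally have "8 dvd h - 3" by (metis dvd_add_left_iff dvd_triv_left)
      thus ?thesis by (simp add: cong_iff_dvd_diff)
    qed
    moreover have "odd a" using H by (simp add: coprime_right_2_iff_odd)
    ultimately obtain \<epsilon> k where k: "\<epsilon> \<in> {1, -1 :: int}" "[\<epsilon> * h ^ k = a] (mod s)"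
      using two_adic_unit_generator[of h N a] H unfolding s_def by blast
    have "[\<epsilon> * A ^ k = \<epsilon> * (h * B) ^ k] (mod s)" by (intro cong_mult cong_refl cong_pow cong_sym[OF h])
    also have "\<epsilon> * (h * B) ^ k = \<epsilon> * h ^ k * B ^ k" by (simp add: power_mult_distrib)
    also have "[\<epsilon> * h ^ k * B ^ k = a * B ^ k] (mod s)" by (intro cong_mult k cong_refl)
    finally show "\<exists>\<epsilon>\<in>{1, -1}. \<exists>k. [\<epsilon> * (x + y * r) ^ k = a * (x - y * r) ^ k] (mod int 2 ^ N)"
      using k(1) unfolding A_def B_def s_def by auto
  qed
  moreover have "M \<ge> 3" "2 * d dvd M" "2 dvd M" using d_pos by (auto simp: M_def intro: dvdI[of _ _ 4])
  ultimately show ?thesis by blast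
qed

end

theorem theorem4p3:
  fixes d p :: nat
  assumes "d > 0" and "squarefree d" and "prime p" and "splits d p"
  shows "infinite {l::nat. prime l \<and> l \<noteq> p \<and> splits d l \<and> T_dense_at d p l}"
proof -
  interpret quad_field d using assms by unfold_locales
  obtain M x0 y0 where M: "M \<ge> 3" "2 * d dvd M" "p dvd M" "coprime (nq (emb d x0 y0)) M" "gen_residue p M x0 y0"
    using gen_residue_odd[OF assms(3,4)] gen_residue_two assms(4)
    by (cases "p = 2") (auto dest!: primes_dvd_imp_eq[OF two_is_prime_nat assms(3)])
  interpret imag_order d M using M assms by unfold_locales
  have "{l. prime l \<and> (\<exists>v\<in>Rg d. v - emb d x0 y0 \<in> multiples d M \<and> nq v = l)}
    \<subseteq> {l. prime l \<and> l \<noteq> p \<and> splits d l \<and> T_dense_at d p l}"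
  proof safe
    fix v assume v: "v \<in> Rg d" "v - emb d x0 y0 \<in> multiples d M" and pr: "prime (nq v)"
    obtain x y where xy: "v = emb d x y" using v(1) by (rule Rg_cases)
    have "int M dvd x - x0" "int M dvd y - y0"
      using v(2) unfolding xy emb_diff emb_in_multiples[OF assms(1)] by auto
    hence c: "[x = x0] (mod int M)" "[y = y0] (mod int M)" by (auto simp: cong_iff_dvd_diff)
    hence "[x\<^sup>2 + int d * y\<^sup>2 = x0\<^sup>2 + int d * y0\<^sup>2] (mod int M)"
      by (intro cong_add cong_mult cong_pow cong_refl)
    hence "[int (nq (emb d x0 y0)) = int (nq v)] (mod int M)"
      unfolding xy nq_emb by (rule cong_sym)
    hence cop: "coprime (nq v) M" using M(4) cong_imp_coprime[of "nq (emb d x0 y0)" "nq v" M] by (simp only: cong_int_iff)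
    \<comment> \<open>As \<open>p\<close> and \<open>2 * d\<close> divide \<open>M\<close>, this
      excludes \<open>l = p\<close> and provides the hypothesis of
      \<open>splits_norm_prime\<close>.\<close>
    have ndvd: "\<not> nq v dvd M" using cop pr by (meson coprime_absorb_left not_prime_unit)
    show False if "p = nq v" using ndvd M(3) that by simp
    have "\<not> nq v dvd 2 * d" using ndvd M(2) dvd_trans by blast
    thus "splits d (nq v)" by (rule splits_norm_prime[OF v(1) refl pr])
    show "T_dense_at d p (nq v)"
      using c M(5) pr unfolding gen_residue_def
      by (intro T_dense_atI[OF assms(3,4) xy refl]) (auto dest: prime_gt_0_nat)
  qed
  thus ?thesis using infinite_primes_of_norm_form[OF Rg_emb M(4)] by (rule infinite_super)
qed

end
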